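(* Let $f:\mathsf{rGph}(\mathcal{B},\mathcal{A})$ be a morphism of reflexive graphs. Then $f$ is a left fibration if and only if $f$ is left cartesian; $f$ is a right fibration if and only if $f$ is right cartesian; and $f$ is a fibration if and only if $f$ is cartesian.
   Context: Setting: Martin-Löf dependent type theory with the usual type formers and univalent universes (so function extensionality holds); $\mathcal{U}$ is a universe. A reflexive graph $\mathcal{A}$ is a triple $(A_0,A_1,\mathsf{rfx}_{\mathcal{A}})$ with $A_0:\mathcal{U}$, $A_1:A_0\to A_0\to\mathcal{U}$, $\mathsf{rfx}_{\mathcal{A}}:\prod_{i:A_0}A_1(i,i)$. A morphism $f:\mathsf{rGph}(\mathcal{A},\mathcal{B})$ is a triple of $f_0:A_0\to B_0$, $f_1:\prod_{i,j}A_1(i,j)\to B_1(f_0(i),f_0(j))$ and $\mathsf{rfx}_f:\prod_{i}f_1(\mathsf{rfx}_{\mathcal{A}}(i))=\mathsf{rfx}_{\mathcal{B}}(f_0(i))$. Morphisms compose in the evident way. The unit graph $\mathbf{1}$ has vertices $\mathbf{1}$ and all edge types $\mathbf{1}$. The walking edge $\mathcal{I}$ has vertices the type $\mathbf{2}=\{0,1\}$ of booleans, edges $I_1(x,y):=(\tau(x)\to\tau(y))$ where $\tau(0):=\emptyset$ and $\tau(1):=\mathbf{1}$, and reflexivity given by identity functions. The vertices $0$ and $1$ determine morphisms $0,1:\mathsf{rGph}(\mathbf{1},\mathcal{I})$. A commuting square of types $p:C\to P$, $q:C\to Q$, $u:P\to Z$, $v:Q\to Z$, $K:u\circ p\sim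 v\circ q$ is a pullback square if $C\to\sum_{a:P}\sum_{b:Q}u(a)=v(b)$, $z\mapsto(p(z),q(z),K(z))$, is an equivalence. $f:\mathsf{rGph}(\mathcal{B},\mathcal{A})$ is right orthogonal to $i:\mathsf{rGph}(\mathcal{X},\mathcal{Y})$ if the commuting square with top map $-\circ i:\mathsf{rGph}(\mathcal{Y},\mathcal{B})\to\mathsf{rGph}(\mathcal{X},\mathcal{B})$, bottom map $-\circ i:\mathsf{rGph}(\mathcal{Y},\mathcal{A})\to\mathsf{rGph}(\mathcal{X},\mathcal{A})$ and vertical maps $f\circ-$ is a pullback square. $f$ is a left (resp. right) fibration if it is right orthogonal to $0:\mathsf{rGph}(\mathbf{1},\mathcal{I})$ (resp. $1:\mathsf{rGph}(\mathbf{1},\mathcal{I})$), and a fibration if it is both. $f$ is left (resp. right) cartesian if the naturality square with top map $\pi_1$ (resp. $\pi_2$) $:\sum_{i,j:B_0}B_1(i,j)\to B_0$, bottom map $\pi_1$ (resp. $\pi_2$) $:\sum_{i,j:A_0}A_1(i,j)\to A_0$, where $\pi_1(i,j,e)=i$ and $\pi_2(i,j,e)=j$, and vertical maps induced by $f_1$ and $f_0$, is a pullback square; $f$ is cartesian if it is both left and right cartesian. *)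

theory Defs
  imports Main
begin

text \<open>
  HOL types are sets, so they cannot play the role of the types of a univalent theory, and
  ``there is a term of this type'' cannot be expressed by HOL truth.  Intensional Martin-Loef
  type theory with univalent universes is therefore defined here as an object language: raw
  terms, and inductively defined judgements following Appendix A.2 and A.3 of the HoTT Book,
  except that pair types have projections and the eta rule instead of an induction principle
  (which is then definable), and that booleans are primitive.
  A theorem of type theory is a closed type for which a closed term is derivable.
\<close>

section \<open>Raw terms\<close>

text \<open>
  Variables are de Bruijn indices.  The arguments under binders are: the second argument of
  \<open>Pi\<close>, \<open>Sig\<close>, \<open>Lam\<close>; every motive \<open>C\<close> (one variable, but three, \<open>x, y, p\<close>, in \<open>J\<close>); the base
  case of \<open>J\<close> (one), the branches of \<open>SumInd\<close> (one) and the successor branch of \<open>NatInd\<close>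
  (two, the second being the inductive hypothesis).  \<open>Funext i\<close> and \<open>Univalence i\<close> are the
  constants inhabiting the two axioms for the universe \<open>Uni i\<close>.
\<close>

datatype tm =
    Var nat
  | Uni nat
  | Pi tm tm | Lam tm tm | App tm tm
  | Sig tm tm | Tup tm tm | Pr1 tm | Pr2 tm
  | Eq tm tm tm | Refl tm
  | J tm tm tm tm tm tm
  | Empty | EmptyInd tm tm
  | Unit | Star | UnitInd tm tm tm
  | Two | Two0 | Two1 | TwoInd tm tm tm tm
  | Sum tm tm | InL tm | InR tm | SumInd tm tm tm tm tm tm
  | NN | NZero | NSuc tm | NatInd tm tm tm tm
  | Funext nat | Univalence nat

definition up_ren :: "(nat \<Rightarrow> nat) \<Rightarrow> nat \<Rightarrow> nat" where
  "up_ren \<rho> = case_nat 0 (\<lambda>k. Suc (\<rho> k))"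

primrec ren :: "tm \<Rightarrow> (nat \<Rightarrow> nat) \<Rightarrow> tm" where
  "ren (Var k) \<rho> = Var (\<rho> k)"
| "ren (Uni i) \<rho> = Uni i"
| "ren (Pi A B) \<rho> = Pi (ren A \<rho>) (ren B (up_ren \<rho>))"
| "ren (Lam A b) \<rho> = Lam (ren A \<rho>) (ren b (up_ren \<rho>))"
| "ren (App f a) \<rho> = App (ren f \<rho>) (ren a \<rho>)"
| "ren (Sig A B) \<rho> = Sig (ren A \<rho>) (ren B (up_ren \<rho>))"
| "ren (Tup a b) \<rho> = Tup (ren a \<rho>) (ren b \<rho>)"
| "ren (Pr1 p) \<rho> = Pr1 (ren p \<rho>)"
| "ren (Pr2 p) \<rho> = Pr2 (ren p \<rho>)"
| "ren (Eq A a b) \<rho> = Eq (ren A \<rho>) (ren a \<rho>) (ren b \<rho>)"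
| "ren (Refl a) \<rho> = Refl (ren a \<rho>)"
| "ren (J A C c a b p) \<rho> =
     J (ren A \<rho>) (ren C (up_ren (up_ren (up_ren \<rho>)))) (ren c (up_ren \<rho>))
       (ren a \<rho>) (ren b \<rho>) (ren p \<rho>)"
| "ren Empty \<rho> = Empty"
| "ren (EmptyInd C e) \<rho> = EmptyInd (ren C (up_ren \<rho>)) (ren e \<rho>)"
| "ren Unit \<rho> = Unit"
| "ren Star \<rho> = Star"
| "ren (UnitInd C c u) \<rho> = UnitInd (ren C (up_ren \<rho>)) (ren c \<rho>) (ren u \<rho>)"
| "ren Two \<rho> = Two"
| "ren Two0 \<rho> = Two0"
| "ren Two1 \<rho> = Two1"
| "ren (TwoInd C c d b) \<rho> = TwoInd (ren C (up_ren \<rho>)) (ren c \<rho>) (ren d \<rho>) (ren b \<rho>)"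
| "ren (Sum A B) \<rho> = Sum (ren A \<rho>) (ren B \<rho>)"
| "ren (InL a) \<rho> = InL (ren a \<rho>)"
| "ren (InR b) \<rho> = InR (ren b \<rho>)"
| "ren (SumInd A B C c d e) \<rho> =
     SumInd (ren A \<rho>) (ren B \<rho>) (ren C (up_ren \<rho>)) (ren c (up_ren \<rho>)) (ren d (up_ren \<rho>))
       (ren e \<rho>)"
| "ren NN \<rho> = NN"
| "ren NZero \<rho> = NZero"
| "ren (NSuc n) \<rho> = NSuc (ren n \<rho>)"
| "ren (NatInd C c d n) \<rho> =
     NatInd (ren C (up_ren \<rho>)) (ren c \<rho>) (ren d (up_ren (up_ren \<rho>))) (ren n \<rho>)"
| "ren (Funext i) \<rho> = Funext i"
| "ren (Univalence i) \<rho> = Univalence i"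

abbreviation lift :: "tm \<Rightarrow> tm" where
  "lift t \<equiv> ren t Suc"

definition scons :: "tm \<Rightarrow> (nat \<Rightarrow> tm) \<Rightarrow> nat \<Rightarrow> tm" (infixr "##" 65) where
  "a ## \<sigma> = case_nat a \<sigma>"

definition up :: "(nat \<Rightarrow> tm) \<Rightarrow> nat \<Rightarrow> tm" where
  "up \<sigma> = Var 0 ## (\<lambda>k. lift (\<sigma> k))"

primrec subst :: "tm \<Rightarrow> (nat \<Rightarrow> tm) \<Rightarrow> tm" where
  "subst (Var k) \<sigma> = \<sigma> k"
| "subst (Uni i) \<sigma> = Uni i"
| "subst (Pi A B) \<sigma> = Pi (subst A \<sigma>) (subst B (up \<sigma>))"
| "subst (Lam A b) \<sigma> = Lam (subst A \<sigma>) (subst b (up \<sigma>))"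
| "subst (App f a) \<sigma> = App (subst f \<sigma>) (subst a \<sigma>)"
| "subst (Sig A B) \<sigma> = Sig (subst A \<sigma>) (subst B (up \<sigma>))"
| "subst (Tup a b) \<sigma> = Tup (subst a \<sigma>) (subst b \<sigma>)"
| "subst (Pr1 p) \<sigma> = Pr1 (subst p \<sigma>)"
| "subst (Pr2 p) \<sigma> = Pr2 (subst p \<sigma>)"
| "subst (Eq A a b) \<sigma> = Eq (subst A \<sigma>) (subst a \<sigma>) (subst b \<sigma>)"
| "subst (Refl a) \<sigma> = Refl (subst a \<sigma>)"
| "subst (J A C c a b p) \<sigma> =
     J (subst A \<sigma>) (subst C (up (up (up \<sigma>)))) (subst c (up \<sigma>))
       (subst a \<sigma>) (subst b \<sigma>) (subst p \<sigma>)"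
| "subst Empty \<sigma> = Empty"
| "subst (EmptyInd C e) \<sigma> = EmptyInd (subst C (up \<sigma>)) (subst e \<sigma>)"
| "subst Unit \<sigma> = Unit"
| "subst Star \<sigma> = Star"
| "subst (UnitInd C c u) \<sigma> = UnitInd (subst C (up \<sigma>)) (subst c \<sigma>) (subst u \<sigma>)"
| "subst Two \<sigma> = Two"
| "subst Two0 \<sigma> = Two0"
| "subst Two1 \<sigma> = Two1"
| "subst (TwoInd C c d b) \<sigma> =
     TwoInd (subst C (up \<sigma>)) (subst c \<sigma>) (subst d \<sigma>) (subst b \<sigma>)"
| "subst (Sum A B) \<sigma> = Sum (subst A \<sigma>) (subst B \<sigma>)"
| "subst (InL a) \<sigma> = InL (subst a \<sigma>)"
| "subst (InR b) \<sigma> = InR (subst b \<sigma>)"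
| "subst (SumInd A B C c d e) \<sigma> =
     SumInd (subst A \<sigma>) (subst B \<sigma>) (subst C (up \<sigma>)) (subst c (up \<sigma>)) (subst d (up \<sigma>))
       (subst e \<sigma>)"
| "subst NN \<sigma> = NN"
| "subst NZero \<sigma> = NZero"
| "subst (NSuc n) \<sigma> = NSuc (subst n \<sigma>)"
| "subst (NatInd C c d n) \<sigma> =
     NatInd (subst C (up \<sigma>)) (subst c \<sigma>) (subst d (up (up \<sigma>))) (subst n \<sigma>)"
| "subst (Funext i) \<sigma> = Funext i"
| "subst (Univalence i) \<sigma> = Univalence i"

abbreviation inst :: "tm \<Rightarrow> tm \<Rightarrow> tm"  ("_\<lbrakk>_\<rbrakk>" [1000, 0] 1000) where
  "B\<lbrakk>a\<rbrakk> \<equiv> subst B (a ## Var)"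


section \<open>Named binders for writing raw terms\<close>

text \<open>
  To write object-language terms with named variables, an \<open>expr\<close> maps the number \<open>n\<close> of
  enclosing binders to the raw term denoted at that depth.  The variable introduced by the
  binder entered at depth \<open>n\<close> has index \<open>m - Suc n\<close> at depth \<open>m\<close>, so that no explicit
  lifting is needed.  A closed expression \<open>E\<close> denotes the raw term \<open>E 0\<close>.
\<close>

type_synonym expr = "nat \<Rightarrow> tm"

definition bound :: "(expr \<Rightarrow> expr) \<Rightarrow> expr" where
  "bound F = (\<lambda>n. F (\<lambda>m. Var (m - Suc n)) (Suc n))"

definition uni :: "nat \<Rightarrow> expr" ("\<U>") where
  "\<U> i = (\<lambda>n. Uni i)"

definition pi :: "expr \<Rightarrow> (expr \<Rightarrow> expr) \<Rightarrow> expr" where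
  "pi A B = (\<lambda>n. Pi (A n) (bound B n))"

definition lam :: "expr \<Rightarrow> (expr \<Rightarrow> expr) \<Rightarrow> expr" where
  "lam A b = (\<lambda>n. Lam (A n) (bound b n))"

definition app :: "expr \<Rightarrow> expr \<Rightarrow> expr" (infixl "\<cdot>" 90) where
  "f \<cdot> a = (\<lambda>n. App (f n) (a n))"

definition sig :: "expr \<Rightarrow> (expr \<Rightarrow> expr) \<Rightarrow> expr" where
  "sig A B = (\<lambda>n. Sig (A n) (bound B n))"

definition tup :: "expr \<Rightarrow> expr \<Rightarrow> expr" ("\<langle>_,/ _\<rangle>") where
  "\<langle>a, b\<rangle> = (\<lambda>n. Tup (a n) (b n))"

definition pr1 :: "expr \<Rightarrow> expr" where
  "pr1 p = (\<lambda>n. Pr1 (p n))"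

definition pr2 :: "expr \<Rightarrow> expr" where
  "pr2 p = (\<lambda>n. Pr2 (p n))"

definition eq :: "expr \<Rightarrow> expr \<Rightarrow> expr \<Rightarrow> expr" ("(_ \<^bold>=\<^bsub>_\<^esub>/ _)" [56, 0, 56] 55) where
  "a \<^bold>=\<^bsub>A\<^esub> b = (\<lambda>n. Eq (A n) (a n) (b n))"

definition rfl :: "expr \<Rightarrow> expr" where
  "rfl a = (\<lambda>n. Refl (a n))"

definition path_ind ::
    "expr \<Rightarrow> (expr \<Rightarrow> expr \<Rightarrow> expr \<Rightarrow> expr) \<Rightarrow> (expr \<Rightarrow> expr) \<Rightarrow> expr \<Rightarrow> expr \<Rightarrow> expr \<Rightarrow> expr" where
  "path_ind A C c a b p =
     (\<lambda>n. J (A n) (bound (\<lambda>x. bound (\<lambda>y. bound (\<lambda>q. C x y q))) n) (bound c n)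
            (a n) (b n) (p n))"

definition empty :: expr where "empty = (\<lambda>n. Empty)"
definition one :: expr where "one = (\<lambda>n. Unit)"
definition star :: expr where "star = (\<lambda>n. Star)"
definition two :: expr where "two = (\<lambda>n. Two)"
definition two0 :: expr where "two0 = (\<lambda>n. Two0)"
definition two1 :: expr where "two1 = (\<lambda>n. Two1)"

definition two_ind :: "(expr \<Rightarrow> expr) \<Rightarrow> expr \<Rightarrow> expr \<Rightarrow> expr \<Rightarrow> expr" where
  "two_ind C c d b = (\<lambda>n. TwoInd (bound C n) (c n) (d n) (b n))"

definition funext_ax :: "nat \<Rightarrow> expr" where
  "funext_ax i = (\<lambda>n. Funext i)"

syntax
  "_pi"  :: "idt \<Rightarrow> expr \<Rightarrow> expr \<Rightarrow> expr" ("(3\<^bold>\<Pi>_\<^bold>:_./ _)" [0, 0, 10] 10)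
  "_sig" :: "idt \<Rightarrow> expr \<Rightarrow> expr \<Rightarrow> expr" ("(3\<^bold>\<Sigma>_\<^bold>:_./ _)" [0, 0, 10] 10)
  "_lam" :: "idt \<Rightarrow> expr \<Rightarrow> expr \<Rightarrow> expr" ("(3\<^bold>\<lambda>_\<^bold>:_./ _)" [0, 0, 10] 10)
translations
  "\<^bold>\<Pi>x\<^bold>:A. B" \<rightleftharpoons> "CONST pi A (\<lambda>x. B)"
  "\<^bold>\<Sigma>x\<^bold>:A. B" \<rightleftharpoons> "CONST sig A (\<lambda>x. B)"
  "\<^bold>\<lambda>x\<^bold>:A. b" \<rightleftharpoons> "CONST lam A (\<lambda>x. b)"

definition arrow :: "expr \<Rightarrow> expr \<Rightarrow> expr" (infixr "\<^bold>\<rightarrow>" 60) where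
  "A \<^bold>\<rightarrow> B = (\<^bold>\<Pi>x\<^bold>:A. B)"

definition times :: "expr \<Rightarrow> expr \<Rightarrow> expr" (infixr "\<^bold>\<times>" 70) where
  "A \<^bold>\<times> B = (\<^bold>\<Sigma>x\<^bold>:A. B)"

definition iff :: "expr \<Rightarrow> expr \<Rightarrow> expr" (infix "\<^bold>\<leftrightarrow>" 50) where
  "A \<^bold>\<leftrightarrow> B = (A \<^bold>\<rightarrow> B) \<^bold>\<times> (B \<^bold>\<rightarrow> A)"


section \<open>Equivalences, function extensionality and univalence\<close>

text \<open>
  Most notions are defined as closed functions of the object language, to be applied as in
  \<open>is_equiv i \<cdot> A \<cdot> B \<cdot> f\<close>; only short ones, such as projections, are HOL functions on
  expressions.  The parameter \<open>i\<close> is the level of the universe in which the types live.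
\<close>

definition is_equiv :: "nat \<Rightarrow> expr" where
  "is_equiv i =
     (\<^bold>\<lambda>A\<^bold>:\<U> i. \<^bold>\<lambda>B\<^bold>:\<U> i. \<^bold>\<lambda>f\<^bold>:A \<^bold>\<rightarrow> B.
        (\<^bold>\<Sigma>g\<^bold>:B \<^bold>\<rightarrow> A. \<^bold>\<Pi>b\<^bold>:B. f \<cdot> (g \<cdot> b) \<^bold>=\<^bsub>B\<^esub> b) \<^bold>\<times>
        (\<^bold>\<Sigma>h\<^bold>:B \<^bold>\<rightarrow> A. \<^bold>\<Pi>a\<^bold>:A. h \<cdot> (f \<cdot> a) \<^bold>=\<^bsub>A\<^esub> a))"

definition equiv :: "nat \<Rightarrow> expr" where
  "equiv i = (\<^bold>\<lambda>A\<^bold>:\<U> i. \<^bold>\<lambda>B\<^bold>:\<U> i. \<^bold>\<Sigma>f\<^bold>:A \<^bold>\<rightarrow> B. is_equiv i \<cdot> A \<cdot> B \<cdot> f)"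

definition happly :: "nat \<Rightarrow> expr" where
  "happly i =
     (\<^bold>\<lambda>A\<^bold>:\<U> i. \<^bold>\<lambda>B\<^bold>:A \<^bold>\<rightarrow> \<U> i. \<^bold>\<lambda>f\<^bold>:(\<^bold>\<Pi>x\<^bold>:A. B \<cdot> x). \<^bold>\<lambda>g\<^bold>:(\<^bold>\<Pi>x\<^bold>:A. B \<cdot> x).
      \<^bold>\<lambda>p\<^bold>:(f \<^bold>=\<^bsub>\<^bold>\<Pi>x\<^bold>:A. B \<cdot> x\<^esub> g).
        path_ind (\<^bold>\<Pi>x\<^bold>:A. B \<cdot> x) (\<lambda>h k q. \<^bold>\<Pi>x\<^bold>:A. h \<cdot> x \<^bold>=\<^bsub>B \<cdot> x\<^esub> k \<cdot> x)
          (\<lambda>h. \<^bold>\<lambda>x\<^bold>:A. rfl (h \<cdot> x)) f g p)"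

definition funext_type :: "nat \<Rightarrow> expr" where
  "funext_type i =
     (\<^bold>\<Pi>A\<^bold>:\<U> i. \<^bold>\<Pi>B\<^bold>:A \<^bold>\<rightarrow> \<U> i. \<^bold>\<Pi>f\<^bold>:(\<^bold>\<Pi>x\<^bold>:A. B \<cdot> x). \<^bold>\<Pi>g\<^bold>:(\<^bold>\<Pi>x\<^bold>:A. B \<cdot> x).
        is_equiv i \<cdot> (f \<^bold>=\<^bsub>\<^bold>\<Pi>x\<^bold>:A. B \<cdot> x\<^esub> g) \<cdot> (\<^bold>\<Pi>x\<^bold>:A. f \<cdot> x \<^bold>=\<^bsub>B \<cdot> x\<^esub> g \<cdot> x) \<cdot>
          (happly i \<cdot> A \<cdot> B \<cdot> f \<cdot> g))"

definition id_to_equiv :: "nat \<Rightarrow> expr" where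
  "id_to_equiv i =
     (\<^bold>\<lambda>A\<^bold>:\<U> i. \<^bold>\<lambda>B\<^bold>:\<U> i. \<^bold>\<lambda>p\<^bold>:(A \<^bold>=\<^bsub>\<U> i\<^esub> B).
        path_ind (\<U> i) (\<lambda>X Y q. equiv i \<cdot> X \<cdot> Y)
          (\<lambda>X. \<langle>\<^bold>\<lambda>x\<^bold>:X. x, \<langle>\<langle>\<^bold>\<lambda>x\<^bold>:X. x, \<^bold>\<lambda>x\<^bold>:X. rfl x\<rangle>, \<langle>\<^bold>\<lambda>x\<^bold>:X. x, \<^bold>\<lambda>x\<^bold>:X. rfl x\<rangle>\<rangle>\<rangle>) A B p)"

definition univalence_type :: "nat \<Rightarrow> expr" where
  "univalence_type i =
     (\<^bold>\<Pi>A\<^bold>:\<U> i. \<^bold>\<Pi>B\<^bold>:\<U> i.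
        is_equiv (Suc i) \<cdot> (A \<^bold>=\<^bsub>\<U> i\<^esub> B) \<cdot> (equiv i \<cdot> A \<cdot> B) \<cdot> (id_to_equiv i \<cdot> A \<cdot> B))"


section \<open>Judgements\<close>

text \<open>
  Contexts are lists with the most recently declared variable first.  Universes are cumulative
  and Russell-style: \<open>A\<close> is a type in \<open>\<Gamma>\<close> if \<open>\<Gamma> \<turnstile> A \<^bold>: Uni i\<close> for some \<open>i\<close>.
  \<open>ty_subst\<close> and \<open>eq_subst\<close> are the structural rules of weakening and substitution,
  in the form of simultaneous substitutions.
\<close>

abbreviation lookup :: "tm list \<Rightarrow> nat \<Rightarrow> tm" where
  "lookup \<Gamma> k \<equiv> ren (\<Gamma> ! k) (\<lambda>j. j + Suc k)"

inductive
  wf_ctx :: "tm list \<Rightarrow> bool" ("\<turnstile> _" [51] 50) and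
  has_type :: "tm list \<Rightarrow> tm \<Rightarrow> tm \<Rightarrow> bool" ("_ \<turnstile> _ \<^bold>: _" [51, 51, 51] 50) and
  jd_eq :: "tm list \<Rightarrow> tm \<Rightarrow> tm \<Rightarrow> tm \<Rightarrow> bool" ("_ \<turnstile> _ \<doteq> _ \<^bold>: _" [51, 51, 51, 51] 50)
where
  \<comment> \<open>contexts and structural rules\<close>
  ctx_nil: "\<turnstile> []"
| ctx_cons: "\<turnstile> \<Gamma> \<Longrightarrow> \<Gamma> \<turnstile> A \<^bold>: Uni i \<Longrightarrow> \<turnstile> A # \<Gamma>"
| ty_var: "\<turnstile> \<Gamma> \<Longrightarrow> k < length \<Gamma> \<Longrightarrow> \<Gamma> \<turnstile> Var k \<^bold>: lookup \<Gamma> k"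
| ty_conv: "\<Gamma> \<turnstile> a \<^bold>: A \<Longrightarrow> \<Gamma> \<turnstile> A \<doteq> B \<^bold>: Uni i \<Longrightarrow> \<Gamma> \<turnstile> a \<^bold>: B"
| ty_subst: "\<Gamma> \<turnstile> a \<^bold>: A \<Longrightarrow> \<turnstile> \<Delta> \<Longrightarrow>
    (\<And>k. k < length \<Gamma> \<Longrightarrow> \<Delta> \<turnstile> \<sigma> k \<^bold>: subst (lookup \<Gamma> k) \<sigma>) \<Longrightarrow>
    \<Delta> \<turnstile> subst a \<sigma> \<^bold>: subst A \<sigma>"
| eq_refl: "\<Gamma> \<turnstile> a \<^bold>: A \<Longrightarrow> \<Gamma> \<turnstile> a \<doteq> a \<^bold>: A"
| eq_sym: "\<Gamma> \<turnstile> a \<doteq> b \<^bold>: A \<Longrightarrow> \<Gamma> \<turnstile> b \<doteq> a \<^bold>: A"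
| eq_trans: "\<Gamma> \<turnstile> a \<doteq> b \<^bold>: A \<Longrightarrow> \<Gamma> \<turnstile> b \<doteq> c \<^bold>: A \<Longrightarrow> \<Gamma> \<turnstile> a \<doteq> c \<^bold>: A"
| eq_conv: "\<Gamma> \<turnstile> a \<doteq> b \<^bold>: A \<Longrightarrow> \<Gamma> \<turnstile> A \<doteq> B \<^bold>: Uni i \<Longrightarrow> \<Gamma> \<turnstile> a \<doteq> b \<^bold>: B"
| eq_subst: "\<Gamma> \<turnstile> a \<doteq> b \<^bold>: A \<Longrightarrow> \<turnstile> \<Delta> \<Longrightarrow>
    (\<And>k. k < length \<Gamma> \<Longrightarrow> \<Delta> \<turnstile> \<sigma> k \<doteq> \<tau> k \<^bold>: subst (lookup \<Gamma> k) \<sigma>) \<Longrightarrow>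
    \<Delta> \<turnstile> subst a \<sigma> \<doteq> subst b \<tau> \<^bold>: subst A \<sigma>"

  \<comment> \<open>universes\<close>
| ty_Uni: "\<turnstile> \<Gamma> \<Longrightarrow> \<Gamma> \<turnstile> Uni i \<^bold>: Uni (Suc i)"
| ty_cumul: "\<Gamma> \<turnstile> A \<^bold>: Uni i \<Longrightarrow> \<Gamma> \<turnstile> A \<^bold>: Uni (Suc i)"
| eq_cumul: "\<Gamma> \<turnstile> A \<doteq> B \<^bold>: Uni i \<Longrightarrow> \<Gamma> \<turnstile> A \<doteq> B \<^bold>: Uni (Suc i)"

  \<comment> \<open>dependent function types\<close>
| ty_Pi: "\<Gamma> \<turnstile> A \<^bold>: Uni i \<Longrightarrow> A # \<Gamma> \<turnstile> B \<^bold>: Uni i \<Longrightarrow> \<Gamma> \<turnstile> Pi A B \<^bold>: Uni i"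
| ty_Lam: "A # \<Gamma> \<turnstile> b \<^bold>: B \<Longrightarrow> \<Gamma> \<turnstile> Lam A b \<^bold>: Pi A B"
| ty_App: "\<Gamma> \<turnstile> f \<^bold>: Pi A B \<Longrightarrow> \<Gamma> \<turnstile> a \<^bold>: A \<Longrightarrow> \<Gamma> \<turnstile> App f a \<^bold>: B\<lbrakk>a\<rbrakk>"
| eq_Pi: "\<Gamma> \<turnstile> A \<doteq> A' \<^bold>: Uni i \<Longrightarrow> A # \<Gamma> \<turnstile> B \<doteq> B' \<^bold>: Uni i \<Longrightarrow>
    \<Gamma> \<turnstile> Pi A B \<doteq> Pi A' B' \<^bold>: Uni i"
| eq_Lam: "\<Gamma> \<turnstile> A \<doteq> A' \<^bold>: Uni i \<Longrightarrow> A # \<Gamma> \<turnstile> b \<doteq> b' \<^bold>: B \<Longrightarrow>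
    \<Gamma> \<turnstile> Lam A b \<doteq> Lam A' b' \<^bold>: Pi A B"
| eq_App: "\<Gamma> \<turnstile> f \<doteq> f' \<^bold>: Pi A B \<Longrightarrow> \<Gamma> \<turnstile> a \<doteq> a' \<^bold>: A \<Longrightarrow>
    \<Gamma> \<turnstile> App f a \<doteq> App f' a' \<^bold>: B\<lbrakk>a\<rbrakk>"
| eq_Pi_beta: "A # \<Gamma> \<turnstile> b \<^bold>: B \<Longrightarrow> \<Gamma> \<turnstile> a \<^bold>: A \<Longrightarrow> \<Gamma> \<turnstile> App (Lam A b) a \<doteq> b\<lbrakk>a\<rbrakk> \<^bold>: B\<lbrakk>a\<rbrakk>"
| eq_Pi_eta: "\<Gamma> \<turnstile> f \<^bold>: Pi A B \<Longrightarrow> \<Gamma> \<turnstile> f \<doteq> Lam A (App (lift f) (Var 0)) \<^bold>: Pi A B"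

  \<comment> \<open>dependent pair types\<close>
| ty_Sig: "\<Gamma> \<turnstile> A \<^bold>: Uni i \<Longrightarrow> A # \<Gamma> \<turnstile> B \<^bold>: Uni i \<Longrightarrow> \<Gamma> \<turnstile> Sig A B \<^bold>: Uni i"
| ty_Tup: "A # \<Gamma> \<turnstile> B \<^bold>: Uni i \<Longrightarrow> \<Gamma> \<turnstile> a \<^bold>: A \<Longrightarrow> \<Gamma> \<turnstile> b \<^bold>: B\<lbrakk>a\<rbrakk> \<Longrightarrow> \<Gamma> \<turnstile> Tup a b \<^bold>: Sig A B"
| ty_Pr1: "\<Gamma> \<turnstile> p \<^bold>: Sig A B \<Longrightarrow> \<Gamma> \<turnstile> Pr1 p \<^bold>: A"
| ty_Pr2: "\<Gamma> \<turnstile> p \<^bold>: Sig A B \<Longrightarrow> \<Gamma> \<turnstile> Pr2 p \<^bold>: B\<lbrakk>Pr1 p\<rbrakk>"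
| eq_Sig: "\<Gamma> \<turnstile> A \<doteq> A' \<^bold>: Uni i \<Longrightarrow> A # \<Gamma> \<turnstile> B \<doteq> B' \<^bold>: Uni i \<Longrightarrow>
    \<Gamma> \<turnstile> Sig A B \<doteq> Sig A' B' \<^bold>: Uni i"
| eq_Tup: "A # \<Gamma> \<turnstile> B \<^bold>: Uni i \<Longrightarrow> \<Gamma> \<turnstile> a \<doteq> a' \<^bold>: A \<Longrightarrow> \<Gamma> \<turnstile> b \<doteq> b' \<^bold>: B\<lbrakk>a\<rbrakk> \<Longrightarrow>
    \<Gamma> \<turnstile> Tup a b \<doteq> Tup a' b' \<^bold>: Sig A B"
| eq_Pr1: "\<Gamma> \<turnstile> p \<doteq> p' \<^bold>: Sig A B \<Longrightarrow> \<Gamma> \<turnstile> Pr1 p \<doteq> Pr1 p' \<^bold>: A"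
| eq_Pr2: "\<Gamma> \<turnstile> p \<doteq> p' \<^bold>: Sig A B \<Longrightarrow> \<Gamma> \<turnstile> Pr2 p \<doteq> Pr2 p' \<^bold>: B\<lbrakk>Pr1 p\<rbrakk>"
| eq_Sig_beta1: "A # \<Gamma> \<turnstile> B \<^bold>: Uni i \<Longrightarrow> \<Gamma> \<turnstile> a \<^bold>: A \<Longrightarrow> \<Gamma> \<turnstile> b \<^bold>: B\<lbrakk>a\<rbrakk> \<Longrightarrow>
    \<Gamma> \<turnstile> Pr1 (Tup a b) \<doteq> a \<^bold>: A"
| eq_Sig_beta2: "A # \<Gamma> \<turnstile> B \<^bold>: Uni i \<Longrightarrow> \<Gamma> \<turnstile> a \<^bold>: A \<Longrightarrow> \<Gamma> \<turnstile> b \<^bold>: B\<lbrakk>a\<rbrakk> \<Longrightarrow>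
    \<Gamma> \<turnstile> Pr2 (Tup a b) \<doteq> b \<^bold>: B\<lbrakk>a\<rbrakk>"
| eq_Sig_eta: "\<Gamma> \<turnstile> p \<^bold>: Sig A B \<Longrightarrow> \<Gamma> \<turnstile> p \<doteq> Tup (Pr1 p) (Pr2 p) \<^bold>: Sig A B"

  \<comment> \<open>identity types\<close>
| ty_Eq: "\<Gamma> \<turnstile> A \<^bold>: Uni i \<Longrightarrow> \<Gamma> \<turnstile> a \<^bold>: A \<Longrightarrow> \<Gamma> \<turnstile> b \<^bold>: A \<Longrightarrow> \<Gamma> \<turnstile> Eq A a b \<^bold>: Uni i"
| ty_Refl: "\<Gamma> \<turnstile> a \<^bold>: A \<Longrightarrow> \<Gamma> \<turnstile> Refl a \<^bold>: Eq A a a"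
| ty_J: "Eq (lift (lift A)) (Var 1) (Var 0) # lift A # A # \<Gamma> \<turnstile> C \<^bold>: Uni i \<Longrightarrow>
    A # \<Gamma> \<turnstile> c \<^bold>: subst C (Refl (Var 0) ## Var 0 ## Var 0 ## (\<lambda>k. Var (Suc k))) \<Longrightarrow>
    \<Gamma> \<turnstile> a \<^bold>: A \<Longrightarrow> \<Gamma> \<turnstile> b \<^bold>: A \<Longrightarrow> \<Gamma> \<turnstile> p \<^bold>: Eq A a b \<Longrightarrow>
    \<Gamma> \<turnstile> J A C c a b p \<^bold>: subst C (p ## b ## a ## Var)"
| eq_Eq: "\<Gamma> \<turnstile> A \<doteq> A' \<^bold>: Uni i \<Longrightarrow> \<Gamma> \<turnstile> a \<doteq> a' \<^bold>: A \<Longrightarrow> \<Gamma> \<turnstile> b \<doteq> b' \<^bold>: A \<Longrightarrow>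
    \<Gamma> \<turnstile> Eq A a b \<doteq> Eq A' a' b' \<^bold>: Uni i"
| eq_Refl: "\<Gamma> \<turnstile> a \<doteq> a' \<^bold>: A \<Longrightarrow> \<Gamma> \<turnstile> Refl a \<doteq> Refl a' \<^bold>: Eq A a a"
| eq_J: "\<Gamma> \<turnstile> A \<doteq> A' \<^bold>: Uni j \<Longrightarrow>
    Eq (lift (lift A)) (Var 1) (Var 0) # lift A # A # \<Gamma> \<turnstile> C \<doteq> C' \<^bold>: Uni i \<Longrightarrow>
    A # \<Gamma> \<turnstile> c \<doteq> c' \<^bold>: subst C (Refl (Var 0) ## Var 0 ## Var 0 ## (\<lambda>k. Var (Suc k))) \<Longrightarrow>
    \<Gamma> \<turnstile> a \<doteq> a' \<^bold>: A \<Longrightarrow> \<Gamma> \<turnstile> b \<doteq> b' \<^bold>: A \<Longrightarrow> \<Gamma> \<turnstile> p \<doteq> p' \<^bold>: Eq A a b \<Longrightarrow>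
    \<Gamma> \<turnstile> J A C c a b p \<doteq> J A' C' c' a' b' p' \<^bold>: subst C (p ## b ## a ## Var)"
| eq_J_beta: "Eq (lift (lift A)) (Var 1) (Var 0) # lift A # A # \<Gamma> \<turnstile> C \<^bold>: Uni i \<Longrightarrow>
    A # \<Gamma> \<turnstile> c \<^bold>: subst C (Refl (Var 0) ## Var 0 ## Var 0 ## (\<lambda>k. Var (Suc k))) \<Longrightarrow>
    \<Gamma> \<turnstile> a \<^bold>: A \<Longrightarrow>
    \<Gamma> \<turnstile> J A C c a a (Refl a) \<doteq> c\<lbrakk>a\<rbrakk> \<^bold>: subst C (Refl a ## a ## a ## Var)"

  \<comment> \<open>the empty type\<close>
| ty_Empty: "\<turnstile> \<Gamma> \<Longrightarrow> \<Gamma> \<turnstile> Empty \<^bold>: Uni i"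
| ty_EmptyInd: "Empty # \<Gamma> \<turnstile> C \<^bold>: Uni i \<Longrightarrow> \<Gamma> \<turnstile> e \<^bold>: Empty \<Longrightarrow> \<Gamma> \<turnstile> EmptyInd C e \<^bold>: C\<lbrakk>e\<rbrakk>"
| eq_EmptyInd: "Empty # \<Gamma> \<turnstile> C \<doteq> C' \<^bold>: Uni i \<Longrightarrow> \<Gamma> \<turnstile> e \<doteq> e' \<^bold>: Empty \<Longrightarrow>
    \<Gamma> \<turnstile> EmptyInd C e \<doteq> EmptyInd C' e' \<^bold>: C\<lbrakk>e\<rbrakk>"

  \<comment> \<open>the unit type\<close>
| ty_Unit: "\<turnstile> \<Gamma> \<Longrightarrow> \<Gamma> \<turnstile> Unit \<^bold>: Uni i"
| ty_Star: "\<turnstile> \<Gamma> \<Longrightarrow> \<Gamma> \<turnstile> Star \<^bold>: Unit"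
| ty_UnitInd: "Unit # \<Gamma> \<turnstile> C \<^bold>: Uni i \<Longrightarrow> \<Gamma> \<turnstile> c \<^bold>: C\<lbrakk>Star\<rbrakk> \<Longrightarrow> \<Gamma> \<turnstile> u \<^bold>: Unit \<Longrightarrow>
    \<Gamma> \<turnstile> UnitInd C c u \<^bold>: C\<lbrakk>u\<rbrakk>"
| eq_UnitInd: "Unit # \<Gamma> \<turnstile> C \<doteq> C' \<^bold>: Uni i \<Longrightarrow> \<Gamma> \<turnstile> c \<doteq> c' \<^bold>: C\<lbrakk>Star\<rbrakk> \<Longrightarrow> \<Gamma> \<turnstile> u \<doteq> u' \<^bold>: Unit \<Longrightarrow>
    \<Gamma> \<turnstile> UnitInd C c u \<doteq> UnitInd C' c' u' \<^bold>: C\<lbrakk>u\<rbrakk>"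
| eq_Unit_beta: "Unit # \<Gamma> \<turnstile> C \<^bold>: Uni i \<Longrightarrow> \<Gamma> \<turnstile> c \<^bold>: C\<lbrakk>Star\<rbrakk> \<Longrightarrow>
    \<Gamma> \<turnstile> UnitInd C c Star \<doteq> c \<^bold>: C\<lbrakk>Star\<rbrakk>"

  \<comment> \<open>the type of booleans\<close>
| ty_Two: "\<turnstile> \<Gamma> \<Longrightarrow> \<Gamma> \<turnstile> Two \<^bold>: Uni i"
| ty_Two0: "\<turnstile> \<Gamma> \<Longrightarrow> \<Gamma> \<turnstile> Two0 \<^bold>: Two"
| ty_Two1: "\<turnstile> \<Gamma> \<Longrightarrow> \<Gamma> \<turnstile> Two1 \<^bold>: Two"
| ty_TwoInd: "Two # \<Gamma> \<turnstile> C \<^bold>: Uni i \<Longrightarrow> \<Gamma> \<turnstile> c \<^bold>: C\<lbrakk>Two0\<rbrakk> \<Longrightarrow> \<Gamma> \<turnstile> d \<^bold>: C\<lbrakk>Two1\<rbrakk> \<Longrightarrow> \<Gamma> \<turnstile> b \<^bold>: Two \<Longrightarrow>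
    \<Gamma> \<turnstile> TwoInd C c d b \<^bold>: C\<lbrakk>b\<rbrakk>"
| eq_TwoInd: "Two # \<Gamma> \<turnstile> C \<doteq> C' \<^bold>: Uni i \<Longrightarrow> \<Gamma> \<turnstile> c \<doteq> c' \<^bold>: C\<lbrakk>Two0\<rbrakk> \<Longrightarrow> \<Gamma> \<turnstile> d \<doteq> d' \<^bold>: C\<lbrakk>Two1\<rbrakk> \<Longrightarrow>
    \<Gamma> \<turnstile> b \<doteq> b' \<^bold>: Two \<Longrightarrow> \<Gamma> \<turnstile> TwoInd C c d b \<doteq> TwoInd C' c' d' b' \<^bold>: C\<lbrakk>b\<rbrakk>"
| eq_Two_beta0: "Two # \<Gamma> \<turnstile> C \<^bold>: Uni i \<Longrightarrow> \<Gamma> \<turnstile> c \<^bold>: C\<lbrakk>Two0\<rbrakk> \<Longrightarrow> \<Gamma> \<turnstile> d \<^bold>: C\<lbrakk>Two1\<rbrakk> \<Longrightarrow>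
    \<Gamma> \<turnstile> TwoInd C c d Two0 \<doteq> c \<^bold>: C\<lbrakk>Two0\<rbrakk>"
| eq_Two_beta1: "Two # \<Gamma> \<turnstile> C \<^bold>: Uni i \<Longrightarrow> \<Gamma> \<turnstile> c \<^bold>: C\<lbrakk>Two0\<rbrakk> \<Longrightarrow> \<Gamma> \<turnstile> d \<^bold>: C\<lbrakk>Two1\<rbrakk> \<Longrightarrow>
    \<Gamma> \<turnstile> TwoInd C c d Two1 \<doteq> d \<^bold>: C\<lbrakk>Two1\<rbrakk>"

  \<comment> \<open>coproduct types\<close>
| ty_Sum: "\<Gamma> \<turnstile> A \<^bold>: Uni i \<Longrightarrow> \<Gamma> \<turnstile> B \<^bold>: Uni i \<Longrightarrow> \<Gamma> \<turnstile> Sum A B \<^bold>: Uni i"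
| ty_InL: "\<Gamma> \<turnstile> B \<^bold>: Uni i \<Longrightarrow> \<Gamma> \<turnstile> a \<^bold>: A \<Longrightarrow> \<Gamma> \<turnstile> InL a \<^bold>: Sum A B"
| ty_InR: "\<Gamma> \<turnstile> A \<^bold>: Uni i \<Longrightarrow> \<Gamma> \<turnstile> b \<^bold>: B \<Longrightarrow> \<Gamma> \<turnstile> InR b \<^bold>: Sum A B"
| ty_SumInd: "Sum A B # \<Gamma> \<turnstile> C \<^bold>: Uni i \<Longrightarrow>
    A # \<Gamma> \<turnstile> c \<^bold>: subst C (InL (Var 0) ## (\<lambda>k. Var (Suc k))) \<Longrightarrow>
    B # \<Gamma> \<turnstile> d \<^bold>: subst C (InR (Var 0) ## (\<lambda>k. Var (Suc k))) \<Longrightarrow>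
    \<Gamma> \<turnstile> e \<^bold>: Sum A B \<Longrightarrow> \<Gamma> \<turnstile> SumInd A B C c d e \<^bold>: C\<lbrakk>e\<rbrakk>"
| eq_Sum: "\<Gamma> \<turnstile> A \<doteq> A' \<^bold>: Uni i \<Longrightarrow> \<Gamma> \<turnstile> B \<doteq> B' \<^bold>: Uni i \<Longrightarrow>
    \<Gamma> \<turnstile> Sum A B \<doteq> Sum A' B' \<^bold>: Uni i"
| eq_InL: "\<Gamma> \<turnstile> B \<^bold>: Uni i \<Longrightarrow> \<Gamma> \<turnstile> a \<doteq> a' \<^bold>: A \<Longrightarrow> \<Gamma> \<turnstile> InL a \<doteq> InL a' \<^bold>: Sum A B"
| eq_InR: "\<Gamma> \<turnstile> A \<^bold>: Uni i \<Longrightarrow> \<Gamma> \<turnstile> b \<doteq> b' \<^bold>: B \<Longrightarrow> \<Gamma> \<turnstile> InR b \<doteq> InR b' \<^bold>: Sum A B"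
| eq_SumInd: "\<Gamma> \<turnstile> A \<doteq> A' \<^bold>: Uni j \<Longrightarrow> \<Gamma> \<turnstile> B \<doteq> B' \<^bold>: Uni j \<Longrightarrow>
    Sum A B # \<Gamma> \<turnstile> C \<doteq> C' \<^bold>: Uni i \<Longrightarrow>
    A # \<Gamma> \<turnstile> c \<doteq> c' \<^bold>: subst C (InL (Var 0) ## (\<lambda>k. Var (Suc k))) \<Longrightarrow>
    B # \<Gamma> \<turnstile> d \<doteq> d' \<^bold>: subst C (InR (Var 0) ## (\<lambda>k. Var (Suc k))) \<Longrightarrow>
    \<Gamma> \<turnstile> e \<doteq> e' \<^bold>: Sum A B \<Longrightarrow>
    \<Gamma> \<turnstile> SumInd A B C c d e \<doteq> SumInd A' B' C' c' d' e' \<^bold>: C\<lbrakk>e\<rbrakk>"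
| eq_Sum_betaL: "Sum A B # \<Gamma> \<turnstile> C \<^bold>: Uni i \<Longrightarrow>
    A # \<Gamma> \<turnstile> c \<^bold>: subst C (InL (Var 0) ## (\<lambda>k. Var (Suc k))) \<Longrightarrow>
    B # \<Gamma> \<turnstile> d \<^bold>: subst C (InR (Var 0) ## (\<lambda>k. Var (Suc k))) \<Longrightarrow>
    \<Gamma> \<turnstile> a \<^bold>: A \<Longrightarrow> \<Gamma> \<turnstile> SumInd A B C c d (InL a) \<doteq> c\<lbrakk>a\<rbrakk> \<^bold>: C\<lbrakk>InL a\<rbrakk>"
| eq_Sum_betaR: "Sum A B # \<Gamma> \<turnstile> C \<^bold>: Uni i \<Longrightarrow>
    A # \<Gamma> \<turnstile> c \<^bold>: subst C (InL (Var 0) ## (\<lambda>k. Var (Suc k))) \<Longrightarrow>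
    B # \<Gamma> \<turnstile> d \<^bold>: subst C (InR (Var 0) ## (\<lambda>k. Var (Suc k))) \<Longrightarrow>
    \<Gamma> \<turnstile> b \<^bold>: B \<Longrightarrow> \<Gamma> \<turnstile> SumInd A B C c d (InR b) \<doteq> d\<lbrakk>b\<rbrakk> \<^bold>: C\<lbrakk>InR b\<rbrakk>"

  \<comment> \<open>natural numbers\<close>
| ty_NN: "\<turnstile> \<Gamma> \<Longrightarrow> \<Gamma> \<turnstile> NN \<^bold>: Uni i"
| ty_NZero: "\<turnstile> \<Gamma> \<Longrightarrow> \<Gamma> \<turnstile> NZero \<^bold>: NN"
| ty_NSuc: "\<Gamma> \<turnstile> n \<^bold>: NN \<Longrightarrow> \<Gamma> \<turnstile> NSuc n \<^bold>: NN"
| ty_NatInd: "NN # \<Gamma> \<turnstile> C \<^bold>: Uni i \<Longrightarrow> \<Gamma> \<turnstile> c \<^bold>: C\<lbrakk>NZero\<rbrakk> \<Longrightarrow>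
    C # NN # \<Gamma> \<turnstile> d \<^bold>: subst C (NSuc (Var 1) ## (\<lambda>k. Var (Suc (Suc k)))) \<Longrightarrow>
    \<Gamma> \<turnstile> n \<^bold>: NN \<Longrightarrow> \<Gamma> \<turnstile> NatInd C c d n \<^bold>: C\<lbrakk>n\<rbrakk>"
| eq_NSuc: "\<Gamma> \<turnstile> n \<doteq> n' \<^bold>: NN \<Longrightarrow> \<Gamma> \<turnstile> NSuc n \<doteq> NSuc n' \<^bold>: NN"
| eq_NatInd: "NN # \<Gamma> \<turnstile> C \<doteq> C' \<^bold>: Uni i \<Longrightarrow> \<Gamma> \<turnstile> c \<doteq> c' \<^bold>: C\<lbrakk>NZero\<rbrakk> \<Longrightarrow>
    C # NN # \<Gamma> \<turnstile> d \<doteq> d' \<^bold>: subst C (NSuc (Var 1) ## (\<lambda>k. Var (Suc (Suc k)))) \<Longrightarrow>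
    \<Gamma> \<turnstile> n \<doteq> n' \<^bold>: NN \<Longrightarrow> \<Gamma> \<turnstile> NatInd C c d n \<doteq> NatInd C' c' d' n' \<^bold>: C\<lbrakk>n\<rbrakk>"
| eq_Nat_beta0: "NN # \<Gamma> \<turnstile> C \<^bold>: Uni i \<Longrightarrow> \<Gamma> \<turnstile> c \<^bold>: C\<lbrakk>NZero\<rbrakk> \<Longrightarrow>
    C # NN # \<Gamma> \<turnstile> d \<^bold>: subst C (NSuc (Var 1) ## (\<lambda>k. Var (Suc (Suc k)))) \<Longrightarrow>
    \<Gamma> \<turnstile> NatInd C c d NZero \<doteq> c \<^bold>: C\<lbrakk>NZero\<rbrakk>"
| eq_Nat_betaS: "NN # \<Gamma> \<turnstile> C \<^bold>: Uni i \<Longrightarrow> \<Gamma> \<turnstile> c \<^bold>: C\<lbrakk>NZero\<rbrakk> \<Longrightarrow>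
    C # NN # \<Gamma> \<turnstile> d \<^bold>: subst C (NSuc (Var 1) ## (\<lambda>k. Var (Suc (Suc k)))) \<Longrightarrow>
    \<Gamma> \<turnstile> n \<^bold>: NN \<Longrightarrow>
    \<Gamma> \<turnstile> NatInd C c d (NSuc n) \<doteq> subst d (NatInd C c d n ## n ## Var) \<^bold>: C\<lbrakk>NSuc n\<rbrakk>"

  \<comment> \<open>axioms\<close>
| ty_Funext: "\<turnstile> \<Gamma> \<Longrightarrow> \<Gamma> \<turnstile> Funext i \<^bold>: funext_type i 0"
| ty_Univalence: "\<turnstile> \<Gamma> \<Longrightarrow> \<Gamma> \<turnstile> Univalence i \<^bold>: univalence_type i 0"

definition provable :: "expr \<Rightarrow> bool" where
  "provable T \<longleftrightarrow> (\<exists>t. [] \<turnstile> t \<^bold>: T 0)"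


section \<open>Paths\<close>

definition ap :: "nat \<Rightarrow> expr" where
  "ap i =
     (\<^bold>\<lambda>A\<^bold>:\<U> i. \<^bold>\<lambda>B\<^bold>:\<U> i. \<^bold>\<lambda>f\<^bold>:A \<^bold>\<rightarrow> B. \<^bold>\<lambda>a\<^bold>:A. \<^bold>\<lambda>b\<^bold>:A. \<^bold>\<lambda>p\<^bold>:(a \<^bold>=\<^bsub>A\<^esub> b).
        path_ind A (\<lambda>x y q. f \<cdot> x \<^bold>=\<^bsub>B\<^esub> f \<cdot> y) (\<lambda>x. rfl (f \<cdot> x)) a b p)"

definition concat :: "nat \<Rightarrow> expr" where
  "concat i =
     (\<^bold>\<lambda>A\<^bold>:\<U> i. \<^bold>\<lambda>a\<^bold>:A. \<^bold>\<lambda>b\<^bold>:A. \<^bold>\<lambda>c\<^bold>:A. \<^bold>\<lambda>p\<^bold>:(a \<^bold>=\<^bsub>A\<^esub> b).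
        path_ind A (\<lambda>x y r. (y \<^bold>=\<^bsub>A\<^esub> c) \<^bold>\<rightarrow> (x \<^bold>=\<^bsub>A\<^esub> c)) (\<lambda>x. \<^bold>\<lambda>s\<^bold>:(x \<^bold>=\<^bsub>A\<^esub> c). s) a b p)"

definition funext :: "nat \<Rightarrow> expr" where
  "funext i =
     (\<^bold>\<lambda>A\<^bold>:\<U> i. \<^bold>\<lambda>B\<^bold>:A \<^bold>\<rightarrow> \<U> i. \<^bold>\<lambda>f\<^bold>:(\<^bold>\<Pi>x\<^bold>:A. B \<cdot> x). \<^bold>\<lambda>g\<^bold>:(\<^bold>\<Pi>x\<^bold>:A. B \<cdot> x).
        pr1 (pr1 (funext_ax i \<cdot> A \<cdot> B \<cdot> f \<cdot> g)))"

text \<open>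
  For \<open>p : a = b\<close> in \<open>E\<close>, \<open>q : g b = c\<close> in \<open>E'\<close> and \<open>r : f c = d\<close> in \<open>E''\<close>, the coherence
  \<open>ap (f \<circ> g) p \<bullet> (ap f q \<bullet> r) = ap f (ap g p \<bullet> q) \<bullet> r\<close>.
\<close>

definition ap_concat_coh :: "nat \<Rightarrow> expr" where
  "ap_concat_coh i =
     (\<^bold>\<lambda>E\<^bold>:\<U> i. \<^bold>\<lambda>E'\<^bold>:\<U> i. \<^bold>\<lambda>E''\<^bold>:\<U> i. \<^bold>\<lambda>g\<^bold>:E \<^bold>\<rightarrow> E'. \<^bold>\<lambda>f\<^bold>:E' \<^bold>\<rightarrow> E''.
      \<^bold>\<lambda>a\<^bold>:E. \<^bold>\<lambda>b\<^bold>:E. \<^bold>\<lambda>c\<^bold>:E'. \<^bold>\<lambda>d\<^bold>:E''.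
      \<^bold>\<lambda>p\<^bold>:(a \<^bold>=\<^bsub>E\<^esub> b). \<^bold>\<lambda>q\<^bold>:(g \<cdot> b \<^bold>=\<^bsub>E'\<^esub> c). \<^bold>\<lambda>r\<^bold>:(f \<cdot> c \<^bold>=\<^bsub>E''\<^esub> d).
        path_ind E
          (\<lambda>x y s. \<^bold>\<Pi>t\<^bold>:(g \<cdot> y \<^bold>=\<^bsub>E'\<^esub> c).
             concat i \<cdot> E'' \<cdot> (f \<cdot> (g \<cdot> x)) \<cdot> (f \<cdot> (g \<cdot> y)) \<cdot> d \<cdot>
               (ap i \<cdot> E \<cdot> E'' \<cdot> (\<^bold>\<lambda>e\<^bold>:E. f \<cdot> (g \<cdot> e)) \<cdot> x \<cdot> y \<cdot> s) \<cdot>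
               (concat i \<cdot> E'' \<cdot> (f \<cdot> (g \<cdot> y)) \<cdot> (f \<cdot> c) \<cdot> d \<cdot>
                  (ap i \<cdot> E' \<cdot> E'' \<cdot> f \<cdot> (g \<cdot> y) \<cdot> c \<cdot> t) \<cdot> r)
             \<^bold>=\<^bsub>f \<cdot> (g \<cdot> x) \<^bold>=\<^bsub>E''\<^esub> d\<^esub>
             concat i \<cdot> E'' \<cdot> (f \<cdot> (g \<cdot> x)) \<cdot> (f \<cdot> c) \<cdot> d \<cdot>
               (ap i \<cdot> E' \<cdot> E'' \<cdot> f \<cdot> (g \<cdot> x) \<cdot> c \<cdot>
                  (concat i \<cdot> E' \<cdot> (g \<cdot> x) \<cdot> (g \<cdot> y) \<cdot> c \<cdot> (ap i \<cdot> E \<cdot> E' \<cdot> g \<cdot> x \<cdot> y \<cdot> s) \<cdot> t)) \<cdot> r)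
          (\<lambda>x. \<^bold>\<lambda>t\<^bold>:(g \<cdot> x \<^bold>=\<^bsub>E'\<^esub> c).
             rfl (concat i \<cdot> E'' \<cdot> (f \<cdot> (g \<cdot> x)) \<cdot> (f \<cdot> c) \<cdot> d \<cdot>
                    (ap i \<cdot> E' \<cdot> E'' \<cdot> f \<cdot> (g \<cdot> x) \<cdot> c \<cdot> t) \<cdot> r))
          a b p \<cdot> q)"


section \<open>Reflexive graphs\<close>

definition rgraph :: "nat \<Rightarrow> expr" where
  "rgraph i = (\<^bold>\<Sigma>V\<^bold>:\<U> i. \<^bold>\<Sigma>E\<^bold>:V \<^bold>\<rightarrow> V \<^bold>\<rightarrow> \<U> i. \<^bold>\<Pi>x\<^bold>:V. E \<cdot> x \<cdot> x)"

definition vert :: "expr \<Rightarrow> expr" where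
  "vert G = pr1 G"

definition edge :: "expr \<Rightarrow> expr \<Rightarrow> expr \<Rightarrow> expr" where
  "edge G x y = pr1 (pr2 G) \<cdot> x \<cdot> y"

definition rfx :: "expr \<Rightarrow> expr \<Rightarrow> expr" where
  "rfx G x = pr2 (pr2 G) \<cdot> x"

definition hom :: "nat \<Rightarrow> expr" where
  "hom i =
     (\<^bold>\<lambda>G\<^bold>:rgraph i. \<^bold>\<lambda>H\<^bold>:rgraph i.
        \<^bold>\<Sigma>f\<^sub>0\<^bold>:vert G \<^bold>\<rightarrow> vert H.
        \<^bold>\<Sigma>f\<^sub>1\<^bold>:(\<^bold>\<Pi>x\<^bold>:vert G. \<^bold>\<Pi>y\<^bold>:vert G. edge G x y \<^bold>\<rightarrow> edge H (f\<^sub>0 \<cdot> x) (f\<^sub>0 \<cdot> y)).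
        \<^bold>\<Pi>x\<^bold>:vert G. f\<^sub>1 \<cdot> x \<cdot> x \<cdot> rfx G x \<^bold>=\<^bsub>edge H (f\<^sub>0 \<cdot> x) (f\<^sub>0 \<cdot> x)\<^esub> rfx H (f\<^sub>0 \<cdot> x))"

definition on_vert :: "expr \<Rightarrow> expr \<Rightarrow> expr" where
  "on_vert f x = pr1 f \<cdot> x"

definition on_edge :: "expr \<Rightarrow> expr \<Rightarrow> expr \<Rightarrow> expr" where
  "on_edge f x y = pr1 (pr2 f) \<cdot> x \<cdot> y"

definition on_rfx :: "expr \<Rightarrow> expr \<Rightarrow> expr" where
  "on_rfx f x = pr2 (pr2 f) \<cdot> x"

text \<open>
  \<open>comp i \<cdot> X \<cdot> Y \<cdot> Z \<cdot> g \<cdot> f\<close> is the composite of \<open>f : X \<rightarrow> Y\<close> followed by \<open>g : Y \<rightarrow> Z\<close>.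
\<close>

definition comp :: "nat \<Rightarrow> expr" where
  "comp i =
     (\<^bold>\<lambda>X\<^bold>:rgraph i. \<^bold>\<lambda>Y\<^bold>:rgraph i. \<^bold>\<lambda>Z\<^bold>:rgraph i. \<^bold>\<lambda>g\<^bold>:hom i \<cdot> Y \<cdot> Z. \<^bold>\<lambda>f\<^bold>:hom i \<cdot> X \<cdot> Y.
        \<langle>\<^bold>\<lambda>x\<^bold>:vert X. on_vert g (on_vert f x),
         \<langle>\<^bold>\<lambda>x\<^bold>:vert X. \<^bold>\<lambda>y\<^bold>:vert X. \<^bold>\<lambda>e\<^bold>:edge X x y.
            on_edge g (on_vert f x) (on_vert f y) \<cdot> (on_edge f x y \<cdot> e),
          \<^bold>\<lambda>x\<^bold>:vert X.
            let fx = on_vert f x; gfx = on_vert g fx; g\<^sub>1 = on_edge g fx fx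
            in concat i \<cdot> edge Z gfx gfx \<cdot>
                 (g\<^sub>1 \<cdot> (on_edge f x x \<cdot> rfx X x)) \<cdot> (g\<^sub>1 \<cdot> rfx Y fx) \<cdot> rfx Z gfx \<cdot>
                 (ap i \<cdot> edge Y fx fx \<cdot> edge Z gfx gfx \<cdot> g\<^sub>1 \<cdot>
                    (on_edge f x x \<cdot> rfx X x) \<cdot> rfx Y fx \<cdot> on_rfx f x) \<cdot>
                 on_rfx g fx\<rangle>\<rangle>)"

text \<open>
  The homotopy filling the square that defines orthogonality: the associativity path
  \<open>(f \<circ> g) \<circ> j = f \<circ> (g \<circ> j)\<close>.  The first two components of both sides are judgementally
  equal; the third ones are compared pointwise by \<open>ap_concat_coh\<close>.
\<close>

definition comp_assoc :: "nat \<Rightarrow> expr" where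
  "comp_assoc i =
     (\<^bold>\<lambda>X\<^bold>:rgraph i. \<^bold>\<lambda>Y\<^bold>:rgraph i. \<^bold>\<lambda>B\<^bold>:rgraph i. \<^bold>\<lambda>A\<^bold>:rgraph i.
      \<^bold>\<lambda>f\<^bold>:hom i \<cdot> B \<cdot> A. \<^bold>\<lambda>g\<^bold>:hom i \<cdot> Y \<cdot> B. \<^bold>\<lambda>j\<^bold>:hom i \<cdot> X \<cdot> Y.
        let l = comp i \<cdot> X \<cdot> Y \<cdot> A \<cdot> (comp i \<cdot> Y \<cdot> B \<cdot> A \<cdot> f \<cdot> g) \<cdot> j;
            r = comp i \<cdot> X \<cdot> B \<cdot> A \<cdot> f \<cdot> (comp i \<cdot> X \<cdot> Y \<cdot> B \<cdot> g \<cdot> j);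
            h\<^sub>0 = pr1 r;
            h\<^sub>1 = pr1 (pr2 r);
            D = (\<lambda>x. h\<^sub>1 \<cdot> x \<cdot> x \<cdot> rfx X x \<^bold>=\<^bsub>edge A (h\<^sub>0 \<cdot> x) (h\<^sub>0 \<cdot> x)\<^esub> rfx A (h\<^sub>0 \<cdot> x))
        in ap i \<cdot> (\<^bold>\<Pi>x\<^bold>:vert X. D x) \<cdot> (hom i \<cdot> X \<cdot> A) \<cdot>
             (\<^bold>\<lambda>s\<^bold>:(\<^bold>\<Pi>x\<^bold>:vert X. D x). \<langle>h\<^sub>0, \<langle>h\<^sub>1, s\<rangle>\<rangle>) \<cdot> pr2 (pr2 l) \<cdot> pr2 (pr2 r) \<cdot>
             (funext i \<cdot> vert X \<cdot> (\<^bold>\<lambda>x\<^bold>:vert X. D x) \<cdot> pr2 (pr2 l) \<cdot> pr2 (pr2 r) \<cdot>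
               (\<^bold>\<lambda>x\<^bold>:vert X.
                  let jx = on_vert j x; gjx = on_vert g jx; fgjx = on_vert f gjx
                  in ap_concat_coh i \<cdot> edge Y jx jx \<cdot> edge B gjx gjx \<cdot> edge A fgjx fgjx \<cdot>
                       on_edge g jx jx \<cdot> on_edge f gjx gjx \<cdot>
                       (on_edge j x x \<cdot> rfx X x) \<cdot> rfx Y jx \<cdot> rfx B gjx \<cdot> rfx A fgjx \<cdot>
                       on_rfx j x \<cdot> on_rfx g jx \<cdot> on_rfx f gjx)))"

definition unit_graph :: expr where
  "unit_graph = \<langle>one, \<langle>\<^bold>\<lambda>x\<^bold>:one. \<^bold>\<lambda>y\<^bold>:one. one, \<^bold>\<lambda>x\<^bold>:one. star\<rangle>\<rangle>"

definition tau :: "nat \<Rightarrow> expr \<Rightarrow> expr" where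
  "tau i b = two_ind (\<lambda>_. \<U> i) empty one b"

definition walking_edge :: "nat \<Rightarrow> expr" where
  "walking_edge i =
     \<langle>two, \<langle>\<^bold>\<lambda>x\<^bold>:two. \<^bold>\<lambda>y\<^bold>:two. tau i x \<^bold>\<rightarrow> tau i y, \<^bold>\<lambda>x\<^bold>:two. \<^bold>\<lambda>t\<^bold>:tau i x. t\<rangle>\<rangle>"

text \<open>The morphism from the unit graph determined by a vertex \<open>v\<close> of \<open>G\<close>.\<close>

definition vertex_hom :: "expr \<Rightarrow> expr \<Rightarrow> expr" where
  "vertex_hom G v =
     \<langle>\<^bold>\<lambda>x\<^bold>:one. v,
      \<langle>\<^bold>\<lambda>x\<^bold>:one. \<^bold>\<lambda>y\<^bold>:one. \<^bold>\<lambda>e\<^bold>:one. rfx G v,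
       \<^bold>\<lambda>x\<^bold>:one. rfl (rfx G v)\<rangle>\<rangle>"


section \<open>Pullback squares, fibrations and cartesian morphisms\<close>

definition is_pullback :: "nat \<Rightarrow> expr" where
  "is_pullback i =
     (\<^bold>\<lambda>C\<^bold>:\<U> i. \<^bold>\<lambda>P\<^bold>:\<U> i. \<^bold>\<lambda>Q\<^bold>:\<U> i. \<^bold>\<lambda>Z\<^bold>:\<U> i.
      \<^bold>\<lambda>p\<^bold>:C \<^bold>\<rightarrow> P. \<^bold>\<lambda>q\<^bold>:C \<^bold>\<rightarrow> Q. \<^bold>\<lambda>u\<^bold>:P \<^bold>\<rightarrow> Z. \<^bold>\<lambda>v\<^bold>:Q \<^bold>\<rightarrow> Z.
      \<^bold>\<lambda>K\<^bold>:(\<^bold>\<Pi>z\<^bold>:C. u \<cdot> (p \<cdot> z) \<^bold>=\<^bsub>Z\<^esub> v \<cdot> (q \<cdot> z)).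
        is_equiv i \<cdot> C \<cdot> (\<^bold>\<Sigma>a\<^bold>:P. \<^bold>\<Sigma>b\<^bold>:Q. u \<cdot> a \<^bold>=\<^bsub>Z\<^esub> v \<cdot> b) \<cdot>
          (\<^bold>\<lambda>z\<^bold>:C. \<langle>p \<cdot> z, \<langle>q \<cdot> z, K \<cdot> z\<rangle>\<rangle>))"

text \<open>
  \<open>right_orthogonal i \<cdot> X \<cdot> Y \<cdot> B \<cdot> A \<cdot> j \<cdot> f\<close>: \<open>f : B \<rightarrow> A\<close> is right orthogonal to \<open>j : X \<rightarrow> Y\<close>.
\<close>

definition right_orthogonal :: "nat \<Rightarrow> expr" where
  "right_orthogonal i =
     (\<^bold>\<lambda>X\<^bold>:rgraph i. \<^bold>\<lambda>Y\<^bold>:rgraph i. \<^bold>\<lambda>B\<^bold>:rgraph i. \<^bold>\<lambda>A\<^bold>:rgraph i.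
      \<^bold>\<lambda>j\<^bold>:hom i \<cdot> X \<cdot> Y. \<^bold>\<lambda>f\<^bold>:hom i \<cdot> B \<cdot> A.
        is_pullback i \<cdot> (hom i \<cdot> Y \<cdot> B) \<cdot> (hom i \<cdot> Y \<cdot> A) \<cdot> (hom i \<cdot> X \<cdot> B) \<cdot> (hom i \<cdot> X \<cdot> A) \<cdot>
          (\<^bold>\<lambda>g\<^bold>:hom i \<cdot> Y \<cdot> B. comp i \<cdot> Y \<cdot> B \<cdot> A \<cdot> f \<cdot> g) \<cdot>
          (\<^bold>\<lambda>g\<^bold>:hom i \<cdot> Y \<cdot> B. comp i \<cdot> X \<cdot> Y \<cdot> B \<cdot> g \<cdot> j) \<cdot>
          (\<^bold>\<lambda>g\<^bold>:hom i \<cdot> Y \<cdot> A. comp i \<cdot> X \<cdot> Y \<cdot> A \<cdot> g \<cdot> j) \<cdot>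
          (\<^bold>\<lambda>g\<^bold>:hom i \<cdot> X \<cdot> B. comp i \<cdot> X \<cdot> B \<cdot> A \<cdot> f \<cdot> g) \<cdot>
          (\<^bold>\<lambda>g\<^bold>:hom i \<cdot> Y \<cdot> B. comp_assoc i \<cdot> X \<cdot> Y \<cdot> B \<cdot> A \<cdot> f \<cdot> g \<cdot> j))"

definition left_fibration :: "nat \<Rightarrow> expr" where
  "left_fibration i =
     (\<^bold>\<lambda>B\<^bold>:rgraph i. \<^bold>\<lambda>A\<^bold>:rgraph i. \<^bold>\<lambda>f\<^bold>:hom i \<cdot> B \<cdot> A.
        right_orthogonal i \<cdot> unit_graph \<cdot> walking_edge i \<cdot> B \<cdot> A \<cdot>
          vertex_hom (walking_edge i) two0 \<cdot> f)"

definition right_fibration :: "nat \<Rightarrow> expr" where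
  "right_fibration i =
     (\<^bold>\<lambda>B\<^bold>:rgraph i. \<^bold>\<lambda>A\<^bold>:rgraph i. \<^bold>\<lambda>f\<^bold>:hom i \<cdot> B \<cdot> A.
        right_orthogonal i \<cdot> unit_graph \<cdot> walking_edge i \<cdot> B \<cdot> A \<cdot>
          vertex_hom (walking_edge i) two1 \<cdot> f)"

definition fibration :: "nat \<Rightarrow> expr" where
  "fibration i =
     (\<^bold>\<lambda>B\<^bold>:rgraph i. \<^bold>\<lambda>A\<^bold>:rgraph i. \<^bold>\<lambda>f\<^bold>:hom i \<cdot> B \<cdot> A.
        left_fibration i \<cdot> B \<cdot> A \<cdot> f \<^bold>\<times> right_fibration i \<cdot> B \<cdot> A \<cdot> f)"

definition total_edge :: "expr \<Rightarrow> expr" where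
  "total_edge G = (\<^bold>\<Sigma>x\<^bold>:vert G. \<^bold>\<Sigma>y\<^bold>:vert G. edge G x y)"

definition src :: "expr \<Rightarrow> expr" where
  "src z = pr1 z"

definition tgt :: "expr \<Rightarrow> expr" where
  "tgt z = pr1 (pr2 z)"

definition on_total :: "expr \<Rightarrow> expr \<Rightarrow> expr" where
  "on_total f z =
     \<langle>on_vert f (src z), \<langle>on_vert f (tgt z), on_edge f (src z) (tgt z) \<cdot> pr2 (pr2 z)\<rangle>\<rangle>"

definition left_cartesian :: "nat \<Rightarrow> expr" where
  "left_cartesian i =
     (\<^bold>\<lambda>B\<^bold>:rgraph i. \<^bold>\<lambda>A\<^bold>:rgraph i. \<^bold>\<lambda>f\<^bold>:hom i \<cdot> B \<cdot> A.
        is_pullback i \<cdot> total_edge B \<cdot> total_edge A \<cdot> vert B \<cdot> vert A \<cdot>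
          (\<^bold>\<lambda>z\<^bold>:total_edge B. on_total f z) \<cdot>
          (\<^bold>\<lambda>z\<^bold>:total_edge B. src z) \<cdot>
          (\<^bold>\<lambda>z\<^bold>:total_edge A. src z) \<cdot>
          (\<^bold>\<lambda>x\<^bold>:vert B. on_vert f x) \<cdot>
          (\<^bold>\<lambda>z\<^bold>:total_edge B. rfl (on_vert f (src z))))"

definition right_cartesian :: "nat \<Rightarrow> expr" where
  "right_cartesian i =
     (\<^bold>\<lambda>B\<^bold>:rgraph i. \<^bold>\<lambda>A\<^bold>:rgraph i. \<^bold>\<lambda>f\<^bold>:hom i \<cdot> B \<cdot> A.
        is_pullback i \<cdot> total_edge B \<cdot> total_edge A \<cdot> vert B \<cdot> vert A \<cdot>
          (\<^bold>\<lambda>z\<^bold>:total_edge B. on_total f z) \<cdot>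
          (\<^bold>\<lambda>z\<^bold>:total_edge B. tgt z) \<cdot>
          (\<^bold>\<lambda>z\<^bold>:total_edge A. tgt z) \<cdot>
          (\<^bold>\<lambda>x\<^bold>:vert B. on_vert f x) \<cdot>
          (\<^bold>\<lambda>z\<^bold>:total_edge B. rfl (on_vert f (tgt z))))"

definition cartesian :: "nat \<Rightarrow> expr" where
  "cartesian i =
     (\<^bold>\<lambda>B\<^bold>:rgraph i. \<^bold>\<lambda>A\<^bold>:rgraph i. \<^bold>\<lambda>f\<^bold>:hom i \<cdot> B \<cdot> A.
        left_cartesian i \<cdot> B \<cdot> A \<cdot> f \<^bold>\<times> right_cartesian i \<cdot> B \<cdot> A \<cdot> f)"

end

theory Submission
  imports Defs
begin

text \<open>
  Functions out of the empty, the unit and the two element type are determined by their values, so morphisms from the unit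
  graph amount to vertices and morphisms from the walking edge amount to edges, by evaluation.  Evaluation identifies
  the gap map of the orthogonality square with that of the naturality square: the restriction along a vertex becomes
  the source or the target, and the associativity path, which only moves the reflexivity components, becomes reflexivity.
  Being an equivalence passes from one gap map to the other.

  The derivation in the object theory is found by reflection: a type checker for terms with type annotations and unfoldable
  constants is proved sound for the judgements, and the simplifier runs it on the argument above.
\<close>

section \<open>Substitution in raw terms\<close>

text \<open>The composite of \<open>f\<close> with the morphism at a vertex \<open>b\<close> is not
  judgementally the morphism at the image of \<open>b\<close>: its edge map sends every edge to the
  image of reflexivity, which is reflexivity only up to a path. The paths in the two pullbacks are
  therefore compared through a homotopy \<open>Kap\<close> between a morphism from the unit graph
  and the one given by its vertex, and two coherences are needed: \<open>Kap\<close> is reflexivity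
  at \<open>VertexHom G v\<close>, and evaluation at the vertex sends \<open>Kap\<close> to
  reflexivity. Both are checked on canonical morphisms, where everything computes; for this reason
  the descriptions of morphisms take the form of elimination principles.

  In the checker, preservation of types under reduction would ordinarily rest on injectivity of the
  type formers up to judgemental equality, hence on a normalization theorem. Here terms carry
  annotations, and a redex is contracted only after the annotations on its two sides have been
  compared. A failed comparison merely leaves the redex standing, so soundness is the only property
  to prove.\<close>

lemma up_ren_simps [simp]: "up_ren \<rho> 0 = 0" "up_ren \<rho> (Suc k) = Suc (\<rho> k)"
  by (simp_all add: up_ren_def)

lemma scons_simps [simp]: "(a ## \<sigma>) 0 = a" "(a ## \<sigma>) (Suc k) = \<sigma> k"
  by (simp_all add: scons_def)

lemma up_simps [simp]: "up \<sigma> 0 = Var 0" "up \<sigma> (Suc k) = lift (\<sigma> k)"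
  by (simp_all add: up_def)

lemma up_ren_comp: "up_ren \<rho>' \<circ> up_ren \<rho> = up_ren (\<rho>' \<circ> \<rho>)"
  by (rule ext, case_tac x) simp_all

lemma ren_ren: "ren (ren t \<rho>) \<rho>' = ren t (\<rho>' \<circ> \<rho>)"
  by (induct t arbitrary: \<rho> \<rho>') (simp_all add: up_ren_comp)

lemma up_up_ren: "up \<sigma> \<circ> up_ren \<rho> = up (\<sigma> \<circ> \<rho>)"
  by (rule ext, case_tac x) simp_all

lemma subst_ren: "subst (ren t \<rho>) \<sigma> = subst t (\<sigma> \<circ> \<rho>)"
  by (induct t arbitrary: \<rho> \<sigma>) (simp_all add: up_up_ren)

lemma up_ren_Suc: "up_ren \<rho> \<circ> Suc = Suc \<circ> \<rho>"
  by auto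

lemma up_Suc: "up \<sigma> \<circ> Suc = lift \<circ> \<sigma>"
  by auto

lemma ren_up: "(\<lambda>t. ren t (up_ren \<rho>)) \<circ> up \<sigma> = up ((\<lambda>t. ren t \<rho>) \<circ> \<sigma>)"
  by (rule ext, case_tac x) (simp_all add: ren_ren up_ren_Suc)

lemma ren_subst: "ren (subst t \<sigma>) \<rho> = subst t ((\<lambda>t. ren t \<rho>) \<circ> \<sigma>)"
  by (induct t arbitrary: \<rho> \<sigma>) (simp_all add: ren_up)

lemma subst_up: "(\<lambda>t. subst t (up \<tau>)) \<circ> up \<sigma> = up ((\<lambda>t. subst t \<tau>) \<circ> \<sigma>)"
  by (rule ext, case_tac x) (simp_all add: subst_ren ren_subst up_Suc)

lemma subst_subst: "subst (subst t \<sigma>) \<tau> = subst t ((\<lambda>t. subst t \<tau>) \<circ> \<sigma>)"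
  by (induct t arbitrary: \<sigma> \<tau>) (simp_all add: subst_up)

lemma up_Var: "up Var = Var"
  by (rule ext, case_tac x) simp_all

lemma subst_Var: "subst t Var = t"
  by (induct t) (simp_all add: up_Var)

lemma up_Var_ren: "up (Var \<circ> \<rho>) = Var \<circ> up_ren \<rho>"
  by (rule ext, case_tac x) simp_all

lemma ren_eq_subst: "ren t \<rho> = subst t (Var \<circ> \<rho>)"
  by (induct t arbitrary: \<rho>) (simp_all add: up_Var_ren)

section \<open>Scoping of raw terms\<close>

text \<open>Scoping is expressed by its effect on substitution instead of by free variables: this is
  the consequence that \<open>closed_subst\<close> draws from it, and it passes through
  \<open>ty_subst\<close> by composing substitutions.\<close>

definition scoped :: "nat \<Rightarrow> tm \<Rightarrow> bool" where
  "scoped n t \<longleftrightarrow> (\<forall>\<sigma> \<tau>. (\<forall>k<n. \<sigma> k = \<tau> k) \<longrightarrow> subst t \<sigma> = subst t \<tau>)"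

lemma scopedI: "(\<And>\<sigma> \<tau>. (\<forall>k<n. \<sigma> k = \<tau> k) \<Longrightarrow> subst t \<sigma> = subst t \<tau>) \<Longrightarrow> scoped n t"
  by (simp add: scoped_def)

lemma scopedD: "scoped n t \<Longrightarrow> \<forall>k<n. \<sigma> k = \<tau> k \<Longrightarrow> subst t \<sigma> = subst t \<tau>"
  by (simp add: scoped_def)

lemma up_cong: "\<forall>k<n. \<sigma> k = \<tau> k \<Longrightarrow> \<forall>k<Suc n. up \<sigma> k = up \<tau> k"
  by (simp add: All_less_Suc2)

lemmas scoped_up =
  scopedD[OF _ up_cong] scopedD[OF _ up_cong[OF up_cong]] scopedD[OF _ up_cong[OF up_cong[OF up_cong]]]

primrec scoped_ctx :: "tm list \<Rightarrow> bool" where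
  "scoped_ctx [] \<longleftrightarrow> True"
| "scoped_ctx (A # \<Gamma>) \<longleftrightarrow> scoped (length \<Gamma>) A \<and> scoped_ctx \<Gamma>"

text \<open>The context belongs to the conclusion because rules such as \<open>ty_Lam\<close> and
  \<open>ty_J\<close> have no premise that types the domain; its scope is read off the extended
  context of another premise. The claim for equality judgements is trivial, as they enter typing
  only through \<open>ty_conv\<close>, which keeps the subject.\<close>

lemma has_type_scoped:
  "\<turnstile> \<Gamma> \<Longrightarrow> scoped_ctx \<Gamma>"
  "\<Gamma> \<turnstile> t \<^bold>: T \<Longrightarrow> scoped_ctx \<Gamma> \<and> scoped (length \<Gamma>) t"
  "\<Gamma> \<turnstile> t \<doteq> t' \<^bold>: T \<Longrightarrow> True"
proof (induct rule: wf_ctx_has_type_jd_eq.inducts)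
  case (ty_subst \<Gamma> a A \<Delta> \<sigma>)
  have IH: "scoped (length \<Gamma>) a" "\<And>k. k < length \<Gamma> \<Longrightarrow> scoped (length \<Delta>) (\<sigma> k)" "scoped_ctx \<Delta>"
    using ty_subst by blast+
  have "scoped (length \<Delta>) (subst a \<sigma>)"
  proof (rule scopedI)
    fix \<tau> \<tau>' :: "nat \<Rightarrow> tm"
    assume *: "\<forall>k<length \<Delta>. \<tau> k = \<tau>' k"
    have "subst (\<sigma> k) \<tau> = subst (\<sigma> k) \<tau>'" if "k < length \<Gamma>" for k
      using IH(2)[OF that] * by (rule scopedD)
    then have "\<forall>k<length \<Gamma>. ((\<lambda>t. subst t \<tau>) \<circ> \<sigma>) k = ((\<lambda>t. subst t \<tau>') \<circ> \<sigma>) k"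
      by simp
    then show "subst (subst a \<sigma>) \<tau> = subst (subst a \<sigma>) \<tau>'"
      unfolding subst_subst by (rule scopedD[OF IH(1)])
  qed
  then show ?case
    using IH(3) by simp
next
  case (ty_conv \<Gamma> a A B i)
  then show ?case by simp
next
  case (ty_var \<Gamma> k)
  then show ?case by (simp add: scoped_def)
qed (simp_all only: simp_thms length_Cons list.size scoped_ctx.simps,
    (rule scopedI, simp only: subst.simps tm.inject simp_thms, (intro conjI)?,
      ((rule scopedD scoped_up, blast, assumption)+)?)+)

text \<open>Used where a closed function of the object language is applied to arguments:
  substitution then acts on the arguments alone.\<close>

lemma closed_subst: "[] \<turnstile> t \<^bold>: T \<Longrightarrow> subst t \<sigma> = t"
  using scopedD[OF conjunct2[OF has_type_scoped(2)], of "[]" t T \<sigma> Var] by (simp add: subst_Var)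


section \<open>Admissible rules\<close>

lemma ty_cumul_le: "\<Gamma> \<turnstile> A \<^bold>: Uni i \<Longrightarrow> i \<le> j \<Longrightarrow> \<Gamma> \<turnstile> A \<^bold>: Uni j"
  by (erule dec_induct[rotated]) (auto intro: ty_cumul)

lemma eq_cumul_le: "\<Gamma> \<turnstile> A \<doteq> B \<^bold>: Uni i \<Longrightarrow> i \<le> j \<Longrightarrow> \<Gamma> \<turnstile> A \<doteq> B \<^bold>: Uni j"
  by (erule dec_induct[rotated]) (auto intro: eq_cumul)

section \<open>Context lookup and weakening\<close>

text \<open>Shifts once per entry passed, where \<open>lookup\<close> shifts in one go, so that an
  extended context unfolds by recursion. \<open>Unit\<close> is a dummy value outside the
  context.\<close>

primrec look :: "tm list \<Rightarrow> nat \<Rightarrow> tm" where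
  "look [] k = Unit"
| "look (A # \<Gamma>) k = lift (case k of 0 \<Rightarrow> A | Suc j \<Rightarrow> look \<Gamma> j)"

lemma lookup_look: "k < length \<Gamma> \<Longrightarrow> lookup \<Gamma> k = look \<Gamma> k"
proof (induct \<Gamma> arbitrary: k)
  case (Cons A \<Gamma>)
  have "lookup (A # \<Gamma>) (Suc j) = lift (lookup \<Gamma> j)" for j
    by (simp add: ren_ren o_def)
  with Cons show ?case
    by (cases k) auto
qed simp

lemma ty_look: "\<turnstile> \<Gamma> \<Longrightarrow> k < length \<Gamma> \<Longrightarrow> \<Gamma> \<turnstile> Var k \<^bold>: look \<Gamma> k"
  by (metis lookup_look ty_var)

lemma ty_subst_look:
  "\<Gamma> \<turnstile> a \<^bold>: A \<Longrightarrow> \<turnstile> \<Delta> \<Longrightarrow> (\<And>k. k < length \<Gamma> \<Longrightarrow> \<Delta> \<turnstile> \<sigma> k \<^bold>: subst (look \<Gamma> k) \<sigma>) \<Longrightarrow>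
    \<Delta> \<turnstile> subst a \<sigma> \<^bold>: subst A \<sigma>"
  by (erule ty_subst, assumption) (simp add: lookup_look[simplified])

lemma eq_subst_look:
  "\<Gamma> \<turnstile> a \<doteq> b \<^bold>: A \<Longrightarrow> \<turnstile> \<Delta> \<Longrightarrow> (\<And>k. k < length \<Gamma> \<Longrightarrow> \<Delta> \<turnstile> \<sigma> k \<doteq> \<tau> k \<^bold>: subst (look \<Gamma> k) \<sigma>) \<Longrightarrow>
    \<Delta> \<turnstile> subst a \<sigma> \<doteq> subst b \<tau> \<^bold>: subst A \<sigma>"
  by (erule eq_subst, assumption) (simp add: lookup_look[simplified])

lemma Var_Suc: "\<turnstile> A # \<Gamma> \<Longrightarrow> k < length \<Gamma> \<Longrightarrow> A # \<Gamma> \<turnstile> (Var \<circ> Suc) k \<^bold>: subst (look \<Gamma> k) (Var \<circ> Suc)"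
  using ty_look[of "A # \<Gamma>" "Suc k"] by (simp add: ren_eq_subst)

lemma ty_lift: "\<Gamma> \<turnstile> a \<^bold>: A \<Longrightarrow> \<turnstile> B # \<Gamma> \<Longrightarrow> B # \<Gamma> \<turnstile> lift a \<^bold>: lift A"
  unfolding ren_eq_subst[of _ Suc] by (erule ty_subst_look) (assumption, erule (1) Var_Suc)

lemma eq_lift: "\<Gamma> \<turnstile> a \<doteq> b \<^bold>: A \<Longrightarrow> \<turnstile> B # \<Gamma> \<Longrightarrow> B # \<Gamma> \<turnstile> lift a \<doteq> lift b \<^bold>: lift A"
  unfolding ren_eq_subst[of _ Suc] by (erule eq_subst_look) (assumption, rule eq_refl, erule (1) Var_Suc)

inductive_cases wf_ctx_Cons: "\<turnstile> A # \<Gamma>"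


section \<open>Annotated terms\<close>

text \<open>Eliminations, abstractions, pairs and reflexivity carry the types involved, and the
  numbers are universe levels relative to a base level \<open>i\<close>. The parameter is later
  \<open>decl\<close>: a constant contains its whole declaration, so there is no global environment,
  and recursion on terms does not enter declarations.\<close>

datatype 'd ex =
    XV nat
  | XU nat
  | XPi nat nat "'d ex" "'d ex" | XLam nat nat "'d ex" "'d ex" "'d ex" | XApp "'d ex" "'d ex" "'d ex"
  | XSig nat nat "'d ex" "'d ex" | XTup "'d ex" "'d ex" "'d ex" | XP1 "'d ex" "'d ex" | XP2 "'d ex" "'d ex"
  | XId nat "'d ex" "'d ex" "'d ex" | XRf nat "'d ex" "'d ex"
  | XJ nat nat "'d ex" "'d ex" "'d ex" "'d ex" "'d ex" "'d ex"
  | XEm | XEmI nat "'d ex" "'d ex"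
  | XOn | XSt | XOnI nat "'d ex" "'d ex" "'d ex"
  | XTw | XT0 | XT1 | XTwI nat "'d ex" "'d ex" "'d ex" "'d ex"
  | XC 'd "'d ex list"

text \<open>\<open>draw\<close> depends on the base level, so that one declaration serves all
  universes; \<open>dno\<close> lets two declarations be told apart without looking into them.
  Without a \<open>dbody\<close> the constant never unfolds.\<close>

datatype decl =
  Decl (dno: nat) (draw: "nat \<Rightarrow> tm") (dtele: "(decl ex \<times> nat) list") (drty: "decl ex") (dlvl: nat)
    (dbody: "decl ex option")

type_synonym xt = "decl ex"

section \<open>Renaming and substitution of annotated terms\<close>

primrec xren :: "'d ex \<Rightarrow> (nat \<Rightarrow> nat) \<Rightarrow> 'd ex" where
  "xren (XV k) \<rho> = XV (\<rho> k)"
| "xren (XU k) \<rho> = XU k"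
| "xren (XPi k l A B) \<rho> = XPi k l (xren A \<rho>) (xren B (up_ren \<rho>))"
| "xren (XLam k l A B b) \<rho> = XLam k l (xren A \<rho>) (xren B (up_ren \<rho>)) (xren b (up_ren \<rho>))"
| "xren (XApp P f a) \<rho> = XApp (xren P \<rho>) (xren f \<rho>) (xren a \<rho>)"
| "xren (XSig k l A B) \<rho> = XSig k l (xren A \<rho>) (xren B (up_ren \<rho>))"
| "xren (XTup S a b) \<rho> = XTup (xren S \<rho>) (xren a \<rho>) (xren b \<rho>)"
| "xren (XP1 S p) \<rho> = XP1 (xren S \<rho>) (xren p \<rho>)"
| "xren (XP2 S p) \<rho> = XP2 (xren S \<rho>) (xren p \<rho>)"
| "xren (XId k A a b) \<rho> = XId k (xren A \<rho>) (xren a \<rho>) (xren b \<rho>)"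
| "xren (XRf k A a) \<rho> = XRf k (xren A \<rho>) (xren a \<rho>)"
| "xren (XJ k l A C c a b p) \<rho> = XJ k l (xren A \<rho>) (xren C (up_ren (up_ren (up_ren \<rho>))))
     (xren c (up_ren \<rho>)) (xren a \<rho>) (xren b \<rho>) (xren p \<rho>)"
| "xren XEm \<rho> = XEm"
| "xren (XEmI l C e) \<rho> = XEmI l (xren C (up_ren \<rho>)) (xren e \<rho>)"
| "xren XOn \<rho> = XOn"
| "xren XSt \<rho> = XSt"
| "xren (XOnI l C c u) \<rho> = XOnI l (xren C (up_ren \<rho>)) (xren c \<rho>) (xren u \<rho>)"
| "xren XTw \<rho> = XTw"
| "xren XT0 \<rho> = XT0"
| "xren XT1 \<rho> = XT1"
| "xren (XTwI l C c d b) \<rho> = XTwI l (xren C (up_ren \<rho>)) (xren c \<rho>) (xren d \<rho>) (xren b \<rho>)"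
| "xren (XC d as) \<rho> = XC d (map (\<lambda>a. xren a \<rho>) as)"

abbreviation xlift :: "'d ex \<Rightarrow> 'd ex" where
  "xlift t \<equiv> xren t Suc"

definition xup :: "(nat \<Rightarrow> 'd ex) \<Rightarrow> nat \<Rightarrow> 'd ex" where
  "xup \<sigma> = case_nat (XV 0) (\<lambda>k. xlift (\<sigma> k))"

primrec xsubst :: "'d ex \<Rightarrow> (nat \<Rightarrow> 'd ex) \<Rightarrow> 'd ex" where
  "xsubst (XV k) \<sigma> = \<sigma> k"
| "xsubst (XU k) \<sigma> = XU k"
| "xsubst (XPi k l A B) \<sigma> = XPi k l (xsubst A \<sigma>) (xsubst B (xup \<sigma>))"
| "xsubst (XLam k l A B b) \<sigma> = XLam k l (xsubst A \<sigma>) (xsubst B (xup \<sigma>)) (xsubst b (xup \<sigma>))"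
| "xsubst (XApp P f a) \<sigma> = XApp (xsubst P \<sigma>) (xsubst f \<sigma>) (xsubst a \<sigma>)"
| "xsubst (XSig k l A B) \<sigma> = XSig k l (xsubst A \<sigma>) (xsubst B (xup \<sigma>))"
| "xsubst (XTup S a b) \<sigma> = XTup (xsubst S \<sigma>) (xsubst a \<sigma>) (xsubst b \<sigma>)"
| "xsubst (XP1 S p) \<sigma> = XP1 (xsubst S \<sigma>) (xsubst p \<sigma>)"
| "xsubst (XP2 S p) \<sigma> = XP2 (xsubst S \<sigma>) (xsubst p \<sigma>)"
| "xsubst (XId k A a b) \<sigma> = XId k (xsubst A \<sigma>) (xsubst a \<sigma>) (xsubst b \<sigma>)"
| "xsubst (XRf k A a) \<sigma> = XRf k (xsubst A \<sigma>) (xsubst a \<sigma>)"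
| "xsubst (XJ k l A C c a b p) \<sigma> = XJ k l (xsubst A \<sigma>) (xsubst C (xup (xup (xup \<sigma>))))
     (xsubst c (xup \<sigma>)) (xsubst a \<sigma>) (xsubst b \<sigma>) (xsubst p \<sigma>)"
| "xsubst XEm \<sigma> = XEm"
| "xsubst (XEmI l C e) \<sigma> = XEmI l (xsubst C (xup \<sigma>)) (xsubst e \<sigma>)"
| "xsubst XOn \<sigma> = XOn"
| "xsubst XSt \<sigma> = XSt"
| "xsubst (XOnI l C c u) \<sigma> = XOnI l (xsubst C (xup \<sigma>)) (xsubst c \<sigma>) (xsubst u \<sigma>)"
| "xsubst XTw \<sigma> = XTw"
| "xsubst XT0 \<sigma> = XT0"
| "xsubst XT1 \<sigma> = XT1"
| "xsubst (XTwI l C c d b) \<sigma> = XTwI l (xsubst C (xup \<sigma>)) (xsubst c \<sigma>) (xsubst d \<sigma>) (xsubst b \<sigma>)"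
| "xsubst (XC d as) \<sigma> = XC d (map (\<lambda>a. xsubst a \<sigma>) as)"

lemma xup_simps [simp]: "xup \<sigma> 0 = XV 0" "xup \<sigma> (Suc k) = xlift (\<sigma> k)"
  by (simp_all add: xup_def)

lemma xren_xren: "xren (xren t \<rho>) \<rho>' = xren t (\<rho>' \<circ> \<rho>)"
  by (induct t arbitrary: \<rho> \<rho>') (simp_all add: up_ren_comp)

lemma xup_up_ren: "xup \<sigma> \<circ> up_ren \<rho> = xup (\<sigma> \<circ> \<rho>)"
  by (rule ext, case_tac x) simp_all

lemma xsubst_xren: "xsubst (xren t \<rho>) \<sigma> = xsubst t (\<sigma> \<circ> \<rho>)"
  by (induct t arbitrary: \<rho> \<sigma>) (simp_all add: xup_up_ren)

lemma xup_Suc: "xup \<sigma> \<circ> Suc = xlift \<circ> \<sigma>"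
  by auto

lemma xren_xup: "(\<lambda>t. xren t (up_ren \<rho>)) \<circ> xup \<sigma> = xup ((\<lambda>t. xren t \<rho>) \<circ> \<sigma>)"
  by (rule ext, case_tac x) (simp_all add: xren_xren up_ren_Suc)

lemma xren_xsubst: "xren (xsubst t \<sigma>) \<rho> = xsubst t ((\<lambda>t. xren t \<rho>) \<circ> \<sigma>)"
  by (induct t arbitrary: \<rho> \<sigma>) (simp_all add: xren_xup)

lemma xsubst_xup: "(\<lambda>t. xsubst t (xup \<tau>)) \<circ> xup \<sigma> = xup ((\<lambda>t. xsubst t \<tau>) \<circ> \<sigma>)"
  by (rule ext, case_tac x) (simp_all add: xsubst_xren xren_xsubst xup_Suc)

lemma xsubst_xsubst: "xsubst (xsubst t \<sigma>) \<tau> = xsubst t ((\<lambda>t. xsubst t \<tau>) \<circ> \<sigma>)"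
  by (induct t arbitrary: \<sigma> \<tau>) (simp_all add: xsubst_xup)

lemma xup_XV: "xup XV = XV"
  by (rule ext, case_tac x) simp_all

lemma xsubst_XV: "xsubst t XV = t"
  by (induct t) (simp_all add: xup_XV map_idI)

lemma xup_XV_ren: "xup (XV \<circ> \<rho>) = XV \<circ> up_ren \<rho>"
  by (rule ext, case_tac x) simp_all

lemma xren_eq_xsubst: "xren t \<rho> = xsubst t (XV \<circ> \<rho>)"
  by (induct t arbitrary: \<rho>) (simp_all add: xup_XV_ren)

text \<open>The head of the list is the value at index 0, in the order of contexts. The rest
  \<open>z\<close> is \<open>XV\<close> for instantiation, \<open>XV \<circ> Suc\<close> for
  instantiation below one new variable, and a closed dummy for the arguments of a constant.\<close>

primrec lk :: "(nat \<Rightarrow> 'a) \<Rightarrow> 'a list \<Rightarrow> nat \<Rightarrow> 'a" where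
  "lk z [] k = z k"
| "lk z (a # as) k = (case k of 0 \<Rightarrow> a | Suc j \<Rightarrow> lk z as j)"

lemma comp_lk: "f \<circ> lk z as = lk (f \<circ> z) (map f as)"
proof
  show "(f \<circ> lk z as) k = lk (f \<circ> z) (map f as) k" for k
    by (induct as arbitrary: k) (auto split: nat.split)
qed

lemma lk_Suc: "lk z (a # as) \<circ> Suc = lk z as"
  by auto

lemma scons_eq_lk: "a ## \<sigma> = lk \<sigma> [a]"
  by (auto simp: scons_def split: nat.split)

abbreviation xinst :: "'d ex \<Rightarrow> 'd ex \<Rightarrow> 'd ex" where
  "xinst B a \<equiv> xsubst B (lk XV [a])"

text \<open>Out-of-range variables in a definition get a closed value, so that substitution commutes
  with unfolding regardless of scoping.\<close>

primrec er :: "nat \<Rightarrow> xt \<Rightarrow> tm" where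
  "er i (XV k) = Var k"
| "er i (XU k) = Uni (i + k)"
| "er i (XPi k l A B) = Pi (er i A) (er i B)"
| "er i (XLam k l A B b) = Lam (er i A) (er i b)"
| "er i (XApp P f a) = App (er i f) (er i a)"
| "er i (XSig k l A B) = Sig (er i A) (er i B)"
| "er i (XTup S a b) = Tup (er i a) (er i b)"
| "er i (XP1 S p) = Pr1 (er i p)"
| "er i (XP2 S p) = Pr2 (er i p)"
| "er i (XId k A a b) = Eq (er i A) (er i a) (er i b)"
| "er i (XRf k A a) = Refl (er i a)"
| "er i (XJ k l A C c a b p) = J (er i A) (er i C) (er i c) (er i a) (er i b) (er i p)"
| "er i XEm = Empty"
| "er i (XEmI l C e) = EmptyInd (er i C) (er i e)"
| "er i XOn = Unit"
| "er i XSt = Star"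
| "er i (XOnI l C c u) = UnitInd (er i C) (er i c) (er i u)"
| "er i XTw = Two"
| "er i XT0 = Two0"
| "er i XT1 = Two1"
| "er i (XTwI l C c d b) = TwoInd (er i C) (er i c) (er i d) (er i b)"
| "er i (XC d as) = subst (draw d i) (lk (\<lambda>_. Unit) (map (er i) as))"

lemma er_xren: "er i (xren t \<rho>) = ren (er i t) \<rho>"
proof (induct t arbitrary: \<rho>)
  case (XC d as)
  then have "map (er i) (map (\<lambda>a. xren a \<rho>) as) = map (\<lambda>t. ren t \<rho>) (map (er i) as)"
    by simp
  then show ?case
    by (simp only: xren.simps er.simps ren_subst comp_lk) (simp add: o_def)
qed simp_all

lemma er_xup: "er i \<circ> xup \<sigma> = up (er i \<circ> \<sigma>)"
  by (rule ext, case_tac x) (simp_all add: er_xren)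

lemma er_xsubst: "er i (xsubst t \<sigma>) = subst (er i t) (er i \<circ> \<sigma>)"
proof (induct t arbitrary: \<sigma>)
  case (XC d as)
  then have "map (er i) (map (\<lambda>a. xsubst a \<sigma>) as) = map (\<lambda>t. subst t (er i \<circ> \<sigma>)) (map (er i) as)"
    by (simp add: o_def)
  then show ?case
    by (simp only: xsubst.simps er.simps subst_subst comp_lk) (simp add: o_def)
qed (simp_all add: er_xup)

lemma er_XV: "er i \<circ> XV = Var"
  by auto

lemma er_xinst: "er i (xinst B a) = (er i B)\<lbrakk>er i a\<rbrakk>"
  by (simp add: er_xsubst comp_lk er_XV scons_eq_lk)

section \<open>Typing of annotated terms\<close>

abbreviation ec :: "nat \<Rightarrow> xt list \<Rightarrow> tm list" where
  "ec i \<equiv> map (er i)"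

primrec xlook :: "'d ex list \<Rightarrow> nat \<Rightarrow> 'd ex" where
  "xlook [] k = XOn"
| "xlook (A # \<Gamma>) k = xlift (case k of 0 \<Rightarrow> A | Suc j \<Rightarrow> xlook \<Gamma> j)"

lemma er_xlook: "er i (xlook \<Gamma> k) = look (ec i \<Gamma>) k"
  by (induct \<Gamma> arbitrary: k) (simp_all add: er_xren split: nat.split)

text \<open>Syntactic identity is a separate disjunct, so that reflexivity holds without knowing the
  type to be well formed; this is what turns \<open>AS\<close> into \<open>AT\<close> at
  once.\<close>

definition teq :: "nat \<Rightarrow> xt list \<Rightarrow> xt \<Rightarrow> xt \<Rightarrow> bool" where
  "teq i \<Gamma> A B \<longleftrightarrow> A = B \<or> (\<exists>j. ec i \<Gamma> \<turnstile> er i A \<doteq> er i B \<^bold>: Uni j)"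

definition jeq :: "nat \<Rightarrow> xt list \<Rightarrow> xt \<Rightarrow> xt \<Rightarrow> xt \<Rightarrow> bool" where
  "jeq i \<Gamma> a b A \<longleftrightarrow> ec i \<Gamma> \<turnstile> er i a \<doteq> er i b \<^bold>: er i A"

abbreviation ctele :: "decl \<Rightarrow> xt list" where
  "ctele d \<equiv> map fst (dtele d)"

abbreviation args :: "xt list \<Rightarrow> nat \<Rightarrow> xt" where
  "args \<equiv> lk (\<lambda>_. XOn)"

text \<open>\<open>AT\<close> is \<open>AS\<close> followed by one conversion of the type, so that inversion needs no induction.
  There is no cumulativity: the levels of the type formers are recorded in the terms.\<close>

inductive AS :: "nat \<Rightarrow> xt list \<Rightarrow> xt \<Rightarrow> xt \<Rightarrow> bool"
  and AT :: "nat \<Rightarrow> xt list \<Rightarrow> xt \<Rightarrow> xt \<Rightarrow> bool"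
  and AL :: "nat \<Rightarrow> xt list \<Rightarrow> xt list \<Rightarrow> xt list \<Rightarrow> bool"
  for i :: nat
where
  AT_I: "AS i \<Gamma> e S \<Longrightarrow> teq i \<Gamma> S T \<Longrightarrow> AT i \<Gamma> e T"
| AS_V: "k < length \<Gamma> \<Longrightarrow> AS i \<Gamma> (XV k) (xlook \<Gamma> k)"
| AS_U: "AS i \<Gamma> (XU k) (XU (Suc k))"
| AS_Pi: "AT i \<Gamma> A (XU k) \<Longrightarrow> AT i (A # \<Gamma>) B (XU l) \<Longrightarrow> AS i \<Gamma> (XPi k l A B) (XU (max k l))"
| AS_Lam: "AT i \<Gamma> A (XU k) \<Longrightarrow> AT i (A # \<Gamma>) B (XU l) \<Longrightarrow> AT i (A # \<Gamma>) b B \<Longrightarrow>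
    AS i \<Gamma> (XLam k l A B b) (XPi k l A B)"
| AS_App: "AT i \<Gamma> A (XU k) \<Longrightarrow> AT i (A # \<Gamma>) B (XU l) \<Longrightarrow> AT i \<Gamma> f (XPi k l A B) \<Longrightarrow> AT i \<Gamma> a A \<Longrightarrow>
    AS i \<Gamma> (XApp (XPi k l A B) f a) (xinst B a)"
| AS_Sig: "AT i \<Gamma> A (XU k) \<Longrightarrow> AT i (A # \<Gamma>) B (XU l) \<Longrightarrow> AS i \<Gamma> (XSig k l A B) (XU (max k l))"
| AS_Tup: "AT i \<Gamma> A (XU k) \<Longrightarrow> AT i (A # \<Gamma>) B (XU l) \<Longrightarrow> AT i \<Gamma> a A \<Longrightarrow> AT i \<Gamma> b (xinst B a) \<Longrightarrow>
    AS i \<Gamma> (XTup (XSig k l A B) a b) (XSig k l A B)"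
| AS_P1: "AT i \<Gamma> A (XU k) \<Longrightarrow> AT i (A # \<Gamma>) B (XU l) \<Longrightarrow> AT i \<Gamma> p (XSig k l A B) \<Longrightarrow>
    AS i \<Gamma> (XP1 (XSig k l A B) p) A"
| AS_P2: "AT i \<Gamma> A (XU k) \<Longrightarrow> AT i (A # \<Gamma>) B (XU l) \<Longrightarrow> AT i \<Gamma> p (XSig k l A B) \<Longrightarrow>
    AS i \<Gamma> (XP2 (XSig k l A B) p) (xinst B (XP1 (XSig k l A B) p))"
| AS_Id: "AT i \<Gamma> A (XU k) \<Longrightarrow> AT i \<Gamma> a A \<Longrightarrow> AT i \<Gamma> b A \<Longrightarrow> AS i \<Gamma> (XId k A a b) (XU k)"
| AS_Rf: "AT i \<Gamma> A (XU k) \<Longrightarrow> AT i \<Gamma> a A \<Longrightarrow> AS i \<Gamma> (XRf k A a) (XId k A a a)"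
| AS_J: "AT i \<Gamma> A (XU k) \<Longrightarrow> AT i (A # \<Gamma>) (xlift A) (XU k) \<Longrightarrow>
    AT i (xlift A # A # \<Gamma>) (XId k (xlift (xlift A)) (XV (Suc 0)) (XV 0)) (XU k) \<Longrightarrow>
    AT i (XId k (xlift (xlift A)) (XV (Suc 0)) (XV 0) # xlift A # A # \<Gamma>) C (XU l) \<Longrightarrow>
    AT i (A # \<Gamma>) c (xsubst C (lk (XV \<circ> Suc) [XRf k (xlift A) (XV 0), XV 0, XV 0])) \<Longrightarrow>
    AT i \<Gamma> a A \<Longrightarrow> AT i \<Gamma> b A \<Longrightarrow> AT i \<Gamma> p (XId k A a b) \<Longrightarrow>
    AS i \<Gamma> (XJ k l A C c a b p) (xsubst C (lk XV [p, b, a]))"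
| AS_Em: "AS i \<Gamma> XEm (XU 0)"
| AS_EmI: "AT i (XEm # \<Gamma>) C (XU l) \<Longrightarrow> AT i \<Gamma> e XEm \<Longrightarrow> AS i \<Gamma> (XEmI l C e) (xinst C e)"
| AS_On: "AS i \<Gamma> XOn (XU 0)"
| AS_St: "AS i \<Gamma> XSt XOn"
| AS_OnI: "AT i (XOn # \<Gamma>) C (XU l) \<Longrightarrow> AT i \<Gamma> c (xinst C XSt) \<Longrightarrow> AT i \<Gamma> u XOn \<Longrightarrow>
    AS i \<Gamma> (XOnI l C c u) (xinst C u)"
| AS_Tw: "AS i \<Gamma> XTw (XU 0)"
| AS_T0: "AS i \<Gamma> XT0 XTw"
| AS_T1: "AS i \<Gamma> XT1 XTw"
| AS_TwI: "AT i (XTw # \<Gamma>) C (XU l) \<Longrightarrow> AT i \<Gamma> c (xinst C XT0) \<Longrightarrow> AT i \<Gamma> d (xinst C XT1) \<Longrightarrow>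
    AT i \<Gamma> b XTw \<Longrightarrow> AS i \<Gamma> (XTwI l C c d b) (xinst C b)"
| AS_C: "AL i \<Gamma> as (ctele d) \<Longrightarrow> \<turnstile> ec i (ctele d) \<Longrightarrow> ec i (ctele d) \<turnstile> draw d i \<^bold>: er i (drty d) \<Longrightarrow>
    (\<forall>b. dbody d = Some b \<longrightarrow> AT i (ctele d) b (drty d) \<and>
       ec i (ctele d) \<turnstile> draw d i \<doteq> er i b \<^bold>: er i (drty d)) \<Longrightarrow>
    AS i \<Gamma> (XC d as) (xsubst (drty d) (args as))"
| AL_Nil: "AL i \<Gamma> [] []"
| AL_Cons: "AL i \<Gamma> as \<Delta> \<Longrightarrow> AT i \<Gamma> a (xsubst A (args as)) \<Longrightarrow> AL i \<Gamma> (a # as) (A # \<Delta>)"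

inductive_cases AT_E: "AT i \<Gamma> e T"
inductive_cases AS_Pi_E: "AS i \<Gamma> (XPi k l A B) T"
inductive_cases AS_Lam_E: "AS i \<Gamma> (XLam k l A B b) T"
inductive_cases AS_App_E: "AS i \<Gamma> (XApp P f a) T"
inductive_cases AS_Sig_E: "AS i \<Gamma> (XSig k l A B) T"
inductive_cases AS_Tup_E: "AS i \<Gamma> (XTup S a b) T"
inductive_cases AS_P1_E: "AS i \<Gamma> (XP1 S p) T"
inductive_cases AS_P2_E: "AS i \<Gamma> (XP2 S p) T"
inductive_cases AS_Id_E: "AS i \<Gamma> (XId k A a b) T"
inductive_cases AS_Rf_E: "AS i \<Gamma> (XRf k A a) T"
inductive_cases AS_J_E: "AS i \<Gamma> (XJ k l A C c a b p) T"
inductive_cases AS_EmI_E: "AS i \<Gamma> (XEmI l C e) T"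
inductive_cases AS_OnI_E: "AS i \<Gamma> (XOnI l C c e) T"
inductive_cases AS_TwI_E: "AS i \<Gamma> (XTwI l C c d e) T"
inductive_cases AS_C_E: "AS i \<Gamma> (XC d as) T"
inductive_cases AL_Cons_E: "AL i \<Gamma> as (A # \<Delta>)"

lemma teq_refl [simp]: "teq i \<Gamma> A A"
  by (simp add: teq_def)

lemma AS_AT: "AS i \<Gamma> e T \<Longrightarrow> AT i \<Gamma> e T"
  by (erule AT_I) simp

lemma teq_sym: "teq i \<Gamma> A B \<Longrightarrow> teq i \<Gamma> B A"
  by (auto simp: teq_def intro: eq_sym)

text \<open>The two equalities may live in different universes; cumulativity lifts both to the
  larger one.\<close>

lemma teq_trans: "teq i \<Gamma> A B \<Longrightarrow> teq i \<Gamma> B C \<Longrightarrow> teq i \<Gamma> A C"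
  unfolding teq_def by (meson eq_trans eq_cumul_le max.cobounded1 max.cobounded2)

lemma AT_teq: "AT i \<Gamma> e S \<Longrightarrow> teq i \<Gamma> S T \<Longrightarrow> AT i \<Gamma> e T"
  by (erule AT_E) (blast intro: AT_I teq_trans)

lemma ty_teq: "ec i \<Gamma> \<turnstile> t \<^bold>: er i A \<Longrightarrow> teq i \<Gamma> A B \<Longrightarrow> ec i \<Gamma> \<turnstile> t \<^bold>: er i B"
  by (auto simp: teq_def intro: ty_conv)

lemma jeq_teq: "jeq i \<Gamma> a b A \<Longrightarrow> teq i \<Gamma> A B \<Longrightarrow> jeq i \<Gamma> a b B"
  by (auto simp: teq_def jeq_def intro: eq_conv)

lemma jeq_imp_teq: "jeq i \<Gamma> A B (XU k) \<Longrightarrow> teq i \<Gamma> A B"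
  by (auto simp: teq_def jeq_def)

lemma jeq_sym: "jeq i \<Gamma> a b A \<Longrightarrow> jeq i \<Gamma> b a A"
  by (auto simp: jeq_def intro: eq_sym)

lemma jeq_trans: "jeq i \<Gamma> a b A \<Longrightarrow> jeq i \<Gamma> b c A \<Longrightarrow> jeq i \<Gamma> a c A"
  by (auto simp: jeq_def intro: eq_trans)

lemma xsubst_xlift_lk: "xsubst (xlift A) (lk z (a # as)) = xsubst A (lk z as)"
  by (simp only: xsubst_xren lk_Suc)

lemma er_args: "er i \<circ> args as = lk (\<lambda>_. Unit) (ec i as)"
  by (simp add: comp_lk) (simp add: o_def)

lemma lk_scons: "lk \<sigma> (a # as) = a ## lk \<sigma> as" "lk \<sigma> [] = \<sigma>"
  by (auto simp: scons_def split: nat.split)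

lemmas er_inst = er_xsubst comp_lk lk_scons

lemma er_inst_J:
  "er i (xsubst C (lk XV [p, b, a])) = subst (er i C) (er i p ## er i b ## er i a ## Var)"
  "er i (xsubst C (lk (XV \<circ> Suc) [XRf k A (XV 0), XV 0, XV 0])) =
     subst (er i C) (Refl (Var 0) ## Var 0 ## Var 0 ## (\<lambda>k. Var (Suc k)))"
  by (simp_all add: er_inst) (simp_all add: o_def)

lemma wf_Empty: "\<turnstile> \<Gamma> \<Longrightarrow> \<turnstile> Empty # \<Gamma>"
  by (rule ctx_cons[OF _ ty_Empty[of _ 0]])

lemma wf_Unit: "\<turnstile> \<Gamma> \<Longrightarrow> \<turnstile> Unit # \<Gamma>"
  by (rule ctx_cons[OF _ ty_Unit[of _ 0]])

lemma wf_Two: "\<turnstile> \<Gamma> \<Longrightarrow> \<turnstile> Two # \<Gamma>"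
  by (rule ctx_cons[OF _ ty_Two[of _ 0]])

text \<open>The third claim presents an argument list as a typed substitution into the telescope,
  the form in which \<open>ty_subst\<close> types a constant. The rules repeat the formation
  premises of their types, from which the contexts under binders are rebuilt.\<close>

lemma AT_sound:
  "AS i \<Gamma> e T \<Longrightarrow> \<turnstile> ec i \<Gamma> \<Longrightarrow> ec i \<Gamma> \<turnstile> er i e \<^bold>: er i T"
  "AT i \<Gamma> e T \<Longrightarrow> \<turnstile> ec i \<Gamma> \<Longrightarrow> ec i \<Gamma> \<turnstile> er i e \<^bold>: er i T"
  "AL i \<Gamma> as \<Delta> \<Longrightarrow> \<turnstile> ec i \<Gamma> \<Longrightarrow> k < length \<Delta> \<Longrightarrow>
    ec i \<Gamma> \<turnstile> er i (args as k) \<^bold>: subst (look (ec i \<Delta>) k) (er i \<circ> args as)"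
proof (induct arbitrary: and and k rule: AS_AT_AL.inducts)
  case (AT_I \<Gamma> e S T)
  then show ?case by (blast intro: ty_teq)
next
  case (AS_V k \<Gamma>)
  then show ?case
    using ty_look[of "ec i \<Gamma>" k] by (simp add: er_xlook)
next
  case (AS_Pi \<Gamma> A k B l)
  have "ec i \<Gamma> \<turnstile> er i A \<^bold>: Uni (i + k)" "er i A # ec i \<Gamma> \<turnstile> er i B \<^bold>: Uni (i + l)"
    using AS_Pi ctx_cons by fastforce+
  \<comment> \<open>\<open>ty_Pi\<close> wants domain and codomain in one universe; both are lifted
    to the maximum of the recorded levels.\<close>
  then show ?case
    by (auto intro!: ty_Pi elim!: ty_cumul_le)
next
  case (AS_Sig \<Gamma> A k B l)
  have "ec i \<Gamma> \<turnstile> er i A \<^bold>: Uni (i + k)" "er i A # ec i \<Gamma> \<turnstile> er i B \<^bold>: Uni (i + l)"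
    using AS_Sig ctx_cons by fastforce+
  then show ?case
    by (auto intro!: ty_Sig elim!: ty_cumul_le)
next
  case (AS_Lam \<Gamma> A k B l b)
  then have "\<turnstile> er i A # ec i \<Gamma>" by (simp add: ctx_cons)
  with AS_Lam show ?case by (auto intro!: ty_Lam)
next
  case (AS_App \<Gamma> A k B l f a)
  then show ?case by (auto intro!: ty_App simp: er_xinst)
next
  case (AS_Tup \<Gamma> A k B l a b)
  then have "\<turnstile> er i A # ec i \<Gamma>" by (simp add: ctx_cons)
  with AS_Tup show ?case by (auto intro!: ty_Tup simp: er_xinst)
next
  case (AS_P1 \<Gamma> A k B l p)
  then show ?case by (auto intro: ty_Pr1)
next
  case (AS_P2 \<Gamma> A k B l p)
  then show ?case by (auto intro!: ty_Pr2 simp: er_xinst)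
next
  case (AS_J \<Gamma> A k C l c a b p)
  then have "\<turnstile> er i A # ec i \<Gamma>"
    by (auto intro: ctx_cons)
  moreover from this have "\<turnstile> lift (er i A) # er i A # ec i \<Gamma>"
    using AS_J by (auto intro: ctx_cons simp: er_xren)
  moreover from this have "\<turnstile> Eq (lift (lift (er i A))) (Var (Suc 0)) (Var 0) # lift (er i A) # er i A # ec i \<Gamma>"
    using AS_J by (auto intro: ctx_cons simp: er_xren)
  ultimately show ?case
    using AS_J by (auto intro!: ty_J simp: er_inst_J er_xren)
next
  case (AS_EmI \<Gamma> C l e)
  then show ?case by (auto intro: ty_EmptyInd wf_Empty simp: er_xinst)
next
  case (AS_OnI \<Gamma> C l c u)
  then show ?case by (auto intro: ty_UnitInd wf_Unit simp: er_xinst)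
next
  case (AS_TwI \<Gamma> C l c d b)
  then show ?case by (auto intro: ty_TwoInd wf_Two simp: er_xinst)
next
  case (AS_C \<Gamma> as d)
  have "ec i \<Gamma> \<turnstile> subst (draw d i) (er i \<circ> args as) \<^bold>: subst (er i (drty d)) (er i \<circ> args as)"
    by (rule ty_subst_look[of "ec i (ctele d)"]) (use AS_C in \<open>simp_all add: o_def\<close>)
  then show ?case by (simp add: er_xsubst er_args)
next
  case (AL_Cons \<Gamma> as \<Delta> a A)
  then show ?case
    by (cases k) (simp_all add: subst_ren o_def er_xsubst)
qed (simp_all add: ty_Uni ty_Eq ty_Refl ty_Empty ty_Unit ty_Star ty_Two ty_Two0 ty_Two1)

lemma wf_ext: "\<turnstile> ec i \<Gamma> \<Longrightarrow> AT i \<Gamma> A (XU k) \<Longrightarrow> \<turnstile> ec i (A # \<Gamma>)"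
  using AT_sound(2) by (fastforce intro: ctx_cons)


section \<open>Renaming and substitution for annotated terms\<close>

lemma xsubst_xinst: "xsubst (xinst B a) \<sigma> = xinst (xsubst B (xup \<sigma>)) (xsubst a \<sigma>)"
  unfolding xsubst_xsubst
  by (rule arg_cong[where f = "xsubst B"]) (auto simp: xup_def xsubst_xren lk_Suc xsubst_XV o_def split: nat.split)

lemma xsubst_xlift: "xsubst (xlift A) (xup \<sigma>) = xlift (xsubst A \<sigma>)"
  by (simp add: xsubst_xren xren_xsubst xup_Suc)

lemma lk_nil: "lk z [] = z"
  by auto

lemma xsubst_inst_J:
  "xsubst (xsubst C (lk XV [p, b, a])) \<sigma> =
    xsubst (xsubst C (xup (xup (xup \<sigma>)))) (lk XV [xsubst p \<sigma>, xsubst b \<sigma>, xsubst a \<sigma>])"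
  "xsubst (xsubst C (lk (XV \<circ> Suc) [XRf k (xlift A) (XV 0), XV 0, XV 0])) (xup \<sigma>) =
    xsubst (xsubst C (xup (xup (xup \<sigma>)))) (lk (XV \<circ> Suc) [XRf k (xlift (xsubst A \<sigma>)) (XV 0), XV 0, XV 0])"
proof -
  \<comment> \<open>The motive of \<open>J\<close> has three variables, so assignments are compared
    at 0, 1, 2 and beyond.\<close>
  have eq: "f = g" if "f 0 = g 0" "f (Suc 0) = g (Suc 0)" "f (Suc (Suc 0)) = g (Suc (Suc 0))"
    "\<And>j. f (Suc (Suc (Suc j))) = g (Suc (Suc (Suc j)))" for f g :: "nat \<Rightarrow> 'd ex"
    using that by (metis ext old.nat.exhaust)
  show "xsubst (xsubst C (lk XV [p, b, a])) \<sigma> =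
      xsubst (xsubst C (xup (xup (xup \<sigma>)))) (lk XV [xsubst p \<sigma>, xsubst b \<sigma>, xsubst a \<sigma>])"
    unfolding xsubst_xsubst
    by (intro arg_cong[where f = "xsubst C"] eq; simp add: xsubst_xlift_lk xsubst_XV lk_nil)
  show "xsubst (xsubst C (lk (XV \<circ> Suc) [XRf k (xlift A) (XV 0), XV 0, XV 0])) (xup \<sigma>) =
      xsubst (xsubst C (xup (xup (xup \<sigma>)))) (lk (XV \<circ> Suc) [XRf k (xlift (xsubst A \<sigma>)) (XV 0), XV 0, XV 0])"
    unfolding xsubst_xsubst
    by (intro arg_cong[where f = "xsubst C"] eq;
        simp add: xsubst_xlift_lk lk_nil xsubst_xlift flip: xren_eq_xsubst)
qed

lemma xsubst_args: "xsubst (xsubst A (args as)) \<sigma> = xsubst A (args (map (\<lambda>a. xsubst a \<sigma>) as))"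
  unfolding xsubst_xsubst comp_lk by (simp add: o_def)

text \<open>Renamings and substitutions are treated by one induction: \<open>W \<Delta> \<sigma> \<Gamma>\<close> is instantiated first
  by renamings, then by substitutions, whose extension under a binder needs the lemma for renamings.\<close>

context
  fixes i :: nat and W :: "xt list \<Rightarrow> (nat \<Rightarrow> xt) \<Rightarrow> xt list \<Rightarrow> bool"
  assumes W_wf: "W \<Delta> \<sigma> \<Gamma> \<Longrightarrow> \<turnstile> ec i \<Delta>"
    and W_var: "W \<Delta> \<sigma> \<Gamma> \<Longrightarrow> k < length \<Gamma> \<Longrightarrow> AT i \<Delta> (\<sigma> k) (xsubst (xlook \<Gamma> k) \<sigma>)"
    and W_up: "W \<Delta> \<sigma> \<Gamma> \<Longrightarrow> AT i \<Delta> (xsubst A \<sigma>) (XU l) \<Longrightarrow> W (xsubst A \<sigma> # \<Delta>) (xup \<sigma>) (A # \<Gamma>)"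
begin

lemma teq_act:
  assumes w: "W \<Delta> \<sigma> \<Gamma>" and "teq i \<Gamma> S T"
  shows "teq i \<Delta> (xsubst S \<sigma>) (xsubst T \<sigma>)"
proof -
  \<comment> \<open>Conversions are raw judgements and are moved by \<open>eq_subst\<close>, with
    the same substitution on both sides.\<close>
  have "ec i \<Delta> \<turnstile> (er i \<circ> \<sigma>) k \<doteq> (er i \<circ> \<sigma>) k \<^bold>: subst (look (ec i \<Gamma>) k) (er i \<circ> \<sigma>)" if "k < length (ec i \<Gamma>)" for k
    using AT_sound(2)[OF W_var[OF w] W_wf[OF w], of k] that by (auto simp: er_xsubst er_xlook intro: eq_refl)
  then have "ec i \<Delta> \<turnstile> er i (xsubst S \<sigma>) \<doteq> er i (xsubst T \<sigma>) \<^bold>: subst (Uni j) (er i \<circ> \<sigma>)"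
    if "ec i \<Gamma> \<turnstile> er i S \<doteq> er i T \<^bold>: Uni j" for j
    unfolding er_xsubst by (rule eq_subst_look[OF that W_wf[OF w]])
  with \<open>teq i \<Gamma> S T\<close> show ?thesis
    by (auto simp: teq_def)
qed

text \<open>Annotations are substituted along with the terms, so every rule is reapplied to the
  substituted premises; below a binder the extension of \<open>W\<close> needs the typing of the
  substituted domain, which is why that is obtained before the other premises.\<close>

lemma AT_act:
  "AS i \<Gamma> e T \<Longrightarrow> W \<Delta> \<sigma> \<Gamma> \<Longrightarrow> AT i \<Delta> (xsubst e \<sigma>) (xsubst T \<sigma>)"
  "AT i \<Gamma> e T \<Longrightarrow> W \<Delta> \<sigma> \<Gamma> \<Longrightarrow> AT i \<Delta> (xsubst e \<sigma>) (xsubst T \<sigma>)"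
  "AL i \<Gamma> as \<Theta> \<Longrightarrow> W \<Delta> \<sigma> \<Gamma> \<Longrightarrow> AL i \<Delta> (map (\<lambda>a. xsubst a \<sigma>) as) \<Theta>"
proof (induct arbitrary: \<Delta> \<sigma> and \<Delta> \<sigma> and \<Delta> \<sigma> rule: AS_AT_AL.inducts)
  case (AT_I \<Gamma> e S T)
  then show ?case by (blast intro: AT_teq teq_act)
next
  case (AS_V k \<Gamma>)
  then show ?case by (simp add: W_var)
next
  case (AS_Pi \<Gamma> A k B l)
  note A = AS_Pi(2)[OF AS_Pi(5), simplified]
  note B = AS_Pi(4)[OF W_up[OF AS_Pi(5) A], simplified]
  show ?case
    using AS_AT_AL.AS_Pi[OF A B] by (simp add: AS_AT)
next
  case (AS_Lam \<Gamma> A k B l b)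
  note A = AS_Lam(2)[OF AS_Lam(7), simplified]
  note B = AS_Lam(4)[OF W_up[OF AS_Lam(7) A], simplified] AS_Lam(6)[OF W_up[OF AS_Lam(7) A], simplified]
  show ?case
    using AS_AT_AL.AS_Lam[OF A B] by (simp add: AS_AT)
next
  case (AS_App \<Gamma> A k B l f a)
  note A = AS_App(2)[OF AS_App(9), simplified]
  note B = AS_App(4)[OF W_up[OF AS_App(9) A], simplified]
  show ?case
    using AS_AT_AL.AS_App[OF A B] AS_App(6,8)[OF AS_App(9)] by (simp add: AS_AT xsubst_xinst)
next
  case (AS_Sig \<Gamma> A k B l)
  note A = AS_Sig(2)[OF AS_Sig(5), simplified]
  note B = AS_Sig(4)[OF W_up[OF AS_Sig(5) A], simplified]
  show ?case
    using AS_AT_AL.AS_Sig[OF A B] by (simp add: AS_AT)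
next
  case (AS_Tup \<Gamma> A k B l a b)
  note A = AS_Tup(2)[OF AS_Tup(9), simplified]
  note B = AS_Tup(4)[OF W_up[OF AS_Tup(9) A], simplified]
  show ?case
    using AS_AT_AL.AS_Tup[OF A B] AS_Tup(6,8)[OF AS_Tup(9)] by (simp add: AS_AT xsubst_xinst)
next
  case (AS_P1 \<Gamma> A k B l p)
  note A = AS_P1(2)[OF AS_P1(7), simplified]
  note B = AS_P1(4)[OF W_up[OF AS_P1(7) A], simplified]
  show ?case
    using AS_AT_AL.AS_P1[OF A B] AS_P1(6)[OF AS_P1(7)] by (simp add: AS_AT)
next
  case (AS_P2 \<Gamma> A k B l p)
  note A = AS_P2(2)[OF AS_P2(7), simplified]
  note B = AS_P2(4)[OF W_up[OF AS_P2(7) A], simplified]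
  show ?case
    using AS_AT_AL.AS_P2[OF A B] AS_P2(6)[OF AS_P2(7)] by (simp add: AS_AT xsubst_xinst)
next
  case (AS_J \<Gamma> A k C l c a b p)
  note w = AS_J(17)
  note A = AS_J(2)[OF w, simplified]
  \<comment> \<open>The motive of \<open>J\<close> stands below two points and the path between
    them: three extensions.\<close>
  note w1 = W_up[OF w A]
  note A1 = AS_J(4)[OF w1, unfolded xsubst_xlift, simplified]
  note w2 = W_up[OF w1, of "xlift A", unfolded xsubst_xlift, OF A1]
  note E = AS_J(6)[OF w2, simplified, unfolded xsubst_xlift]
  note w3 = W_up[OF w2, of "XId k (xlift (xlift A)) (XV (Suc 0)) (XV 0)", simplified, unfolded xsubst_xlift, OF E]
  show ?case
    using AS_AT_AL.AS_J[OF A A1 E AS_J(8)[OF w3, simplified] AS_J(10)[OF w1, unfolded xsubst_inst_J]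
        AS_J(12)[OF w] AS_J(14)[OF w]] AS_J(16)[OF w]
    by (simp add: AS_AT xsubst_inst_J)
next
  case (AS_EmI \<Gamma> C l e)
  note C = AS_EmI(2)[OF W_up[OF AS_EmI(5), of XEm, simplified, OF AS_AT[OF AS_Em]], simplified]
  show ?case
    using AS_AT_AL.AS_EmI[OF C] AS_EmI(4)[OF AS_EmI(5)] by (simp add: AS_AT xsubst_xinst)
next
  case (AS_OnI \<Gamma> C l c u)
  note C = AS_OnI(2)[OF W_up[OF AS_OnI(7), of XOn, simplified, OF AS_AT[OF AS_On]], simplified]
  show ?case
    using AS_AT_AL.AS_OnI[OF C] AS_OnI(4,6)[OF AS_OnI(7)] by (simp add: AS_AT xsubst_xinst)
next
  case (AS_TwI \<Gamma> C l c d b)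
  note C = AS_TwI(2)[OF W_up[OF AS_TwI(9), of XTw, simplified, OF AS_AT[OF AS_Tw]], simplified]
  show ?case
    using AS_AT_AL.AS_TwI[OF C] AS_TwI(4,6,8)[OF AS_TwI(9)] by (simp add: AS_AT xsubst_xinst)
next
  case (AS_C \<Gamma> as d)
  then show ?case
    using AS_AT_AL.AS_C[of i \<Delta> "map (\<lambda>a. xsubst a \<sigma>) as" d] by (simp add: AS_AT xsubst_args)
next
  case (AL_Cons \<Gamma> as \<Theta> a A)
  then show ?case
    by (simp add: AS_AT_AL.AL_Cons flip: xsubst_args)
next
  case (AS_Id \<Gamma> A k a b)
  then show ?case
    using AS_AT_AL.AS_Id[of i \<Delta> "xsubst A \<sigma>" k] by (simp add: AS_AT)
next
  case (AS_Rf \<Gamma> A k a)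
  then show ?case
    using AS_AT_AL.AS_Rf[of i \<Delta> "xsubst A \<sigma>" k] by (simp add: AS_AT)
qed (simp_all add: AS_AT AS_AT_AL.intros)

end

section \<open>Typed renamings and typed substitutions\<close>

text \<open>Lookups are preserved as terms, not just up to conversion; weakening and its lifts under
  binders satisfy this.\<close>

definition wren :: "nat \<Rightarrow> xt list \<Rightarrow> (nat \<Rightarrow> nat) \<Rightarrow> xt list \<Rightarrow> bool" where
  "wren i \<Delta> \<rho> \<Gamma> \<longleftrightarrow> \<turnstile> ec i \<Delta> \<and> (\<forall>k<length \<Gamma>. \<rho> k < length \<Delta> \<and> xlook \<Delta> (\<rho> k) = xren (xlook \<Gamma> k) \<rho>)"

lemma AT_xren:
  assumes "AT i \<Gamma> e T" "wren i \<Delta> \<rho> \<Gamma>"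
  shows "AT i \<Delta> (xren e \<rho>) (xren T \<rho>)"
proof -
  define W :: "xt list \<Rightarrow> (nat \<Rightarrow> xt) \<Rightarrow> xt list \<Rightarrow> bool" where "W \<Delta> \<sigma> \<Gamma> \<longleftrightarrow> (\<exists>\<rho>. \<sigma> = XV \<circ> \<rho> \<and> wren i \<Delta> \<rho> \<Gamma>)" for \<Delta> \<sigma> \<Gamma>
  have "AT i \<Delta> (xsubst e (XV \<circ> \<rho>)) (xsubst T (XV \<circ> \<rho>))"
  proof (rule AT_act(2)[of W])
    show "\<turnstile> ec i \<Delta>" if "W \<Delta> \<sigma> \<Gamma>" for \<Delta> \<sigma> \<Gamma>
      using that by (auto simp: W_def wren_def)
    show "AT i \<Delta> (\<sigma> k) (xsubst (xlook \<Gamma> k) \<sigma>)" if "W \<Delta> \<sigma> \<Gamma>" "k < length \<Gamma>" for \<Delta> \<sigma> \<Gamma> k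
      using that by (auto simp: W_def wren_def simp flip: xren_eq_xsubst intro!: AS_AT) (metis AS_V)
    show "W (xsubst A \<sigma> # \<Delta>) (xup \<sigma>) (A # \<Gamma>)" if "W \<Delta> \<sigma> \<Gamma>" "AT i \<Delta> (xsubst A \<sigma>) (XU l)" for \<Delta> \<sigma> \<Gamma> A l
    proof -
      obtain \<rho> where \<rho>: "\<sigma> = XV \<circ> \<rho>" "wren i \<Delta> \<rho> \<Gamma>"
        using \<open>W \<Delta> \<sigma> \<Gamma>\<close> by (auto simp: W_def)
      moreover have "wren i (xren A \<rho> # \<Delta>) (up_ren \<rho>) (A # \<Gamma>)"
        using \<rho> that(2) wf_ext[of i \<Delta> "xren A \<rho>" l]
        by (auto simp: wren_def All_less_Suc2 xren_xren up_ren_Suc simp flip: xren_eq_xsubst)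
      ultimately show ?thesis
        by (auto simp: W_def xup_XV_ren simp flip: xren_eq_xsubst)
    qed
  qed (use assms in \<open>auto simp: W_def\<close>)
  then show ?thesis
    by (simp add: xren_eq_xsubst)
qed

lemma AT_lift: "AT i \<Gamma> e T \<Longrightarrow> \<turnstile> ec i (A # \<Gamma>) \<Longrightarrow> AT i (A # \<Gamma>) (xlift e) (xlift T)"
  by (erule AT_xren) (simp add: wren_def)

definition wsub :: "nat \<Rightarrow> xt list \<Rightarrow> (nat \<Rightarrow> xt) \<Rightarrow> xt list \<Rightarrow> bool" where
  "wsub i \<Delta> \<sigma> \<Gamma> \<longleftrightarrow> \<turnstile> ec i \<Delta> \<and> (\<forall>k<length \<Gamma>. AT i \<Delta> (\<sigma> k) (xsubst (xlook \<Gamma> k) \<sigma>))"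

lemma wsub_up:
  assumes "wsub i \<Delta> \<sigma> \<Gamma>" "AT i \<Delta> (xsubst A \<sigma>) (XU l)"
  shows "wsub i (xsubst A \<sigma> # \<Delta>) (xup \<sigma>) (A # \<Gamma>)"
  using assms AS_V[of 0 "xsubst A \<sigma> # \<Delta>"] wf_ext[of i \<Delta> "xsubst A \<sigma>" l]
  by (auto simp: wsub_def All_less_Suc2 xsubst_xlift intro: AS_AT AT_lift)

lemma AT_xsubst: "AT i \<Gamma> e T \<Longrightarrow> wsub i \<Delta> \<sigma> \<Gamma> \<Longrightarrow> AT i \<Delta> (xsubst e \<sigma>) (xsubst T \<sigma>)"
  by (rule AT_act(2)[of "wsub i"]) (auto simp: wsub_up, auto simp: wsub_def)

lemma teq_xsubst: "teq i \<Gamma> S T \<Longrightarrow> wsub i \<Delta> \<sigma> \<Gamma> \<Longrightarrow> teq i \<Delta> (xsubst S \<sigma>) (xsubst T \<sigma>)"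
  by (rule teq_act[of "wsub i"]) (auto simp: wsub_up, auto simp: wsub_def)

section \<open>Instantiations and congruence\<close>

inductive_cases AL_NilE: "AL i \<Gamma> [] \<Delta>"
inductive_cases AL_ConsE: "AL i \<Gamma> (a # as) \<Delta>"

lemma wsub_nil: "\<turnstile> ec i \<Gamma> \<Longrightarrow> wsub i \<Gamma> XV \<Gamma>"
  by (auto simp: wsub_def xsubst_XV intro: AS_AT AS_V)

lemma wsub_Cons: "wsub i \<Delta> (lk z as) \<Gamma> \<Longrightarrow> AT i \<Delta> a (xsubst A (lk z as)) \<Longrightarrow> wsub i \<Delta> (lk z (a # as)) (A # \<Gamma>)"
  by (auto simp: wsub_def All_less_Suc2 xsubst_xlift_lk simp del: lk.simps split: nat.split)
     (auto simp: xsubst_xlift_lk[unfolded lk.simps])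

lemma wsub_inst: "\<turnstile> ec i \<Gamma> \<Longrightarrow> AT i \<Gamma> a A \<Longrightarrow> wsub i \<Gamma> (lk XV [a]) (A # \<Gamma>)"
  by (rule wsub_Cons) (simp_all only: lk_nil wsub_nil xsubst_XV)

lemma wsub_args: "AL i \<Gamma> as \<Delta> \<Longrightarrow> \<turnstile> ec i \<Gamma> \<Longrightarrow> wsub i \<Gamma> (args as) \<Delta>"
proof (induct as arbitrary: \<Delta>)
  case Nil
  then show ?case
    by (auto simp: wsub_def elim: AL_NilE)
next
  case (Cons a as)
  from Cons(2) show ?case
    by (rule AL_ConsE) (use Cons in \<open>simp add: wsub_Cons del: lk.simps\<close>)
qed

section \<open>Equal substitutions and change of context\<close>

text \<open>The equalities are typed along the first substitution, as in the rule
  \<open>eq_subst\<close>.\<close>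

definition wsubeq :: "nat \<Rightarrow> xt list \<Rightarrow> (nat \<Rightarrow> xt) \<Rightarrow> (nat \<Rightarrow> xt) \<Rightarrow> xt list \<Rightarrow> bool" where
  "wsubeq i \<Delta> \<sigma> \<tau> \<Gamma> \<longleftrightarrow> \<turnstile> ec i \<Delta> \<and> (\<forall>k<length \<Gamma>. jeq i \<Delta> (\<sigma> k) (\<tau> k) (xsubst (xlook \<Gamma> k) \<sigma>))"

lemma jeq_refl: "AT i \<Gamma> a A \<Longrightarrow> \<turnstile> ec i \<Gamma> \<Longrightarrow> jeq i \<Gamma> a a A"
  unfolding jeq_def by (intro eq_refl AT_sound(2))

lemma wsubeq_nil: "\<turnstile> ec i \<Gamma> \<Longrightarrow> wsubeq i \<Gamma> XV XV \<Gamma>"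
  by (auto simp: wsubeq_def xsubst_XV intro: jeq_refl AS_AT AS_V)

lemma wsubeq_Cons:
  "wsubeq i \<Delta> (lk z as) (lk z bs) \<Gamma> \<Longrightarrow> jeq i \<Delta> a b (xsubst A (lk z as)) \<Longrightarrow>
    wsubeq i \<Delta> (lk z (a # as)) (lk z (b # bs)) (A # \<Gamma>)"
  by (auto simp: wsubeq_def All_less_Suc2 xsubst_xlift_lk simp del: lk.simps split: nat.split)
     (auto simp: xsubst_xlift_lk[unfolded lk.simps])

lemma wsubeq_inst: "\<turnstile> ec i \<Gamma> \<Longrightarrow> jeq i \<Gamma> a b A \<Longrightarrow> wsubeq i \<Gamma> (lk XV [a]) (lk XV [b]) (A # \<Gamma>)"
  by (rule wsubeq_Cons) (simp_all only: lk_nil wsubeq_nil xsubst_XV)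

lemma eq_wsubeq: "ec i \<Gamma> \<turnstile> s \<doteq> t \<^bold>: T \<Longrightarrow> wsubeq i \<Delta> \<sigma> \<tau> \<Gamma> \<Longrightarrow>
  ec i \<Delta> \<turnstile> subst s (er i \<circ> \<sigma>) \<doteq> subst t (er i \<circ> \<tau>) \<^bold>: subst T (er i \<circ> \<sigma>)"
  by (rule eq_subst_look[of "ec i \<Gamma>"]) (auto simp: wsubeq_def jeq_def er_xsubst er_xlook o_def)

lemma teq_wsubeq: "AT i \<Gamma> A (XU k) \<Longrightarrow> \<turnstile> ec i \<Gamma> \<Longrightarrow> wsubeq i \<Delta> \<sigma> \<tau> \<Gamma> \<Longrightarrow> teq i \<Delta> (xsubst A \<sigma>) (xsubst A \<tau>)"
  using eq_wsubeq[OF eq_refl[OF AT_sound(2)], of i \<Gamma> A "XU k" \<Delta> \<sigma> \<tau>] by (auto simp: teq_def er_xsubst)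

lemma teq_lift: "teq i \<Gamma> S T \<Longrightarrow> \<turnstile> ec i (A # \<Gamma>) \<Longrightarrow> teq i (A # \<Gamma>) (xlift S) (xlift T)"
  by (auto simp: teq_def er_xren dest: eq_lift)

lemma jeq_lift: "jeq i \<Gamma> a b T \<Longrightarrow> \<turnstile> ec i (A # \<Gamma>) \<Longrightarrow> jeq i (A # \<Gamma>) (xlift a) (xlift b) (xlift T)"
  by (auto simp: jeq_def er_xren dest: eq_lift)

text \<open>Replacing the type of a variable by a convertible one is substitution by the identity
  assignment, so conversion of contexts follows from the substitution lemma instead of a new
  induction.\<close>

lemma wsub_ext:
  assumes "wsub i \<Delta> XV \<Gamma>" "AT i \<Delta> A (XU k)" "teq i \<Delta> A' A"
  shows "wsub i (A # \<Delta>) XV (A' # \<Gamma>)"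
proof -
  have wf: "\<turnstile> ec i (A # \<Delta>)"
    using assms(1,2) by (auto simp: wsub_def intro: wf_ext[simplified])
  have "AT i (A # \<Delta>) (XV 0) (xlift A')"
    using AS_V[of 0 "A # \<Delta>"] teq_sym[OF teq_lift[OF assms(3) wf]] by (auto intro: AT_I)
  moreover have "AT i (A # \<Delta>) (XV (Suc j)) (xlift (xlook \<Gamma> j))" if "j < length \<Gamma>" for j
    using assms(1) that AT_lift[OF _ wf, of "XV j"] by (simp add: wsub_def xsubst_XV)
  ultimately show ?thesis
    using wf by (simp add: wsub_def All_less_Suc2 xsubst_XV)
qed

lemma wsub_conv_ctx:
  "\<turnstile> ec i \<Gamma> \<Longrightarrow> teq i \<Gamma> A A' \<Longrightarrow> AT i \<Gamma> A (XU k) \<Longrightarrow> AT i \<Gamma> A' (XU k') \<Longrightarrow> wsub i (A' # \<Gamma>) XV (A # \<Gamma>)"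
  by (rule wsub_ext[OF wsub_nil])

lemma AT_conv_ctx:
  "AT i (A # \<Gamma>) e T \<Longrightarrow> \<turnstile> ec i \<Gamma> \<Longrightarrow> teq i \<Gamma> A A' \<Longrightarrow> AT i \<Gamma> A (XU k) \<Longrightarrow> AT i \<Gamma> A' (XU k') \<Longrightarrow>
    AT i (A' # \<Gamma>) e T"
  using AT_xsubst[OF _ wsub_conv_ctx] by (metis xsubst_XV)

lemma AT_inst: "AT i (A # \<Gamma>) b B \<Longrightarrow> AT i \<Gamma> a A \<Longrightarrow> \<turnstile> ec i \<Gamma> \<Longrightarrow> AT i \<Gamma> (xinst b a) (xinst B a)"
  by (blast intro: AT_xsubst wsub_inst)

lemma teq_inst: "AT i (A # \<Gamma>) B (XU l) \<Longrightarrow> jeq i \<Gamma> a b A \<Longrightarrow> AT i \<Gamma> A (XU k) \<Longrightarrow> \<turnstile> ec i \<Gamma> \<Longrightarrow>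
  teq i \<Gamma> (xinst B a) (xinst B b)"
  by (blast intro: teq_wsubeq wsubeq_inst wf_ext)

text \<open>The annotations are invisible to \<open>jeq\<close>, which is why they may differ below.\<close>

lemma jeq_Pi: "jeq i \<Gamma> A A' (XU k) \<Longrightarrow> jeq i (A # \<Gamma>) B B' (XU l) \<Longrightarrow> jeq i \<Gamma> (XPi k l A B) (XPi k l A' B') (XU (max k l))"
  by (auto simp: jeq_def intro!: eq_Pi elim!: eq_cumul_le)

lemma jeq_Sig: "jeq i \<Gamma> A A' (XU k) \<Longrightarrow> jeq i (A # \<Gamma>) B B' (XU l) \<Longrightarrow> jeq i \<Gamma> (XSig k l A B) (XSig k l A' B') (XU (max k l))"
  by (auto simp: jeq_def intro!: eq_Sig elim!: eq_cumul_le)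

lemma jeq_Lam: "jeq i \<Gamma> A A' (XU k) \<Longrightarrow> jeq i (A # \<Gamma>) b b' B \<Longrightarrow>
  jeq i \<Gamma> (XLam k l A B b) (XLam k' l' A' B' b') (XPi k l A B)"
  by (auto simp: jeq_def intro!: eq_Lam)

lemma jeq_App: "jeq i \<Gamma> f f' (XPi k l A B) \<Longrightarrow> jeq i \<Gamma> a a' A \<Longrightarrow> jeq i \<Gamma> (XApp P f a) (XApp P' f' a') (xinst B a)"
  by (auto simp: jeq_def er_xinst intro!: eq_App)

lemma jeq_Tup: "AT i (A # \<Gamma>) B (XU l) \<Longrightarrow> \<turnstile> ec i (A # \<Gamma>) \<Longrightarrow> jeq i \<Gamma> a a' A \<Longrightarrow> jeq i \<Gamma> b b' (xinst B a) \<Longrightarrow>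
  jeq i \<Gamma> (XTup S a b) (XTup S' a' b') (XSig k l A B)"
  using AT_sound(2)[of i "A # \<Gamma>" B "XU l"] by (auto simp: jeq_def er_xinst intro!: eq_Tup)

lemma jeq_P1: "jeq i \<Gamma> p p' (XSig k l A B) \<Longrightarrow> jeq i \<Gamma> (XP1 S p) (XP1 S' p') A"
  by (auto simp: jeq_def intro: eq_Pr1)

lemma jeq_P2: "jeq i \<Gamma> p p' (XSig k l A B) \<Longrightarrow> jeq i \<Gamma> (XP2 S p) (XP2 S' p') (xinst B (XP1 S p))"
  by (auto simp: jeq_def er_xinst intro: eq_Pr2)

lemma jeq_Id: "jeq i \<Gamma> A A' (XU k) \<Longrightarrow> jeq i \<Gamma> a a' A \<Longrightarrow> jeq i \<Gamma> b b' A \<Longrightarrow> jeq i \<Gamma> (XId k A a b) (XId k A' a' b') (XU k)"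
  by (auto simp: jeq_def intro: eq_Eq)

lemma jeq_Rf: "jeq i \<Gamma> a a' A \<Longrightarrow> jeq i \<Gamma> (XRf k B a) (XRf k' B' a') (XId k'' A a a)"
  by (auto simp: jeq_def intro: eq_Refl)

lemma jeq_J: "jeq i \<Gamma> A A' (XU k) \<Longrightarrow>
  jeq i (XId k (xlift (xlift A)) (XV (Suc 0)) (XV 0) # xlift A # A # \<Gamma>) C C' (XU l) \<Longrightarrow>
  jeq i (A # \<Gamma>) c c' (xsubst C (lk (XV \<circ> Suc) [XRf k (xlift A) (XV 0), XV 0, XV 0])) \<Longrightarrow>
  jeq i \<Gamma> a a' A \<Longrightarrow> jeq i \<Gamma> b b' A \<Longrightarrow> jeq i \<Gamma> p p' (XId k A a b) \<Longrightarrow>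
  jeq i \<Gamma> (XJ k l A C c a b p) (XJ k' l' A' C' c' a' b' p') (xsubst C (lk XV [p, b, a]))"
  by (auto simp: jeq_def er_inst_J er_xren intro!: eq_J)

lemma jeq_EmI: "jeq i (XEm # \<Gamma>) C C' (XU l) \<Longrightarrow> jeq i \<Gamma> e e' XEm \<Longrightarrow> jeq i \<Gamma> (XEmI l C e) (XEmI l' C' e') (xinst C e)"
  by (auto simp: jeq_def er_xinst intro: eq_EmptyInd)

lemma jeq_OnI: "jeq i (XOn # \<Gamma>) C C' (XU l) \<Longrightarrow> jeq i \<Gamma> c c' (xinst C XSt) \<Longrightarrow> jeq i \<Gamma> e e' XOn \<Longrightarrow>
  jeq i \<Gamma> (XOnI l C c e) (XOnI l' C' c' e') (xinst C e)"
  by (auto simp: jeq_def er_xinst intro: eq_UnitInd)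

lemma jeq_TwI: "jeq i (XTw # \<Gamma>) C C' (XU l) \<Longrightarrow> jeq i \<Gamma> c c' (xinst C XT0) \<Longrightarrow> jeq i \<Gamma> d d' (xinst C XT1) \<Longrightarrow>
  jeq i \<Gamma> e e' XTw \<Longrightarrow> jeq i \<Gamma> (XTwI l C c d e) (XTwI l' C' c' d' e') (xinst C e)"
  by (auto simp: jeq_def er_xinst intro: eq_TwoInd)

lemma jeq_C: "wsubeq i \<Gamma> (args as) (args bs) (ctele d) \<Longrightarrow> ec i (ctele d) \<turnstile> draw d i \<^bold>: er i (drty d) \<Longrightarrow>
  jeq i \<Gamma> (XC d as) (XC d bs) (xsubst (drty d) (args as))"
  unfolding jeq_def er.simps er_xsubst er_args[symmetric] by (rule eq_wsubeq[OF eq_refl])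


section \<open>Normalization and conversion\<close>

text \<open>\<open>cv\<close> is meaningful only for two terms of one type. Equal levels put the
  domains into one universe, and convertible domains put the codomains over one context.\<close>

definition tpeq :: "(xt \<Rightarrow> xt \<Rightarrow> bool) \<Rightarrow> xt \<Rightarrow> xt \<Rightarrow> bool" where
  "tpeq cv P Q \<longleftrightarrow> (if P = Q then True else (case P of
      XPi k l A B \<Rightarrow> (case Q of XPi k' l' A' B' \<Rightarrow>
        if k = k' then if l = l' then if cv A A' then cv B B' else False else False else False
      | _ \<Rightarrow> False)
    | XSig k l A B \<Rightarrow> (case Q of XSig k' l' A' B' \<Rightarrow>
        if k = k' then if l = l' then if cv A A' then cv B B' else False else False else False
      | _ \<Rightarrow> False)
    | _ \<Rightarrow> False))"

text \<open>\<open>w\<close> and \<open>cv\<close> stand for reduction and comparison with less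
  fuel. The annotations of application and abstraction are compared because having a function type
  in common does not by itself identify their domains and codomains.\<close>

definition wapp where
  "wapp w cv P a f = (case f of XLam k l A B b \<Rightarrow> if tpeq cv P (XPi k l A B) then w (xinst b a) else XApp P f a
    | _ \<Rightarrow> XApp P f a)"

definition wp1 where
  "wp1 w cv S p = (case p of XTup S' a b \<Rightarrow> if tpeq cv S S' then w a else XP1 S p | _ \<Rightarrow> XP1 S p)"

definition wp2 where
  "wp2 w cv S p = (case p of XTup S' a b \<Rightarrow> if tpeq cv S S' then w b else XP2 S p | _ \<Rightarrow> XP2 S p)"

text \<open>For the same reason the type and the point of the reflexivity term are compared with the
  type and both endpoints of the elimination.\<close>

definition wj where
  "wj w cv k l A C c a b p = (case p of XRf k' A' x \<Rightarrow>
      if k' = k then if cv A' A then if cv x a then if cv x b then w (xinst c a)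
      else XJ k l A C c a b p else XJ k l A C c a b p else XJ k l A C c a b p else XJ k l A C c a b p
    | _ \<Rightarrow> XJ k l A C c a b p)"

definition won where
  "won w l C c u = (case u of XSt \<Rightarrow> w c | _ \<Rightarrow> XOnI l C c u)"

definition wtw where
  "wtw w l C c d u = (case u of XT0 \<Rightarrow> w c | XT1 \<Rightarrow> w d | _ \<Rightarrow> XTwI l C c d u)"

section \<open>Structural comparison and eta\<close>

text \<open>The tail is compared before the head: the last argument comes first in the list, and its
  type depends on the earlier ones.\<close>

fun cvl :: "(xt \<Rightarrow> xt \<Rightarrow> bool) \<Rightarrow> xt list \<Rightarrow> xt list \<Rightarrow> bool" where
  "cvl cv [] [] \<longleftrightarrow> True"
| "cvl cv (a # as) (b # bs) \<longleftrightarrow> (if cvl cv as bs then cv a b else False)"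
| "cvl cv _ _ \<longleftrightarrow> False"

definition cvc where
  "cvc cv a b = (case a of XC d as \<Rightarrow> (case b of XC d' bs \<Rightarrow> if d = d' then cvl cv as bs else False | _ \<Rightarrow> False)
    | _ \<Rightarrow> False)"

definition etal where
  "etal cv k l A B s f = cv s (XApp (XPi k l (xlift A) (xren B (up_ren Suc))) (xlift f) (XV 0))"

definition etas where
  "etas cv S a b p = (if cv a (XP1 S p) then cv b (XP2 S p) else False)"

definition cv_lam where
  "cv_lam cv k l A B s b = (case b of
      XLam k' l' A' B' s' \<Rightarrow> if tpeq cv (XPi k l A B) (XPi k' l' A' B') then cv s s' else False
    | _ \<Rightarrow> etal cv k l A B s b)"

definition cv_tup where
  "cv_tup cv S x y b = (case b of
      XTup S' x' y' \<Rightarrow> if tpeq cv S S' then if cv x x' then cv y y' else False else False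
    | _ \<Rightarrow> etas cv S x y b)"

definition cv_pi where
  "cv_pi cv a b = (case b of XPi k l A B \<Rightarrow> tpeq cv a b | _ \<Rightarrow> False)"

definition cv_sig where
  "cv_sig cv a b = (case b of XSig k l A B \<Rightarrow> tpeq cv a b | _ \<Rightarrow> False)"

definition cv_app where
  "cv_app cv P f x b = (case b of
      XApp P' f' x' \<Rightarrow> if tpeq cv P P' then if cv f f' then cv x x' else False else False | _ \<Rightarrow> False)"

definition cv_p1 where
  "cv_p1 cv S p b = (case b of XP1 S' p' \<Rightarrow> if tpeq cv S S' then cv p p' else False | _ \<Rightarrow> False)"

definition cv_p2 where
  "cv_p2 cv S p b = (case b of XP2 S' p' \<Rightarrow> if tpeq cv S S' then cv p p' else False | _ \<Rightarrow> False)"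

definition cv_id where
  "cv_id cv k A x y b = (case b of
      XId k' A' x' y' \<Rightarrow> if k = k' then if cv A A' then if cv x x' then cv y y' else False else False else False
    | _ \<Rightarrow> False)"

definition cv_rf where
  "cv_rf cv k A x b = (case b of
      XRf k' A' x' \<Rightarrow> if k = k' then if cv A A' then cv x x' else False else False | _ \<Rightarrow> False)"

definition cv_j where
  "cv_j cv k l A C c x y p b = (case b of
      XJ k' l' A' C' c' x' y' p' \<Rightarrow>
        if k = k' then if l = l' then if cv A A' then if cv C C' then if cv c c' then if cv x x' then if cv y y'
        then cv p p' else False else False else False else False else False else False else False
    | _ \<Rightarrow> False)"

definition cv_emi where
  "cv_emi cv l C e b = (case b of
      XEmI l' C' e' \<Rightarrow> if l = l' then if cv C C' then cv e e' else False else False | _ \<Rightarrow> False)"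

definition cv_oni where
  "cv_oni cv l C c e b = (case b of
      XOnI l' C' c' e' \<Rightarrow> if l = l' then if cv C C' then if cv c c' then cv e e' else False else False else False
    | _ \<Rightarrow> False)"

definition cv_twi where
  "cv_twi cv l C c d e b = (case b of
      XTwI l' C' c' d' e' \<Rightarrow> if l = l' then if cv C C' then if cv c c' then if cv d d' then cv e e'
        else False else False else False else False
    | _ \<Rightarrow> False)"

definition cv_head :: "(xt \<Rightarrow> xt \<Rightarrow> bool) \<Rightarrow> xt \<Rightarrow> xt \<Rightarrow> bool" where
  "cv_head cv a b = (case a of
      XPi k l A B \<Rightarrow> cv_pi cv a b
    | XSig k l A B \<Rightarrow> cv_sig cv a b
    | XApp P f x \<Rightarrow> cv_app cv P f x b
    | XP1 S p \<Rightarrow> cv_p1 cv S p b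
    | XP2 S p \<Rightarrow> cv_p2 cv S p b
    | XId k A x y \<Rightarrow> cv_id cv k A x y b
    | XRf k A x \<Rightarrow> cv_rf cv k A x b
    | XJ k l A C c x y p \<Rightarrow> cv_j cv k l A C c x y p b
    | XEmI l C e \<Rightarrow> cv_emi cv l C e b
    | XOnI l C c e \<Rightarrow> cv_oni cv l C c e b
    | XTwI l C c d e \<Rightarrow> cv_twi cv l C c d e b
    | XC d as \<Rightarrow> cvc cv a b
    | _ \<Rightarrow> False)"

definition cv_right :: "(xt \<Rightarrow> xt \<Rightarrow> bool) \<Rightarrow> xt \<Rightarrow> xt \<Rightarrow> bool" where
  "cv_right cv a b = (case b of
      XLam k l A B s \<Rightarrow> etal cv k l A B s a
    | XTup S x y \<Rightarrow> etas cv S x y a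
    | _ \<Rightarrow> cv_head cv a b)"

definition cvs :: "(xt \<Rightarrow> xt \<Rightarrow> bool) \<Rightarrow> xt \<Rightarrow> xt \<Rightarrow> bool" where
  "cvs cv a b = (if a = b then True else (case a of
      XLam k l A B s \<Rightarrow> cv_lam cv k l A B s b
    | XTup S x y \<Rightarrow> cv_tup cv S x y b
    | _ \<Rightarrow> cv_right cv a b))"

text \<open>Applications of one constant are compared by their arguments before anything is
  unfolded; unfolding is the fallback.\<close>

definition conv1 where
  "conv1 w cv a b = (if a = b then True else if cvc cv a b then True else cvs cv (w a) (w b))"

text \<open>The flag allows the unfolding of constants. Fuel stands in for a termination argument:
  when it runs out, reduction returns its input and comparison answers \<open>False\<close>, both of
  which are sound.\<close>

fun whnf :: "nat \<Rightarrow> bool \<Rightarrow> xt \<Rightarrow> xt" and conv :: "nat \<Rightarrow> xt \<Rightarrow> xt \<Rightarrow> bool" where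
  "whnf 0 dl e = e"
| "whnf (Suc n) dl e = (case e of
      XApp P f a \<Rightarrow> wapp (whnf n dl) (conv n) P a (whnf n dl f)
    | XP1 S p \<Rightarrow> wp1 (whnf n dl) (conv n) S (whnf n dl p)
    | XP2 S p \<Rightarrow> wp2 (whnf n dl) (conv n) S (whnf n dl p)
    | XJ k l A C c a b p \<Rightarrow> wj (whnf n dl) (conv n) k l A C c a b (whnf n dl p)
    | XOnI l C c u \<Rightarrow> won (whnf n dl) l C c (whnf n dl u)
    | XTwI l C c d u \<Rightarrow> wtw (whnf n dl) l C c d (whnf n dl u)
    | XC d as \<Rightarrow> if dl then (case dbody d of None \<Rightarrow> e | Some b \<Rightarrow> whnf n dl (xsubst b (args as))) else e
    | _ \<Rightarrow> e)"
| "conv 0 a b \<longleftrightarrow> False"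
| "conv (Suc n) a b \<longleftrightarrow> (if a = b then True else conv1 (whnf n True) (conv n) (whnf n False a) (whnf n False b))"


section \<open>Soundness of reduction\<close>

text \<open>A common type of both sides is presupposed; a successful comparison does not by itself
  produce one.\<close>

definition good_cv :: "nat \<Rightarrow> (xt \<Rightarrow> xt \<Rightarrow> bool) \<Rightarrow> bool" where
  "good_cv i cv \<longleftrightarrow> (\<forall>\<Gamma> a b T. cv a b \<longrightarrow> \<turnstile> ec i \<Gamma> \<longrightarrow> AT i \<Gamma> a T \<longrightarrow> AT i \<Gamma> b T \<longrightarrow> jeq i \<Gamma> a b T)"

definition good_wh :: "nat \<Rightarrow> (xt \<Rightarrow> xt) \<Rightarrow> bool" where
  "good_wh i w \<longleftrightarrow> (\<forall>\<Gamma> e T. \<turnstile> ec i \<Gamma> \<longrightarrow> AT i \<Gamma> e T \<longrightarrow> AT i \<Gamma> (w e) T \<and> jeq i \<Gamma> e (w e) T)"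

lemma good_cvD: "good_cv i cv \<Longrightarrow> cv a b \<Longrightarrow> \<turnstile> ec i \<Gamma> \<Longrightarrow> AT i \<Gamma> a T \<Longrightarrow> AT i \<Gamma> b T \<Longrightarrow> jeq i \<Gamma> a b T"
  by (auto simp: good_cv_def)

lemma good_whD: "good_wh i w \<Longrightarrow> \<turnstile> ec i \<Gamma> \<Longrightarrow> AT i \<Gamma> e T \<Longrightarrow> AT i \<Gamma> (w e) T \<and> jeq i \<Gamma> e (w e) T"
  by (auto simp: good_wh_def)

definition istype2 :: "nat \<Rightarrow> xt list \<Rightarrow> nat \<Rightarrow> nat \<Rightarrow> xt \<Rightarrow> xt \<Rightarrow> bool" where
  "istype2 i \<Gamma> k l A B \<longleftrightarrow> \<turnstile> ec i \<Gamma> \<and> AT i \<Gamma> A (XU k) \<and> AT i (A # \<Gamma>) B (XU l)"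

lemma conv_fam:
  assumes cv: "good_cv i cv" and AB: "istype2 i \<Gamma> k l A B" and AB': "istype2 i \<Gamma> k l A' B'"
    and "cv A A'" "cv B B'"
  shows "jeq i \<Gamma> A A' (XU k)" "jeq i (A # \<Gamma>) B B' (XU l)" "teq i \<Gamma> A A'" "teq i (A # \<Gamma>) B B'"
proof -
  show A: "jeq i \<Gamma> A A' (XU k)"
    using assms by (auto simp: istype2_def intro: good_cvD)
  then show tA: "teq i \<Gamma> A A'"
    by (rule jeq_imp_teq)
  \<comment> \<open>\<open>B'\<close> lives over \<open>A'\<close>; the equality of domains just
    obtained moves it over \<open>A\<close>.\<close>
  have "AT i (A # \<Gamma>) B' (XU l)"
    using AB AB' tA by (auto simp: istype2_def intro: AT_conv_ctx teq_sym)
  with cv \<open>cv B B'\<close> show B: "jeq i (A # \<Gamma>) B B' (XU l)"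
    using AB wf_ext[of i \<Gamma> A k] by (auto simp: istype2_def elim!: good_cvD)
  then show "teq i (A # \<Gamma>) B B'"
    by (rule jeq_imp_teq)
qed

lemma tpeq_fam:
  assumes "good_cv i cv" "istype2 i \<Gamma> k l A B" "istype2 i \<Gamma> k' l' A' B'"
    and "tpeq cv (XPi k l A B) (XPi k' l' A' B') \<or> tpeq cv (XSig k l A B) (XSig k' l' A' B')"
  shows "k = k'" "l = l'" "jeq i \<Gamma> A A' (XU k)" "jeq i (A # \<Gamma>) B B' (XU l)" "teq i \<Gamma> A A'" "teq i (A # \<Gamma>) B B'"
proof -
  have "(k = k' \<and> l = l' \<and> A = A' \<and> B = B') \<or> (k = k' \<and> l = l' \<and> cv A A' \<and> cv B B')"
    using assms(4) by (auto simp: tpeq_def split: if_splits)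
  moreover have "jeq i \<Gamma> A A (XU k)" "jeq i (A # \<Gamma>) B B (XU l)"
    using assms(2) by (auto simp: istype2_def intro!: jeq_refl wf_ext[simplified])
  ultimately show "k = k'" "l = l'" "jeq i \<Gamma> A A' (XU k)" "jeq i (A # \<Gamma>) B B' (XU l)" "teq i \<Gamma> A A'" "teq i (A # \<Gamma>) B B'"
    using conv_fam[OF assms(1), of \<Gamma> k l A B A' B'] assms(2,3) by auto
qed

lemma teq_Pi:
  "istype2 i \<Gamma> k l A B \<Longrightarrow> jeq i \<Gamma> A A' (XU k) \<Longrightarrow> jeq i (A # \<Gamma>) B B' (XU l) \<Longrightarrow> teq i \<Gamma> (XPi k l A B) (XPi k l A' B')"
  "istype2 i \<Gamma> k l A B \<Longrightarrow> jeq i \<Gamma> A A' (XU k) \<Longrightarrow> jeq i (A # \<Gamma>) B B' (XU l) \<Longrightarrow> teq i \<Gamma> (XSig k l A B) (XSig k l A' B')"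
  by (blast intro: jeq_imp_teq jeq_Pi jeq_Sig)+

lemma AT_LamD:
  assumes "AT i \<Gamma> (XLam k l A B b) T" "\<turnstile> ec i \<Gamma>"
  shows "istype2 i \<Gamma> k l A B" "AT i (A # \<Gamma>) b B" "teq i \<Gamma> (XPi k l A B) T"
  by (rule AT_E[OF assms(1)]; use assms(2) in \<open>auto elim!: AS_Lam_E simp: istype2_def\<close>)+

lemma AT_AppD:
  assumes "AT i \<Gamma> (XApp P f a) T" "\<turnstile> ec i \<Gamma>"
  obtains k l A B where "P = XPi k l A B" "istype2 i \<Gamma> k l A B" "AT i \<Gamma> f (XPi k l A B)" "AT i \<Gamma> a A" "teq i \<Gamma> (xinst B a) T"
  by (rule AT_E[OF assms(1)]) (use assms(2) that in \<open>auto elim!: AS_App_E simp: istype2_def\<close>)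

lemma AT_TupD:
  assumes "AT i \<Gamma> (XTup S a b) T" "\<turnstile> ec i \<Gamma>"
  obtains k l A B where "S = XSig k l A B" "istype2 i \<Gamma> k l A B" "AT i \<Gamma> a A" "AT i \<Gamma> b (xinst B a)" "teq i \<Gamma> (XSig k l A B) T"
  by (rule AT_E[OF assms(1)]) (use assms(2) that in \<open>auto elim!: AS_Tup_E simp: istype2_def\<close>)

lemma AT_P1D:
  assumes "AT i \<Gamma> (XP1 S p) T" "\<turnstile> ec i \<Gamma>"
  obtains k l A B where "S = XSig k l A B" "istype2 i \<Gamma> k l A B" "AT i \<Gamma> p (XSig k l A B)" "teq i \<Gamma> A T"
  by (rule AT_E[OF assms(1)]) (use assms(2) that in \<open>auto elim!: AS_P1_E simp: istype2_def\<close>)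

lemma AT_P2D:
  assumes "AT i \<Gamma> (XP2 S p) T" "\<turnstile> ec i \<Gamma>"
  obtains k l A B where "S = XSig k l A B" "istype2 i \<Gamma> k l A B" "AT i \<Gamma> p (XSig k l A B)"
    "teq i \<Gamma> (xinst B (XP1 (XSig k l A B) p)) T"
  by (rule AT_E[OF assms(1)]) (use assms(2) that in \<open>auto elim!: AS_P2_E simp: istype2_def\<close>)

lemma wapp_sound:
  assumes w: "good_wh i w" and cv: "good_cv i cv" and wf: "\<turnstile> ec i \<Gamma>" and e: "AT i \<Gamma> (XApp P f a) T"
    and f: "\<And>T. AT i \<Gamma> f T \<Longrightarrow> AT i \<Gamma> f' T \<and> jeq i \<Gamma> f f' T"
  shows "AT i \<Gamma> (wapp w cv P a f') T \<and> jeq i \<Gamma> (XApp P f a) (wapp w cv P a f') T"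
proof -
  obtain k l A B where P: "P = XPi k l A B" and AB: "istype2 i \<Gamma> k l A B" and fP: "AT i \<Gamma> f (XPi k l A B)"
    and a: "AT i \<Gamma> a A" and T: "teq i \<Gamma> (xinst B a) T"
    using e wf by (rule AT_AppD)
  note f' = f[OF fP, THEN conjunct1] and ff' = f[OF fP, THEN conjunct2]
  have A: "AT i \<Gamma> A (XU k)" and B: "AT i (A # \<Gamma>) B (XU l)"
    using AB by (auto simp: istype2_def)
  have e': "AT i \<Gamma> (XApp P f' a) T"
    unfolding P using AS_App[OF A B f' a] T by (rule AT_I)
  have ee': "jeq i \<Gamma> (XApp P f a) (XApp P f' a) T"
    using jeq_App[OF ff' jeq_refl[OF a wf]] T by (rule jeq_teq)
  have "AT i \<Gamma> (w (xinst b a)) T \<and> jeq i \<Gamma> (XApp P f a) (w (xinst b a)) T"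
    if L: "f' = XLam k' l' A' B' b" and eq: "tpeq cv P (XPi k' l' A' B')" for k' l' A' B' b
  proof -
    note L' = AT_LamD[OF f'[unfolded L] wf]
    \<comment> \<open>The compared annotations give what injectivity of \<open>Pi\<close> would
      give.\<close>
    note fam = tpeq_fam[OF cv AB L'(1) disjI1[OF eq[unfolded P]]]
    have A': "AT i \<Gamma> A' (XU k')"
      using L'(1) by (simp add: istype2_def)
    have b: "AT i (A # \<Gamma>) b B"
      using AT_conv_ctx[OF L'(2) wf teq_sym[OF fam(5)] A' A] teq_sym[OF fam(6)] by (rule AT_teq)
    \<comment> \<open>The beta rule speaks about the domain written in the abstraction, so the body
      is moved back over \<open>A'\<close>, now with the codomain \<open>B\<close> of the
      application.\<close>
    then have b': "AT i (A' # \<Gamma>) b B"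
      using wf fam(5) A A' by (rule AT_conv_ctx)
    have a': "AT i \<Gamma> a A'"
      using a fam(5) by (rule AT_teq)
    have ba: "AT i \<Gamma> (xinst b a) T"
      using AT_inst[OF b a wf] T by (rule AT_teq)
    have "jeq i \<Gamma> (XApp P f' a) (xinst b a) (xinst B a)"
      unfolding L jeq_def er.simps er_xinst
      using AT_sound(2)[OF b' wf_ext[OF wf A']] AT_sound(2)[OF a' wf] by (simp add: eq_Pi_beta)
    then have "jeq i \<Gamma> (XApp P f a) (xinst b a) T"
      using T ee' by (blast intro: jeq_teq jeq_trans)
    then show ?thesis
      using good_whD[OF w wf ba] by (blast intro: jeq_trans)
  qed
  then show ?thesis
    using e' ee' by (auto simp: wapp_def split: ex.split)
qed

lemma wp1_sound:
  assumes w: "good_wh i w" and cv: "good_cv i cv" and wf: "\<turnstile> ec i \<Gamma>" and e: "AT i \<Gamma> (XP1 S p) T"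
    and p: "\<And>T. AT i \<Gamma> p T \<Longrightarrow> AT i \<Gamma> p' T \<and> jeq i \<Gamma> p p' T"
  shows "AT i \<Gamma> (wp1 w cv S p') T \<and> jeq i \<Gamma> (XP1 S p) (wp1 w cv S p') T"
proof -
  obtain k l A B where S: "S = XSig k l A B" and AB: "istype2 i \<Gamma> k l A B" and pS: "AT i \<Gamma> p (XSig k l A B)"
    and T: "teq i \<Gamma> A T"
    using e wf by (rule AT_P1D)
  note p' = p[OF pS, THEN conjunct1] and pp' = p[OF pS, THEN conjunct2]
  have A: "AT i \<Gamma> A (XU k)" and B: "AT i (A # \<Gamma>) B (XU l)"
    using AB by (auto simp: istype2_def)
  have e': "AT i \<Gamma> (XP1 S p') T"
    unfolding S using AS_P1[OF A B p'] T by (rule AT_I)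
  have ee': "jeq i \<Gamma> (XP1 S p) (XP1 S p') T"
    using jeq_P1[OF pp'] T by (rule jeq_teq)
  have "AT i \<Gamma> (w a) T \<and> jeq i \<Gamma> (XP1 S p) (w a) T"
    if L: "p' = XTup S' a b" and eq: "tpeq cv S S'" for S' a b
  proof -
    obtain k' l' A' B' where S': "S' = XSig k' l' A' B'" and AB': "istype2 i \<Gamma> k' l' A' B'"
      and a: "AT i \<Gamma> a A'" and b: "AT i \<Gamma> b (xinst B' a)"
      using p'[unfolded L] wf by (rule AT_TupD)
    note fam = tpeq_fam[OF cv AB AB' disjI2[OF eq[unfolded S S']]]
    have A': "AT i \<Gamma> A' (XU k')" and B': "AT i (A' # \<Gamma>) B' (XU l')"
      using AB' by (auto simp: istype2_def)
    have "jeq i \<Gamma> (XP1 S p') a A'"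
      unfolding L jeq_def er.simps
      by (rule eq_Sig_beta1[OF AT_sound(2)[OF B' wf_ext[OF wf A'], simplified]])
         (use AT_sound(2)[OF a wf] AT_sound(2)[OF b wf] in \<open>simp_all add: er_xinst\<close>)
    then have "jeq i \<Gamma> (XP1 S p) a T"
      using T ee' fam(5) by (blast intro: jeq_teq jeq_trans teq_sym)
    moreover have "AT i \<Gamma> a T"
      using a fam(5) T by (blast intro: AT_teq teq_sym)
    ultimately show ?thesis
      using good_whD[OF w wf] by (blast intro: jeq_trans)
  qed
  then show ?thesis
    using e' ee' by (auto simp: wp1_def split: ex.split)
qed

lemma wp2_sound:
  assumes w: "good_wh i w" and cv: "good_cv i cv" and wf: "\<turnstile> ec i \<Gamma>" and e: "AT i \<Gamma> (XP2 S p) T"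
    and p: "\<And>T. AT i \<Gamma> p T \<Longrightarrow> AT i \<Gamma> p' T \<and> jeq i \<Gamma> p p' T"
  shows "AT i \<Gamma> (wp2 w cv S p') T \<and> jeq i \<Gamma> (XP2 S p) (wp2 w cv S p') T"
proof -
  obtain k l A B where S: "S = XSig k l A B" and AB: "istype2 i \<Gamma> k l A B" and pS: "AT i \<Gamma> p (XSig k l A B)"
    and T: "teq i \<Gamma> (xinst B (XP1 (XSig k l A B) p)) T"
    using e wf by (rule AT_P2D)
  note p' = p[OF pS, THEN conjunct1] and pp' = p[OF pS, THEN conjunct2]
  have A: "AT i \<Gamma> A (XU k)" and B: "AT i (A # \<Gamma>) B (XU l)"
    using AB by (auto simp: istype2_def)
  \<comment> \<open>The type of the second projection mentions the first one, so reducing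
    \<open>p\<close> changes it to an equal instance.\<close>
  have "teq i \<Gamma> (xinst B (XP1 S p)) (xinst B (XP1 S p'))"
    using B jeq_P1[OF pp'] A wf by (rule teq_inst)
  then have T': "teq i \<Gamma> (xinst B (XP1 S p')) T"
    using T by (auto simp: S intro: teq_trans teq_sym)
  have e': "AT i \<Gamma> (XP2 S p') T"
    unfolding S using AS_P2[OF A B p'] T'[unfolded S] by (rule AT_I)
  have ee': "jeq i \<Gamma> (XP2 S p) (XP2 S p') T"
    using jeq_P2[OF pp'] T by (auto simp: S intro: jeq_teq)
  have "AT i \<Gamma> (w b) T \<and> jeq i \<Gamma> (XP2 S p) (w b) T"
    if L: "p' = XTup S' a b" and eq: "tpeq cv S S'" for S' a b
  proof -
    obtain k' l' A' B' where S': "S' = XSig k' l' A' B'" and AB': "istype2 i \<Gamma> k' l' A' B'"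
      and a: "AT i \<Gamma> a A'" and b: "AT i \<Gamma> b (xinst B' a)"
      using p'[unfolded L] wf by (rule AT_TupD)
    note fam = tpeq_fam[OF cv AB AB' disjI2[OF eq[unfolded S S']]]
    have A': "AT i \<Gamma> A' (XU k')" and B': "AT i (A' # \<Gamma>) B' (XU l')"
      using AB' by (auto simp: istype2_def)
    note raw = AT_sound(2)[OF B' wf_ext[OF wf A'], simplified] AT_sound(2)[OF a wf] AT_sound(2)[OF b wf, unfolded er_xinst]
    have aA: "AT i \<Gamma> a A"
      using a fam(5) by (blast intro: AT_teq teq_sym)
    have "jeq i \<Gamma> a (XP1 S p') A'"
      unfolding L jeq_def er.simps by (rule eq_sym[OF eq_Sig_beta1[OF raw]])
    then have 1: "jeq i \<Gamma> a (XP1 S p') A"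
      using fam(5) by (blast intro: jeq_teq teq_sym)
    have "teq i \<Gamma> (xinst B a) (xinst B' a)"
      using teq_xsubst[OF fam(6) wsub_inst[OF wf aA]] .
    then have 2: "teq i \<Gamma> (xinst B' a) T"
      using teq_inst[OF B 1 A wf] T' by (blast intro: teq_trans teq_sym)
    have "jeq i \<Gamma> (XP2 S p') b (xinst B' a)"
      unfolding L jeq_def er.simps er_xinst by (rule eq_Sig_beta2[OF raw])
    then have "jeq i \<Gamma> (XP2 S p) b T"
      using 2 ee' by (blast intro: jeq_teq jeq_trans)
    moreover have "AT i \<Gamma> b T"
      using b 2 by (blast intro: AT_teq)
    ultimately show ?thesis
      using good_whD[OF w wf] by (blast intro: jeq_trans)
  qed
  then show ?thesis
    using e' ee' by (auto simp: wp2_def split: ex.split)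
qed

lemma wsub_J:
  assumes "\<turnstile> ec i \<Gamma>" "AT i \<Gamma> a A" "AT i \<Gamma> b A" "AT i \<Gamma> p (XId k A a b)"
  shows "wsub i \<Gamma> (lk XV [p, b, a]) (XId k (xlift (xlift A)) (XV (Suc 0)) (XV 0) # xlift A # A # \<Gamma>)"
  by (intro wsub_Cons; simp only: lk_nil wsub_nil[OF assms(1)] xsubst_xlift_lk xsubst.simps xsubst_XV)
     (use assms in \<open>simp_all\<close>)

lemma wsubeq_J:
  assumes "\<turnstile> ec i \<Gamma>" "jeq i \<Gamma> a a' A" "jeq i \<Gamma> b b' A" "jeq i \<Gamma> p p' (XId k A a b)"
  shows "wsubeq i \<Gamma> (lk XV [p, b, a]) (lk XV [p', b', a']) (XId k (xlift (xlift A)) (XV (Suc 0)) (XV 0) # xlift A # A # \<Gamma>)"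
  by (intro wsubeq_Cons; simp only: lk_nil wsubeq_nil[OF assms(1)] xsubst_xlift_lk xsubst.simps xsubst_XV)
     (use assms in \<open>simp_all\<close>)


lemma AT_JD:
  assumes "AT i \<Gamma> (XJ k l A C c a b p) T"
  shows "AT i \<Gamma> A (XU k)" "AT i (A # \<Gamma>) (xlift A) (XU k)"
    "AT i (xlift A # A # \<Gamma>) (XId k (xlift (xlift A)) (XV (Suc 0)) (XV 0)) (XU k)"
    "AT i (XId k (xlift (xlift A)) (XV (Suc 0)) (XV 0) # xlift A # A # \<Gamma>) C (XU l)"
    "AT i (A # \<Gamma>) c (xsubst C (lk (XV \<circ> Suc) [XRf k (xlift A) (XV 0), XV 0, XV 0]))"
    "AT i \<Gamma> a A" "AT i \<Gamma> b A" "AT i \<Gamma> p (XId k A a b)" "teq i \<Gamma> (xsubst C (lk XV [p, b, a])) T"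
  by (rule AT_E[OF assms]; erule AS_J_E; simp)+

lemma xinst_J: "xinst (xsubst C (lk (XV \<circ> Suc) [XRf k (xlift A) (XV 0), XV 0, XV 0])) a = xsubst C (lk XV [XRf k A a, a, a])"
  unfolding xsubst_xsubst comp_lk
  by (rule arg_cong[where f = "xsubst C"]) (simp add: o_def xsubst_xlift_lk lk_nil xsubst_XV)

lemma wj_sound:
  assumes w: "good_wh i w" and cv: "good_cv i cv" and wf: "\<turnstile> ec i \<Gamma>" and e: "AT i \<Gamma> (XJ k l A C c a b p) T"
    and p: "\<And>T. AT i \<Gamma> p T \<Longrightarrow> AT i \<Gamma> p' T \<and> jeq i \<Gamma> p p' T"
  shows "AT i \<Gamma> (wj w cv k l A C c a b p') T \<and> jeq i \<Gamma> (XJ k l A C c a b p) (wj w cv k l A C c a b p') T"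
proof -
  note J = AT_JD[OF e]
  note T = J(9)
  note p' = p[OF J(8), THEN conjunct1] and pp' = p[OF J(8), THEN conjunct2]
  note wf1 = wf_ext[OF wf J(1)]
  note wf2 = wf_ext[OF wf1 J(2)]
  note wf3 = wf_ext[OF wf2 J(3)]
  note refls = jeq_refl[OF J(1) wf] jeq_refl[OF J(4) wf3] jeq_refl[OF J(5) wf1] jeq_refl[OF J(6) wf]
  have "teq i \<Gamma> (xsubst C (lk XV [p, b, a])) (xsubst C (lk XV [p', b, a]))"
    by (rule teq_wsubeq[OF J(4) wf3 wsubeq_J[OF wf refls(4) jeq_refl[OF J(7) wf] pp']])
  then have "teq i \<Gamma> (xsubst C (lk XV [p', b, a])) T"
    using T by (blast intro: teq_trans teq_sym)
  then have e': "AT i \<Gamma> (XJ k l A C c a b p') T"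
    by (rule AT_I[OF AS_J[OF J(1-7) p']])
  have ee': "jeq i \<Gamma> (XJ k l A C c a b p) (XJ k l A C c a b p') T"
    by (rule jeq_teq[OF jeq_J[OF refls jeq_refl[OF J(7) wf] pp'] T])
  have "AT i \<Gamma> (w (xinst c a)) T \<and> jeq i \<Gamma> (XJ k l A C c a b p) (w (xinst c a)) T"
    if p'_eq: "p' = XRf k A' x" and cvs: "cv A' A" "cv x a" "cv x b" for A' x
  proof -
    have A': "AT i \<Gamma> A' (XU k)" and x': "AT i \<Gamma> x A'"
      by (rule AT_E[OF p'[unfolded p'_eq]]; erule AS_Rf_E; simp)+
    have "teq i \<Gamma> A' A"
      by (rule jeq_imp_teq[OF good_cvD[OF cv cvs(1) wf A' J(1)]])
    with x' have x: "AT i \<Gamma> x A"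
      by (rule AT_teq)
    note xa = good_cvD[OF cv cvs(2) wf x J(6)] and xb = good_cvD[OF cv cvs(3) wf x J(7)]
    \<comment> \<open>The beta rule requires both endpoints to be \<open>a\<close> and the path to
      be reflexivity at \<open>a\<close>, whereas \<open>p'\<close> is reflexivity at
      \<open>x\<close>; the comparisons of \<open>x\<close> with \<open>a\<close> and
      \<open>b\<close> bridge the difference.\<close>
    have "jeq i \<Gamma> p' (XRf k A a) (XId k A x x)"
      unfolding p'_eq by (rule jeq_Rf[OF xa])
    moreover have "teq i \<Gamma> (XId k A x x) (XId k A a b)"
      by (rule jeq_imp_teq[OF jeq_Id[OF refls(1) xa xb]])
    ultimately have "jeq i \<Gamma> p' (XRf k A a) (XId k A a b)"
      by (rule jeq_teq)
    with pp' have pr: "jeq i \<Gamma> p (XRf k A a) (XId k A a b)"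
      by (rule jeq_trans)
    have ba: "jeq i \<Gamma> b a A"
      using xa xb by (blast intro: jeq_trans jeq_sym)
    have "teq i \<Gamma> (xsubst C (lk XV [p, b, a])) (xsubst C (lk XV [XRf k A a, a, a]))"
      by (rule teq_wsubeq[OF J(4) wf3 wsubeq_J[OF wf refls(4) ba pr]])
    then have T': "teq i \<Gamma> (xsubst C (lk XV [XRf k A a, a, a])) T"
      using T by (blast intro: teq_trans teq_sym)
    have ca: "AT i \<Gamma> (xinst c a) T"
      using AT_inst[OF J(5,6) wf] T' unfolding xinst_J by (rule AT_teq)
    have "jeq i \<Gamma> (XJ k l A C c a b p) (XJ k l A C c a a (XRf k A a)) T"
      by (rule jeq_teq[OF jeq_J[OF refls ba pr] T])
    moreover have "jeq i \<Gamma> (XJ k l A C c a a (XRf k A a)) (xinst c a) (xsubst C (lk XV [XRf k A a, a, a]))"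
      unfolding jeq_def er_inst_J er.simps er_xinst
      using AT_sound(2)[OF J(4) wf3] AT_sound(2)[OF J(5) wf1] AT_sound(2)[OF J(6) wf]
      by (intro eq_J_beta) (simp_all add: er_inst_J er_xren)
    ultimately have "jeq i \<Gamma> (XJ k l A C c a b p) (xinst c a) T"
      using T' by (blast intro: jeq_teq jeq_trans)
    then show ?thesis
      using good_whD[OF w wf ca] by (blast intro: jeq_trans)
  qed
  then show ?thesis
    using e' ee' by (auto simp: wj_def split: ex.split)
qed

lemma AT_OnID:
  assumes "AT i \<Gamma> (XOnI l C c u) T"
  shows "AT i (XOn # \<Gamma>) C (XU l)" "AT i \<Gamma> c (xinst C XSt)" "AT i \<Gamma> u XOn" "teq i \<Gamma> (xinst C u) T"
  by (rule AT_E[OF assms]; erule AS_OnI_E; simp)+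

lemma AT_TwID:
  assumes "AT i \<Gamma> (XTwI l C c d u) T"
  shows "AT i (XTw # \<Gamma>) C (XU l)" "AT i \<Gamma> c (xinst C XT0)" "AT i \<Gamma> d (xinst C XT1)" "AT i \<Gamma> u XTw"
    "teq i \<Gamma> (xinst C u) T"
  by (rule AT_E[OF assms]; erule AS_TwI_E; simp)+

lemma won_sound:
  assumes w: "good_wh i w" and wf: "\<turnstile> ec i \<Gamma>" and e: "AT i \<Gamma> (XOnI l C c u) T"
    and u: "\<And>T. AT i \<Gamma> u T \<Longrightarrow> AT i \<Gamma> u' T \<and> jeq i \<Gamma> u u' T"
  shows "AT i \<Gamma> (won w l C c u') T \<and> jeq i \<Gamma> (XOnI l C c u) (won w l C c u') T"
proof -
  note D = AT_OnID[OF e]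
  note u' = u[OF D(3), THEN conjunct1] and uu' = u[OF D(3), THEN conjunct2]
  note On = AS_AT[OF AS_On, of i \<Gamma>]
  note wf1 = wf_ext[OF wf On]
  have T': "teq i \<Gamma> (xinst C u') T"
    using teq_inst[OF D(1) uu' On wf] D(4) by (blast intro: teq_trans teq_sym)
  have e': "AT i \<Gamma> (XOnI l C c u') T"
    by (rule AT_I[OF AS_OnI[OF D(1,2) u'] T'])
  have ee': "jeq i \<Gamma> (XOnI l C c u) (XOnI l C c u') T"
    by (rule jeq_teq[OF jeq_OnI[OF jeq_refl[OF D(1) wf1] jeq_refl[OF D(2) wf] uu'] D(4)])
  have "AT i \<Gamma> (w c) T \<and> jeq i \<Gamma> (XOnI l C c u) (w c) T" if "u' = XSt"
  proof -
    have c: "AT i \<Gamma> c T"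
      using D(2) T' by (auto simp: that intro: AT_teq)
    have "jeq i \<Gamma> (XOnI l C c u') c (xinst C XSt)"
      unfolding that jeq_def er.simps er_xinst
      using AT_sound(2)[OF D(1) wf1] AT_sound(2)[OF D(2) wf] by (simp add: er_xinst eq_Unit_beta)
    then have "jeq i \<Gamma> (XOnI l C c u) c T"
      using T' ee' by (auto simp: that intro: jeq_teq jeq_trans)
    with good_whD[OF w wf c] show ?thesis
      by (blast intro: jeq_trans)
  qed
  then show ?thesis
    using e' ee' by (auto simp: won_def split: ex.split)
qed

lemma wtw_sound:
  assumes w: "good_wh i w" and wf: "\<turnstile> ec i \<Gamma>" and e: "AT i \<Gamma> (XTwI l C c d u) T"
    and u: "\<And>T. AT i \<Gamma> u T \<Longrightarrow> AT i \<Gamma> u' T \<and> jeq i \<Gamma> u u' T"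
  shows "AT i \<Gamma> (wtw w l C c d u') T \<and> jeq i \<Gamma> (XTwI l C c d u) (wtw w l C c d u') T"
proof -
  note D = AT_TwID[OF e]
  note u' = u[OF D(4), THEN conjunct1] and uu' = u[OF D(4), THEN conjunct2]
  note Tw = AS_AT[OF AS_Tw, of i \<Gamma>]
  note wf1 = wf_ext[OF wf Tw]
  have T': "teq i \<Gamma> (xinst C u') T"
    using teq_inst[OF D(1) uu' Tw wf] D(5) by (blast intro: teq_trans teq_sym)
  have e': "AT i \<Gamma> (XTwI l C c d u') T"
    by (rule AT_I[OF AS_TwI[OF D(1,2,3) u'] T'])
  have ee': "jeq i \<Gamma> (XTwI l C c d u) (XTwI l C c d u') T"
    by (rule jeq_teq[OF jeq_TwI[OF jeq_refl[OF D(1) wf1] jeq_refl[OF D(2) wf] jeq_refl[OF D(3) wf] uu'] D(5)])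
  have "AT i \<Gamma> (w x) T \<and> jeq i \<Gamma> (XTwI l C c d u) (w x) T" if "u' = XT0 \<and> x = c \<or> u' = XT1 \<and> x = d" for x
  proof -
    have x: "AT i \<Gamma> x T"
      using D(2,3) T' that by (auto intro: AT_teq)
    have "jeq i \<Gamma> (XTwI l C c d u') x (xinst C u')"
      using that AT_sound(2)[OF D(1) wf1] AT_sound(2)[OF D(2) wf] AT_sound(2)[OF D(3) wf]
      by (auto simp: jeq_def er_xinst intro: eq_Two_beta0 eq_Two_beta1)
    then have "jeq i \<Gamma> (XTwI l C c d u) x T"
      using T' ee' by (blast intro: jeq_teq jeq_trans)
    with good_whD[OF w wf x] show ?thesis
      by (blast intro: jeq_trans)
  qed
  then show ?thesis
    using e' ee' by (auto simp: wtw_def split: ex.split)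
qed

lemma wsub_wsubeq: "wsub i \<Delta> \<sigma> \<Gamma> \<Longrightarrow> wsubeq i \<Delta> \<sigma> \<sigma> \<Gamma>"
  by (auto simp: wsub_def wsubeq_def intro: jeq_refl)

lemma AT_CD:
  assumes "AT i \<Gamma> (XC d as) T"
  shows "AL i \<Gamma> as (ctele d)" "\<turnstile> ec i (ctele d)" "ec i (ctele d) \<turnstile> draw d i \<^bold>: er i (drty d)"
    "dbody d = Some b \<Longrightarrow> AT i (ctele d) b (drty d)"
    "dbody d = Some b \<Longrightarrow> ec i (ctele d) \<turnstile> draw d i \<doteq> er i b \<^bold>: er i (drty d)"
    "teq i \<Gamma> (xsubst (drty d) (args as)) T"
  by (rule AT_E[OF assms]; erule AS_C_E; simp)+

lemma unfold_sound:
  assumes wf: "\<turnstile> ec i \<Gamma>" and e: "AT i \<Gamma> (XC d as) T" and b: "dbody d = Some b"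
  shows "AT i \<Gamma> (xsubst b (args as)) T \<and> jeq i \<Gamma> (XC d as) (xsubst b (args as)) T"
proof
  note D = AT_CD[OF e]
  have w: "wsub i \<Gamma> (args as) (ctele d)"
    using D(1) wf by (rule wsub_args)
  show "AT i \<Gamma> (xsubst b (args as)) T"
    using AT_xsubst[OF D(4)[OF b] w] D(6) by (rule AT_teq)
  have "jeq i \<Gamma> (XC d as) (xsubst b (args as)) (xsubst (drty d) (args as))"
    unfolding jeq_def er.simps er_xsubst er_args[symmetric]
    by (rule eq_wsubeq[OF D(5)[OF b] wsub_wsubeq[OF w]])
  then show "jeq i \<Gamma> (XC d as) (xsubst b (args as)) T"
    using D(6) by (rule jeq_teq)
qed

section \<open>Soundness of the comparison\<close>

text \<open>Once the tails are equal, the two types of the heads are equal instances of one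
  telescope entry, so that the heads can be compared at a common type.\<close>

lemma cvl_sound:
  assumes cv: "good_cv i cv" and wf: "\<turnstile> ec i \<Gamma>"
  shows "AL i \<Gamma> as \<Delta> \<Longrightarrow> AL i \<Gamma> bs \<Delta> \<Longrightarrow> cvl cv as bs \<Longrightarrow> \<turnstile> ec i \<Delta> \<Longrightarrow> wsubeq i \<Gamma> (args as) (args bs) \<Delta>"
proof (induct as arbitrary: bs \<Delta>)
  case Nil
  then show ?case
    using wf by (auto simp: wsubeq_def elim: AL_NilE)
next
  case (Cons a as)
  obtain A \<Delta>' where \<Delta>: "\<Delta> = A # \<Delta>'" and as: "AL i \<Gamma> as \<Delta>'" and a: "AT i \<Gamma> a (xsubst A (args as))"
    using Cons.prems(1) by (rule AL_ConsE)
  obtain b bs' where bs: "bs = b # bs'" "AL i \<Gamma> bs' \<Delta>'" and b: "AT i \<Gamma> b (xsubst A (args bs'))"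
    using Cons.prems(2) unfolding \<Delta> by (rule AL_Cons_E)
  obtain j where \<Delta>': "\<turnstile> ec i \<Delta>'" "ec i \<Delta>' \<turnstile> er i A \<^bold>: Uni j"
    using Cons.prems(4) by (auto simp: \<Delta> elim: wf_ctx_Cons)
  have eq: "wsubeq i \<Gamma> (args as) (args bs') \<Delta>'"
    using Cons.prems(3) \<Delta>' by (intro Cons.hyps as bs(2)) (auto simp: bs(1) split: if_splits)
  have "teq i \<Gamma> (xsubst A (args bs')) (xsubst A (args as))"
    using eq_wsubeq[OF eq_refl[OF \<Delta>'(2)] eq] by (auto simp: teq_def er_xsubst intro: eq_sym)
  with b have "AT i \<Gamma> b (xsubst A (args as))"
    by (rule AT_teq)
  then have "jeq i \<Gamma> a b (xsubst A (args as))"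
    using Cons.prems(3) by (intro good_cvD[OF cv _ wf a]) (auto simp: bs(1) split: if_splits)
  with eq show ?case
    unfolding \<Delta> bs(1) by (rule wsubeq_Cons)
qed

lemma cvc_sound:
  assumes cv: "good_cv i cv" and wf: "\<turnstile> ec i \<Gamma>" and "AT i \<Gamma> a T" "AT i \<Gamma> b T" "cvc cv a b"
  shows "jeq i \<Gamma> a b T"
proof -
  obtain d as bs where eq: "a = XC d as" "b = XC d bs" "cvl cv as bs"
    using assms(5) by (auto simp: cvc_def split: ex.splits if_splits)
  note A = AT_CD[OF assms(3)[unfolded eq]] and B = AT_CD[OF assms(4)[unfolded eq]]
  show ?thesis
    unfolding eq by (rule jeq_teq[OF jeq_C[OF cvl_sound[OF cv wf A(1) B(1) eq(3) A(2)] A(3)] A(6)])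
qed

lemma xinst_up: "xinst (xren B (up_ren Suc)) (XV 0) = (B :: 'd ex)"
proof -
  have "lk XV [XV 0] \<circ> up_ren Suc = (XV :: nat \<Rightarrow> 'd ex)"
    by (rule ext, case_tac x) simp_all
  then show ?thesis
    by (simp only: xsubst_xren xsubst_XV)
qed

lemma etal_sound:
  assumes cv: "good_cv i cv" and wf: "\<turnstile> ec i \<Gamma>" and L: "AT i \<Gamma> (XLam k l A B s) T" and f: "AT i \<Gamma> f T"
    and "etal cv k l A B s f"
  shows "jeq i \<Gamma> (XLam k l A B s) f T"
proof -
  note D = AT_LamD[OF L wf]
  have A: "AT i \<Gamma> A (XU k)" and B: "AT i (A # \<Gamma>) B (XU l)"
    using D(1) by (auto simp: istype2_def)
  note wf1 = wf_ext[OF wf A]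
  have A1: "AT i (A # \<Gamma>) (xlift A) (XU k)"
    using AT_lift[OF A wf1] by simp
  have f': "AT i \<Gamma> f (XPi k l A B)"
    using f D(3) by (blast intro: AT_teq teq_sym)
  have "wren i (xlift A # A # \<Gamma>) (up_ren Suc) (A # \<Gamma>)"
    using wf_ext[OF wf1 A1] by (auto simp: wren_def All_less_Suc2 xren_xren up_ren_Suc)
  from AT_xren[OF B this] have B1: "AT i (xlift A # A # \<Gamma>) (xren B (up_ren Suc)) (XU l)"
    by simp
  have "AT i (A # \<Gamma>) (XApp (XPi k l (xlift A) (xren B (up_ren Suc))) (xlift f) (XV 0)) B"
    using AS_App[OF A1 B1 AT_lift[OF f' wf1, simplified], of "XV 0"] AS_V[of 0 "A # \<Gamma>"]
    by (auto simp: xinst_up intro: AS_AT)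
  from good_cvD[OF cv assms(5)[unfolded etal_def] wf1 D(2) this]
  have "jeq i \<Gamma> (XLam k l A B s) (XLam k l A B (XApp (XPi k l (xlift A) (xren B (up_ren Suc))) (xlift f) (XV 0))) (XPi k l A B)"
    by (rule jeq_Lam[OF jeq_refl[OF A wf]])
  moreover have "jeq i \<Gamma> (XLam k l A B (XApp (XPi k l (xlift A) (xren B (up_ren Suc))) (xlift f) (XV 0))) f (XPi k l A B)"
    using eq_Pi_eta[OF AT_sound(2)[OF f' wf, simplified]] by (simp add: jeq_def er_xren eq_sym)
  ultimately show ?thesis
    using D(3) by (blast intro: jeq_trans jeq_teq)
qed

lemma etas_sound:
  assumes cv: "good_cv i cv" and wf: "\<turnstile> ec i \<Gamma>" and t: "AT i \<Gamma> (XTup S a b) T" and p: "AT i \<Gamma> p T"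
    and "etas cv S a b p"
  shows "jeq i \<Gamma> (XTup S a b) p T"
proof -
  obtain k l A B where S: "S = XSig k l A B" and AB: "istype2 i \<Gamma> k l A B" and a: "AT i \<Gamma> a A"
    and b: "AT i \<Gamma> b (xinst B a)" and T: "teq i \<Gamma> (XSig k l A B) T"
    using t wf by (rule AT_TupD)
  have A: "AT i \<Gamma> A (XU k)" and B: "AT i (A # \<Gamma>) B (XU l)"
    using AB by (auto simp: istype2_def)
  have p': "AT i \<Gamma> p (XSig k l A B)"
    using p T by (blast intro: AT_teq teq_sym)
  have 1: "jeq i \<Gamma> a (XP1 S p) A"
    using assms(5) AS_AT[OF AS_P1[OF A B p']] by (auto simp: S etas_def split: if_splits intro: good_cvD[OF cv _ wf a])
  \<comment> \<open>The second projection has its type over the first projection of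
    \<open>p\<close>; equality of first components moves it over \<open>a\<close>.\<close>
  have "AT i \<Gamma> (XP2 S p) (xinst B a)"
    using AS_AT[OF AS_P2[OF A B p']] teq_sym[OF teq_inst[OF B 1 A wf]] by (auto simp: S intro: AT_teq)
  then have 2: "jeq i \<Gamma> b (XP2 S p) (xinst B a)"
    using assms(5) by (auto simp: etas_def split: if_splits intro: good_cvD[OF cv _ wf b])
  have "jeq i \<Gamma> (XTup S a b) (XTup S (XP1 S p) (XP2 S p)) (XSig k l A B)"
    by (rule jeq_Tup[OF B wf_ext[OF wf A] 1 2])
  moreover have "jeq i \<Gamma> (XTup S (XP1 S p) (XP2 S p)) p (XSig k l A B)"
    using eq_Sig_eta[OF AT_sound(2)[OF p' wf, simplified]] by (simp add: jeq_def eq_sym)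
  ultimately show ?thesis
    using T by (blast intro: jeq_trans jeq_teq)
qed

context
  fixes i cv \<Gamma>
  assumes cv: "good_cv i cv" and wf: "\<turnstile> ec i \<Gamma>"
begin

lemma cvs_Lam:
  assumes a: "AT i \<Gamma> (XLam k l A B s) T" and b: "AT i \<Gamma> (XLam k' l' A' B' s') T"
    and eq: "tpeq cv (XPi k l A B) (XPi k' l' A' B')" "cv s s'"
  shows "jeq i \<Gamma> (XLam k l A B s) (XLam k' l' A' B' s') T"
proof -
  note D = AT_LamD[OF a wf] and D' = AT_LamD[OF b wf]
  note fam = tpeq_fam[OF cv D(1) D'(1) disjI1[OF eq(1)]]
  have A: "AT i \<Gamma> A (XU k)" "AT i \<Gamma> A' (XU k')"
    using D(1) D'(1) by (auto simp: istype2_def)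
  have "AT i (A # \<Gamma>) s' B"
    using AT_conv_ctx[OF D'(2) wf teq_sym[OF fam(5)] A(2,1)] teq_sym[OF fam(6)] by (rule AT_teq)
  from good_cvD[OF cv eq(2) wf_ext[OF wf A(1)] D(2) this]
  show ?thesis
    using jeq_Lam[OF fam(3)] D(3) by (blast intro: jeq_teq)
qed

lemma cvs_Tup:
  assumes a: "AT i \<Gamma> (XTup S x y) T" and b: "AT i \<Gamma> (XTup S' x' y') T"
    and eq: "tpeq cv S S'" "cv x x'" "cv y y'"
  shows "jeq i \<Gamma> (XTup S x y) (XTup S' x' y') T"
proof -
  obtain k l A B where S: "S = XSig k l A B" and AB: "istype2 i \<Gamma> k l A B" and x: "AT i \<Gamma> x A"
    and y: "AT i \<Gamma> y (xinst B x)" and T: "teq i \<Gamma> (XSig k l A B) T"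
    using a wf by (rule AT_TupD)
  obtain k' l' A' B' where S': "S' = XSig k' l' A' B'" and AB': "istype2 i \<Gamma> k' l' A' B'" and x': "AT i \<Gamma> x' A'"
    and y': "AT i \<Gamma> y' (xinst B' x')"
    using b wf by (rule AT_TupD)
  note fam = tpeq_fam[OF cv AB AB' disjI2[OF eq(1)[unfolded S S']]]
  have A: "AT i \<Gamma> A (XU k)" and B: "AT i (A # \<Gamma>) B (XU l)"
    using AB by (auto simp: istype2_def)
  have x'A: "AT i \<Gamma> x' A"
    using x' teq_sym[OF fam(5)] by (rule AT_teq)
  note xx = good_cvD[OF cv eq(2) wf x x'A]
  have "teq i \<Gamma> (xinst B' x') (xinst B x)"
    using teq_xsubst[OF fam(6) wsub_inst[OF wf x'A]] teq_inst[OF B xx A wf] by (blast intro: teq_trans teq_sym)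
  with y' have "AT i \<Gamma> y' (xinst B x)"
    by (rule AT_teq)
  from good_cvD[OF cv eq(3) wf y this]
  show ?thesis
    using jeq_Tup[OF B wf_ext[OF wf A] xx] T by (blast intro: jeq_teq)
qed

lemma cvs_PiSig:
  assumes "AT i \<Gamma> a T" "AT i \<Gamma> b T" "tpeq cv a b"
    "(a = XPi k l A B \<and> b = XPi k' l' A' B') \<or> (a = XSig k l A B \<and> b = XSig k' l' A' B')"
  shows "jeq i \<Gamma> a b T"
proof -
  have D: "istype2 i \<Gamma> k l A B" "teq i \<Gamma> (XU (max k l)) T"
    by (rule AT_E[OF assms(1)]; use assms(4) wf in \<open>auto simp: istype2_def elim: AS_Pi_E AS_Sig_E\<close>)+
  have D': "istype2 i \<Gamma> k' l' A' B'"
    by (rule AT_E[OF assms(2)]; use assms(4) wf in \<open>auto simp: istype2_def elim: AS_Pi_E AS_Sig_E\<close>)+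
  have "tpeq cv (XPi k l A B) (XPi k' l' A' B') \<or> tpeq cv (XSig k l A B) (XSig k' l' A' B')"
    using assms(3,4) by auto
  note fam = tpeq_fam[OF cv D(1) D' this]
  show ?thesis
    using assms(4) jeq_Pi[OF fam(3,4)] jeq_Sig[OF fam(3,4)] D(2) fam(1,2) by (auto intro: jeq_teq)
qed

lemma cvs_App:
  assumes a: "AT i \<Gamma> (XApp P f x) T" and b: "AT i \<Gamma> (XApp P' f' x') T"
    and eq: "tpeq cv P P'" "cv f f'" "cv x x'"
  shows "jeq i \<Gamma> (XApp P f x) (XApp P' f' x') T"
proof -
  obtain k l A B where P: "P = XPi k l A B" and AB: "istype2 i \<Gamma> k l A B" and f: "AT i \<Gamma> f (XPi k l A B)"
    and x: "AT i \<Gamma> x A" and T: "teq i \<Gamma> (xinst B x) T"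
    using a wf by (rule AT_AppD)
  obtain k' l' A' B' where P': "P' = XPi k' l' A' B'" and AB': "istype2 i \<Gamma> k' l' A' B'"
    and f': "AT i \<Gamma> f' (XPi k' l' A' B')" and x': "AT i \<Gamma> x' A'"
    using b wf by (rule AT_AppD)
  note fam = tpeq_fam[OF cv AB AB' disjI1[OF eq(1)[unfolded P P']]]
  have "AT i \<Gamma> f' (XPi k l A B)"
    using f' teq_sym[OF teq_Pi(1)[OF AB fam(3,4)]] fam(1,2) by (auto intro: AT_teq)
  from good_cvD[OF cv eq(2) wf f this]
  show ?thesis
    using good_cvD[OF cv eq(3) wf x AT_teq[OF x' teq_sym[OF fam(5)]]] T by (blast intro: jeq_teq jeq_App)
qed

lemma cvs_P1:
  assumes a: "AT i \<Gamma> (XP1 S p) T" and b: "AT i \<Gamma> (XP1 S' p') T" and eq: "tpeq cv S S'" "cv p p'"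
  shows "jeq i \<Gamma> (XP1 S p) (XP1 S' p') T"
proof -
  obtain k l A B where S: "S = XSig k l A B" and AB: "istype2 i \<Gamma> k l A B" and p: "AT i \<Gamma> p (XSig k l A B)"
    and T: "teq i \<Gamma> A T"
    using a wf by (rule AT_P1D)
  obtain k' l' A' B' where S': "S' = XSig k' l' A' B'" and AB': "istype2 i \<Gamma> k' l' A' B'"
    and p': "AT i \<Gamma> p' (XSig k' l' A' B')"
    using b wf by (rule AT_P1D)
  note fam = tpeq_fam[OF cv AB AB' disjI2[OF eq(1)[unfolded S S']]]
  have "AT i \<Gamma> p' (XSig k l A B)"
    using p' teq_sym[OF teq_Pi(2)[OF AB fam(3,4)]] fam(1,2) by (auto intro: AT_teq)
  from good_cvD[OF cv eq(2) wf p this]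
  show ?thesis
    using T by (blast intro: jeq_teq jeq_P1)
qed

lemma cvs_P2:
  assumes a: "AT i \<Gamma> (XP2 S p) T" and b: "AT i \<Gamma> (XP2 S' p') T" and eq: "tpeq cv S S'" "cv p p'"
  shows "jeq i \<Gamma> (XP2 S p) (XP2 S' p') T"
proof -
  obtain k l A B where S: "S = XSig k l A B" and AB: "istype2 i \<Gamma> k l A B" and p: "AT i \<Gamma> p (XSig k l A B)"
    and T: "teq i \<Gamma> (xinst B (XP1 (XSig k l A B) p)) T"
    using a wf by (rule AT_P2D)
  obtain k' l' A' B' where S': "S' = XSig k' l' A' B'" and AB': "istype2 i \<Gamma> k' l' A' B'"
    and p': "AT i \<Gamma> p' (XSig k' l' A' B')"
    using b wf by (rule AT_P2D)
  note fam = tpeq_fam[OF cv AB AB' disjI2[OF eq(1)[unfolded S S']]]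
  have "AT i \<Gamma> p' (XSig k l A B)"
    using p' teq_sym[OF teq_Pi(2)[OF AB fam(3,4)]] fam(1,2) by (auto intro: AT_teq)
  from jeq_P2[OF good_cvD[OF cv eq(2) wf p this], of S S']
  show ?thesis
    using T by (auto simp: S intro: jeq_teq)
qed

lemma cvs_Id:
  assumes a: "AT i \<Gamma> (XId k A x y) T" and b: "AT i \<Gamma> (XId k A' x' y') T" and eq: "cv A A'" "cv x x'" "cv y y'"
  shows "jeq i \<Gamma> (XId k A x y) (XId k A' x' y') T"
proof -
  have D: "AT i \<Gamma> A (XU k)" "AT i \<Gamma> x A" "AT i \<Gamma> y A" "teq i \<Gamma> (XU k) T"
    by (rule AT_E[OF a]; erule AS_Id_E; simp)+
  have D': "AT i \<Gamma> A' (XU k)" "AT i \<Gamma> x' A'" "AT i \<Gamma> y' A'"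
    by (rule AT_E[OF b]; erule AS_Id_E; simp)+
  note AA = good_cvD[OF cv eq(1) wf D(1) D'(1)]
  note t = teq_sym[OF jeq_imp_teq[OF AA]]
  show ?thesis
    using jeq_Id[OF AA good_cvD[OF cv eq(2) wf D(2) AT_teq[OF D'(2) t]] good_cvD[OF cv eq(3) wf D(3) AT_teq[OF D'(3) t]]] D(4)
    by (rule jeq_teq)
qed

lemma cvs_Rf:
  assumes a: "AT i \<Gamma> (XRf k A x) T" and b: "AT i \<Gamma> (XRf k A' x') T" and eq: "cv A A'" "cv x x'"
  shows "jeq i \<Gamma> (XRf k A x) (XRf k A' x') T"
proof -
  have D: "AT i \<Gamma> A (XU k)" "AT i \<Gamma> x A" "teq i \<Gamma> (XId k A x x) T"
    by (rule AT_E[OF a]; erule AS_Rf_E; simp)+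
  have D': "AT i \<Gamma> A' (XU k)" "AT i \<Gamma> x' A'"
    by (rule AT_E[OF b]; erule AS_Rf_E; simp)+
  note t = teq_sym[OF jeq_imp_teq[OF good_cvD[OF cv eq(1) wf D(1) D'(1)]]]
  show ?thesis
    using jeq_Rf[OF good_cvD[OF cv eq(2) wf D(2) AT_teq[OF D'(2) t]]] D(3) by (rule jeq_teq)
qed

lemma cvs_EmI:
  assumes a: "AT i \<Gamma> (XEmI l C u) T" and b: "AT i \<Gamma> (XEmI l C' u') T" and eq: "cv C C'" "cv u u'"
  shows "jeq i \<Gamma> (XEmI l C u) (XEmI l C' u') T"
proof -
  have D: "AT i (XEm # \<Gamma>) C (XU l)" "AT i \<Gamma> u XEm" "teq i \<Gamma> (xinst C u) T"
    by (rule AT_E[OF a]; erule AS_EmI_E; simp)+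
  have D': "AT i (XEm # \<Gamma>) C' (XU l)" "AT i \<Gamma> u' XEm"
    by (rule AT_E[OF b]; erule AS_EmI_E; simp)+
  show ?thesis
    using jeq_EmI[OF good_cvD[OF cv eq(1) wf_ext[OF wf AS_AT[OF AS_Em]] D(1) D'(1)] good_cvD[OF cv eq(2) wf D(2) D'(2)]] D(3)
    by (rule jeq_teq)
qed

lemma cvs_OnI:
  assumes a: "AT i \<Gamma> (XOnI l C c u) T" and b: "AT i \<Gamma> (XOnI l C' c' u') T" and eq: "cv C C'" "cv c c'" "cv u u'"
  shows "jeq i \<Gamma> (XOnI l C c u) (XOnI l C' c' u') T"
proof -
  note D = AT_OnID[OF a] and D' = AT_OnID[OF b]
  note CC = good_cvD[OF cv eq(1) wf_ext[OF wf AS_AT[OF AS_On]] D(1) D'(1)]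
  have "teq i \<Gamma> (xinst C' XSt) (xinst C XSt)"
    by (rule teq_xsubst[OF teq_sym[OF jeq_imp_teq[OF CC]] wsub_inst[OF wf AS_AT[OF AS_St]]])
  note cc = good_cvD[OF cv eq(2) wf D(2) AT_teq[OF D'(2) this]]
  show ?thesis
    using jeq_OnI[OF CC cc good_cvD[OF cv eq(3) wf D(3) D'(3)]] D(4) by (rule jeq_teq)
qed

lemma cvs_TwI:
  assumes a: "AT i \<Gamma> (XTwI l C c d u) T" and b: "AT i \<Gamma> (XTwI l C' c' d' u') T"
    and eq: "cv C C'" "cv c c'" "cv d d'" "cv u u'"
  shows "jeq i \<Gamma> (XTwI l C c d u) (XTwI l C' c' d' u') T"
proof -
  note D = AT_TwID[OF a] and D' = AT_TwID[OF b]
  note CC = good_cvD[OF cv eq(1) wf_ext[OF wf AS_AT[OF AS_Tw]] D(1) D'(1)]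
  note t = teq_sym[OF jeq_imp_teq[OF CC]]
  note cc = good_cvD[OF cv eq(2) wf D(2) AT_teq[OF D'(2) teq_xsubst[OF t wsub_inst[OF wf AS_AT[OF AS_T0]]]]]
  note dd = good_cvD[OF cv eq(3) wf D(3) AT_teq[OF D'(3) teq_xsubst[OF t wsub_inst[OF wf AS_AT[OF AS_T1]]]]]
  show ?thesis
    using jeq_TwI[OF CC cc dd good_cvD[OF cv eq(4) wf D(4) D'(4)]] D(5) by (rule jeq_teq)
qed

lemma cvs_J:
  assumes a: "AT i \<Gamma> (XJ k l A C c x y p) T" and b: "AT i \<Gamma> (XJ k l A' C' c' x' y' p') T"
    and eq: "cv A A'" "cv C C'" "cv c c'" "cv x x'" "cv y y'" "cv p p'"
  shows "jeq i \<Gamma> (XJ k l A C c x y p) (XJ k l A' C' c' x' y' p') T"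
proof -
  note D = AT_JD[OF a] and D' = AT_JD[OF b]
  note wf1 = wf_ext[OF wf D(1)]
  note wf2 = wf_ext[OF wf1 D(2)]
  note wf3 = wf_ext[OF wf2 D(3)]
  note AA = good_cvD[OF cv eq(1) wf D(1) D'(1)]
  note t = teq_sym[OF jeq_imp_teq[OF AA]]
  note t1 = teq_lift[OF t wf1]
  note t2 = teq_lift[OF t1 wf2]
  let ?E = "\<lambda>A. XId k (xlift (xlift A)) (XV (Suc 0)) (XV 0)"
  have V: "AT i (xlift A # A # \<Gamma>) (XV j) (xlift (xlift A))" if "j < 2" for j
    using that AS_AT[OF AS_V[of j "xlift A # A # \<Gamma>"]] by (auto simp: less_2_cases_iff)
  have "jeq i (xlift A # A # \<Gamma>) (xlift (xlift A')) (xlift (xlift A)) (XU k)"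
    using jeq_lift[OF jeq_lift[OF jeq_sym[OF AA] wf1] wf2] by simp
  from jeq_Id[OF this]
  have t3: "teq i (xlift A # A # \<Gamma>) (?E A') (?E A)"
    by (rule jeq_imp_teq)
       (auto intro!: jeq_refl[OF _ wf2] AT_teq[OF V teq_sym[OF t2]])
  note s1 = wsub_ext[OF wsub_nil[OF wf] D(1) t]
  \<comment> \<open>Identity substitution between the contexts of the two motives, which differ in
    all three entries because each mentions the compared type.\<close>
  note s3 = wsub_ext[OF wsub_ext[OF s1 D(2) t1] D(3) t3]
  have CC': "AT i (?E A # xlift A # A # \<Gamma>) C' (XU l)"
    using AT_xsubst[OF D'(4) s3] by (simp add: xsubst_XV)
  note CC = good_cvD[OF cv eq(2) wf3 D(4) CC']
  let ?b = "\<lambda>A C. xsubst C (lk (XV \<circ> Suc) [XRf k (xlift A) (XV 0), XV 0, XV 0])"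
  have c': "AT i (A # \<Gamma>) c' (?b A' C')"
    using AT_xsubst[OF D'(5) s1] by (simp only: xsubst_XV)
  have sh: "wsub i (A # \<Gamma>) (lk (XV \<circ> Suc) []) \<Gamma>"
    using wf1 AT_lift[OF AS_AT[OF AS_V] wf1]
    by (auto simp: wsub_def lk_nil simp flip: xren_eq_xsubst)
  have V0: "AT i (A # \<Gamma>) (XV 0) (xlift A)"
    using AS_AT[OF AS_V[of 0 "A # \<Gamma>"]] by simp
  have "AT i (A # \<Gamma>) (XRf k (xlift A) (XV 0)) (XId k (xlift A) (XV 0) (XV 0))"
    using AS_AT[OF AS_Rf[OF D(2) V0]] .
  then have w: "wsub i (A # \<Gamma>) (lk (XV \<circ> Suc) [XRf k (xlift A) (XV 0), XV 0, XV 0]) (?E A # xlift A # A # \<Gamma>)"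
    by (intro wsub_Cons sh; simp only: xsubst_xlift_lk lk_nil xsubst.simps flip: xren_eq_xsubst)
       (simp_all add: V0)
  have "teq i (A # \<Gamma>) (?b A' C') (?b A C)"
  proof -
    have "teq i (A # \<Gamma>) (?b A C') (?b A C)"
      by (rule teq_xsubst[OF teq_sym[OF jeq_imp_teq[OF CC]] w])
    \<comment> \<open>The two instances differ in the annotation of a reflexivity term, which
      erasure removes.\<close>
    moreover have "er i (?b A' C') = er i (?b A C')"
      by (simp only: er_inst_J)
    moreover have "ec i (A # \<Gamma>) \<turnstile> er i (?b A C') \<doteq> er i (?b A C') \<^bold>: Uni (i + l)"
      using AT_sound(2)[OF AT_xsubst[OF CC' w] wf1] by (auto intro: eq_refl)
    ultimately have "teq i (A # \<Gamma>) (?b A' C') (?b A C')" "teq i (A # \<Gamma>) (?b A C') (?b A C)"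
      by (auto simp: teq_def simp del: list.map)
    then show ?thesis
      by (rule teq_trans)
  qed
  with c' have "AT i (A # \<Gamma>) c' (?b A C)"
    by (rule AT_teq)
  note cc = good_cvD[OF cv eq(3) wf1 D(5) this]
  note xx = good_cvD[OF cv eq(4) wf D(6) AT_teq[OF D'(6) t]]
  note yy = good_cvD[OF cv eq(5) wf D(7) AT_teq[OF D'(7) t]]
  have "AT i \<Gamma> p' (XId k A x y)"
    using D'(8) teq_sym[OF jeq_imp_teq[OF jeq_Id[OF AA xx yy]]] by (rule AT_teq)
  note pp = good_cvD[OF cv eq(6) wf D(8) this]
  show ?thesis
    using jeq_J[OF AA CC cc xx yy pp] D(9) by (rule jeq_teq)
qed

lemma cv_lam_sound:
  assumes "AT i \<Gamma> (XLam k l A B s) T" "AT i \<Gamma> b T" "cv_lam cv k l A B s b"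
  shows "jeq i \<Gamma> (XLam k l A B s) b T"
  using assms by (cases b) (simp_all add: cv_lam_def etal_sound[OF cv wf] cvs_Lam split: if_splits)

lemma cv_tup_sound:
  assumes "AT i \<Gamma> (XTup S x y) T" "AT i \<Gamma> b T" "cv_tup cv S x y b"
  shows "jeq i \<Gamma> (XTup S x y) b T"
  using assms by (cases b) (simp_all add: cv_tup_def etas_sound[OF cv wf] cvs_Tup split: if_splits)

lemma cv_head_sound:
  assumes a: "AT i \<Gamma> a T" and b: "AT i \<Gamma> b T" and c: "cv_head cv a b"
  shows "jeq i \<Gamma> a b T"
proof (cases a)
  case (XPi k l A B)
  with c obtain k' l' A' B' where "b = XPi k' l' A' B'" "tpeq cv a b"
    by (auto simp: cv_head_def cv_pi_def split: ex.splits)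
  with XPi a b show ?thesis by (blast intro: cvs_PiSig)
next
  case (XSig k l A B)
  with c obtain k' l' A' B' where "b = XSig k' l' A' B'" "tpeq cv a b"
    by (auto simp: cv_head_def cv_sig_def split: ex.splits)
  with XSig a b show ?thesis by (blast intro: cvs_PiSig)
next
  case (XApp P f x)
  with c show ?thesis
    using a b by (cases b) (simp_all add: cv_head_def cv_app_def cvs_App split: if_splits)
next
  case (XP1 S p)
  with c show ?thesis
    using a b by (cases b) (simp_all add: cv_head_def cv_p1_def cvs_P1 split: if_splits)
next
  case (XP2 S p)
  with c show ?thesis
    using a b by (cases b) (simp_all add: cv_head_def cv_p2_def cvs_P2 split: if_splits)
next
  case (XId k A x y)
  with c show ?thesis
    using a b by (cases b) (simp_all add: cv_head_def cv_id_def cvs_Id split: if_splits)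
next
  case (XRf k A x)
  with c show ?thesis
    using a b by (cases b) (simp_all add: cv_head_def cv_rf_def cvs_Rf split: if_splits)
next
  case (XJ k l A C c' x y p)
  with c show ?thesis
    using a b by (cases b) (simp_all add: cv_head_def cv_j_def cvs_J split: if_splits)
next
  case (XEmI l C e)
  with c show ?thesis
    using a b by (cases b) (simp_all add: cv_head_def cv_emi_def cvs_EmI split: if_splits)
next
  case (XOnI l C c' e)
  with c show ?thesis
    using a b by (cases b) (simp_all add: cv_head_def cv_oni_def cvs_OnI split: if_splits)
next
  case (XTwI l C c' d e)
  with c show ?thesis
    using a b by (cases b) (simp_all add: cv_head_def cv_twi_def cvs_TwI split: if_splits)
next
  case (XC d as)
  with c show ?thesis
    using cvc_sound[OF cv wf a b] by (simp add: cv_head_def)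
qed (use c in \<open>simp_all add: cv_head_def\<close>)

lemma cv_right_sound:
  assumes "AT i \<Gamma> a T" "AT i \<Gamma> b T" "cv_right cv a b"
  shows "jeq i \<Gamma> a b T"
  using assms
  by (cases b) (simp_all add: cv_right_def jeq_sym[OF etal_sound[OF cv wf]] jeq_sym[OF etas_sound[OF cv wf]] cv_head_sound)

lemma cvs_sound:
  assumes "AT i \<Gamma> a T" "AT i \<Gamma> b T" "cvs cv a b"
  shows "jeq i \<Gamma> a b T"
proof (cases "a = b")
  case True
  then show ?thesis
    using assms wf by (simp add: jeq_refl)
next
  case False
  with assms show ?thesis
    by (cases a) (simp_all add: cvs_def cv_right_sound cv_lam_sound cv_tup_sound)
qed

end

text \<open>Reduction calls the comparison on annotations and the comparison calls reduction, always
  with less fuel; hence one induction for both.\<close>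

lemma whnf_conv_sound: "(\<forall>dl. good_wh i (whnf n dl)) \<and> good_cv i (conv n)"
proof (induct n)
  case 0
  show ?case
    by (simp add: good_wh_def good_cv_def jeq_refl)
next
  case (Suc n)
  then have w: "good_wh i (whnf n dl)" and cv: "good_cv i (conv n)" for dl
    by auto
  have "AT i \<Gamma> (whnf (Suc n) dl e) T \<and> jeq i \<Gamma> e (whnf (Suc n) dl e) T"
    if wf: "\<turnstile> ec i \<Gamma>" and e: "AT i \<Gamma> e T" for \<Gamma> e T dl
  proof -
    note IH = good_whD[OF w wf, of _ _ dl]
    show ?thesis
    proof (cases e)
      case (XC d as)
      show ?thesis
      proof (cases "dbody d")
        case (Some b)
        with unfold_sound[OF wf e[unfolded XC]] IH[of "xsubst b (args as)" T] show ?thesis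
          using e jeq_refl[OF e wf] by (auto simp: XC intro: jeq_trans)
      qed (use e jeq_refl[OF e wf] in \<open>simp add: XC\<close>)
    qed (use e jeq_refl[OF e wf] in \<open>simp_all add: IH wapp_sound[OF w cv wf] wp1_sound[OF w cv wf]
        wp2_sound[OF w cv wf] wj_sound[OF w cv wf] won_sound[OF w wf] wtw_sound[OF w wf]\<close>)
  qed
  moreover have "jeq i \<Gamma> a b T"
    if c: "conv (Suc n) a b" and wf: "\<turnstile> ec i \<Gamma>" and a: "AT i \<Gamma> a T" and b: "AT i \<Gamma> b T" for \<Gamma> a b T
  proof -
    note wF = good_whD[OF w wf, of _ _ False] and wT = good_whD[OF w wf, of _ _ True]
    define a' b' where "a' = whnf n False a" and "b' = whnf n False b"
    have a': "AT i \<Gamma> a' T" "jeq i \<Gamma> a a' T" and b': "AT i \<Gamma> b' T" "jeq i \<Gamma> b b' T"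
      using wF[OF a] wF[OF b] by (auto simp: a'_def b'_def)
    note a'' = wT[OF a'(1)] and b'' = wT[OF b'(1)]
    \<comment> \<open>The four ways in which the comparison can succeed, from the cheapest test to
      full unfolding.\<close>
    consider "a = b" | "a' = b'" | "cvc (conv n) a' b'" | "cvs (conv n) (whnf n True a') (whnf n True b')"
      using c by (auto simp: conv1_def a'_def b'_def split: if_splits)
    then show ?thesis
    proof cases
      case 1
      then show ?thesis using jeq_refl[OF a wf] by simp
    next
      case 2
      then show ?thesis using a'(2) b'(2) by (blast intro: jeq_trans jeq_sym)
    next
      case 3
      then show ?thesis using cvc_sound[OF cv wf a'(1) b'(1)] a'(2) b'(2) by (blast intro: jeq_trans jeq_sym)
    next
      case 4
      then show ?thesis
        using cvs_sound[OF cv wf a''[THEN conjunct1] b''[THEN conjunct1]] a'' b'' a'(2) b'(2)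
        by (blast intro: jeq_trans jeq_sym)
    qed
  qed
  ultimately show ?case
    by (auto simp: good_wh_def good_cv_def)
qed

lemma whnf_sound: "\<turnstile> ec i \<Gamma> \<Longrightarrow> AT i \<Gamma> e T \<Longrightarrow> AT i \<Gamma> (whnf n dl e) T \<and> jeq i \<Gamma> e (whnf n dl e) T"
  using whnf_conv_sound good_whD by blast

lemma conv_sound: "conv n a b \<Longrightarrow> \<turnstile> ec i \<Gamma> \<Longrightarrow> AT i \<Gamma> a T \<Longrightarrow> AT i \<Gamma> b T \<Longrightarrow> jeq i \<Gamma> a b T"
  using whnf_conv_sound good_cvD by blast

section \<open>Elaboration\<close>

text \<open>Variables of pre-terms are de Bruijn levels.  The arguments of a constant are listed in the
  order of its context, the last declared variable first.\<close>

datatype pre =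
    PV nat | PU nat
  | PPi pre pre | PLam pre pre | PApp pre pre
  | PSig pre pre | PTup pre pre | PP1 pre | PP2 pre
  | PId pre pre pre | PRf pre | PJ pre pre pre pre pre pre
  | PEm | PEmI pre pre
  | POn | PSt | POnI pre pre pre
  | PTw | PT0 | PT1 | PTwI pre pre pre pre
  | PC decl "pre list"

type_synonym cx = "(xt \<times> nat) list"

text \<open>Entries carry the universe of their type, so a variable is synthesized together with the
  level of its type.\<close>

inductive okc :: "nat \<Rightarrow> cx \<Rightarrow> bool" for i where
  okc_Nil: "okc i []"
| okc_Cons: "okc i \<Gamma> \<Longrightarrow> AT i (map fst \<Gamma>) A (XU k) \<Longrightarrow> okc i ((A, k) # \<Gamma>)"

inductive_cases okc_ConsE: "okc i ((A, k) # \<Gamma>)"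

text \<open>Everything \<open>AS_C\<close> asks of a declaration, at every base level. The
  elaborator tests this undecidable condition; evaluation answers the test with the theorem recorded
  when the declaration was made.\<close>

definition valid :: "decl \<Rightarrow> bool" where
  "valid d \<longleftrightarrow> (\<forall>i. okc i (dtele d) \<and> AT i (ctele d) (drty d) (XU (dlvl d)) \<and>
    ec i (ctele d) \<turnstile> draw d i \<^bold>: er i (drty d) \<and>
    (\<forall>b. dbody d = Some b \<longrightarrow> AT i (ctele d) b (drty d) \<and>
       ec i (ctele d) \<turnstile> draw d i \<doteq> er i b \<^bold>: er i (drty d)))"

text \<open>A uniform bound on the recursion depth of reduction and comparison that suffices for
  every declaration below.\<close>

definition fuel :: nat where
  "fuel = 40"

definition elT :: "(xt \<times> xt \<times> nat) option \<Rightarrow> (xt \<times> nat) option" where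
  "elT r = (case r of None \<Rightarrow> None | Some (A, T, l) \<Rightarrow> (case whnf fuel True T of XU k \<Rightarrow> Some (A, k) | _ \<Rightarrow> None))"

text \<open>\<open>m\<close> is the expected type in checking mode and \<open>None\<close> in
  synthesis. \<open>conv\<close> is sound only within one universe, hence the test of
  levels.\<close>

definition fin :: "(xt \<times> nat) option \<Rightarrow> xt \<Rightarrow> xt \<Rightarrow> nat \<Rightarrow> (xt \<times> xt \<times> nat) option" where
  "fin m e T l = (case m of None \<Rightarrow> Some (e, T, l) | Some (T0, l0) \<Rightarrow>
     if l = l0 then if conv fuel T T0 then Some (e, T0, l0) else None else None)"

text \<open>The tail is elaborated before the head, whose expected type is instantiated by it.
  Taking functions in place of pre-terms keeps \<open>el\<close> primitive recursive, through
  \<open>map\<close>.\<close>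

primrec ela :: "(cx \<Rightarrow> (xt \<times> nat) option \<Rightarrow> (xt \<times> xt \<times> nat) option) list \<Rightarrow> cx \<Rightarrow> cx \<Rightarrow> xt list option" where
  "ela [] \<Gamma> \<Delta> = (case \<Delta> of [] \<Rightarrow> Some [] | _ \<Rightarrow> None)"
| "ela (f # fs) \<Gamma> \<Delta> = (case \<Delta> of [] \<Rightarrow> None | D # \<Delta>' \<Rightarrow> (case ela fs \<Gamma> \<Delta>' of None \<Rightarrow> None | Some as \<Rightarrow>
     (case f \<Gamma> (Some (xsubst (fst D) (args as), snd D)) of None \<Rightarrow> None | Some (a, _, _) \<Rightarrow> Some (a # as))))"

text \<open>Bidirectional: pairs are only checked, abstractions are checked or synthesized, and all
  other terms are synthesized and compared with the expected type by \<open>fin\<close>. A checked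
  abstraction takes its codomain annotation from the expected type.\<close>

primrec el :: "pre \<Rightarrow> cx \<Rightarrow> (xt \<times> nat) option \<Rightarrow> (xt \<times> xt \<times> nat) option" where
  "el (PV v) \<Gamma> m = (if v < length \<Gamma> then
     fin m (XV (length \<Gamma> - Suc v)) (xlook (map fst \<Gamma>) (length \<Gamma> - Suc v)) (snd (\<Gamma> ! (length \<Gamma> - Suc v))) else None)"
| "el (PU k) \<Gamma> m = fin m (XU k) (XU (Suc k)) (Suc (Suc k))"
| "el (PPi A B) \<Gamma> m = (case elT (el A \<Gamma> None) of None \<Rightarrow> None | Some (A', k) \<Rightarrow>
     (case elT (el B ((A', k) # \<Gamma>) None) of None \<Rightarrow> None | Some (B', l) \<Rightarrow>
       fin m (XPi k l A' B') (XU (max k l)) (Suc (max k l))))"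
| "el (PLam A b) \<Gamma> m = (case elT (el A \<Gamma> None) of None \<Rightarrow> None | Some (A', k) \<Rightarrow> (case m of
      None \<Rightarrow> (case el b ((A', k) # \<Gamma>) None of None \<Rightarrow> None | Some (b', B', l) \<Rightarrow>
        Some (XLam k l A' B' b', XPi k l A' B', max k l))
    | Some (T, n) \<Rightarrow> (case whnf fuel True T of XPi k0 l0 A0 B0 \<Rightarrow>
        if k = k0 then if conv fuel A' A0 then
          (case el b ((A', k) # \<Gamma>) (Some (B0, l0)) of None \<Rightarrow> None | Some (b', _, _) \<Rightarrow>
            Some (XLam k l0 A' B0 b', T, n)) else None else None
      | _ \<Rightarrow> None)))"
| "el (PApp f a) \<Gamma> m = (case el f \<Gamma> None of None \<Rightarrow> None | Some (f', F, _) \<Rightarrow> (case whnf fuel True F of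
      XPi k l A B \<Rightarrow> (case el a \<Gamma> (Some (A, k)) of None \<Rightarrow> None | Some (a', _, _) \<Rightarrow>
        fin m (XApp (XPi k l A B) f' a') (xinst B a') l)
    | _ \<Rightarrow> None))"
| "el (PSig A B) \<Gamma> m = (case elT (el A \<Gamma> None) of None \<Rightarrow> None | Some (A', k) \<Rightarrow>
     (case elT (el B ((A', k) # \<Gamma>) None) of None \<Rightarrow> None | Some (B', l) \<Rightarrow>
       fin m (XSig k l A' B') (XU (max k l)) (Suc (max k l))))"
| "el (PTup a b) \<Gamma> m = (case m of None \<Rightarrow> None | Some (T, n) \<Rightarrow> (case whnf fuel True T of
      XSig k l A B \<Rightarrow> (case el a \<Gamma> (Some (A, k)) of None \<Rightarrow> None | Some (a', _, _) \<Rightarrow>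
        (case el b \<Gamma> (Some (xinst B a', l)) of None \<Rightarrow> None | Some (b', _, _) \<Rightarrow>
          Some (XTup (XSig k l A B) a' b', T, n)))
    | _ \<Rightarrow> None))"
| "el (PP1 p) \<Gamma> m = (case el p \<Gamma> None of None \<Rightarrow> None | Some (p', F, _) \<Rightarrow> (case whnf fuel True F of
      XSig k l A B \<Rightarrow> fin m (XP1 (XSig k l A B) p') A k | _ \<Rightarrow> None))"
| "el (PP2 p) \<Gamma> m = (case el p \<Gamma> None of None \<Rightarrow> None | Some (p', F, _) \<Rightarrow> (case whnf fuel True F of
      XSig k l A B \<Rightarrow> fin m (XP2 (XSig k l A B) p') (xinst B (XP1 (XSig k l A B) p')) l | _ \<Rightarrow> None))"
| "el (PId A a b) \<Gamma> m = (case elT (el A \<Gamma> None) of None \<Rightarrow> None | Some (A', k) \<Rightarrow>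
     (case el a \<Gamma> (Some (A', k)) of None \<Rightarrow> None | Some (a', _, _) \<Rightarrow>
     (case el b \<Gamma> (Some (A', k)) of None \<Rightarrow> None | Some (b', _, _) \<Rightarrow> fin m (XId k A' a' b') (XU k) (Suc k))))"
| "el (PRf a) \<Gamma> m = (case el a \<Gamma> None of None \<Rightarrow> None | Some (a', A', k) \<Rightarrow> fin m (XRf k A' a') (XId k A' a' a') k)"
| "el (PJ A C c a b p) \<Gamma> m = (case elT (el A \<Gamma> None) of None \<Rightarrow> None | Some (A', k) \<Rightarrow>
     (case elT (el C ((XId k (xlift (xlift A')) (XV (Suc 0)) (XV 0), k) # (xlift A', k) # (A', k) # \<Gamma>) None) of
       None \<Rightarrow> None | Some (C', l) \<Rightarrow>
     (case el c ((A', k) # \<Gamma>) (Some (xsubst C' (lk (XV \<circ> Suc) [XRf k (xlift A') (XV 0), XV 0, XV 0]), l)) of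
       None \<Rightarrow> None | Some (c', _, _) \<Rightarrow>
     (case el a \<Gamma> (Some (A', k)) of None \<Rightarrow> None | Some (a', _, _) \<Rightarrow>
     (case el b \<Gamma> (Some (A', k)) of None \<Rightarrow> None | Some (b', _, _) \<Rightarrow>
     (case el p \<Gamma> (Some (XId k A' a' b', k)) of None \<Rightarrow> None | Some (p', _, _) \<Rightarrow>
       fin m (XJ k l A' C' c' a' b' p') (xsubst C' (lk XV [p', b', a'])) l))))))"
| "el PEm \<Gamma> m = fin m XEm (XU 0) (Suc 0)"
| "el (PEmI C e) \<Gamma> m = (case elT (el C ((XEm, 0) # \<Gamma>) None) of None \<Rightarrow> None | Some (C', l) \<Rightarrow>
     (case el e \<Gamma> (Some (XEm, 0)) of None \<Rightarrow> None | Some (e', _, _) \<Rightarrow> fin m (XEmI l C' e') (xinst C' e') l))"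
| "el POn \<Gamma> m = fin m XOn (XU 0) (Suc 0)"
| "el PSt \<Gamma> m = fin m XSt XOn 0"
| "el (POnI C c e) \<Gamma> m = (case elT (el C ((XOn, 0) # \<Gamma>) None) of None \<Rightarrow> None | Some (C', l) \<Rightarrow>
     (case el c \<Gamma> (Some (xinst C' XSt, l)) of None \<Rightarrow> None | Some (c', _, _) \<Rightarrow>
     (case el e \<Gamma> (Some (XOn, 0)) of None \<Rightarrow> None | Some (e', _, _) \<Rightarrow> fin m (XOnI l C' c' e') (xinst C' e') l)))"
| "el PTw \<Gamma> m = fin m XTw (XU 0) (Suc 0)"
| "el PT0 \<Gamma> m = fin m XT0 XTw 0"
| "el PT1 \<Gamma> m = fin m XT1 XTw 0"
| "el (PTwI C c d e) \<Gamma> m = (case elT (el C ((XTw, 0) # \<Gamma>) None) of None \<Rightarrow> None | Some (C', l) \<Rightarrow>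
     (case el c \<Gamma> (Some (xinst C' XT0, l)) of None \<Rightarrow> None | Some (c', _, _) \<Rightarrow>
     (case el d \<Gamma> (Some (xinst C' XT1, l)) of None \<Rightarrow> None | Some (d', _, _) \<Rightarrow>
     (case el e \<Gamma> (Some (XTw, 0)) of None \<Rightarrow> None | Some (e', _, _) \<Rightarrow>
       fin m (XTwI l C' c' d' e') (xinst C' e') l))))"
| "el (PC d ps) \<Gamma> m = (if valid d then (case ela (map el ps) \<Gamma> (dtele d) of None \<Rightarrow> None | Some as \<Rightarrow>
     fin m (XC d as) (xsubst (drty d) (args as)) (dlvl d)) else None)"

abbreviation cxt :: "cx \<Rightarrow> xt list" where
  "cxt \<equiv> map fst"

section \<open>Soundness of elaboration\<close>

lemma okc_wf: "okc i \<Gamma> \<Longrightarrow> \<turnstile> ec i (cxt \<Gamma>)"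
proof (induct rule: okc.induct)
  case (okc_Cons \<Gamma> A k)
  then show ?case using wf_ext[of i "cxt \<Gamma>" A k] by simp
qed (simp add: ctx_nil)

definition okm :: "nat \<Rightarrow> cx \<Rightarrow> (xt \<times> nat) option \<Rightarrow> bool" where
  "okm i \<Gamma> m \<longleftrightarrow> (case m of None \<Rightarrow> True | Some (T, l) \<Rightarrow> AT i (cxt \<Gamma>) T (XU l))"

text \<open>In checking mode the expected type is returned unchanged, so a caller obtains the typing
  at exactly the type it asked for.\<close>

definition okr :: "nat \<Rightarrow> cx \<Rightarrow> (xt \<times> nat) option \<Rightarrow> xt \<times> xt \<times> nat \<Rightarrow> bool" where
  "okr i \<Gamma> m r \<longleftrightarrow> (case r of (e, T, l) \<Rightarrow> AT i (cxt \<Gamma>) e T \<and> AT i (cxt \<Gamma>) T (XU l) \<and>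
     (\<forall>T0 l0. m = Some (T0, l0) \<longrightarrow> T = T0 \<and> l = l0))"

definition okel :: "nat \<Rightarrow> (cx \<Rightarrow> (xt \<times> nat) option \<Rightarrow> (xt \<times> xt \<times> nat) option) \<Rightarrow> bool" where
  "okel i f \<longleftrightarrow> (\<forall>\<Gamma> m r. okc i \<Gamma> \<longrightarrow> okm i \<Gamma> m \<longrightarrow> f \<Gamma> m = Some r \<longrightarrow> okr i \<Gamma> m r)"

lemma okelD: "okel i f \<Longrightarrow> okc i \<Gamma> \<Longrightarrow> okm i \<Gamma> m \<Longrightarrow> f \<Gamma> m = Some r \<Longrightarrow> okr i \<Gamma> m r"
  unfolding okel_def by blast

lemma okel_inf: "okel i f \<Longrightarrow> okc i \<Gamma> \<Longrightarrow> f \<Gamma> None = Some (e, T, l) \<Longrightarrow> AT i (cxt \<Gamma>) e T \<and> AT i (cxt \<Gamma>) T (XU l)"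
  using okelD[of i f \<Gamma> None "(e, T, l)"] by (simp add: okm_def okr_def)

lemma okel_chk: "okel i f \<Longrightarrow> okc i \<Gamma> \<Longrightarrow> AT i (cxt \<Gamma>) T (XU l) \<Longrightarrow> f \<Gamma> (Some (T, l)) = Some (e, T', l') \<Longrightarrow>
  AT i (cxt \<Gamma>) e T"
  using okelD[of i f \<Gamma> "Some (T, l)" "(e, T', l')"] by (auto simp: okm_def okr_def)

lemma whnf_teq:
  assumes "okc i \<Gamma>" "AT i (cxt \<Gamma>) T (XU l)"
  shows "AT i (cxt \<Gamma>) (whnf n dl T) (XU l)" "teq i (cxt \<Gamma>) T (whnf n dl T)"
  using whnf_sound[OF okc_wf[OF assms(1)] assms(2)] by (auto dest: jeq_imp_teq)

lemma elT_ok: "okel i f \<Longrightarrow> okc i \<Gamma> \<Longrightarrow> elT (f \<Gamma> None) = Some (A, k) \<Longrightarrow> AT i (cxt \<Gamma>) A (XU k)"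
proof -
  assume *: "okel i f" "okc i \<Gamma>" "elT (f \<Gamma> None) = Some (A, k)"
  then obtain T l where f: "f \<Gamma> None = Some (A, T, l)" "whnf fuel True T = XU k"
    by (auto simp: elT_def split: option.splits prod.splits ex.splits)
  have A: "AT i (cxt \<Gamma>) A T" and T: "AT i (cxt \<Gamma>) T (XU l)"
    using okel_inf[OF *(1,2) f(1)] by blast+
  show ?thesis
    using AT_teq[OF A whnf_teq(2)[OF *(2) T, of fuel True]] f(2) by simp
qed

lemma whnf_Pi:
  assumes "okc i \<Gamma>" "AT i (cxt \<Gamma>) T (XU n)" "whnf fuel True T = XPi k l A B"
  shows "AT i (cxt \<Gamma>) A (XU k)" "AT i (A # cxt \<Gamma>) B (XU l)" "teq i (cxt \<Gamma>) T (XPi k l A B)"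
  using whnf_teq[OF assms(1,2), of fuel True] assms(3) by (auto elim: AT_E AS_Pi_E)

lemma whnf_Sig:
  assumes "okc i \<Gamma>" "AT i (cxt \<Gamma>) T (XU n)" "whnf fuel True T = XSig k l A B"
  shows "AT i (cxt \<Gamma>) A (XU k)" "AT i (A # cxt \<Gamma>) B (XU l)" "teq i (cxt \<Gamma>) T (XSig k l A B)"
  using whnf_teq[OF assms(1,2), of fuel True] assms(3) by (auto elim: AT_E AS_Sig_E)

lemma fin_ok:
  assumes "okc i \<Gamma>" "okm i \<Gamma> m" "AS i (cxt \<Gamma>) e T" "AT i (cxt \<Gamma>) T (XU l)" "fin m e T l = Some r"
  shows "okr i \<Gamma> m r"
proof (cases m)
  case None
  then show ?thesis
    using assms by (auto simp: fin_def okr_def intro: AS_AT)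
next
  case (Some M)
  then obtain T0 where m: "m = Some (T0, l)" "conv fuel T T0" "r = (e, T0, l)"
    using assms(5) by (cases M) (auto simp: fin_def split: if_splits)
  then have T0: "AT i (cxt \<Gamma>) T0 (XU l)"
    using assms(2) by (simp add: okm_def)
  then have "teq i (cxt \<Gamma>) T T0"
    using conv_sound[OF m(2) okc_wf[OF assms(1)] assms(4)] by (blast intro: jeq_imp_teq)
  then show ?thesis
    using assms(3) T0 m by (auto simp: okr_def intro: AT_I)
qed

lemma ela_ok:
  assumes \<Gamma>: "okc i \<Gamma>"
  shows "\<forall>f\<in>set fs. okel i f \<Longrightarrow> okc i \<Delta> \<Longrightarrow> ela fs \<Gamma> \<Delta> = Some as \<Longrightarrow> AL i (cxt \<Gamma>) as (cxt \<Delta>)"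
proof (induct fs arbitrary: \<Delta> as)
  case Nil
  then show ?case by (auto intro: AL_Nil split: list.splits)
next
  case (Cons f fs)
  then obtain A k \<Delta>' as' a T l where \<Delta>: "\<Delta> = (A, k) # \<Delta>'" and as: "as = a # as'" "ela fs \<Gamma> \<Delta>' = Some as'"
    and f: "f \<Gamma> (Some (xsubst A (args as'), k)) = Some (a, T, l)"
    by (auto split: list.splits option.splits)
  have \<Delta>': "okc i \<Delta>'" "AT i (cxt \<Delta>') A (XU k)"
    using Cons.prems(2) by (auto simp: \<Delta> elim: okc_ConsE)
  have AL: "AL i (cxt \<Gamma>) as' (cxt \<Delta>')"
    using Cons as \<Delta>' by auto
  have "AT i (cxt \<Gamma>) (xsubst A (args as')) (XU k)"
    using AT_xsubst[OF \<Delta>'(2) wsub_args[OF AL okc_wf[OF \<Gamma>]]] by simp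
  then have "AT i (cxt \<Gamma>) a (xsubst A (args as'))"
    using Cons.prems(1) f by (intro okel_chk[of i f \<Gamma> "xsubst A (args as')" k a T l]) (simp_all add: \<Gamma>)
  with AL show ?case
    by (simp add: \<Delta> as AL_Cons)
qed

lemma okelI: "(\<And>\<Gamma> m r. okc i \<Gamma> \<Longrightarrow> okm i \<Gamma> m \<Longrightarrow> f \<Gamma> m = Some r \<Longrightarrow> okr i \<Gamma> m r) \<Longrightarrow> okel i f"
  by (simp add: okel_def)

lemma okc_look:
  "okc i \<Gamma> \<Longrightarrow> k < length \<Gamma> \<Longrightarrow> AT i (cxt \<Gamma>) (xlook (cxt \<Gamma>) k) (XU (snd (\<Gamma> ! k)))"
proof (induct arbitrary: k rule: okc.induct)
  case (okc_Cons \<Gamma> A j)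
  have wf: "\<turnstile> ec i (A # cxt \<Gamma>)"
    using okc_wf[OF okc.okc_Cons[OF okc_Cons(1,3)]] by simp
  show ?case
  proof (cases k)
    case 0
    then show ?thesis
      using AT_lift[OF okc_Cons(3) wf] by simp
  next
    case (Suc k')
    then show ?thesis
      using AT_lift[OF okc_Cons(2)[of k'] wf] okc_Cons(4) by simp
  qed
qed simp

lemma XU_type: "AT i \<Gamma> (XU k) (XU (Suc k))"
  by (rule AS_AT[OF AS_U])

lemmas xtypes = XU_type AS_AT[OF AS_Em] AS_AT[OF AS_On] AS_AT[OF AS_Tw]

lemma okc_inst: "okc i \<Gamma> \<Longrightarrow> AT i (A # cxt \<Gamma>) B (XU l) \<Longrightarrow> AT i (cxt \<Gamma>) a A \<Longrightarrow> AT i (cxt \<Gamma>) (xinst B a) (XU l)"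
  using AT_inst[of i A "cxt \<Gamma>" B "XU l" a] okc_wf[of i \<Gamma>] by simp

lemma okr_Some: "AT i (cxt \<Gamma>) e T \<Longrightarrow> AT i (cxt \<Gamma>) T (XU n) \<Longrightarrow> okr i \<Gamma> (Some (T, n)) (e, T, n)"
  by (simp add: okr_def)

lemma okel_const:
  assumes "\<And>\<Gamma> m. el p \<Gamma> m = fin m e T l" "\<And>\<Gamma>. AS i \<Gamma> e T" "\<And>\<Gamma>. AT i \<Gamma> T (XU l)"
  shows "okel i (el p)"
  by (rule okelI) (simp add: assms(1) fin_ok[OF _ _ assms(2,3)])

lemma okel_Lam:
  assumes A: "okel i (el A)" and b: "okel i (el b)"
  shows "okel i (el (PLam A b))"
proof (rule okelI)
  fix \<Gamma> m r
  assume \<Gamma>: "okc i \<Gamma>" and m: "okm i \<Gamma> m" and r: "el (PLam A b) \<Gamma> m = Some r"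
  obtain A' k where A': "elT (el A \<Gamma> None) = Some (A', k)"
    using r by (auto split: option.splits)
  note TA = elT_ok[OF A \<Gamma> A']
  show "okr i \<Gamma> m r"
  proof (cases m)
    case None
    then obtain b' B' l where b': "el b ((A', k) # \<Gamma>) None = Some (b', B', l)"
      and r': "r = (XLam k l A' B' b', XPi k l A' B', max k l)"
      using r A' by (auto split: option.splits)
    have "AT i (A' # cxt \<Gamma>) b' B'" "AT i (A' # cxt \<Gamma>) B' (XU l)"
      using okel_inf[OF b okc_Cons[OF \<Gamma> TA] b'] by simp_all
    then show ?thesis
      using TA by (simp add: okr_def r' None AS_AT[OF AS_Lam] AS_AT[OF AS_Pi])
  next
    case (Some M)
    obtain T n where M: "m = Some (T, n)" by (cases M) (use Some in simp)
    have T: "AT i (cxt \<Gamma>) T (XU n)" using m by (simp add: okm_def M)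
    obtain k0 l0 A0 B0 where w: "whnf fuel True T = XPi k0 l0 A0 B0"
      using r A' by (auto simp: M split: ex.splits)
    obtain b' T' l' where b': "el b ((A', k) # \<Gamma>) (Some (B0, l0)) = Some (b', T', l')"
      and c: "k = k0" "conv fuel A' A0" and r': "r = (XLam k l0 A' B0 b', T, n)"
      using r A' w by (auto simp: M split: if_splits option.splits)
    note P = whnf_Pi[OF \<Gamma> T w, folded c(1)]
    have eq: "jeq i (cxt \<Gamma>) A' A0 (XU k)"
      by (rule conv_sound[OF c(2) okc_wf[OF \<Gamma>] TA P(1)])
    \<comment> \<open>The written domain \<open>A'\<close> and the expected domain \<open>A0\<close>
      are merely convertible: the expected codomain is moved over \<open>A'\<close>, and the two
      function types are identified afterwards.\<close>
    have B0: "AT i (A' # cxt \<Gamma>) B0 (XU l0)"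
      by (rule AT_conv_ctx[OF P(2) okc_wf[OF \<Gamma>] teq_sym[OF jeq_imp_teq[OF eq]] P(1) TA])
    have TP: "teq i (cxt \<Gamma>) (XPi k l0 A' B0) (XPi k l0 A0 B0)"
      using jeq_Pi[OF eq jeq_refl[OF B0]] wf_ext[OF okc_wf[OF \<Gamma>] TA] by (blast intro: jeq_imp_teq)
    have Tb: "AT i (A' # cxt \<Gamma>) b' B0"
      using okel_chk[OF b okc_Cons[OF \<Gamma> TA] _ b'] B0 by simp
    have "AT i (cxt \<Gamma>) (XLam k l0 A' B0 b') T"
      by (rule AT_I[OF AS_Lam[OF TA B0 Tb] teq_trans[OF TP teq_sym[OF P(3)]]])
    with T show ?thesis by (simp add: M r' okr_Some)
  qed
qed

lemma okel_Tup:
  assumes a: "okel i (el a)" and b: "okel i (el b)"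
  shows "okel i (el (PTup a b))"
proof (rule okelI)
  fix \<Gamma> m r
  assume \<Gamma>: "okc i \<Gamma>" and m: "okm i \<Gamma> m" and r: "el (PTup a b) \<Gamma> m = Some r"
  obtain T n where M: "m = Some (T, n)" using r by (auto split: option.splits)
  have T: "AT i (cxt \<Gamma>) T (XU n)" using m by (simp add: okm_def M)
  obtain k l A B where w: "whnf fuel True T = XSig k l A B"
    using r by (auto simp: M split: ex.splits)
  obtain a' Ta la where a': "el a \<Gamma> (Some (A, k)) = Some (a', Ta, la)"
    using r w by (auto simp: M split: option.splits)
  obtain b' Tb lb where b': "el b \<Gamma> (Some (xinst B a', l)) = Some (b', Tb, lb)"
      and r': "r = (XTup (XSig k l A B) a' b', T, n)"
    using r w a' by (auto simp: M split: option.splits)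
  note P = whnf_Sig[OF \<Gamma> T w]
  note a'' = okel_chk[OF a \<Gamma> P(1) a']
  note b'' = okel_chk[OF b \<Gamma> okc_inst[OF \<Gamma> P(2) a''] b']
  have "AT i (cxt \<Gamma>) (XTup (XSig k l A B) a' b') T"
    by (rule AT_I[OF AS_Tup[OF P(1,2) a'' b''] teq_sym[OF P(3)]])
  with T show "okr i \<Gamma> m r" by (simp add: M r' okr_Some)
qed

lemma okel_App:
  assumes f: "okel i (el f)" and a: "okel i (el a)"
  shows "okel i (el (PApp f a))"
proof (rule okelI)
  fix \<Gamma> m r
  assume \<Gamma>: "okc i \<Gamma>" and m: "okm i \<Gamma> m" and r: "el (PApp f a) \<Gamma> m = Some r"
  obtain f' F n where f': "el f \<Gamma> None = Some (f', F, n)" using r by (auto split: option.splits)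
  obtain k l A B where w: "whnf fuel True F = XPi k l A B"
    using r f' by (auto split: ex.splits)
  obtain a' Ta la where a': "el a \<Gamma> (Some (A, k)) = Some (a', Ta, la)"
      and r': "fin m (XApp (XPi k l A B) f' a') (xinst B a') l = Some r"
    using r w f' by (auto split: option.splits)
  note F = okel_inf[OF f \<Gamma> f']
  note P = whnf_Pi[OF \<Gamma> conjunct2[OF F] w]
  note a'' = okel_chk[OF a \<Gamma> P(1) a']
  show "okr i \<Gamma> m r"
    by (rule fin_ok[OF \<Gamma> m AS_App[OF P(1,2) AT_teq[OF conjunct1[OF F] P(3)] a''] okc_inst[OF \<Gamma> P(2) a''] r'])
qed

lemma okel_P:
  assumes p: "okel i (el p)"
  shows "okel i (el (PP1 p))" "okel i (el (PP2 p))"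
proof -
  have *: "okr i \<Gamma> m r" if \<Gamma>: "okc i \<Gamma>" and m: "okm i \<Gamma> m"
    and r: "el (PP1 p) \<Gamma> m = Some r \<or> el (PP2 p) \<Gamma> m = Some r" for \<Gamma> m r
  proof -
    obtain p' F n where p': "el p \<Gamma> None = Some (p', F, n)" using r by (auto split: option.splits)
    obtain k l A B where w: "whnf fuel True F = XSig k l A B"
      using r p' by (auto split: ex.splits)
    note F = okel_inf[OF p \<Gamma> p']
    note P = whnf_Sig[OF \<Gamma> conjunct2[OF F] w]
    note q = AT_teq[OF conjunct1[OF F] P(3)]
    note p1 = AS_P1[OF P(1,2) q]
    have "fin m (XP1 (XSig k l A B) p') A k = Some r \<or>
        fin m (XP2 (XSig k l A B) p') (xinst B (XP1 (XSig k l A B) p')) l = Some r"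
      using r p' w by simp
    then show ?thesis
    proof
      show ?thesis if "fin m (XP1 (XSig k l A B) p') A k = Some r"
        by (rule fin_ok[OF \<Gamma> m p1 P(1) that])
      show ?thesis if "fin m (XP2 (XSig k l A B) p') (xinst B (XP1 (XSig k l A B) p')) l = Some r"
        by (rule fin_ok[OF \<Gamma> m AS_P2[OF P(1,2) q] okc_inst[OF \<Gamma> P(2) AS_AT[OF p1]] that])
    qed
  qed
  show "okel i (el (PP1 p))" "okel i (el (PP2 p))"
    by (rule okelI, rule *, assumption+, blast)+
qed

lemma wsub_shift: "\<turnstile> ec i (A # \<Gamma>) \<Longrightarrow> wsub i (A # \<Gamma>) (XV \<circ> Suc) \<Gamma>"
proof -
  assume wf: "\<turnstile> ec i (A # \<Gamma>)"
  have "AT i (A # \<Gamma>) (XV (Suc k)) (xlift (xlook \<Gamma> k))" if "k < length \<Gamma>" for k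
    using AS_V[of "Suc k" "A # \<Gamma>" i] that by (simp add: AS_AT)
  with wf show ?thesis
    by (simp add: wsub_def flip: xren_eq_xsubst)
qed

lemma okc_wf_Cons:
  "okc i ((A, k) # \<Gamma>) \<Longrightarrow> \<turnstile> ec i (A # cxt \<Gamma>)"
  "okc i ((A, k) # (B, l) # \<Gamma>) \<Longrightarrow> \<turnstile> ec i (A # B # cxt \<Gamma>)"
  using okc_wf[of i "(A, k) # \<Gamma>"] okc_wf[of i "(A, k) # (B, l) # \<Gamma>"] by simp_all

lemma okel_J:
  assumes A: "okel i (el A)" and C: "okel i (el C)" and c: "okel i (el c)"
    and a: "okel i (el a)" and b: "okel i (el b)" and p: "okel i (el p)"
  shows "okel i (el (PJ A C c a b p))"
proof (rule okelI)
  fix \<Gamma> m r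
  assume \<Gamma>: "okc i \<Gamma>" and m: "okm i \<Gamma> m" and r: "el (PJ A C c a b p) \<Gamma> m = Some r"
  obtain A' k where A': "elT (el A \<Gamma> None) = Some (A', k)"
    using r by (auto split: option.splits)
  let ?E = "XId k (xlift (xlift A')) (XV (Suc 0)) (XV 0)"
  obtain C' l where C': "elT (el C ((?E, k) # (xlift A', k) # (A', k) # \<Gamma>) None) = Some (C', l)"
    using r A' by (auto split: option.splits)
  obtain c' Tc lc where c': "el c ((A', k) # \<Gamma>) (Some (xsubst C' (lk (XV \<circ> Suc) [XRf k (xlift A') (XV 0), XV 0, XV 0]), l)) =
      Some (c', Tc, lc)"
    using r A' C' by (auto split: option.splits)
  obtain a' Ta la where a': "el a \<Gamma> (Some (A', k)) = Some (a', Ta, la)"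
    using r A' C' c' by (auto split: option.splits)
  obtain b' Tb lb where b': "el b \<Gamma> (Some (A', k)) = Some (b', Tb, lb)"
    using r A' C' c' a' by (auto split: option.splits)
  obtain p' Tp lp where p': "el p \<Gamma> (Some (XId k A' a' b', k)) = Some (p', Tp, lp)"
    and r': "fin m (XJ k l A' C' c' a' b' p') (xsubst C' (lk XV [p', b', a'])) l = Some r"
    using r A' C' c' a' b' by (auto split: option.splits)
  note TA = elT_ok[OF A \<Gamma> A']
  note \<Gamma>1 = okc_Cons[OF \<Gamma> TA]
  note wf1 = okc_wf_Cons(1)[OF \<Gamma>1]
  note TA1 = AT_lift[OF TA wf1, unfolded xren.simps]
  note \<Gamma>2 = okc_Cons[OF \<Gamma>1, unfolded list.map fst_conv, OF TA1]
  note wf2 = okc_wf_Cons(2)[OF \<Gamma>2]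
  have TE: "AT i (xlift A' # A' # cxt \<Gamma>) ?E (XU k)"
    using AS_V[of 0 "xlift A' # A' # cxt \<Gamma>" i] AS_V[of "Suc 0" "xlift A' # A' # cxt \<Gamma>" i]
    by (intro AS_AT[OF AS_Id] AT_lift[OF TA1 wf2, unfolded xren.simps] AS_AT) simp_all
  note \<Gamma>3 = okc_Cons[OF \<Gamma>2, unfolded list.map fst_conv, OF TE]
  note TC = elT_ok[OF C \<Gamma>3 C', unfolded list.map fst_conv]
  have v0: "AT i (A' # cxt \<Gamma>) (XV 0) (xlift A')"
    using AS_V[of 0 "A' # cxt \<Gamma>" i] by (simp add: AS_AT)
  have "wsub i (A' # cxt \<Gamma>) (lk (XV \<circ> Suc) [XRf k (xlift A') (XV 0), XV 0, XV 0]) (?E # xlift A' # A' # cxt \<Gamma>)"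
    by (intro wsub_Cons; simp only: lk_nil wsub_shift[OF wf1] xsubst_xlift_lk xsubst.simps flip: xren_eq_xsubst)
       (simp_all add: v0 AS_AT[OF AS_Rf[OF TA1 v0]])
  note Tc = AT_xsubst[OF TC this, unfolded xsubst.simps]
  note Tc' = okel_chk[OF c \<Gamma>1, unfolded list.map fst_conv, OF Tc c']
  note Ta = okel_chk[OF a \<Gamma> TA a']
  note Tb = okel_chk[OF b \<Gamma> TA b']
  note Tp = okel_chk[OF p \<Gamma> AS_AT[OF AS_Id[OF TA Ta Tb]] p']
  note S = AS_J[OF TA TA1 TE TC Tc' Ta Tb Tp]
  note wsub_J[OF okc_wf[OF \<Gamma>] Ta Tb Tp]
  from AT_xsubst[OF TC this, unfolded xsubst.simps]
  show "okr i \<Gamma> m r"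
    by (rule fin_ok[OF \<Gamma> m S _ r'])
qed

lemma okel_el: "okel i (el p)"
proof (induct p)
  case (PV v)
  show ?case
  proof (rule okelI)
    fix \<Gamma> m r
    assume *: "okc i \<Gamma>" "okm i \<Gamma> m" "el (PV v) \<Gamma> m = Some r"
    then have k: "length \<Gamma> - Suc v < length \<Gamma>"
      and r: "fin m (XV (length \<Gamma> - Suc v)) (xlook (cxt \<Gamma>) (length \<Gamma> - Suc v)) (snd (\<Gamma> ! (length \<Gamma> - Suc v))) = Some r"
      by (auto split: if_splits)
    show "okr i \<Gamma> m r"
      by (rule fin_ok[OF *(1,2) AS_V okc_look[OF *(1) k] r]) (use k in simp)
  qed
next
  case (PU k)
  show ?case by (rule okel_const, rule el.simps, rule AS_U, rule XU_type)
next
  case (PPi A B)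
  show ?case
  proof (rule okelI)
    fix \<Gamma> m r
    assume *: "okc i \<Gamma>" "okm i \<Gamma> m" "el (PPi A B) \<Gamma> m = Some r"
    obtain A' k where A': "elT (el A \<Gamma> None) = Some (A', k)"
      using * by (auto split: option.splits)
    obtain B' l where B': "elT (el B ((A', k) # \<Gamma>) None) = Some (B', l)"
      and r: "fin m (XPi k l A' B') (XU (max k l)) (Suc (max k l)) = Some r"
      using * A' by (auto split: option.splits)
    note TA = elT_ok[OF PPi(1) *(1) A']
    note TB = elT_ok[OF PPi(2) okc_Cons[OF *(1) TA] B', unfolded list.map fst_conv]
    show "okr i \<Gamma> m r"
      by (rule fin_ok[OF *(1,2) AS_Pi[OF TA TB] XU_type r])
  qed
next
  case (PSig A B)
  show ?case
  proof (rule okelI)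
    fix \<Gamma> m r
    assume *: "okc i \<Gamma>" "okm i \<Gamma> m" "el (PSig A B) \<Gamma> m = Some r"
    obtain A' k where A': "elT (el A \<Gamma> None) = Some (A', k)"
      using * by (auto split: option.splits)
    obtain B' l where B': "elT (el B ((A', k) # \<Gamma>) None) = Some (B', l)"
      and r: "fin m (XSig k l A' B') (XU (max k l)) (Suc (max k l)) = Some r"
      using * A' by (auto split: option.splits)
    note TA = elT_ok[OF PSig(1) *(1) A']
    note TB = elT_ok[OF PSig(2) okc_Cons[OF *(1) TA] B', unfolded list.map fst_conv]
    show "okr i \<Gamma> m r"
      by (rule fin_ok[OF *(1,2) AS_Sig[OF TA TB] XU_type r])
  qed
next
  case (PId A a b)
  show ?case
  proof (rule okelI)
    fix \<Gamma> m r
    assume *: "okc i \<Gamma>" "okm i \<Gamma> m" "el (PId A a b) \<Gamma> m = Some r"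
    obtain A' k where A': "elT (el A \<Gamma> None) = Some (A', k)"
      using * by (auto split: option.splits)
    obtain a' Ta la where a': "el a \<Gamma> (Some (A', k)) = Some (a', Ta, la)"
      using * A' by (auto split: option.splits)
    obtain b' Tb lb where b': "el b \<Gamma> (Some (A', k)) = Some (b', Tb, lb)"
      and r: "fin m (XId k A' a' b') (XU k) (Suc k) = Some r"
      using * A' a' by (auto split: option.splits)
    note TA = elT_ok[OF PId(1) *(1) A']
    show "okr i \<Gamma> m r"
      by (rule fin_ok[OF *(1,2) AS_Id[OF TA okel_chk[OF PId(2) *(1) TA a'] okel_chk[OF PId(3) *(1) TA b']] XU_type r])
  qed
next
  case (PRf a)
  show ?case
  proof (rule okelI)
    fix \<Gamma> m r
    assume *: "okc i \<Gamma>" "okm i \<Gamma> m" "el (PRf a) \<Gamma> m = Some r"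
    obtain a' A' k where a': "el a \<Gamma> None = Some (a', A', k)"
      and r: "fin m (XRf k A' a') (XId k A' a' a') k = Some r"
      using * by (auto split: option.splits)
    have a: "AT i (cxt \<Gamma>) a' A'" and A: "AT i (cxt \<Gamma>) A' (XU k)"
      using okel_inf[OF PRf *(1) a'] by blast+
    show "okr i \<Gamma> m r"
      by (rule fin_ok[OF *(1,2) AS_Rf[OF A a] AS_AT[OF AS_Id[OF A a a]] r])
  qed
next
  case (PEmI C e)
  show ?case
  proof (rule okelI)
    fix \<Gamma> m r
    assume *: "okc i \<Gamma>" "okm i \<Gamma> m" "el (PEmI C e) \<Gamma> m = Some r"
    obtain C' l where C': "elT (el C ((XEm, 0) # \<Gamma>) None) = Some (C', l)"
      using * by (auto split: option.splits)
    obtain e' Te le where e': "el e \<Gamma> (Some (XEm, 0)) = Some (e', Te, le)"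
      and r: "fin m (XEmI l C' e') (xinst C' e') l = Some r"
      using * C' by (auto split: option.splits)
    note TC = elT_ok[OF PEmI(1) okc_Cons[OF *(1) xtypes(2)] C', unfolded list.map fst_conv]
    note Te = okel_chk[OF PEmI(2) *(1) xtypes(2) e']
    show "okr i \<Gamma> m r"
      by (rule fin_ok[OF *(1,2) AS_EmI[OF TC Te] okc_inst[OF *(1) TC Te] r])
  qed
next
  case (POnI C c e)
  show ?case
  proof (rule okelI)
    fix \<Gamma> m r
    assume *: "okc i \<Gamma>" "okm i \<Gamma> m" "el (POnI C c e) \<Gamma> m = Some r"
    obtain C' l where C': "elT (el C ((XOn, 0) # \<Gamma>) None) = Some (C', l)"
      using * by (auto split: option.splits)
    obtain c' Tc lc where c': "el c \<Gamma> (Some (xinst C' XSt, l)) = Some (c', Tc, lc)"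
      using * C' by (auto split: option.splits)
    obtain e' Te le where e': "el e \<Gamma> (Some (XOn, 0)) = Some (e', Te, le)"
      and r: "fin m (XOnI l C' c' e') (xinst C' e') l = Some r"
      using * C' c' by (auto split: option.splits)
    note TC = elT_ok[OF POnI(1) okc_Cons[OF *(1) xtypes(3)] C', unfolded list.map fst_conv]
    note Tc = okel_chk[OF POnI(2) *(1) okc_inst[OF *(1) TC AS_AT[OF AS_St]] c']
    note Te = okel_chk[OF POnI(3) *(1) xtypes(3) e']
    show "okr i \<Gamma> m r"
      by (rule fin_ok[OF *(1,2) AS_OnI[OF TC Tc Te] okc_inst[OF *(1) TC Te] r])
  qed
next
  case (PTwI C c d e)
  show ?case
  proof (rule okelI)
    fix \<Gamma> m r
    assume *: "okc i \<Gamma>" "okm i \<Gamma> m" "el (PTwI C c d e) \<Gamma> m = Some r"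
    obtain C' l where C': "elT (el C ((XTw, 0) # \<Gamma>) None) = Some (C', l)"
      using * by (auto split: option.splits)
    obtain c' Tc lc where c': "el c \<Gamma> (Some (xinst C' XT0, l)) = Some (c', Tc, lc)"
      using * C' by (auto split: option.splits)
    obtain d' Td ld where d': "el d \<Gamma> (Some (xinst C' XT1, l)) = Some (d', Td, ld)"
      using * C' c' by (auto split: option.splits)
    obtain e' Te le where e': "el e \<Gamma> (Some (XTw, 0)) = Some (e', Te, le)"
      and r: "fin m (XTwI l C' c' d' e') (xinst C' e') l = Some r"
      using * C' c' d' by (auto split: option.splits)
    note TC = elT_ok[OF PTwI(1) okc_Cons[OF *(1) xtypes(4)] C', unfolded list.map fst_conv]
    note Tc = okel_chk[OF PTwI(2) *(1) okc_inst[OF *(1) TC AS_AT[OF AS_T0]] c']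
    note Td = okel_chk[OF PTwI(3) *(1) okc_inst[OF *(1) TC AS_AT[OF AS_T1]] d']
    note Te = okel_chk[OF PTwI(4) *(1) xtypes(4) e']
    show "okr i \<Gamma> m r"
      by (rule fin_ok[OF *(1,2) AS_TwI[OF TC Tc Td Te] okc_inst[OF *(1) TC Te] r])
  qed
next
  case (PC d ps)
  show ?case
  proof (rule okelI)
    fix \<Gamma> m r
    assume *: "okc i \<Gamma>" "okm i \<Gamma> m" "el (PC d ps) \<Gamma> m = Some r"
    then obtain as where d: "valid d" and as: "ela (map el ps) \<Gamma> (dtele d) = Some as"
      and r: "fin m (XC d as) (xsubst (drty d) (args as)) (dlvl d) = Some r"
      by (auto split: if_splits option.splits)
    have v: "okc i (dtele d)" "AT i (ctele d) (drty d) (XU (dlvl d))"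
      "ec i (ctele d) \<turnstile> draw d i \<^bold>: er i (drty d)"
      "\<forall>b. dbody d = Some b \<longrightarrow> AT i (ctele d) b (drty d) \<and>
         ec i (ctele d) \<turnstile> draw d i \<doteq> er i b \<^bold>: er i (drty d)"
      using d by (simp_all add: valid_def)
    have AL: "AL i (cxt \<Gamma>) as (ctele d)"
      by (rule ela_ok[OF *(1) _ v(1) as]) (use PC in auto)
    have "AT i (cxt \<Gamma>) (xsubst (drty d) (args as)) (XU (dlvl d))"
      using AT_xsubst[OF v(2) wsub_args[OF AL okc_wf[OF *(1)]]] by simp
    then show "okr i \<Gamma> m r"
      by (rule fin_ok[OF *(1,2) AS_C[OF AL okc_wf[OF v(1)] v(3,4)] _ r])
  qed
next
  case PEm
  show ?case by (rule okel_const, rule el.simps, rule AS_Em, rule XU_type)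
next
  case POn
  show ?case by (rule okel_const, rule el.simps, rule AS_On, rule XU_type)
next
  case PTw
  show ?case by (rule okel_const, rule el.simps, rule AS_Tw, rule XU_type)
next
  case PSt
  show ?case by (rule okel_const, rule el.simps, rule AS_St, rule xtypes)
next
  case PT0
  show ?case by (rule okel_const, rule el.simps, rule AS_T0, rule xtypes)
next
  case PT1
  show ?case by (rule okel_const, rule el.simps, rule AS_T1, rule xtypes)
qed (blast intro: okel_Lam okel_Tup okel_App okel_P okel_J)+

section \<open>Declarations\<close>

datatype sg = SPar pre sg | SEnd pre "pre option"

primrec els :: "sg \<Rightarrow> cx \<Rightarrow> (cx \<times> xt \<times> nat \<times> xt option) option" where
  "els (SPar A s) \<Gamma> = (case elT (el A \<Gamma> None) of None \<Rightarrow> None | Some (A', k) \<Rightarrow> els s ((A', k) # \<Gamma>))"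
| "els (SEnd R b) \<Gamma> = (case elT (el R \<Gamma> None) of None \<Rightarrow> None | Some (R', l) \<Rightarrow> (case b of
      None \<Rightarrow> Some (\<Gamma>, R', l, None)
    | Some e \<Rightarrow> (case el e \<Gamma> (Some (R', l)) of None \<Rightarrow> None | Some (b', _, _) \<Rightarrow> Some (\<Gamma>, R', l, Some b'))))"

lemma els_sound:
  "els s \<Gamma> = Some (\<Delta>, R, l, b) \<Longrightarrow> okc i \<Gamma> \<Longrightarrow>
    okc i \<Delta> \<and> AT i (cxt \<Delta>) R (XU l) \<and> (\<forall>b'. b = Some b' \<longrightarrow> AT i (cxt \<Delta>) b' R)"
proof (induct s arbitrary: \<Gamma>)
  case (SPar A s)
  then obtain A' k where A: "elT (el A \<Gamma> None) = Some (A', k)" and s: "els s ((A', k) # \<Gamma>) = Some (\<Delta>, R, l, b)"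
    by (auto split: option.splits)
  show ?case
    by (rule SPar(1)[OF s okc_Cons[OF SPar(3) elT_ok[OF okel_el SPar(3) A]]])
next
  case (SEnd S e)
  then obtain R' l' where R': "elT (el S \<Gamma> None) = Some (R', l')"
    by (auto split: option.splits)
  note TR = elT_ok[OF okel_el SEnd(2) R']
  show ?case
  proof (cases e)
    case None
    then show ?thesis using SEnd R' TR by auto
  next
    case (Some e')
    then obtain b' T n where b': "el e' \<Gamma> (Some (R', l')) = Some (b', T, n)"
      and eq: "\<Delta> = \<Gamma>" "R = R'" "l = l'" "b = Some b'"
      using SEnd R' by (auto split: option.splits)
    show ?thesis
      using okel_chk[OF okel_el SEnd(2) TR b'] SEnd(2) TR by (simp add: eq)
  qed
qed

section \<open>Iterated application and abstraction\<close>

text \<open>The last argument comes first, as in contexts, so \<open>apl t (vars n)\<close> applies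
  \<open>t\<close> to the variables of a context of length \<open>n\<close> from the oldest to the
  newest.\<close>

primrec apl :: "tm \<Rightarrow> tm list \<Rightarrow> tm" where
  "apl t [] = t"
| "apl t (a # as) = App (apl t as) a"

abbreviation vars :: "nat \<Rightarrow> tm list" where
  "vars n \<equiv> map Var [0..<n]"

primrec lams :: "tm list \<Rightarrow> tm \<Rightarrow> tm" where
  "lams [] b = b"
| "lams (A # \<Gamma>) b = lams \<Gamma> (Lam A b)"

primrec pis :: "tm list \<Rightarrow> tm \<Rightarrow> tm" where
  "pis [] R = R"
| "pis (A # \<Gamma>) R = pis \<Gamma> (Pi A R)"

lemma ty_lams: "\<Gamma> \<turnstile> b \<^bold>: R \<Longrightarrow> [] \<turnstile> lams \<Gamma> b \<^bold>: pis \<Gamma> R"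
  by (induct \<Gamma> arbitrary: b R) (simp_all add: ty_Lam)

lemma subst_apl: "subst (apl t as) \<sigma> = apl (subst t \<sigma>) (map (\<lambda>a. subst a \<sigma>) as)"
  by (induct as) simp_all

lemma vars_Suc: "vars (Suc n) = Var 0 # map lift (vars n)"
  by (simp add: map_upt_Suc o_def del: upt_Suc)

lemma inst_lift: "(ren t (up_ren Suc))\<lbrakk>Var 0\<rbrakk> = t"
proof -
  have "(Var 0 ## Var) \<circ> up_ren Suc = Var"
    by (rule ext, case_tac x) simp_all
  then show ?thesis
    by (simp add: subst_ren subst_Var)
qed

lemma apl_lift: "[] \<turnstile> t \<^bold>: T \<Longrightarrow> lift (apl t (vars n)) = apl t (map lift (vars n))"
  by (simp add: ren_eq_subst subst_apl closed_subst o_def)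

lemma ty_apl: "[] \<turnstile> t \<^bold>: pis \<Gamma> R \<Longrightarrow> \<turnstile> \<Gamma> \<Longrightarrow> \<Gamma> \<turnstile> apl t (vars (length \<Gamma>)) \<^bold>: R"
proof (induct \<Gamma> arbitrary: R)
  case (Cons A \<Gamma>)
  have wf: "\<turnstile> \<Gamma>"
    using Cons(3) by (rule wf_ctx_Cons)
  have "\<Gamma> \<turnstile> apl t (vars (length \<Gamma>)) \<^bold>: Pi A R"
    using Cons(1)[of "Pi A R"] Cons(2) wf by simp
  from ty_lift[OF this Cons(3)]
  have "A # \<Gamma> \<turnstile> apl t (map lift (vars (length \<Gamma>))) \<^bold>: Pi (lift A) (ren R (up_ren Suc))"
    by (simp only: apl_lift[OF Cons(2)] ren.simps)
  moreover have "A # \<Gamma> \<turnstile> Var 0 \<^bold>: lift A"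
    using ty_look[OF Cons(3), of 0] by simp
  ultimately show ?case
    using ty_App[of "A # \<Gamma>" _ "lift A" "ren R (up_ren Suc)" "Var 0"] by (simp only: length_Cons vars_Suc apl.simps inst_lift)
qed simp

text \<open>Iterated beta against the variables of the context itself. It makes unfolding a
  \<open>lamd\<close> constant to its body legitimate, although the constant stands for an
  application of a closed function.\<close>

lemma apl_lams: "\<Gamma> \<turnstile> b \<^bold>: R \<Longrightarrow> \<turnstile> \<Gamma> \<Longrightarrow> \<Gamma> \<turnstile> apl (lams \<Gamma> b) (vars (length \<Gamma>)) \<doteq> b \<^bold>: R"
proof (induct \<Gamma> arbitrary: b R)
  case (Cons A \<Gamma>)
  have wf: "\<turnstile> \<Gamma>"
    using Cons(3) by (rule wf_ctx_Cons)
  note lam = ty_Lam[OF Cons(2)]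
  from eq_lift[OF Cons(1)[OF lam wf] Cons(3)]
  have "A # \<Gamma> \<turnstile> apl (lams (A # \<Gamma>) b) (map lift (vars (length \<Gamma>))) \<doteq> lift (Lam A b) \<^bold>: Pi (lift A) (ren R (up_ren Suc))"
    by (simp only: apl_lift[OF ty_lams[OF lam]] ren.simps lams.simps)
  moreover have v: "A # \<Gamma> \<turnstile> Var 0 \<^bold>: lift A"
    using ty_look[OF Cons(3), of 0] by simp
  ultimately have "A # \<Gamma> \<turnstile> apl (lams (A # \<Gamma>) b) (vars (length (A # \<Gamma>))) \<doteq> App (lift (Lam A b)) (Var 0) \<^bold>: R"
    using eq_App[of "A # \<Gamma>" _ _ "lift A" "ren R (up_ren Suc)" "Var 0" "Var 0"]
    by (simp only: length_Cons vars_Suc apl.simps inst_lift eq_refl)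
  moreover have wf2: "\<turnstile> lift A # A # \<Gamma>"
  proof -
    obtain k where "\<Gamma> \<turnstile> A \<^bold>: Uni k"
      using Cons(3) by (rule wf_ctx_Cons)
    from ty_lift[OF this Cons(3)] show ?thesis
      using Cons(3) by (auto intro: ctx_cons)
  qed
  \<comment> \<open>The abstraction is weakened before it meets the new variable, so the beta rule
    needs its body over the weakened domain.\<close>
  have "lift A # A # \<Gamma> \<turnstile> ren b (up_ren Suc) \<^bold>: ren R (up_ren Suc)"
    unfolding ren_eq_subst[of _ "up_ren Suc"]
  proof (rule ty_subst_look[OF Cons(2) wf2])
    fix k
    assume "k < length (A # \<Gamma>)"
    then show "lift A # A # \<Gamma> \<turnstile> (Var \<circ> up_ren Suc) k \<^bold>: subst (look (A # \<Gamma>) k) (Var \<circ> up_ren Suc)"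
      using ty_look[OF wf2, of 0] ty_look[OF wf2, of "Suc k"]
      by (cases k) (simp_all add: ren_ren up_ren_Suc flip: ren_eq_subst)
  qed
  from eq_Pi_beta[OF this v] have "A # \<Gamma> \<turnstile> App (lift (Lam A b)) (Var 0) \<doteq> b \<^bold>: R"
    by (simp only: inst_lift ren.simps)
  ultimately show ?case
    by (blast intro: eq_trans)
qed (simp add: eq_refl)

text \<open>Notions that \<open>Defs\<close> introduces as closed functions of the object language are declared by \<open>lamd\<close>, so that
  they erase to applications of these functions.  Notions that are HOL functions on expressions in \<open>Defs\<close> are declared
  by \<open>transp\<close>, whose erasure substitutes into the body.  The checker never unfolds an \<open>opaq\<close> constant.\<close>

definition transp :: "nat \<Rightarrow> sg \<Rightarrow> decl" where
  "transp n s = (case els s [] of Some (\<Gamma>, R, l, Some b) \<Rightarrow> Decl n (\<lambda>i. er i b) \<Gamma> R l (Some b) | _ \<Rightarrow> undefined)"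

definition opaq :: "nat \<Rightarrow> sg \<Rightarrow> decl" where
  "opaq n s = (case els s [] of Some (\<Gamma>, R, l, Some b) \<Rightarrow> Decl n (\<lambda>i. er i b) \<Gamma> R l None | _ \<Rightarrow> undefined)"

definition lamd :: "nat \<Rightarrow> sg \<Rightarrow> decl" where
  "lamd n s = (case els s [] of Some (\<Gamma>, R, l, Some b) \<Rightarrow>
     Decl n (\<lambda>i. apl (lams (ec i (cxt \<Gamma>)) (er i b)) (vars (length \<Gamma>))) \<Gamma> R l (Some b) | _ \<Rightarrow> undefined)"

definition postul :: "nat \<Rightarrow> (nat \<Rightarrow> tm) \<Rightarrow> sg \<Rightarrow> decl" where
  "postul n t s = (case els s [] of Some (\<Gamma>, R, l, None) \<Rightarrow>
     Decl n (\<lambda>i. apl (t i) (vars (length \<Gamma>))) \<Gamma> R l None | _ \<Rightarrow> undefined)"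

definition clo :: "decl \<Rightarrow> nat \<Rightarrow> tm" where
  "clo d i = lams (ec i (ctele d)) (er i (the (dbody d)))"

definition sig_of :: "decl \<Rightarrow> nat \<Rightarrow> cx \<Rightarrow> xt \<Rightarrow> nat \<Rightarrow> xt option \<Rightarrow> bool" where
  "sig_of d n \<Gamma> R l b \<longleftrightarrow> valid d \<and> dno d = n \<and> dtele d = \<Gamma> \<and> drty d = R \<and> dlvl d = l \<and> dbody d = b"

lemma transp_sig:
  assumes "els s [] = Some (\<Gamma>, R, l, Some b)"
  shows "sig_of (transp n s) n \<Gamma> R l (Some b) \<and> (\<forall>i as. er i (XC (transp n s) as) = er i (xsubst b (args as)))"
proof -
  have "ec i (cxt \<Gamma>) \<turnstile> er i b \<^bold>: er i R" "okc i \<Gamma>" "AT i (cxt \<Gamma>) R (XU l)" "AT i (cxt \<Gamma>) b R" for i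
    using els_sound[OF assms okc_Nil, of i] AT_sound(2)[of i "cxt \<Gamma>" b R] okc_wf[of i \<Gamma>] by auto
  with assms show ?thesis
    by (simp add: sig_of_def transp_def valid_def eq_refl er_xsubst er_args)
qed

lemma opaq_sig:
  assumes "els s [] = Some (\<Gamma>, R, l, Some b)"
  shows "sig_of (opaq n s) n \<Gamma> R l None"
proof -
  have "ec i (cxt \<Gamma>) \<turnstile> er i b \<^bold>: er i R" "okc i \<Gamma>" "AT i (cxt \<Gamma>) R (XU l)" for i
    using els_sound[OF assms okc_Nil, of i] AT_sound(2)[of i "cxt \<Gamma>" b R] okc_wf[of i \<Gamma>] by auto
  with assms show ?thesis
    by (simp add: sig_of_def opaq_def valid_def)
qed

text \<open>As \<open>t\<close> is closed, the arguments replace exactly the listed variables; a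
  declared notion thus erases to the closed function applied to its arguments.\<close>

lemma er_apl:
  assumes "[] \<turnstile> t \<^bold>: T" "length as = n"
  shows "subst (apl t (vars n)) (lk z as) = apl t as"
proof -
  have "map (lk z as) [0..<length as] = as"
    by (induct as) (simp_all add: map_upt_Suc del: upt_Suc)
  then show ?thesis
    using assms by (simp add: subst_apl closed_subst o_def)
qed

lemma lamd_sig:
  assumes "els s [] = Some (\<Gamma>, R, l, Some b)"
  shows "sig_of (lamd n s) n \<Gamma> R l (Some b) \<and>
    (\<forall>i as. length as = length \<Gamma> \<longrightarrow> er i (XC (lamd n s) as) = apl (clo (lamd n s) i) (ec i as))"
proof -
  have *: "ec i (cxt \<Gamma>) \<turnstile> er i b \<^bold>: er i R" "okc i \<Gamma>" "AT i (cxt \<Gamma>) R (XU l)" "AT i (cxt \<Gamma>) b R" "\<turnstile> ec i (cxt \<Gamma>)" for i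
    using els_sound[OF assms okc_Nil, of i] AT_sound(2)[of i "cxt \<Gamma>" b R] okc_wf[of i \<Gamma>] by auto
  note l = ty_lams[OF *(1)]
  show ?thesis
    using assms * ty_apl[OF l *(5)] apl_lams[OF *(1,5)] er_apl[OF l]
    by (simp add: sig_of_def lamd_def valid_def clo_def o_def)
qed

lemma postul_sig:
  assumes "els s [] = Some (\<Gamma>, R, l, None)" "\<And>i. [] \<turnstile> t i \<^bold>: pis (ec i (cxt \<Gamma>)) (er i R)"
  shows "sig_of (postul n t s) n \<Gamma> R l None \<and>
    (\<forall>i as. length as = length \<Gamma> \<longrightarrow> er i (XC (postul n t s) as) = apl (t i) (ec i as))"
proof -
  have *: "okc i \<Gamma>" "AT i (cxt \<Gamma>) R (XU l)" "\<turnstile> ec i (cxt \<Gamma>)" for i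
    using els_sound[OF assms(1) okc_Nil, of i] okc_wf[of i \<Gamma>] by auto
  show ?thesis
    using assms * ty_apl[OF assms(2) *(3)] er_apl[OF assms(2)]
    by (simp add: sig_of_def postul_def valid_def o_def)
qed

section \<open>Evaluation\<close>

text \<open>The checker is run by the simplifier.  The simplifier does not visit again the instances of the
  variables on the right-hand side of a rule, which are in normal form already; this is lost for rules about
  constants with a weak congruence rule, such as \<open>if\<close> and \<open>case\<close>.  The equations below therefore
  only use functions that are strict in data, and branches are delayed by partial application.\<close>

named_theorems ev

text \<open>The shift by \<open>d\<close> that spares the \<open>c\<close> innermost variables. The
  renamings that arise are encoded by two numbers, so that no composed functions build up during
  evaluation.\<close>

primrec shr :: "nat \<Rightarrow> nat \<Rightarrow> nat \<Rightarrow> nat" where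
  "shr d 0 = (\<lambda>k. d + k)"
| "shr d (Suc c) = up_ren (shr d c)"

definition xsh :: "nat \<Rightarrow> xt \<Rightarrow> nat \<Rightarrow> xt" where
  "xsh d t c = xren t (shr d c)"

primrec xshl :: "nat \<Rightarrow> xt list \<Rightarrow> nat \<Rightarrow> xt list" where
  "xshl d [] c = []"
| "xshl d (a # as) c = xsh d a c # xshl d as c"

primrec xups :: "(nat \<Rightarrow> xt) \<Rightarrow> nat \<Rightarrow> nat \<Rightarrow> xt" where
  "xups f 0 = f"
| "xups f (Suc d) = xup (xups f d)"

definition xsb :: "(nat \<Rightarrow> xt) \<Rightarrow> xt \<Rightarrow> nat \<Rightarrow> xt" where
  "xsb f t d = xsubst t (xups f d)"

primrec xsbl :: "(nat \<Rightarrow> xt) \<Rightarrow> xt list \<Rightarrow> nat \<Rightarrow> xt list" where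
  "xsbl f [] d = []"
| "xsbl f (a # as) d = xsb f a d # xsbl f as d"

text \<open>The value of a substitution below binders at a variable: \<open>e\<close> counts the
  binders still to be stripped, while \<open>d\<close> and \<open>k0\<close> remember their total
  number and the original index. One shift by \<open>d\<close> replaces \<open>d\<close> single
  weakenings.\<close>

fun xvs :: "(nat \<Rightarrow> xt) \<Rightarrow> nat \<Rightarrow> nat \<Rightarrow> nat \<Rightarrow> nat \<Rightarrow> xt" where
  "xvs f k 0 d k0 = xsh d (f k) 0"
| "xvs f 0 (Suc e) d k0 = XV k0"
| "xvs f (Suc k) (Suc e) d k0 = xvs f k e d k0"

lemma map_xren: "map (\<lambda>a. xren a (shr d c)) as = xshl d as c"
  by (induct as) (simp_all add: xsh_def)

lemma map_xsubst: "map (\<lambda>a. xsubst a (xups f d)) as = xsbl f as d"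
  by (induct as) (simp_all add: xsb_def)

lemma xsh_0: "xsh 0 t 0 = t"
proof -
  have "XV \<circ> (\<lambda>k. k) = (XV :: nat \<Rightarrow> xt)" by auto
  then show ?thesis by (simp add: xsh_def xren_eq_xsubst xsubst_XV)
qed

text \<open>The offset \<open>j\<close> counts the binders already stripped; the induction adds one
  to it at each step.\<close>

lemma xvs: "xvs f k e (e + j) (k + j) = xsh j (xups f e k) 0"
proof (induct e arbitrary: j k)
  case (Suc e)
  show ?case
  proof (cases k)
    case 0
    then show ?thesis by (simp add: xsh_def)
  next
    case (Suc k')
    have "shr j 0 \<circ> Suc = shr (Suc j) 0" by auto
    with Suc.hyps[of k' "Suc j"] Suc show ?thesis by (simp add: xsh_def xren_xren)
  qed
qed simp

lemma xups_xvs: "xups f d k = xvs f k d d k"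
  using xvs[of f k d 0] by (simp add: xsh_0)

lemma xren_Suc: "xlift t = xsh (Suc 0) t 0"
proof -
  have "shr (Suc 0) 0 = Suc" by auto
  then show ?thesis by (simp add: xsh_def)
qed

lemma xren_up_Suc: "xren t (up_ren Suc) = xsh (Suc 0) t (Suc 0)"
proof -
  have "shr (Suc 0) 0 = Suc" by auto
  then show ?thesis by (simp add: xsh_def)
qed

lemma xsubst_lk: "xsubst t (lk z as) = xsb (lk z as) t 0"
  by (simp add: xsb_def)

lemmas xsh_eqs = xren.simps[where 'd = decl and \<rho> = "shr d c" for d c, unfolded map_xren, folded shr.simps(2), folded xsh_def]

lemmas xsb_eqs = xsubst.simps[where \<sigma> = "xups f d" for f d, unfolded map_xsubst, folded xups.simps(2), folded xsb_def, unfolded xups_xvs]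

text \<open>The weakenings of a lookup are counted in \<open>s\<close> and carried out as a single
  shift.\<close>

primrec xlk :: "xt list \<Rightarrow> nat \<Rightarrow> nat \<Rightarrow> xt" where
  "xlk [] k s = XOn"
| "xlk (A # \<Gamma>) k s = (case k of 0 \<Rightarrow> xsh (Suc s) A 0 | Suc j \<Rightarrow> xlk \<Gamma> j (Suc s))"

lemma xlk: "xlk \<Gamma> k s = xsh s (xlook \<Gamma> k) 0"
proof (induct \<Gamma> arbitrary: k s)
  case (Cons A \<Gamma>)
  have "shr s 0 \<circ> Suc = shr (Suc s) 0" by auto
  with Cons show ?case by (simp add: xsh_def xren_xren split: nat.split)
qed (simp add: xsh_def)

lemma xlook_xlk: "xlook \<Gamma> k = xlk \<Gamma> k 0"
  by (simp add: xlk xsh_0)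

lemma shr_simps: "shr d 0 k = d + k" "shr d (Suc c) 0 = 0" "shr d (Suc c) (Suc k) = Suc (shr d c k)"
  by simp_all

lemma nat_simps:
  "0 + k = (k :: nat)" "Suc d + k = Suc (d + k)" "(0 = Suc k) = False" "(Suc k = 0) = False" "(Suc j = Suc k) = (j = k)"
  "(k < 0) = False" "(0 < Suc k) = True" "(Suc j < Suc k) = (j < k)" "0 - k = (0 :: nat)" "k - 0 = k" "Suc j - Suc k = j - k"
  "max 0 k = k" "max (Suc k) 0 = Suc k" "max (Suc j) (Suc k) = Suc (max j k)"
  for j k d :: nat
  by simp_all

definition "side s x y = (if s then y else x)"

lemma side_simps: "side False x y = x" "side True x y = y"
  by (simp_all add: side_def)

text \<open>Forty as eight times five successors, because the recursion equations match on
  \<open>Suc\<close>.\<close>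

lemma fuel_Suc: "fuel = (let f = \<lambda>n. Suc (Suc (Suc (Suc (Suc n)))) in f (f (f (f (f (f (f (f 0))))))))"
  by (simp add: fuel_def)

lemma lk_eqs: "lk z [] k = z k" "lk z (a # as) 0 = a" "lk z (a # as) (Suc k) = lk z as k"
  by simp_all

lemma xlk_eqs: "xlk (A # \<Gamma>) 0 s = xsh (Suc s) A 0" "xlk (A # \<Gamma>) (Suc k) s = xlk \<Gamma> k (Suc s)"
  by simp_all

text \<open>Comparing numbers spares the comparison of telescopes, types and bodies.\<close>

lemma decl_neq: "dno d \<noteq> dno d' \<Longrightarrow> (d = d') = False"
  by auto

lemma numeral_neq: "((numeral m :: nat) \<noteq> numeral n) = (m \<noteq> n)"
  by simp

section \<open>Strict connectives and equality of annotated terms\<close>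

text \<open>In this and the next definitions the later test is held as separate arguments; it
  becomes a redex only when the first one has been evaluated to \<open>True\<close>, or to
  \<open>False\<close> for \<open>oif\<close>.\<close>

definition "eqa p x y \<longleftrightarrow> p \<and> x = y"

definition "cvb cv p x y \<longleftrightarrow> p \<and> cv x y"

definition "oif p f x y \<longleftrightarrow> p \<or> f x y"

definition "wif p w e e0 = (if p then w e else e0)"

definition "obind r f = (case r of None \<Rightarrow> None | Some x \<Rightarrow> f x)"

lemma strict_simps:
  "eqa True x y = (x = y)" "eqa False x y = False" "cvb cv True x y = cv x y" "cvb cv False x y = False"
  "oif True f x y = True" "oif False f x y = f x y" "wif True w e e0 = w e" "wif False w e e0 = e0"
  "obind None h = None" "obind (Some z) h = h z"
  by (simp_all add: eqa_def cvb_def oif_def wif_def obind_def)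

text \<open>Distinct constructors are separated by distinct numerals, instead of by one inequality
  for every pair of constructors.\<close>

primrec tag :: "xt \<Rightarrow> nat" where
  "tag (XV k) = 10"
| "tag (XU k) = 11"
| "tag (XPi k l A B) = 12"
| "tag (XLam k l A B b) = 13"
| "tag (XApp P f a) = 14"
| "tag (XSig k l A B) = 15"
| "tag (XTup S a b) = 16"
| "tag (XP1 S p) = 17"
| "tag (XP2 S p) = 18"
| "tag (XId k A a b) = 19"
| "tag (XRf k A a) = 20"
| "tag (XJ k l A C c a b p) = 21"
| "tag XEm = 22"
| "tag (XEmI l C e) = 23"
| "tag XOn = 24"
| "tag XSt = 25"
| "tag (XOnI l C c u) = 26"
| "tag XTw = 27"
| "tag XT0 = 28"
| "tag XT1 = 29"
| "tag (XTwI l C c d b) = 30"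
| "tag (XC d as) = 31"

lemma list_eqs: "([] = []) = True" "([] = a # as) = False" "(a # as = []) = False" "(a # as = b # bs) = eqa (a = b) as bs"
  by (simp_all add: eqa_def)

lemma ex_neq: "tag a \<noteq> tag b \<Longrightarrow> (a = b) = False"
  by auto

text \<open>In applications, pairs and projections the type annotation is compared last, so that a
  difference in the subterms settles the matter before the types are entered.\<close>

lemma ex_injects:
  "(XV k = XV k') = (k = k')"
  "(XU k = XU k') = (k = k')"
  "(XPi k l A B = XPi k' l' A' B') = eqa (eqa (eqa (k = k') l l') A A') B B'"
  "(XLam k l A B b = XLam k' l' A' B' b') = eqa (eqa (eqa (eqa (k = k') l l') A A') B B') b b'"
  "(XApp P f a = XApp P' f' a') = eqa (eqa (f = f') a a') P P'"
  "(XSig k l A B = XSig k' l' A' B') = eqa (eqa (eqa (k = k') l l') A A') B B'"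
  "(XTup S a b = XTup S' a' b') = eqa (eqa (a = a') b b') S S'"
  "(XP1 S p = XP1 S' p') = eqa (p = p') S S'"
  "(XP2 S p = XP2 S' p') = eqa (p = p') S S'"
  "(XId k A a b = XId k' A' a' b') = eqa (eqa (eqa (k = k') A A') a a') b b'"
  "(XRf k A a = XRf k' A' a') = eqa (eqa (k = k') A A') a a'"
  "(XJ k l A C c a b p = XJ k' l' A' C' c' a' b' p') =
     eqa (eqa (eqa (eqa (eqa (eqa (eqa (k = k') l l') A A') a a') b b') p p') C C') c c'"
  "(XEmI l C e = XEmI l' C' e') = eqa (eqa (l = l') e e') C C'"
  "(XOnI l C c e = XOnI l' C' c' e') = eqa (eqa (eqa (l = l') e e') C C') c c'"
  "(XTwI l C c b e = XTwI l' C' c' b' e') = eqa (eqa (eqa (eqa (l = l') e e') C C') c c') b b'"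
  "(XC d as = XC d' as') = eqa (d = d') as as'"
  by (auto simp: eqa_def)

section \<open>Evaluation rules for reduction and comparison\<close>

definition "wdl n d as r = (case r of None \<Rightarrow> XC d as | Some b \<Rightarrow> whnf n True (xsubst b (args as)))"

lemma whnf_eqs:
  "whnf (Suc n) dl (XV k) = XV k"
  "whnf (Suc n) dl (XU k) = XU k"
  "whnf (Suc n) dl (XPi k l A B) = XPi k l A B"
  "whnf (Suc n) dl (XLam k l A B b) = XLam k l A B b"
  "whnf (Suc n) dl (XApp P f a) = wapp (whnf n dl) (conv n) P a (whnf n dl f)"
  "whnf (Suc n) dl (XSig k l A B) = XSig k l A B"
  "whnf (Suc n) dl (XTup P a b) = XTup P a b"
  "whnf (Suc n) dl (XP1 P p) = wp1 (whnf n dl) (conv n) P (whnf n dl p)"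
  "whnf (Suc n) dl (XP2 P p) = wp2 (whnf n dl) (conv n) P (whnf n dl p)"
  "whnf (Suc n) dl (XId k A a b) = XId k A a b"
  "whnf (Suc n) dl (XRf k A a) = XRf k A a"
  "whnf (Suc n) dl (XJ k l A C c a b p) = wj (whnf n dl) (conv n) k l A C c a b (whnf n dl p)"
  "whnf (Suc n) dl XEm = XEm"
  "whnf (Suc n) dl (XEmI l C e) = XEmI l C e"
  "whnf (Suc n) dl XOn = XOn"
  "whnf (Suc n) dl XSt = XSt"
  "whnf (Suc n) dl (XOnI l C c u) = won (whnf n dl) l C c (whnf n dl u)"
  "whnf (Suc n) dl XTw = XTw"
  "whnf (Suc n) dl XT0 = XT0"
  "whnf (Suc n) dl XT1 = XT1"
  "whnf (Suc n) dl (XTwI l C c b u) = wtw (whnf n dl) l C c b (whnf n dl u)"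
  "whnf (Suc n) False (XC d as) = XC d as"
  "whnf (Suc n) True (XC d as) = wdl n d as (dbody d)"
  "wdl n d as None = XC d as"
  "wdl n d as (Some e) = whnf n True (xsubst e (args as))"
  by (simp_all add: wdl_def)

lemma red_eqs:
  "wapp w cv P a (XLam k l A B b) = wif (tpeq cv P (XPi k l A B)) w (xinst b a) (XApp P (XLam k l A B b) a)"
  "tag f \<noteq> 13 \<Longrightarrow> wapp w cv P a f = XApp P f a"
  "wp1 w cv P (XTup Q a b) = wif (tpeq cv P Q) w a (XP1 P (XTup Q a b))"
  "tag f \<noteq> 16 \<Longrightarrow> wp1 w cv P f = XP1 P f"
  "wp2 w cv P (XTup Q a b) = wif (tpeq cv P Q) w b (XP2 P (XTup Q a b))"
  "tag f \<noteq> 16 \<Longrightarrow> wp2 w cv P f = XP2 P f"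
  "wj w cv k l A C c a b (XRf k' A' x) =
     wif (cvb cv (cvb cv (cvb cv (k' = k) A' A) x a) x b) w (xinst c a) (XJ k l A C c a b (XRf k' A' x))"
  "tag f \<noteq> 20 \<Longrightarrow> wj w cv k l A C c a b f = XJ k l A C c a b f"
  "won w l C c XSt = w c"
  "tag f \<noteq> 25 \<Longrightarrow> won w l C c f = XOnI l C c f"
  "wtw w l C c b XT0 = w c"
  "wtw w l C c b XT1 = w b"
  "tag f \<noteq> 28 \<Longrightarrow> tag f \<noteq> 29 \<Longrightarrow> wtw w l C c b f = XTwI l C c b f"
  by (simp_all add: wapp_def wp1_def wp2_def wj_def won_def wtw_def wif_def cvb_def)
    (auto split: ex.splits)

definition "tpe cv P Q = (case P of
    XPi k l A B \<Rightarrow> (case Q of XPi k' l' A' B' \<Rightarrow> cvb cv (cvb cv (eqa (k = k') l l') A A') B B' | _ \<Rightarrow> False)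
  | XSig k l A B \<Rightarrow> (case Q of XSig k' l' A' B' \<Rightarrow> cvb cv (cvb cv (eqa (k = k') l l') A A') B B' | _ \<Rightarrow> False)
  | _ \<Rightarrow> False)"

lemma tpeq_eqs:
  "tpeq cv P Q = oif (P = Q) (tpe cv) P Q"
  "tpe cv (XPi k l A B) (XPi k' l' A' B') = cvb cv (cvb cv (eqa (k = k') l l') A A') B B'"
  "tpe cv (XSig k l A B) (XSig k' l' A' B') = cvb cv (cvb cv (eqa (k = k') l l') A A') B B'"
  "tag P \<noteq> tag Q \<Longrightarrow> tpe cv P Q = False"
  by (auto simp: tpeq_def tpe_def oif_def cvb_def eqa_def split: ex.split)

definition "cvw n a b = conv1 (whnf n True) (conv n) (whnf n False a) (whnf n False b)"

definition "cvu w cv a b = cvs cv (w a) (w b)"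

definition "cvd w cv a b = oif (cvc cv a b) (cvu w cv) a b"

definition "cvh cv a b = (case a of
    XLam k l A B s \<Rightarrow> cv_lam cv k l A B s b | XTup S x y \<Rightarrow> cv_tup cv S x y b | _ \<Rightarrow> cv_right cv a b)"

definition "cva p cv as bs \<longleftrightarrow> p \<and> cvl cv as bs"

lemma conv_eqs:
  "conv (Suc n) a b = oif (a = b) (cvw n) a b"
  "cvw n a b = conv1 (whnf n True) (conv n) (whnf n False a) (whnf n False b)"
  "conv1 w cv a b = oif (a = b) (cvd w cv) a b"
  "cvd w cv a b = oif (cvc cv a b) (cvu w cv) a b"
  "cvu w cv a b = cvs cv (w a) (w b)"
  "cvs cv a b = oif (a = b) (cvh cv) a b"
  by (auto simp: oif_def cvw_def cvd_def cvu_def cvh_def conv1_def cvs_def)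

lemma cvh_eqs:
  "cvh cv (XLam k l A B s) b = cv_lam cv k l A B s b"
  "cvh cv (XTup S x y) b = cv_tup cv S x y b"
  "cv_lam cv k l A B s (XLam k' l' A' B' s') = cvb cv (tpeq cv (XPi k l A B) (XPi k' l' A' B')) s s'"
  "cv_tup cv S x y (XTup S' x' y') = cvb cv (cvb cv (tpeq cv S S') x x') y y'"
  "cv_right cv a (XLam k l A B s) = etal cv k l A B s a"
  "cv_right cv a (XTup S x y) = etas cv S x y a"
  "etas cv S a b p = cvb cv (cv a (XP1 S p)) b (XP2 S p)"
  by (simp_all add: cvh_def cv_lam_def cv_tup_def cv_right_def etas_def cvb_def)

lemma cvh_neqs:
  "tag a \<noteq> 13 \<Longrightarrow> tag a \<noteq> 16 \<Longrightarrow> cvh cv a b = cv_right cv a b"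
  "tag a \<noteq> 13 \<Longrightarrow> cv_lam cv k l A B s a = etal cv k l A B s a"
  "tag a \<noteq> 16 \<Longrightarrow> cv_tup cv S x y a = etas cv S x y a"
  "tag a \<noteq> 13 \<Longrightarrow> tag a \<noteq> 16 \<Longrightarrow> cv_right cv b a = cv_head cv b a"
  by (cases a; simp add: cvh_def cv_lam_def cv_tup_def cv_right_def)+

lemma cv_head_eqs:
  "cv_head cv (XV k) b = False"
  "cv_head cv (XU k) b = False"
  "cv_head cv (XPi k l A B) (XPi k' l' A' B') = tpeq cv (XPi k l A B) (XPi k' l' A' B')"
  "cv_head cv (XApp P f x) (XApp P' f' x') = cvb cv (cvb cv (tpeq cv P P') f f') x x'"
  "cv_head cv (XSig k l A B) (XSig k' l' A' B') = tpeq cv (XSig k l A B) (XSig k' l' A' B')"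
  "cv_head cv (XP1 S p) (XP1 S' p') = cvb cv (tpeq cv S S') p p'"
  "cv_head cv (XP2 S p) (XP2 S' p') = cvb cv (tpeq cv S S') p p'"
  "cv_head cv (XId k A x y) (XId k' A' x' y') = cvb cv (cvb cv (cvb cv (k = k') A A') x x') y y'"
  "cv_head cv (XRf k A x) (XRf k' A' x') = cvb cv (cvb cv (k = k') A A') x x'"
  "cv_head cv (XJ k l A C c x y p) (XJ k' l' A' C' c' x' y' p') =
     cvb cv (cvb cv (cvb cv (cvb cv (cvb cv (cvb cv (eqa (k = k') l l') A A') C C') c c') x x') y y') p p'"
  "cv_head cv (XEmI l C e) (XEmI l' C' e') = cvb cv (cvb cv (l = l') C C') e e'"
  "cv_head cv (XOnI l C c e) (XOnI l' C' c' e') = cvb cv (cvb cv (cvb cv (l = l') C C') c c') e e'"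
  "cv_head cv (XTwI l C c d e) (XTwI l' C' c' d' e') = cvb cv (cvb cv (cvb cv (cvb cv (l = l') C C') c c') d d') e e'"
  "cv_head cv (XC g as) b = cvc cv (XC g as) b"
  "cvc cv (XC g as) (XC g' bs) = cva (g = g') cv as bs"
  "cva True cv as bs = cvl cv as bs"
  "cva False cv as bs = False"
  "cvl cv [] [] = True"
  "cvl cv (a # as) (b # bs) = cvb cv (cvl cv as bs) a b"
  by (simp_all add: cv_head_def cv_pi_def cv_sig_def cv_app_def cv_p1_def cv_p2_def cv_id_def cv_rf_def cv_j_def cv_emi_def
      cv_oni_def cv_twi_def cvc_def cva_def cvb_def eqa_def)

lemma cvc_neqs: "tag a \<noteq> 31 \<Longrightarrow> cvc cv a b = False" "tag a \<noteq> 31 \<Longrightarrow> cvc cv b a = False"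
  by (cases a; simp add: cvc_def split: ex.split)+

lemma cv_head_neq: "tag a \<noteq> tag b \<Longrightarrow> cv_head cv a b = False"
  by (cases a; cases b;
      simp add: cv_head_def cv_pi_def cv_sig_def cv_app_def cv_p1_def cv_p2_def cv_id_def cv_rf_def cv_j_def cv_emi_def
        cv_oni_def cv_twi_def cvc_def)

section \<open>Evaluation rules for elaboration\<close>

definition "elT2 A T = (case T of XU k \<Rightarrow> Some (A, k) | _ \<Rightarrow> None)"
definition "elT1 = (\<lambda>(A, T, l :: nat). elT2 A (whnf fuel True T))"

definition "fin1 p e T l = (if p then Some (e, T, l :: nat) else None)"

definition "ela2 as = (\<lambda>(a :: xt, T :: xt, l :: nat). Some (a # as))"
definition "ela1 f \<Gamma> D as = obind (f \<Gamma> (Some (xsubst (fst D) (args as), snd D))) (ela2 as)"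

lemma elT_eqs:
  "elT r = obind r elT1"
  "elT1 (A, T, l) = elT2 A (whnf fuel True T)"
  "elT2 A (XU k) = Some (A, k)"
  "tag T \<noteq> 11 \<Longrightarrow> elT2 A T = None"
  "fin None e T l = Some (e, T, l)"
  "fin (Some (T0, l0)) e T l = fin1 (cvb (conv fuel) (l = l0) T T0) e T0 l0"
  "fin1 True e T l = Some (e, T, l)"
  "fin1 False e T l = None"
  "ela [] \<Gamma> [] = Some []"
  "ela (f # fs) \<Gamma> (D # \<Delta>) = obind (ela fs \<Gamma> \<Delta>) (ela1 f \<Gamma> D)"
  "ela1 f \<Gamma> (A, k) as = obind (f \<Gamma> (Some (xsubst A (args as), k))) (ela2 as)"
  "ela2 as (a, T, l) = Some (a # as)"
  by (auto simp: elT_def obind_def elT1_def elT2_def fin_def fin1_def cvb_def ela1_def ela2_def split: option.split ex.split)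

text \<open>These are the continuations of the case distinctions in \<open>el\<close>. Being named
  and partially applied, they are not entered before the result they wait for is known.\<close>

definition "elV p m \<Gamma> k = (if p then fin m (XV k) (xlook (cxt \<Gamma>) k) (snd (\<Gamma> ! k)) else None)"
definition "elPi2 m A k = (\<lambda>(B, l). fin m (XPi k l A B) (XU (max k l)) (Suc (max k l)))"
definition "elPi1 f \<Gamma> m = (\<lambda>(A, k). obind (elT (f ((A, k) # \<Gamma>) None)) (elPi2 m A k))"
definition "elSig2 m A k = (\<lambda>(B, l). fin m (XSig k l A B) (XU (max k l)) (Suc (max k l)))"
definition "elSig1 f \<Gamma> m = (\<lambda>(A, k). obind (elT (f ((A, k) # \<Gamma>) None)) (elSig2 m A k))"
definition "elLam2 A k = (\<lambda>(b, B, l). Some (XLam k l A B b, XPi k l A B, max k l))"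
definition "elLam5 k l A B T n = (\<lambda>(b :: xt, T' :: xt, l' :: nat). Some (XLam k l A B b, T :: xt, n :: nat))"
definition "elLam4 p f \<Gamma> k l A B T n = (if p then obind (f ((A, k) # \<Gamma>) (Some (B, l))) (elLam5 k l A B T n) else None)"
definition "elLam3 f \<Gamma> A k T n W = (case W of
  XPi k0 l0 A0 B0 \<Rightarrow> elLam4 (cvb (conv fuel) (k = k0) A A0) f \<Gamma> k l0 A B0 T n | _ \<Rightarrow> None)"
definition "elLam1 f \<Gamma> m = (\<lambda>(A, k). case m of None \<Rightarrow> obind (f ((A, k) # \<Gamma>) None) (elLam2 A k)
  | Some (T, n) \<Rightarrow> elLam3 f \<Gamma> A k T n (whnf fuel True T))"
definition "elApp3 m k l A B f = (\<lambda>(a, T :: xt, n :: nat). fin m (XApp (XPi k l A B) f a) (xinst B a) l)"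
definition "elApp2 g \<Gamma> m f W = (case W of XPi k l A B \<Rightarrow> obind (g \<Gamma> (Some (A, k))) (elApp3 m k l A B f) | _ \<Rightarrow> None)"
definition "elApp1 g \<Gamma> m = (\<lambda>(f, F, n :: nat). elApp2 g \<Gamma> m f (whnf fuel True F))"
definition "elTup3 k l A B a T n = (\<lambda>(b, T' :: xt, l' :: nat). Some (XTup (XSig k l A B) a b, T :: xt, n :: nat))"
definition "elTup2 g \<Gamma> k l A B T n = (\<lambda>(a, T' :: xt, l' :: nat). obind (g \<Gamma> (Some (xinst B a, l))) (elTup3 k l A B a T n))"
definition "elTup1 f g \<Gamma> T n W = (case W of XSig k l A B \<Rightarrow> obind (f \<Gamma> (Some (A, k))) (elTup2 g \<Gamma> k l A B T n) | _ \<Rightarrow> None)"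
definition "elP12 m p W = (case W of XSig k l A B \<Rightarrow> fin m (XP1 (XSig k l A B) p) A k | _ \<Rightarrow> None)"
definition "elP11 m = (\<lambda>(p, F, n :: nat). elP12 m p (whnf fuel True F))"
definition "elP22 m p W = (case W of
  XSig k l A B \<Rightarrow> fin m (XP2 (XSig k l A B) p) (xinst B (XP1 (XSig k l A B) p)) l | _ \<Rightarrow> None)"
definition "elP21 m = (\<lambda>(p, F, n :: nat). elP22 m p (whnf fuel True F))"
definition "elId3 m A k a = (\<lambda>(b, T :: xt, n :: nat). fin m (XId k A a b) (XU k) (Suc k))"
definition "elId2 g \<Gamma> m A k = (\<lambda>(a, T :: xt, n :: nat). obind (g \<Gamma> (Some (A, k))) (elId3 m A k a))"
definition "elId1 f g \<Gamma> m = (\<lambda>(A, k). obind (f \<Gamma> (Some (A, k))) (elId2 g \<Gamma> m A k))"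
definition "elRf m = (\<lambda>(a, A, k). fin m (XRf k A a) (XId k A a a) k)"
definition "elJ6 m A k C l c a b = (\<lambda>(p, T :: xt, n :: nat). fin m (XJ k l A C c a b p) (xsubst C (lk XV [p, b, a])) l)"
definition "elJ5 fp \<Gamma> m A k C l c a = (\<lambda>(b, T :: xt, n :: nat). obind (fp \<Gamma> (Some (XId k A a b, k))) (elJ6 m A k C l c a b))"
definition "elJ4 fb fp \<Gamma> m A k C l c = (\<lambda>(a, T :: xt, n :: nat). obind (fb \<Gamma> (Some (A, k))) (elJ5 fp \<Gamma> m A k C l c a))"
definition "elJ3 fa fb fp \<Gamma> m A k C l = (\<lambda>(c, T :: xt, n :: nat). obind (fa \<Gamma> (Some (A, k))) (elJ4 fb fp \<Gamma> m A k C l c))"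
definition "elJ2 fc fa fb fp \<Gamma> m A k = (\<lambda>(C, l). obind
  (fc ((A, k) # \<Gamma>) (Some (xsubst C (lk (XV \<circ> Suc) [XRf k (xlift A) (XV 0), XV 0, XV 0]), l)))
  (elJ3 fa fb fp \<Gamma> m A k C l))"
definition "elJ1 fC fc fa fb fp \<Gamma> m = (\<lambda>(A, k). obind
  (elT (fC ((XId k (xlift (xlift A)) (XV (Suc 0)) (XV 0), k) # (xlift A, k) # (A, k) # \<Gamma>) None))
  (elJ2 fc fa fb fp \<Gamma> m A k))"
definition "elEm2 m C l = (\<lambda>(e, T :: xt, n :: nat). fin m (XEmI l C e) (xinst C e) l)"
definition "elEm1 fe \<Gamma> m = (\<lambda>(C, l). obind (fe \<Gamma> (Some (XEm, 0 :: nat))) (elEm2 m C l))"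
definition "elOn3 m C l c = (\<lambda>(e, T :: xt, n :: nat). fin m (XOnI l C c e) (xinst C e) l)"
definition "elOn2 fe \<Gamma> m C l = (\<lambda>(c, T :: xt, n :: nat). obind (fe \<Gamma> (Some (XOn, 0 :: nat))) (elOn3 m C l c))"
definition "elOn1 fc fe \<Gamma> m = (\<lambda>(C, l). obind (fc \<Gamma> (Some (xinst C XSt, l))) (elOn2 fe \<Gamma> m C l))"
definition "elTw4 m C l c d = (\<lambda>(e, T :: xt, n :: nat). fin m (XTwI l C c d e) (xinst C e) l)"
definition "elTw3 fe \<Gamma> m C l c = (\<lambda>(d, T :: xt, n :: nat). obind (fe \<Gamma> (Some (XTw, 0 :: nat))) (elTw4 m C l c d))"
definition "elTw2 fd fe \<Gamma> m C l = (\<lambda>(c, T :: xt, n :: nat). obind (fd \<Gamma> (Some (xinst C XT1, l))) (elTw3 fe \<Gamma> m C l c))"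
definition "elTw1 fc fd fe \<Gamma> m = (\<lambda>(C, l). obind (fc \<Gamma> (Some (xinst C XT0, l))) (elTw2 fd fe \<Gamma> m C l))"
definition "elC1 m d as = fin m (XC d as) (xsubst (drty d) (args as)) (dlvl d)"

lemmas el_conts = elV_def elPi2_def elPi1_def elSig2_def elSig1_def elLam2_def elLam5_def elLam4_def elLam3_def elLam1_def
  elApp3_def elApp2_def elApp1_def elTup3_def elTup2_def elTup1_def elP12_def elP11_def elP22_def elP21_def elId3_def elId2_def
  elId1_def elRf_def elJ6_def elJ5_def elJ4_def elJ3_def elJ2_def elJ1_def elEm2_def elEm1_def elOn3_def elOn2_def elOn1_def
  elTw4_def elTw3_def elTw2_def elTw1_def elC1_def

lemmas pair_conts = elPi2_def elPi1_def elSig2_def elSig1_def elId1_def elJ2_def elJ1_def elEm1_def elOn1_def elTw1_def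

lemmas triple_conts = elLam2_def elLam5_def elApp3_def elApp1_def elTup3_def elTup2_def elP11_def elP21_def elId3_def elId2_def elRf_def elJ6_def elJ5_def elJ4_def elJ3_def elEm2_def elOn3_def elOn2_def elTw4_def elTw3_def elTw2_def

lemmas cont_eqs =
  pair_conts[THEN fun_cong, where x = "(x, y)" for x y, unfolded prod.case]
  triple_conts[THEN fun_cong, where x = "(x, y, z)" for x y z, unfolded prod.case]

lemma el_split_eqs:
  "elV True m \<Gamma> k = fin m (XV k) (xlook (cxt \<Gamma>) k) (snd (\<Gamma> ! k))"
  "elLam1 f \<Gamma> None (A, k) = obind (f ((A, k) # \<Gamma>) None) (elLam2 A k)"
  "elLam1 f \<Gamma> (Some (T, n)) (A, k) = elLam3 f \<Gamma> A k T n (whnf fuel True T)"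
  "elLam3 f \<Gamma> A k T n (XPi k0 l0 A0 B0) = elLam4 (cvb (conv fuel) (k = k0) A A0) f \<Gamma> k l0 A B0 T n"
  "elLam4 True f \<Gamma> k l A B T n = obind (f ((A, k) # \<Gamma>) (Some (B, l))) (elLam5 k l A B T n)"
  "elApp2 g \<Gamma> m f' (XPi k l A B) = obind (g \<Gamma> (Some (A, k))) (elApp3 m k l A B f')"
  "elTup1 f g \<Gamma> T n (XSig k l A B) = obind (f \<Gamma> (Some (A, k))) (elTup2 g \<Gamma> k l A B T n)"
  "elP12 m p (XSig k l A B) = fin m (XP1 (XSig k l A B) p) A k"
  "elP22 m p (XSig k l A B) = fin m (XP2 (XSig k l A B) p) (xinst B (XP1 (XSig k l A B) p)) l"
  "elC1 m d as = fin m (XC d as) (xsubst (drty d) (args as)) (dlvl d)"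
  by (simp_all add: el_conts)

lemma if_conj: "(if p \<and> q then x else y) = (if p then if q then x else y else y)"
  by simp

lemma el_eqs:
  "el (PV v) \<Gamma> m = elV (v < length \<Gamma>) m \<Gamma> (length \<Gamma> - Suc v)"
  "el (PU k) \<Gamma> m = fin m (XU k) (XU (Suc k)) (Suc (Suc k))"
  "el (PPi A B) \<Gamma> m = obind (elT (el A \<Gamma> None)) (elPi1 (el B) \<Gamma> m)"
  "el (PLam A b) \<Gamma> m = obind (elT (el A \<Gamma> None)) (elLam1 (el b) \<Gamma> m)"
  "el (PApp f a) \<Gamma> m = obind (el f \<Gamma> None) (elApp1 (el a) \<Gamma> m)"
  "el (PSig A B) \<Gamma> m = obind (elT (el A \<Gamma> None)) (elSig1 (el B) \<Gamma> m)"
  "el (PTup a b) \<Gamma> (Some (T, n)) = elTup1 (el a) (el b) \<Gamma> T n (whnf fuel True T)"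
  "el (PP1 p) \<Gamma> m = obind (el p \<Gamma> None) (elP11 m)"
  "el (PP2 p) \<Gamma> m = obind (el p \<Gamma> None) (elP21 m)"
  "el (PId A a b) \<Gamma> m = obind (elT (el A \<Gamma> None)) (elId1 (el a) (el b) \<Gamma> m)"
  "el (PRf a) \<Gamma> m = obind (el a \<Gamma> None) (elRf m)"
  "el (PJ A C c a b p) \<Gamma> m = obind (elT (el A \<Gamma> None)) (elJ1 (el C) (el c) (el a) (el b) (el p) \<Gamma> m)"
  "el PEm \<Gamma> m = fin m XEm (XU 0) (Suc 0)"
  "el (PEmI C e) \<Gamma> m = obind (elT (el C ((XEm, 0) # \<Gamma>) None)) (elEm1 (el e) \<Gamma> m)"
  "el POn \<Gamma> m = fin m XOn (XU 0) (Suc 0)"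
  "el PSt \<Gamma> m = fin m XSt XOn 0"
  "el (POnI C c e) \<Gamma> m = obind (elT (el C ((XOn, 0) # \<Gamma>) None)) (elOn1 (el c) (el e) \<Gamma> m)"
  "el PTw \<Gamma> m = fin m XTw (XU 0) (Suc 0)"
  "el PT0 \<Gamma> m = fin m XT0 XTw 0"
  "el PT1 \<Gamma> m = fin m XT1 XTw 0"
  "el (PTwI C c d e) \<Gamma> m = obind (elT (el C ((XTw, 0) # \<Gamma>) None)) (elTw1 (el c) (el d) (el e) \<Gamma> m)"
  "valid g \<Longrightarrow> el (PC g ps) \<Gamma> m = obind (ela (map el ps) \<Gamma> (dtele g)) (elC1 m g)"
  by (simp_all only: el.simps obind_def el_conts case_prod_unfold cvb_def if_True if_conj fst_conv snd_conv option.case)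

definition "els3 \<Gamma> R l = (\<lambda>(b :: xt, T :: xt, n :: nat). Some (\<Gamma> :: cx, R :: xt, l :: nat, Some b))"
definition "els2 b \<Gamma> = (\<lambda>(R, l). case b of None \<Rightarrow> Some (\<Gamma>, R, l, None)
  | Some e \<Rightarrow> obind (el e \<Gamma> (Some (R, l))) (els3 \<Gamma> R l))"
definition "els1 f \<Gamma> = (\<lambda>(A :: xt, k :: nat). f ((A, k) # \<Gamma>))"

lemma els_eqs:
  "els (SPar A s) \<Gamma> = obind (elT (el A \<Gamma> None)) (els1 (els s) \<Gamma>)"
  "els (SEnd R b) \<Gamma> = obind (elT (el R \<Gamma> None)) (els2 b \<Gamma>)"
  "els1 f \<Gamma> (A', k) = f ((A', k) # \<Gamma>)"
  "els2 None \<Gamma> (R', l) = Some (\<Gamma>, R', l, None)"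
  "els2 (Some e) \<Gamma> (R', l) = obind (el e \<Gamma> (Some (R', l))) (els3 \<Gamma> R' l)"
  "els3 \<Gamma> R' l (b', T, n) = Some (\<Gamma>, R', l, Some b')"
  by (auto simp: obind_def els1_def els2_def els3_def split: option.split)

lemmas ev_rules [ev] =
  xsh_0 xsh_eqs xshl.simps xsb_eqs xsbl.simps xvs.simps xren_Suc xren_up_Suc xsubst_lk lk_eqs xlook_xlk
  xlk_eqs shr_simps nat_simps decl_neq numeral_neq num.distinct num.inject not_True_eq_False not_False_eq_True
  side_simps strict_simps tag.simps list_eqs ex_injects ex_neq refl[THEN eq_True[THEN iffD2]]
  o_apply fst_conv snd_conv list.map list.size(3) length_Cons nth_Cons_0 nth_Cons_Suc fuel_Suc[unfolded Let_def]
  whnf_eqs red_eqs tpeq_eqs conv_eqs cvh_eqs cvh_neqs etal_def cv_head_eqs cvc_neqs cv_head_neq elT_eqs el_split_eqs cont_eqs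
  el_eqs els_eqs

section \<open>Notation for pre-terms\<close>

type_synonym px = "nat \<Rightarrow> pre"

named_theorems px

text \<open>Since variables are levels, a bound variable is the same pre-term at every depth, unlike
  in \<open>bound\<close>, where the index depends on the place of use.\<close>

definition bnd :: "(px \<Rightarrow> nat \<Rightarrow> 'a) \<Rightarrow> nat \<Rightarrow> 'a" where [px]: "bnd F = (\<lambda>n. F (\<lambda>_. PV n) (Suc n))"
definition Ty :: "nat \<Rightarrow> px" where [px]: "Ty k = (\<lambda>n. PU k)"
definition ppi :: "px \<Rightarrow> (px \<Rightarrow> px) \<Rightarrow> px" where [px]: "ppi A B = (\<lambda>n. PPi (A n) (bnd B n))"
definition plam :: "px \<Rightarrow> (px \<Rightarrow> px) \<Rightarrow> px" where [px]: "plam A B = (\<lambda>n. PLam (A n) (bnd B n))"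
definition psig :: "px \<Rightarrow> (px \<Rightarrow> px) \<Rightarrow> px" where [px]: "psig A B = (\<lambda>n. PSig (A n) (bnd B n))"
definition papp :: "px \<Rightarrow> px \<Rightarrow> px" (infixl "$" 90) where [px]: "f $ a = (\<lambda>n. PApp (f n) (a n))"
definition ptup :: "px \<Rightarrow> px \<Rightarrow> px" ("<<_,/ _>>") where [px]: "<<a, b>> = (\<lambda>n. PTup (a n) (b n))"
definition p1 :: "px \<Rightarrow> px" where [px]: "p1 p = (\<lambda>n. PP1 (p n))"
definition p2 :: "px \<Rightarrow> px" where [px]: "p2 p = (\<lambda>n. PP2 (p n))"
definition Eqt :: "px \<Rightarrow> px \<Rightarrow> px \<Rightarrow> px" where [px]: "Eqt A a b = (\<lambda>n. PId (A n) (a n) (b n))"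
definition idp :: "px \<Rightarrow> px" where [px]: "idp a = (\<lambda>n. PRf (a n))"
definition Jd :: "px \<Rightarrow> (px \<Rightarrow> px \<Rightarrow> px \<Rightarrow> px) \<Rightarrow> (px \<Rightarrow> px) \<Rightarrow> px \<Rightarrow> px \<Rightarrow> px \<Rightarrow> px" where [px]: "Jd A C c a b p =
  (\<lambda>n. PJ (A n) (bnd (\<lambda>x. bnd (\<lambda>y. bnd (\<lambda>q. C x y q))) n) (bnd c n) (a n) (b n) (p n))"
definition Em :: px where [px]: "Em = (\<lambda>n. PEm)"
definition EmI :: "(px \<Rightarrow> px) \<Rightarrow> px \<Rightarrow> px" where [px]: "EmI C e = (\<lambda>n. PEmI (bnd C n) (e n))"
definition On :: px where [px]: "On = (\<lambda>n. POn)"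
definition st :: px where [px]: "st = (\<lambda>n. PSt)"
definition OnI :: "(px \<Rightarrow> px) \<Rightarrow> px \<Rightarrow> px \<Rightarrow> px" where [px]: "OnI C c e = (\<lambda>n. POnI (bnd C n) (c n) (e n))"
definition Tw :: px where [px]: "Tw = (\<lambda>n. PTw)"
definition ff :: px where [px]: "ff = (\<lambda>n. PT0)"
definition tt :: px where [px]: "tt = (\<lambda>n. PT1)"
definition TwI :: "(px \<Rightarrow> px) \<Rightarrow> px \<Rightarrow> px \<Rightarrow> px \<Rightarrow> px" where [px]: "TwI C c d e = (\<lambda>n. PTwI (bnd C n) (c n) (d n) (e n))"
definition pcon :: "decl \<Rightarrow> px list \<Rightarrow> px" where [px]: "pcon d es = (\<lambda>n. PC d (map (\<lambda>e. e n) es))"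
definition tele :: "px \<Rightarrow> (px \<Rightarrow> nat \<Rightarrow> sg) \<Rightarrow> nat \<Rightarrow> sg" where [px]: "tele A s = (\<lambda>n. SPar (A n) (bnd s n))"
definition body :: "px \<Rightarrow> px \<Rightarrow> nat \<Rightarrow> sg" (infix ":==" 5) where [px]: "(R :== b) = (\<lambda>n. SEnd (R n) (Some (b n)))"
definition postulated :: "px \<Rightarrow> nat \<Rightarrow> sg" where [px]: "postulated R = (\<lambda>n. SEnd (R n) None)"

syntax
  "_ppi" :: "idt \<Rightarrow> px \<Rightarrow> px \<Rightarrow> px" ("(3PI _:_./ _)" [0, 0, 10] 10)
  "_plam" :: "idt \<Rightarrow> px \<Rightarrow> px \<Rightarrow> px" ("(3LAM _:_./ _)" [0, 0, 10] 10)
  "_psig" :: "idt \<Rightarrow> px \<Rightarrow> px \<Rightarrow> px" ("(3SIG _:_./ _)" [0, 0, 10] 10)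
  "_tele" :: "idt \<Rightarrow> px \<Rightarrow> px \<Rightarrow> px" ("ANY _:_./ _" [0, 0, 5] 5)
translations
  "PI x:A. B" \<rightleftharpoons> "CONST ppi A (\<lambda>x. B)"
  "LAM x:A. B" \<rightleftharpoons> "CONST plam A (\<lambda>x. B)"
  "SIG x:A. B" \<rightleftharpoons> "CONST psig A (\<lambda>x. B)"
  "ANY x:A. s" \<rightleftharpoons> "CONST tele A (\<lambda>x. s)"

abbreviation parr (infixr "->" 60) where "A -> B \<equiv> PI _:A. B"
abbreviation pprod (infixr "**" 70) where "A ** B \<equiv> SIG _:A. B"

lemmas [px] = list.map side_simps

section \<open>Signatures and their agreement with the raw terms\<close>

lemma er_simps: "i + 0 = i" "i + Suc k = Suc (i + k)" "n - n = (0 :: nat)" "n \<le> m \<Longrightarrow> Suc m - n = Suc (m - n)"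
  "(n \<le> n) = True" "n \<le> m \<Longrightarrow> (n \<le> Suc m) = True" for i k m n :: nat
  by simp_all

lemmas er_eqs = er_simps er.simps(1-21) lams.simps apl.simps option.sel list.map fst_conv

lemmas raw = Let_def bound_def uni_def pi_def lam_def app_def sig_def tup_def pr1_def pr2_def eq_def rfl_def path_ind_def
  empty_def one_def star_def two_def two0_def two1_def two_ind_def arrow_def times_def iff_def funext_ax_def
  rgraph_def vert_def edge_def rfx_def on_vert_def on_edge_def on_rfx_def unit_graph_def tau_def walking_edge_def
  vertex_hom_def total_edge_def src_def tgt_def on_total_def

definition "tsig d n \<Gamma> R l b \<longleftrightarrow> sig_of d n \<Gamma> R l (Some b) \<and> (\<forall>i as. er i (XC d as) = er i (xsubst b (args as)))"

definition "lsig d n \<Gamma> R l b \<longleftrightarrow> sig_of d n \<Gamma> R l (Some b) \<and>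
  (\<forall>i as. length as = length \<Gamma> \<longrightarrow> er i (XC d as) = apl (clo d i) (ec i as))"

definition "osig d n \<Gamma> R l \<longleftrightarrow> sig_of d n \<Gamma> R l None"

text \<open>Checking a declaration means evaluating \<open>els\<close>: the telescope, type, level
  and body are left schematic and are filled by the result of elaboration.\<close>

lemma sigI:
  "d = transp n s \<Longrightarrow> els s [] = Some (\<Gamma>, R, l, Some b) \<Longrightarrow> tsig d n \<Gamma> R l b"
  "d = lamd n s \<Longrightarrow> els s [] = Some (\<Gamma>, R, l, Some b) \<Longrightarrow> lsig d n \<Gamma> R l b"
  "d = opaq n s \<Longrightarrow> els s [] = Some (\<Gamma>, R, l, Some b) \<Longrightarrow> osig d n \<Gamma> R l"
  unfolding tsig_def lsig_def osig_def by (hypsubst, erule transp_sig lamd_sig opaq_sig)+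

lemma tsigD:
  assumes "tsig d n \<Gamma> R l b"
  shows "valid d" "dno d = n" "dtele d = \<Gamma>" "drty d = R" "dlvl d = l" "dbody d = Some b"
    "er i (XC d as) = er i (xsubst b (args as))"
  using assms by (simp_all add: tsig_def sig_of_def del: er.simps)

lemma lsigD:
  assumes "lsig d n \<Gamma> R l b"
  shows "valid d" "dno d = n" "dtele d = \<Gamma>" "drty d = R" "dlvl d = l" "dbody d = Some b"
    "length as = length \<Gamma> \<Longrightarrow> er i (XC d as) = apl (clo d i) (ec i as)"
  using assms by (simp_all add: lsig_def sig_of_def del: er.simps)

lemma osigD:
  assumes "osig d n \<Gamma> R l"
  shows "valid d" "dno d = n" "dtele d = \<Gamma>" "drty d = R" "dlvl d = l" "dbody d = None"
  using assms by (simp_all add: osig_def sig_of_def)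

definition "asig d n \<Gamma> R l t \<longleftrightarrow> sig_of d n \<Gamma> R l None \<and>
  (\<forall>i as. length as = length \<Gamma> \<longrightarrow> er i (XC d as) = apl (t i) (ec i as))"

text \<open>The middle equation guards the postulate: its elaborated type has to erase literally to
  the type that the theory gives to \<open>Funext i\<close>.\<close>

lemma asigI:
  "d = postul n Funext s \<Longrightarrow> els s [] = Some (\<Gamma>, R, l, None) \<Longrightarrow>
    (\<And>i. funext_type i 0 = pis (ec i (cxt \<Gamma>)) (er i R)) \<Longrightarrow> asig d n \<Gamma> R l Funext"
  unfolding asig_def by (hypsubst, erule postul_sig) (metis ty_Funext ctx_nil)

lemma asigD:
  assumes "asig d n \<Gamma> R l t"
  shows "valid d" "dno d = n" "dtele d = \<Gamma>" "drty d = R" "dlvl d = l" "dbody d = None"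
    "length as = length \<Gamma> \<Longrightarrow> er i (XC d as) = apl (t i) (ec i as)"
  using assms by (simp_all add: asig_def sig_of_def del: er.simps)

section \<open>The notions of the theorem\<close>

definition "Isequiv_d = lamd 10 ((ANY A:Ty 0. ANY B:Ty 0. ANY f:A -> B.
  Ty 0 :==
  (SIG g:B -> A. PI b:B. Eqt B (f $ (g $ b)) b) ** (SIG h:B -> A. PI a:A. Eqt A (h $ (f $ a)) a)) 0)"
schematic_goal Isequiv_sig: "lsig Isequiv_d ?n ?\<Gamma> ?R ?l ?b"
  by (rule sigI(2)[OF Isequiv_d_def], unfold px) (simp only: ev)
lemmas [ev] = lsigD[OF Isequiv_sig]
abbreviation "Isequiv A B f \<equiv> pcon Isequiv_d [f, B, A]"
text \<open>The link to the given notion: its raw term is literally the closed function built from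
  the elaborated declaration, and the depth \<open>n\<close> is arbitrary because that function is
  closed. The later \<open>_clo\<close> lemmas play the same role.\<close>

lemma Isequiv_clo [ev]: "is_equiv i n = clo Isequiv_d i"
  by (simp only: is_equiv_def clo_def[of Isequiv_d] raw er_eqs ev)

definition "Happly_d = lamd 11 ((ANY A:Ty 0. ANY B:A -> Ty 0. ANY f:PI x:A. B $ x. ANY g:PI x:A. B $ x.
  (Eqt (PI x:A. B $ x) f g -> (PI x:A. Eqt (B $ x) (f $ x) (g $ x))) :==
  LAM p:Eqt (PI x:A. B $ x) f g. Jd (PI x:A. B $ x) (\<lambda>h k q. PI x:A. Eqt (B $ x) (h $ x) (k $ x)) (\<lambda>h. LAM x:A. idp (h $ x)) f g p) 0)"
schematic_goal Happly_sig: "lsig Happly_d ?n ?\<Gamma> ?R ?l ?b"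
  by (rule sigI(2)[OF Happly_d_def], unfold px) (simp only: ev)
lemmas [ev] = lsigD[OF Happly_sig]
abbreviation "Happly A B f g \<equiv> pcon Happly_d [g, f, B, A]"
lemma Happly_clo [ev]: "happly i n = clo Happly_d i"
  by (simp only: happly_def clo_def[of Happly_d] raw er_eqs ev)

definition "FunextAx_d = postul 12 Funext ((ANY A:Ty 0. ANY B:A -> Ty 0. ANY f:PI x:A. B $ x. ANY g:PI x:A. B $ x.
  postulated (Isequiv (Eqt (PI x:A. B $ x) f g) (PI x:A. Eqt (B $ x) (f $ x) (g $ x)) (Happly A B f g))) 0)"
schematic_goal FunextAx_sig: "asig FunextAx_d ?n ?\<Gamma> ?R ?l Funext"
  by (rule asigI[OF FunextAx_d_def], unfold px, (simp only: ev)[1]) (simp only: funext_type_def raw er_eqs pis.simps ev)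
lemmas [ev] = asigD[OF FunextAx_sig]
abbreviation "FunextAx A B f g \<equiv> pcon FunextAx_d [g, f, B, A]"

definition "Ap_d = lamd 13 ((ANY A:Ty 0. ANY B:Ty 0. ANY f:A -> B. ANY a:A. ANY b:A. ANY p:Eqt A a b.
  Eqt B (f $ a) (f $ b) :==
  Jd A (\<lambda>x y q. Eqt B (f $ x) (f $ y)) (\<lambda>x. idp (f $ x)) a b p) 0)"
schematic_goal Ap_sig: "lsig Ap_d ?n ?\<Gamma> ?R ?l ?b"
  by (rule sigI(2)[OF Ap_d_def], unfold px) (simp only: ev)
lemmas [ev] = lsigD[OF Ap_sig]
abbreviation "Ap A B f a b p \<equiv> pcon Ap_d [p, b, a, f, B, A]"
lemma Ap_clo [ev]: "ap i n = clo Ap_d i"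
  by (simp only: ap_def clo_def[of Ap_d] raw er_eqs ev)

definition "Concat_d = lamd 14 ((ANY A:Ty 0. ANY a:A. ANY b:A. ANY c:A. ANY p:Eqt A a b.
  (Eqt A b c -> Eqt A a c) :==
  Jd A (\<lambda>x y r. Eqt A y c -> Eqt A x c) (\<lambda>x. LAM s:Eqt A x c. s) a b p) 0)"
schematic_goal Concat_sig: "lsig Concat_d ?n ?\<Gamma> ?R ?l ?b"
  by (rule sigI(2)[OF Concat_d_def], unfold px) (simp only: ev)
lemmas [ev] = lsigD[OF Concat_sig]
abbreviation "Concat A a b c p \<equiv> pcon Concat_d [p, c, b, a, A]"
lemma Concat_clo [ev]: "concat i n = clo Concat_d i"
  by (simp only: concat_def clo_def[of Concat_d] raw er_eqs ev)

definition "FunextC_d = lamd 15 ((ANY A:Ty 0. ANY B:A -> Ty 0. ANY f:PI x:A. B $ x. ANY g:PI x:A. B $ x.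
  ((PI x:A. Eqt (B $ x) (f $ x) (g $ x)) -> Eqt (PI x:A. B $ x) f g) :==
  p1 (p1 (FunextAx A B f g))) 0)"
schematic_goal FunextC_sig: "lsig FunextC_d ?n ?\<Gamma> ?R ?l ?b"
  by (rule sigI(2)[OF FunextC_d_def], unfold px) (simp only: ev)
lemmas [ev] = lsigD[OF FunextC_sig]
abbreviation "FunextC A B f g \<equiv> pcon FunextC_d [g, f, B, A]"
lemma FunextC_clo [ev]: "funext i n = clo FunextC_d i"
  by (simp only: funext_def clo_def[of FunextC_d] raw er_eqs ev)

definition "Coh_d = lamd 16 ((ANY E:Ty 0. ANY F:Ty 0. ANY H:Ty 0. ANY g:E -> F. ANY f:F -> H. ANY a:E. ANY b:E. ANY c:F. ANY d:H. ANY p:Eqt E a b. ANY q:Eqt F (g $ b) c. ANY r:Eqt H (f $ c) d.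
  Eqt (Eqt H (f $ (g $ a)) d)
   (Concat H (f $ (g $ a)) (f $ (g $ b)) d (Ap E H (LAM e:E. f $ (g $ e)) a b p) $ (Concat H (f $ (g $ b)) (f $ c) d (Ap F H f (g $ b) c q) $ r))
   (Concat H (f $ (g $ a)) (f $ c) d (Ap F H f (g $ a) c (Concat F (g $ a) (g $ b) c (Ap E F g a b p) $ q)) $ r) :==
  Jd E (\<lambda>x y s. PI t:Eqt F (g $ y) c.
     Eqt (Eqt H (f $ (g $ x)) d)
      (Concat H (f $ (g $ x)) (f $ (g $ y)) d (Ap E H (LAM e:E. f $ (g $ e)) x y s) $ (Concat H (f $ (g $ y)) (f $ c) d (Ap F H f (g $ y) c t) $ r))
      (Concat H (f $ (g $ x)) (f $ c) d (Ap F H f (g $ x) c (Concat F (g $ x) (g $ y) c (Ap E F g x y s) $ t)) $ r))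
   (\<lambda>x. LAM t:Eqt F (g $ x) c. idp (Concat H (f $ (g $ x)) (f $ c) d (Ap F H f (g $ x) c t) $ r))
   a b p $ q) 0)"
schematic_goal Coh_sig: "lsig Coh_d ?n ?\<Gamma> ?R ?l ?b"
  by (rule sigI(2)[OF Coh_d_def], unfold px) (simp only: ev)
lemmas [ev] = lsigD[OF Coh_sig]
abbreviation "Coh E F H g f a b c d p q r \<equiv> pcon Coh_d [r, q, p, d, c, b, a, f, g, H, F, E]"
lemma Coh_clo [ev]: "ap_concat_coh i n = clo Coh_d i"
  by (simp only: ap_concat_coh_def clo_def[of Coh_d] raw er_eqs ev)

section \<open>Reflexive graphs and morphisms\<close>

text \<open>The inner parts of the nested sums get names of their own, as \<open>Hom1T\<close> does
  below; annotations of pairs and projections then mention a constant instead of a copy of the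
  type.\<close>

definition "ReflT_d = transp 17 ((ANY V:Ty 0. ANY E:V -> V -> Ty 0.
  Ty 0 :==
  PI x:V. E $ x $ x) 0)"
schematic_goal ReflT_sig: "tsig ReflT_d ?n ?\<Gamma> ?R ?l ?b"
  by (rule sigI(1)[OF ReflT_d_def], unfold px) (simp only: ev)
lemmas [ev] = tsigD[OF ReflT_sig]
abbreviation "ReflT V E \<equiv> pcon ReflT_d [E, V]"

definition "EdgesT_d = transp 18 ((ANY V:Ty 0.
  Ty (Suc 0) :==
  SIG E:V -> V -> Ty 0. ReflT V E) 0)"
schematic_goal EdgesT_sig: "tsig EdgesT_d ?n ?\<Gamma> ?R ?l ?b"
  by (rule sigI(1)[OF EdgesT_d_def], unfold px) (simp only: ev)
lemmas [ev] = tsigD[OF EdgesT_sig]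
abbreviation "EdgesT V \<equiv> pcon EdgesT_d [V]"

definition "Rgraph_d = transp 19 ((Ty (Suc 0) :==
  SIG V:Ty 0. EdgesT V) 0)"
schematic_goal Rgraph_sig: "tsig Rgraph_d ?n ?\<Gamma> ?R ?l ?b"
  by (rule sigI(1)[OF Rgraph_d_def], unfold px) (simp only: ev)
lemmas [ev] = tsigD[OF Rgraph_sig]
abbreviation "Rgraph \<equiv> pcon Rgraph_d []"

definition "Vert_d = transp 20 ((ANY G:Rgraph.
  Ty 0 :==
  p1 G) 0)"
schematic_goal Vert_sig: "tsig Vert_d ?n ?\<Gamma> ?R ?l ?b"
  by (rule sigI(1)[OF Vert_d_def], unfold px) (simp only: ev)
lemmas [ev] = tsigD[OF Vert_sig]
abbreviation "Vert G \<equiv> pcon Vert_d [G]"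

definition "Edges_d = transp 21 ((ANY G:Rgraph.
  (Vert G -> Vert G -> Ty 0) :==
  p1 (p2 G)) 0)"
schematic_goal Edges_sig: "tsig Edges_d ?n ?\<Gamma> ?R ?l ?b"
  by (rule sigI(1)[OF Edges_d_def], unfold px) (simp only: ev)
lemmas [ev] = tsigD[OF Edges_sig]
abbreviation "Edges G \<equiv> pcon Edges_d [G]"

definition "Edge_d = transp 22 ((ANY G:Rgraph. ANY x:Vert G. ANY y:Vert G.
  Ty 0 :==
  Edges G $ x $ y) 0)"
schematic_goal Edge_sig: "tsig Edge_d ?n ?\<Gamma> ?R ?l ?b"
  by (rule sigI(1)[OF Edge_d_def], unfold px) (simp only: ev)
lemmas [ev] = tsigD[OF Edge_sig]
abbreviation "Edge G x y \<equiv> pcon Edge_d [y, x, G]"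

definition "Rfx_d = transp 23 ((ANY G:Rgraph. ANY x:Vert G.
  Edge G x x :==
  p2 (p2 G) $ x) 0)"
schematic_goal Rfx_sig: "tsig Rfx_d ?n ?\<Gamma> ?R ?l ?b"
  by (rule sigI(1)[OF Rfx_d_def], unfold px) (simp only: ev)
lemmas [ev] = tsigD[OF Rfx_sig]
abbreviation "Rfx G x \<equiv> pcon Rfx_d [x, G]"

definition "EdgeMapT_d = transp 24 ((ANY G:Rgraph. ANY H:Rgraph. ANY f0:Vert G -> Vert H.
  Ty 0 :==
  PI x:Vert G. PI y:Vert G. Edge G x y -> Edge H (f0 $ x) (f0 $ y)) 0)"
schematic_goal EdgeMapT_sig: "tsig EdgeMapT_d ?n ?\<Gamma> ?R ?l ?b"
  by (rule sigI(1)[OF EdgeMapT_d_def], unfold px) (simp only: ev)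
lemmas [ev] = tsigD[OF EdgeMapT_sig]
abbreviation "EdgeMapT G H f0 \<equiv> pcon EdgeMapT_d [f0, H, G]"

definition "RfxMapT_d = transp 25 ((ANY G:Rgraph. ANY H:Rgraph. ANY f0:Vert G -> Vert H. ANY f1:EdgeMapT G H f0.
  Ty 0 :==
  PI x:Vert G. Eqt (Edge H (f0 $ x) (f0 $ x)) (f1 $ x $ x $ Rfx G x) (Rfx H (f0 $ x))) 0)"
schematic_goal RfxMapT_sig: "tsig RfxMapT_d ?n ?\<Gamma> ?R ?l ?b"
  by (rule sigI(1)[OF RfxMapT_d_def], unfold px) (simp only: ev)
lemmas [ev] = tsigD[OF RfxMapT_sig]
abbreviation "RfxMapT G H f0 f1 \<equiv> pcon RfxMapT_d [f1, f0, H, G]"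

definition "Hom1T_d = transp 26 ((ANY G:Rgraph. ANY H:Rgraph. ANY f0:Vert G -> Vert H.
  Ty 0 :==
  SIG f1:EdgeMapT G H f0. RfxMapT G H f0 f1) 0)"
schematic_goal Hom1T_sig: "tsig Hom1T_d ?n ?\<Gamma> ?R ?l ?b"
  by (rule sigI(1)[OF Hom1T_d_def], unfold px) (simp only: ev)
lemmas [ev] = tsigD[OF Hom1T_sig]
abbreviation "Hom1T G H f0 \<equiv> pcon Hom1T_d [f0, H, G]"

definition "Hom_d = lamd 27 ((ANY G:Rgraph. ANY H:Rgraph.
  Ty 0 :==
  SIG f0:Vert G -> Vert H. Hom1T G H f0) 0)"
schematic_goal Hom_sig: "lsig Hom_d ?n ?\<Gamma> ?R ?l ?b"
  by (rule sigI(2)[OF Hom_d_def], unfold px) (simp only: ev)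
lemmas [ev] = lsigD[OF Hom_sig]
abbreviation "Hom G H \<equiv> pcon Hom_d [H, G]"
lemma Hom_clo [ev]: "hom i n = clo Hom_d i"
  by (simp only: hom_def clo_def[of Hom_d] raw er_eqs ev)

definition "H0_d = transp 28 ((ANY G:Rgraph. ANY H:Rgraph. ANY f:Hom G H.
  (Vert G -> Vert H) :==
  p1 f) 0)"
schematic_goal H0_sig: "tsig H0_d ?n ?\<Gamma> ?R ?l ?b"
  by (rule sigI(1)[OF H0_d_def], unfold px) (simp only: ev)
lemmas [ev] = tsigD[OF H0_sig]
abbreviation "H0 G H f \<equiv> pcon H0_d [f, H, G]"

definition "H1_d = transp 29 ((ANY G:Rgraph. ANY H:Rgraph. ANY f:Hom G H.
  EdgeMapT G H (H0 G H f) :==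
  p1 (p2 f)) 0)"
schematic_goal H1_sig: "tsig H1_d ?n ?\<Gamma> ?R ?l ?b"
  by (rule sigI(1)[OF H1_d_def], unfold px) (simp only: ev)
lemmas [ev] = tsigD[OF H1_sig]
abbreviation "H1 G H f \<equiv> pcon H1_d [f, H, G]"

definition "H2_d = transp 30 ((ANY G:Rgraph. ANY H:Rgraph. ANY f:Hom G H.
  RfxMapT G H (H0 G H f) (H1 G H f) :==
  p2 (p2 f)) 0)"
schematic_goal H2_sig: "tsig H2_d ?n ?\<Gamma> ?R ?l ?b"
  by (rule sigI(1)[OF H2_d_def], unfold px) (simp only: ev)
lemmas [ev] = tsigD[OF H2_sig]
abbreviation "H2 G H f \<equiv> pcon H2_d [f, H, G]"

definition "OnV_d = transp 31 ((ANY G:Rgraph. ANY H:Rgraph. ANY f:Hom G H. ANY x:Vert G.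
  Vert H :==
  H0 G H f $ x) 0)"
schematic_goal OnV_sig: "tsig OnV_d ?n ?\<Gamma> ?R ?l ?b"
  by (rule sigI(1)[OF OnV_d_def], unfold px) (simp only: ev)
lemmas [ev] = tsigD[OF OnV_sig]
abbreviation "OnV G H f x \<equiv> pcon OnV_d [x, f, H, G]"

definition "OnE_d = transp 32 ((ANY G:Rgraph. ANY H:Rgraph. ANY f:Hom G H. ANY x:Vert G. ANY y:Vert G.
  (Edge G x y -> Edge H (OnV G H f x) (OnV G H f y)) :==
  H1 G H f $ x $ y) 0)"
schematic_goal OnE_sig: "tsig OnE_d ?n ?\<Gamma> ?R ?l ?b"
  by (rule sigI(1)[OF OnE_d_def], unfold px) (simp only: ev)
lemmas [ev] = tsigD[OF OnE_sig]
abbreviation "OnE G H f x y \<equiv> pcon OnE_d [y, x, f, H, G]"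

definition "OnR_d = transp 33 ((ANY G:Rgraph. ANY H:Rgraph. ANY f:Hom G H. ANY x:Vert G.
  Eqt (Edge H (OnV G H f x) (OnV G H f x)) (OnE G H f x x $ Rfx G x) (Rfx H (OnV G H f x)) :==
  H2 G H f $ x) 0)"
schematic_goal OnR_sig: "tsig OnR_d ?n ?\<Gamma> ?R ?l ?b"
  by (rule sigI(1)[OF OnR_d_def], unfold px) (simp only: ev)
lemmas [ev] = tsigD[OF OnR_sig]
abbreviation "OnR G H f x \<equiv> pcon OnR_d [x, f, H, G]"

section \<open>Composition and its associativity path\<close>

definition "Comp0_d = transp 34 ((ANY X:Rgraph. ANY Y:Rgraph. ANY Z:Rgraph. ANY g:Hom Y Z. ANY f:Hom X Y.
  (Vert X -> Vert Z) :==
  LAM x:Vert X. OnV Y Z g (OnV X Y f x)) 0)"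
schematic_goal Comp0_sig: "tsig Comp0_d ?n ?\<Gamma> ?R ?l ?b"
  by (rule sigI(1)[OF Comp0_d_def], unfold px) (simp only: ev)
lemmas [ev] = tsigD[OF Comp0_sig]
abbreviation "Comp0 X Y Z g f \<equiv> pcon Comp0_d [f, g, Z, Y, X]"

definition "Comp1_d = transp 35 ((ANY X:Rgraph. ANY Y:Rgraph. ANY Z:Rgraph. ANY g:Hom Y Z. ANY f:Hom X Y.
  EdgeMapT X Z (Comp0 X Y Z g f) :==
  LAM x:Vert X. LAM y:Vert X. LAM e:Edge X x y. OnE Y Z g (OnV X Y f x) (OnV X Y f y) $ (OnE X Y f x y $ e)) 0)"
schematic_goal Comp1_sig: "tsig Comp1_d ?n ?\<Gamma> ?R ?l ?b"
  by (rule sigI(1)[OF Comp1_d_def], unfold px) (simp only: ev)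
lemmas [ev] = tsigD[OF Comp1_sig]
abbreviation "Comp1 X Y Z g f \<equiv> pcon Comp1_d [f, g, Z, Y, X]"

definition "Comp2_d = transp 36 ((ANY X:Rgraph. ANY Y:Rgraph. ANY Z:Rgraph. ANY g:Hom Y Z. ANY f:Hom X Y.
  RfxMapT X Z (Comp0 X Y Z g f) (Comp1 X Y Z g f) :==
  LAM x:Vert X. Concat (Edge Z (OnV Y Z g (OnV X Y f x)) (OnV Y Z g (OnV X Y f x)))
      (OnE Y Z g (OnV X Y f x) (OnV X Y f x) $ (OnE X Y f x x $ Rfx X x))
      (OnE Y Z g (OnV X Y f x) (OnV X Y f x) $ Rfx Y (OnV X Y f x))
      (Rfx Z (OnV Y Z g (OnV X Y f x)))
      (Ap (Edge Y (OnV X Y f x) (OnV X Y f x)) (Edge Z (OnV Y Z g (OnV X Y f x)) (OnV Y Z g (OnV X Y f x)))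
         (OnE Y Z g (OnV X Y f x) (OnV X Y f x)) (OnE X Y f x x $ Rfx X x) (Rfx Y (OnV X Y f x)) (OnR X Y f x)) $
      OnR Y Z g (OnV X Y f x)) 0)"
schematic_goal Comp2_sig: "tsig Comp2_d ?n ?\<Gamma> ?R ?l ?b"
  by (rule sigI(1)[OF Comp2_d_def], unfold px) (simp only: ev)
lemmas [ev] = tsigD[OF Comp2_sig]
abbreviation "Comp2 X Y Z g f \<equiv> pcon Comp2_d [f, g, Z, Y, X]"

definition "Comp_d = lamd 37 ((ANY X:Rgraph. ANY Y:Rgraph. ANY Z:Rgraph. ANY g:Hom Y Z. ANY f:Hom X Y.
  Hom X Z :==
  <<Comp0 X Y Z g f, <<Comp1 X Y Z g f, Comp2 X Y Z g f>>>>) 0)"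
schematic_goal Comp_sig: "lsig Comp_d ?n ?\<Gamma> ?R ?l ?b"
  by (rule sigI(2)[OF Comp_d_def], unfold px) (simp only: ev)
lemmas [ev] = lsigD[OF Comp_sig]
abbreviation "Comp X Y Z g f \<equiv> pcon Comp_d [f, g, Z, Y, X]"
lemma Comp_clo [ev]: "comp i n = clo Comp_d i"
  by (simp only: comp_def clo_def[of Comp_d] raw er_eqs ev)

text \<open>\<open>AsL\<close>, \<open>AsR\<close> and \<open>AsD\<close> are \<open>l\<close>, \<open>r\<close> and \<open>D\<close> in \<open>comp_assoc\<close>.\<close>

abbreviation "AsL X Y B A f g j \<equiv> Comp X Y A (Comp Y B A f g) j"

abbreviation "AsR X Y B A f g j \<equiv> Comp X B A f (Comp X Y B g j)"

abbreviation "AsD X Y B A f g j x \<equiv> Eqt (Edge A (H0 X A (AsR X Y B A f g j) $ x) (H0 X A (AsR X Y B A f g j) $ x))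
     (H1 X A (AsR X Y B A f g j) $ x $ x $ Rfx X x) (Rfx A (H0 X A (AsR X Y B A f g j) $ x))"

text \<open>The reflexivity component of the left composite has a type over the maps of the right
  one because the vertex and edge maps of both composites agree judgementally.\<close>

definition "AssocHtpy_d = transp 38 ((ANY X:Rgraph. ANY Y:Rgraph. ANY B:Rgraph. ANY A:Rgraph. ANY f:Hom B A. ANY g:Hom Y B. ANY j:Hom X Y.
  (PI x:Vert X. Eqt (AsD X Y B A f g j x) (H2 X A (AsL X Y B A f g j) $ x) (H2 X A (AsR X Y B A f g j) $ x)) :==
  (LAM x:Vert X. Coh (Edge Y (OnV X Y j x) (OnV X Y j x))
          (Edge B (OnV Y B g (OnV X Y j x)) (OnV Y B g (OnV X Y j x)))
          (Edge A (OnV B A f (OnV Y B g (OnV X Y j x))) (OnV B A f (OnV Y B g (OnV X Y j x))))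
          (OnE Y B g (OnV X Y j x) (OnV X Y j x))
          (OnE B A f (OnV Y B g (OnV X Y j x)) (OnV Y B g (OnV X Y j x)))
          (OnE X Y j x x $ Rfx X x) (Rfx Y (OnV X Y j x)) (Rfx B (OnV Y B g (OnV X Y j x)))
          (Rfx A (OnV B A f (OnV Y B g (OnV X Y j x))))
          (OnR X Y j x) (OnR Y B g (OnV X Y j x)) (OnR B A f (OnV Y B g (OnV X Y j x))))) 0)"
schematic_goal AssocHtpy_sig: "tsig AssocHtpy_d ?n ?\<Gamma> ?R ?l ?b"
  by (rule sigI(1)[OF AssocHtpy_d_def], unfold px) (simp only: ev)
lemmas [ev] = tsigD[OF AssocHtpy_sig]
abbreviation "AssocHtpy X Y B A f g j \<equiv> pcon AssocHtpy_d [j, g, f, A, B, Y, X]"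

definition "AssocPath_d = transp 39 ((ANY X:Rgraph. ANY Y:Rgraph. ANY B:Rgraph. ANY A:Rgraph. ANY f:Hom B A. ANY g:Hom Y B. ANY j:Hom X Y.
  Eqt (PI x:Vert X. AsD X Y B A f g j x) (H2 X A (AsL X Y B A f g j)) (H2 X A (AsR X Y B A f g j)) :==
  FunextC (Vert X) (LAM x:Vert X. AsD X Y B A f g j x) (H2 X A (AsL X Y B A f g j)) (H2 X A (AsR X Y B A f g j)) $ AssocHtpy X Y B A f g j) 0)"
schematic_goal AssocPath_sig: "tsig AssocPath_d ?n ?\<Gamma> ?R ?l ?b"
  by (rule sigI(1)[OF AssocPath_d_def], unfold px) (simp only: ev)
lemmas [ev] = tsigD[OF AssocPath_sig]
abbreviation "AssocPath X Y B A f g j \<equiv> pcon AssocPath_d [j, g, f, A, B, Y, X]"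

definition "CompAssoc_d = lamd 40 ((ANY X:Rgraph. ANY Y:Rgraph. ANY B:Rgraph. ANY A:Rgraph. ANY f:Hom B A. ANY g:Hom Y B. ANY j:Hom X Y.
  Eqt (Hom X A) (AsL X Y B A f g j) (AsR X Y B A f g j) :==
  Ap (PI x:Vert X. AsD X Y B A f g j x) (Hom X A)
    (LAM s:(PI x:Vert X. AsD X Y B A f g j x). <<H0 X A (AsR X Y B A f g j), <<H1 X A (AsR X Y B A f g j), s>>>>)
    (H2 X A (AsL X Y B A f g j)) (H2 X A (AsR X Y B A f g j)) (AssocPath X Y B A f g j)) 0)"
schematic_goal CompAssoc_sig: "lsig CompAssoc_d ?n ?\<Gamma> ?R ?l ?b"
  by (rule sigI(2)[OF CompAssoc_d_def], unfold px) (simp only: ev)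
lemmas [ev] = lsigD[OF CompAssoc_sig]
abbreviation "CompAssoc X Y B A f g j \<equiv> pcon CompAssoc_d [j, g, f, A, B, Y, X]"
lemma CompAssoc_clo [ev]: "comp_assoc i n = clo CompAssoc_d i"
  by (simp only: comp_assoc_def clo_def[of CompAssoc_d] raw er_eqs ev)

section \<open>The unit graph and the walking edge\<close>

definition "UnitG_d = transp 41 ((Rgraph :==
  <<On, <<LAM x:On. LAM y:On. On, LAM x:On. st>>>>) 0)"
schematic_goal UnitG_sig: "tsig UnitG_d ?n ?\<Gamma> ?R ?l ?b"
  by (rule sigI(1)[OF UnitG_d_def], unfold px) (simp only: ev)
lemmas [ev] = tsigD[OF UnitG_sig]
abbreviation "UnitG \<equiv> pcon UnitG_d []"

definition "Tau_d = transp 42 ((ANY b:Tw.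
  Ty 0 :==
  TwI (\<lambda>x. Ty 0) Em On b) 0)"
schematic_goal Tau_sig: "tsig Tau_d ?n ?\<Gamma> ?R ?l ?b"
  by (rule sigI(1)[OF Tau_d_def], unfold px) (simp only: ev)
lemmas [ev] = tsigD[OF Tau_sig]
abbreviation "Tau b \<equiv> pcon Tau_d [b]"

definition "WalkE_d = transp 43 ((Rgraph :==
  <<Tw, <<LAM x:Tw. LAM y:Tw. Tau x -> Tau y, LAM x:Tw. LAM t:Tau x. t>>>>) 0)"
schematic_goal WalkE_sig: "tsig WalkE_d ?n ?\<Gamma> ?R ?l ?b"
  by (rule sigI(1)[OF WalkE_d_def], unfold px) (simp only: ev)
lemmas [ev] = tsigD[OF WalkE_sig]
abbreviation "WalkE \<equiv> pcon WalkE_d []"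

definition "VertexHom1_d = transp 44 ((ANY G:Rgraph. ANY v:Vert G.
  EdgeMapT UnitG G (LAM x:On. v) :==
  LAM x:On. LAM y:On. LAM e:On. Rfx G v) 0)"
schematic_goal VertexHom1_sig: "tsig VertexHom1_d ?n ?\<Gamma> ?R ?l ?b"
  by (rule sigI(1)[OF VertexHom1_d_def], unfold px) (simp only: ev)
lemmas [ev] = tsigD[OF VertexHom1_sig]
abbreviation "VertexHom1 G v \<equiv> pcon VertexHom1_d [v, G]"

definition "VertexHom2_d = transp 45 ((ANY G:Rgraph. ANY v:Vert G.
  RfxMapT UnitG G (LAM x:On. v) (VertexHom1 G v) :==
  LAM x:On. idp (Rfx G v)) 0)"
schematic_goal VertexHom2_sig: "tsig VertexHom2_d ?n ?\<Gamma> ?R ?l ?b"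
  by (rule sigI(1)[OF VertexHom2_d_def], unfold px) (simp only: ev)
lemmas [ev] = tsigD[OF VertexHom2_sig]
abbreviation "VertexHom2 G v \<equiv> pcon VertexHom2_d [v, G]"

definition "VertexHom_d = transp 46 ((ANY G:Rgraph. ANY v:Vert G.
  Hom UnitG G :==
  <<LAM x:On. v, <<VertexHom1 G v, VertexHom2 G v>>>>) 0)"
schematic_goal VertexHom_sig: "tsig VertexHom_d ?n ?\<Gamma> ?R ?l ?b"
  by (rule sigI(1)[OF VertexHom_d_def], unfold px) (simp only: ev)
lemmas [ev] = tsigD[OF VertexHom_sig]
abbreviation "VertexHom G v \<equiv> pcon VertexHom_d [v, G]"

section \<open>Pullbacks, fibrations and cartesian morphisms\<close>

definition "IsPb_d = lamd 47 ((ANY C:Ty 0. ANY P:Ty 0. ANY Q:Ty 0. ANY Z:Ty 0. ANY p:C -> P. ANY q:C -> Q. ANY u:P -> Z. ANY v:Q -> Z. ANY K:PI z:C. Eqt Z (u $ (p $ z)) (v $ (q $ z)).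
  Ty 0 :==
  Isequiv C (SIG a:P. SIG b:Q. Eqt Z (u $ a) (v $ b)) (LAM z:C. <<p $ z, <<q $ z, K $ z>>>>)) 0)"
schematic_goal IsPb_sig: "lsig IsPb_d ?n ?\<Gamma> ?R ?l ?b"
  by (rule sigI(2)[OF IsPb_d_def], unfold px) (simp only: ev)
lemmas [ev] = lsigD[OF IsPb_sig]
abbreviation "IsPb C P Q Z p q u v K \<equiv> pcon IsPb_d [K, v, u, q, p, Z, Q, P, C]"
lemma IsPb_clo [ev]: "is_pullback i n = clo IsPb_d i"
  by (simp only: is_pullback_def clo_def[of IsPb_d] raw er_eqs ev)

definition "ROrth_d = lamd 48 ((ANY X:Rgraph. ANY Y:Rgraph. ANY B:Rgraph. ANY A:Rgraph. ANY j:Hom X Y. ANY f:Hom B A.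
  Ty 0 :==
  IsPb (Hom Y B) (Hom Y A) (Hom X B) (Hom X A)
   (LAM g:Hom Y B. Comp Y B A f g) (LAM g:Hom Y B. Comp X Y B g j) (LAM g:Hom Y A. Comp X Y A g j) (LAM g:Hom X B. Comp X B A f g)
   (LAM g:Hom Y B. CompAssoc X Y B A f g j)) 0)"
schematic_goal ROrth_sig: "lsig ROrth_d ?n ?\<Gamma> ?R ?l ?b"
  by (rule sigI(2)[OF ROrth_d_def], unfold px) (simp only: ev)
lemmas [ev] = lsigD[OF ROrth_sig]
abbreviation "ROrth X Y B A j f \<equiv> pcon ROrth_d [f, j, A, B, Y, X]"
lemma ROrth_clo [ev]: "right_orthogonal i n = clo ROrth_d i"
  by (simp only: right_orthogonal_def clo_def[of ROrth_d] raw er_eqs ev)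

definition "LFib_d = lamd 49 ((ANY B:Rgraph. ANY A:Rgraph. ANY f:Hom B A.
  Ty 0 :==
  ROrth UnitG WalkE B A (VertexHom WalkE ff) f) 0)"
schematic_goal LFib_sig: "lsig LFib_d ?n ?\<Gamma> ?R ?l ?b"
  by (rule sigI(2)[OF LFib_d_def], unfold px) (simp only: ev)
lemmas [ev] = lsigD[OF LFib_sig]
abbreviation "LFib B A f \<equiv> pcon LFib_d [f, A, B]"
lemma LFib_clo [ev]: "left_fibration i n = clo LFib_d i"
  by (simp only: left_fibration_def clo_def[of LFib_d] raw er_eqs ev)

definition "RFib_d = lamd 50 ((ANY B:Rgraph. ANY A:Rgraph. ANY f:Hom B A.
  Ty 0 :==
  ROrth UnitG WalkE B A (VertexHom WalkE tt) f) 0)"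
schematic_goal RFib_sig: "lsig RFib_d ?n ?\<Gamma> ?R ?l ?b"
  by (rule sigI(2)[OF RFib_d_def], unfold px) (simp only: ev)
lemmas [ev] = lsigD[OF RFib_sig]
abbreviation "RFib B A f \<equiv> pcon RFib_d [f, A, B]"
lemma RFib_clo [ev]: "right_fibration i n = clo RFib_d i"
  by (simp only: right_fibration_def clo_def[of RFib_d] raw er_eqs ev)

definition "Fib_d = lamd 51 ((ANY B:Rgraph. ANY A:Rgraph. ANY f:Hom B A.
  Ty 0 :==
  LFib B A f ** RFib B A f) 0)"
schematic_goal Fib_sig: "lsig Fib_d ?n ?\<Gamma> ?R ?l ?b"
  by (rule sigI(2)[OF Fib_d_def], unfold px) (simp only: ev)
lemmas [ev] = lsigD[OF Fib_sig]
abbreviation "Fib B A f \<equiv> pcon Fib_d [f, A, B]"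
lemma Fib_clo [ev]: "fibration i n = clo Fib_d i"
  by (simp only: fibration_def clo_def[of Fib_d] raw er_eqs ev)

definition "TotE_d = transp 52 ((ANY G:Rgraph.
  Ty 0 :==
  SIG x:Vert G. SIG y:Vert G. Edge G x y) 0)"
schematic_goal TotE_sig: "tsig TotE_d ?n ?\<Gamma> ?R ?l ?b"
  by (rule sigI(1)[OF TotE_d_def], unfold px) (simp only: ev)
lemmas [ev] = tsigD[OF TotE_sig]
abbreviation "TotE G \<equiv> pcon TotE_d [G]"

definition "Src_d = transp 53 ((ANY G:Rgraph. ANY z:TotE G.
  Vert G :==
  p1 z) 0)"
schematic_goal Src_sig: "tsig Src_d ?n ?\<Gamma> ?R ?l ?b"
  by (rule sigI(1)[OF Src_d_def], unfold px) (simp only: ev)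
lemmas [ev] = tsigD[OF Src_sig]
abbreviation "Src G z \<equiv> pcon Src_d [z, G]"

definition "Tgt_d = transp 54 ((ANY G:Rgraph. ANY z:TotE G.
  Vert G :==
  p1 (p2 z)) 0)"
schematic_goal Tgt_sig: "tsig Tgt_d ?n ?\<Gamma> ?R ?l ?b"
  by (rule sigI(1)[OF Tgt_d_def], unfold px) (simp only: ev)
lemmas [ev] = tsigD[OF Tgt_sig]
abbreviation "Tgt G z \<equiv> pcon Tgt_d [z, G]"

definition "OnT_d = transp 55 ((ANY G:Rgraph. ANY H:Rgraph. ANY f:Hom G H. ANY z:TotE G.
  TotE H :==
  <<OnV G H f (Src G z), <<OnV G H f (Tgt G z), OnE G H f (Src G z) (Tgt G z) $ p2 (p2 z)>>>>) 0)"
schematic_goal OnT_sig: "tsig OnT_d ?n ?\<Gamma> ?R ?l ?b"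
  by (rule sigI(1)[OF OnT_d_def], unfold px) (simp only: ev)
lemmas [ev] = tsigD[OF OnT_sig]
abbreviation "OnT G H f z \<equiv> pcon OnT_d [z, f, H, G]"

definition "LCart_d = lamd 56 ((ANY B:Rgraph. ANY A:Rgraph. ANY f:Hom B A.
  Ty 0 :==
  IsPb (TotE B) (TotE A) (Vert B) (Vert A) (LAM z:TotE B. OnT B A f z) (LAM z:TotE B. Src B z) (LAM z:TotE A. Src A z)
   (LAM x:Vert B. OnV B A f x) (LAM z:TotE B. idp (OnV B A f (Src B z)))) 0)"
schematic_goal LCart_sig: "lsig LCart_d ?n ?\<Gamma> ?R ?l ?b"
  by (rule sigI(2)[OF LCart_d_def], unfold px) (simp only: ev)
lemmas [ev] = lsigD[OF LCart_sig]
abbreviation "LCart B A f \<equiv> pcon LCart_d [f, A, B]"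
lemma LCart_clo [ev]: "left_cartesian i n = clo LCart_d i"
  by (simp only: left_cartesian_def clo_def[of LCart_d] raw er_eqs ev)

definition "RCart_d = lamd 57 ((ANY B:Rgraph. ANY A:Rgraph. ANY f:Hom B A.
  Ty 0 :==
  IsPb (TotE B) (TotE A) (Vert B) (Vert A) (LAM z:TotE B. OnT B A f z) (LAM z:TotE B. Tgt B z) (LAM z:TotE A. Tgt A z)
   (LAM x:Vert B. OnV B A f x) (LAM z:TotE B. idp (OnV B A f (Tgt B z)))) 0)"
schematic_goal RCart_sig: "lsig RCart_d ?n ?\<Gamma> ?R ?l ?b"
  by (rule sigI(2)[OF RCart_d_def], unfold px) (simp only: ev)
lemmas [ev] = lsigD[OF RCart_sig]
abbreviation "RCart B A f \<equiv> pcon RCart_d [f, A, B]"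
lemma RCart_clo [ev]: "right_cartesian i n = clo RCart_d i"
  by (simp only: right_cartesian_def clo_def[of RCart_d] raw er_eqs ev)

definition "Cart_d = lamd 58 ((ANY B:Rgraph. ANY A:Rgraph. ANY f:Hom B A.
  Ty 0 :==
  LCart B A f ** RCart B A f) 0)"
schematic_goal Cart_sig: "lsig Cart_d ?n ?\<Gamma> ?R ?l ?b"
  by (rule sigI(2)[OF Cart_d_def], unfold px) (simp only: ev)
lemmas [ev] = lsigD[OF Cart_sig]
abbreviation "Cart B A f \<equiv> pcon Cart_d [f, A, B]"
lemma Cart_clo [ev]: "cartesian i n = clo Cart_d i"
  by (simp only: cartesian_def clo_def[of Cart_d] raw er_eqs ev)


section \<open>Identity types\<close>

definition "Sym_d = transp 59 ((ANY A:Ty 0. ANY a:A. ANY b:A. ANY p:Eqt A a b.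
  Eqt A b a :==
  Jd A (\<lambda>x y q. Eqt A y x) (\<lambda>x. idp x) a b p) 0)"
schematic_goal Sym_sig: "tsig Sym_d ?n ?\<Gamma> ?R ?l ?b"
  by (rule sigI(1)[OF Sym_d_def], unfold px) (simp only: ev)
lemmas [ev] = tsigD[OF Sym_sig]
abbreviation "Sym A a b p \<equiv> pcon Sym_d [p, b, a, A]"

definition "Trans_d = transp 60 ((ANY A:Ty 0. ANY a:A. ANY b:A. ANY c:A. ANY p:Eqt A a b. ANY q:Eqt A b c.
  Eqt A a c :==
  Concat A a b c p $ q) 0)"
schematic_goal Trans_sig: "tsig Trans_d ?n ?\<Gamma> ?R ?l ?b"
  by (rule sigI(1)[OF Trans_d_def], unfold px) (simp only: ev)
lemmas [ev] = tsigD[OF Trans_sig]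
abbreviation "Trans A a b c p q \<equiv> pcon Trans_d [q, p, c, b, a, A]"

text \<open>Opaque, like the other principles that enter later constructions only through their
  type; what has to compute later, such as \<open>Jr\<close>, stays transparent.\<close>

definition "Tr_d = opaq 61 ((ANY A:Ty 0. ANY P:A -> Ty 0. ANY a:A. ANY b:A. ANY p:Eqt A a b. ANY d:P $ a.
  P $ b :==
  Jd A (\<lambda>x y q. P $ x -> P $ y) (\<lambda>x. LAM d:P $ x. d) a b p $ d) 0)"
schematic_goal Tr_sig: "osig Tr_d ?n ?\<Gamma> ?R ?l"
  by (rule sigI(3)[OF Tr_d_def], unfold px) (simp only: ev)
lemmas [ev] = osigD[OF Tr_sig]
abbreviation "Tr A P a b p d \<equiv> pcon Tr_d [d, p, b, a, P, A]"

text \<open>\<open>J\<close> moves both endpoints. Quantifying over the family inside the motive, at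
  the price of one universe, gives induction with the right endpoint fixed. It has to compute at
  reflexivity for the sake of \<open>IvP\<close>.\<close>

definition "Jr_d = transp 62 ((ANY A:Ty 0. ANY b:A. ANY P:PI x:A. Eqt A x b -> Ty 0. ANY d:P $ b $ idp b. ANY a:A. ANY p:Eqt A a b.
  P $ a $ p :==
  Jd A (\<lambda>x y q. PI P:(PI z:A. Eqt A z y -> Ty 0). P $ y $ idp y -> P $ x $ q)
    (\<lambda>x. LAM P:(PI z:A. Eqt A z x -> Ty 0). LAM d:P $ x $ idp x. d) a b p $ P $ d) 0)"
schematic_goal Jr_sig: "tsig Jr_d ?n ?\<Gamma> ?R ?l ?b"
  by (rule sigI(1)[OF Jr_d_def], unfold px) (simp only: ev)
lemmas [ev] = tsigD[OF Jr_sig]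
abbreviation "Jr A b P d a p \<equiv> pcon Jr_d [p, a, d, P, b, A]"

definition "Jl_d = opaq 63 ((ANY A:Ty 0. ANY a:A. ANY P:PI x:A. Eqt A a x -> Ty 0. ANY d:P $ a $ idp a. ANY b:A. ANY p:Eqt A a b.
  P $ b $ p :==
  Jd A (\<lambda>x y q. PI P:(PI z:A. Eqt A x z -> Ty 0). P $ x $ idp x -> P $ y $ q)
    (\<lambda>x. LAM P:(PI z:A. Eqt A x z -> Ty 0). LAM d:P $ x $ idp x. d) a b p $ P $ d) 0)"
schematic_goal Jl_sig: "osig Jl_d ?n ?\<Gamma> ?R ?l"
  by (rule sigI(3)[OF Jl_d_def], unfold px) (simp only: ev)
lemmas [ev] = osigD[OF Jl_sig]
abbreviation "Jl A a P d b p \<equiv> pcon Jl_d [p, b, d, P, a, A]"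

definition "SymTrans_d = opaq 64 ((ANY A:Ty 0. ANY a:A. ANY b:A. ANY p:Eqt A a b.
  Eqt (Eqt A b b) (Trans A b a b (Sym A a b p) p) (idp b) :==
  Jd A (\<lambda>x y q. Eqt (Eqt A y y) (Trans A y x y (Sym A x y q) q) (idp y)) (\<lambda>x. idp (idp x)) a b p) 0)"
schematic_goal SymTrans_sig: "osig SymTrans_d ?n ?\<Gamma> ?R ?l"
  by (rule sigI(3)[OF SymTrans_d_def], unfold px) (simp only: ev)
lemmas [ev] = osigD[OF SymTrans_sig]
abbreviation "SymTrans A a b p \<equiv> pcon SymTrans_d [p, b, a, A]"

section \<open>Functions out of small types\<close>

definition "FunExt_d = opaq 65 ((ANY A:Ty 0. ANY B:A -> Ty 0. ANY f:PI x:A. B $ x. ANY g:PI x:A. B $ x. ANY h:PI x:A. Eqt (B $ x) (f $ x) (g $ x).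
  Eqt (PI x:A. B $ x) f g :==
  FunextC A B f g $ h) 0)"
schematic_goal FunExt_sig: "osig FunExt_d ?n ?\<Gamma> ?R ?l"
  by (rule sigI(3)[OF FunExt_d_def], unfold px) (simp only: ev)
lemmas [ev] = osigD[OF FunExt_sig]
abbreviation "FunExt A B f g h \<equiv> pcon FunExt_d [h, g, f, B, A]"

text \<open>\<open>Two\<close> has no eta rule, so a function and the case distinction on its values
  are identified by function extensionality. The motive is transported along this path, and only
  functions given by cases remain to be treated.\<close>

definition "TwoElim_d = opaq 66 ((ANY P:Tw -> Ty 0. ANY Q:(PI b:Tw. P $ b) -> Ty 0. ANY d:PI x:P $ ff. PI y:P $ tt. Q $ (LAM b:Tw. TwI (\<lambda>b. P $ b) x y b). ANY f:PI b:Tw. P $ b.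
  Q $ f :==
  Tr (PI b:Tw. P $ b) Q (LAM b:Tw. TwI (\<lambda>b. P $ b) (f $ ff) (f $ tt) b) f
   (FunExt Tw P (LAM b:Tw. TwI (\<lambda>b. P $ b) (f $ ff) (f $ tt) b) f
     (LAM b:Tw. TwI (\<lambda>b. Eqt (P $ b) (TwI (\<lambda>b. P $ b) (f $ ff) (f $ tt) b) (f $ b)) (idp (f $ ff)) (idp (f $ tt)) b))
   (d $ (f $ ff) $ (f $ tt))) 0)"
schematic_goal TwoElim_sig: "osig TwoElim_d ?n ?\<Gamma> ?R ?l"
  by (rule sigI(3)[OF TwoElim_d_def], unfold px) (simp only: ev)
lemmas [ev] = osigD[OF TwoElim_sig]
abbreviation "TwoElim P Q d f \<equiv> pcon TwoElim_d [f, d, Q, P]"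

text \<open>A function on a contractible type is connected by a path to the constant function at its
  value on the centre.\<close>

definition "ContrElim_d = opaq 67 ((ANY X:Ty 0. ANY c:X. ANY h:PI x:X. Eqt X c x. ANY W:Ty 0. ANY Q:(X -> W) -> Ty 0. ANY d:PI w:W. Q $ (LAM x:X. w). ANY k:X -> W.
  Q $ k :==
  Tr (X -> W) Q (LAM x:X. k $ c) k (FunExt X (LAM x:X. W) (LAM x:X. k $ c) k (LAM x:X. Ap X W k c x (h $ x))) (d $ (k $ c))) 0)"
schematic_goal ContrElim_sig: "osig ContrElim_d ?n ?\<Gamma> ?R ?l"
  by (rule sigI(3)[OF ContrElim_d_def], unfold px) (simp only: ev)
lemmas [ev] = osigD[OF ContrElim_sig]
abbreviation "ContrElim X c h W Q d k \<equiv> pcon ContrElim_d [k, d, Q, W, h, c, X]"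

text \<open>Stated for any domain with a map to \<open>Em\<close>, because it is applied to
  \<open>On -> Em\<close>, the edges from 1 to 0 of the walking edge.\<close>

definition "EmptyElim_d = opaq 68 ((ANY X:Ty 0. ANY n:X -> Em. ANY W:Ty 0. ANY Q:(X -> W) -> Ty 0. ANY d:Q $ (LAM x:X. EmI (\<lambda>u. W) (n $ x)). ANY k:X -> W.
  Q $ k :==
  Tr (X -> W) Q (LAM x:X. EmI (\<lambda>u. W) (n $ x)) k
    (FunExt X (LAM x:X. W) (LAM x:X. EmI (\<lambda>u. W) (n $ x)) k (LAM x:X. EmI (\<lambda>u. Eqt W (EmI (\<lambda>u. W) (n $ x)) (k $ x)) (n $ x))) d) 0)"
schematic_goal EmptyElim_sig: "osig EmptyElim_d ?n ?\<Gamma> ?R ?l"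
  by (rule sigI(3)[OF EmptyElim_d_def], unfold px) (simp only: ev)
lemmas [ev] = osigD[OF EmptyElim_sig]
abbreviation "EmptyElim X n W Q d k \<equiv> pcon EmptyElim_d [k, d, Q, W, n, X]"

definition "OneContr_d = opaq 69 ((ANY x:On.
  Eqt On st x :==
  OnI (\<lambda>u. Eqt On st u) (idp st) x) 0)"
schematic_goal OneContr_sig: "osig OneContr_d ?n ?\<Gamma> ?R ?l"
  by (rule sigI(3)[OF OneContr_d_def], unfold px) (simp only: ev)
lemmas [ev] = osigD[OF OneContr_sig]
abbreviation "OneContr x \<equiv> pcon OneContr_d [x]"

definition "OneElim_d = opaq 70 ((ANY W:Ty 0. ANY Q:(On -> W) -> Ty 0. ANY d:PI w:W. Q $ (LAM x:On. w). ANY k:On -> W.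
  Q $ k :==
  ContrElim On st (LAM x:On. OneContr x) W Q d k) 0)"
schematic_goal OneElim_sig: "osig OneElim_d ?n ?\<Gamma> ?R ?l"
  by (rule sigI(3)[OF OneElim_d_def], unfold px) (simp only: ev)
lemmas [ev] = osigD[OF OneElim_sig]
abbreviation "OneElim W Q d k \<equiv> pcon OneElim_d [k, d, Q, W]"

definition "FromEmptyContr_d = opaq 71 ((ANY Y:Ty 0. ANY c:Em -> Y. ANY x:Em -> Y.
  Eqt (Em -> Y) c x :==
  FunExt Em (LAM u:Em. Y) c x (LAM u:Em. EmI (\<lambda>v. Eqt Y (c $ u) (x $ u)) u)) 0)"
schematic_goal FromEmptyContr_sig: "osig FromEmptyContr_d ?n ?\<Gamma> ?R ?l"
  by (rule sigI(3)[OF FromEmptyContr_d_def], unfold px) (simp only: ev)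
lemmas [ev] = osigD[OF FromEmptyContr_sig]
abbreviation "FromEmptyContr Y c x \<equiv> pcon FromEmptyContr_d [x, c, Y]"

text \<open>These are the edges from 1 to 1 of the walking edge. Without an eta rule for
  \<open>Unit\<close>, contractibility needs induction on it together with function
  extensionality.\<close>

definition "OneEndoContr_d = opaq 72 ((ANY x:On -> On.
  Eqt (On -> On) (LAM t:On. t) x :==
  FunExt On (LAM u:On. On) (LAM t:On. t) x (LAM t:On. Trans On t st (x $ t) (Sym On st t (OneContr t)) (OneContr (x $ t)))) 0)"
schematic_goal OneEndoContr_sig: "osig OneEndoContr_d ?n ?\<Gamma> ?R ?l"
  by (rule sigI(3)[OF OneEndoContr_d_def], unfold px) (simp only: ev)
lemmas [ev] = osigD[OF OneEndoContr_sig]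
abbreviation "OneEndoContr x \<equiv> pcon OneEndoContr_d [x]"


section \<open>Morphisms from the unit graph and from the walking edge\<close>

text \<open>The vertex map, the edge map in each of its three arguments, and the reflexivity
  component become constant by \<open>OneElim\<close>. What remains beside the vertex is a loop
  \<open>e\<close> with a path to reflexivity, a pair that \<open>Jr\<close> contracts to
  reflexivity itself.\<close>

definition "HomUnitElim_d = opaq 73 ((ANY G:Rgraph. ANY Q:Hom UnitG G -> Ty 0. ANY d:PI v:Vert G. Q $ VertexHom G v. ANY h:Hom UnitG G.
  Q $ h :==
  OneElim (Vert G) (LAM f0:On -> Vert G. PI f1:EdgeMapT UnitG G f0. PI r:RfxMapT UnitG G f0 f1. Q $ <<f0, <<f1, r>>>>)
   (LAM v:Vert G. LAM f1:(PI x:On. PI y:On. PI e:On. Edge G v v).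
     OneElim (On -> On -> Edge G v v)
       (LAM f1:(On -> On -> On -> Edge G v v). PI r:(PI x:On. Eqt (Edge G v v) (f1 $ x $ x $ st) (Rfx G v)). Q $ <<LAM x:On. v, <<f1, r>>>>)
       (LAM f2:(On -> On -> Edge G v v). OneElim (On -> Edge G v v)
         (LAM f2:(On -> On -> Edge G v v). PI r:(PI x:On. Eqt (Edge G v v) (f2 $ x $ st) (Rfx G v)). Q $ <<LAM x:On. v, <<LAM x:On. f2, r>>>>)
         (LAM f3:(On -> Edge G v v). OneElim (Edge G v v)
           (LAM f3:(On -> Edge G v v). PI r:(PI x:On. Eqt (Edge G v v) (f3 $ st) (Rfx G v)). Q $ <<LAM x:On. v, <<LAM x:On. LAM y:On. f3, r>>>>)
           (LAM e:Edge G v v. LAM r:(PI x:On. Eqt (Edge G v v) e (Rfx G v)).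
             OneElim (Eqt (Edge G v v) e (Rfx G v))
               (LAM r:(On -> Eqt (Edge G v v) e (Rfx G v)). Q $ <<LAM x:On. v, <<LAM x:On. LAM y:On. LAM z:On. e, r>>>>)
               (LAM r:Eqt (Edge G v v) e (Rfx G v).
                  Jr (Edge G v v) (Rfx G v)
                     (LAM e:Edge G v v. LAM r:Eqt (Edge G v v) e (Rfx G v). Q $ <<LAM x:On. v, <<LAM x:On. LAM y:On. LAM z:On. e, LAM x:On. r>>>>)
                     (d $ v) e r)
               r)
           f3)
         f2)
       f1)
   (H0 UnitG G h) $ H1 UnitG G h $ H2 UnitG G h) 0)"
schematic_goal HomUnitElim_sig: "osig HomUnitElim_d ?n ?\<Gamma> ?R ?l"
  by (rule sigI(3)[OF HomUnitElim_d_def], unfold px) (simp only: ev)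
lemmas [ev] = osigD[OF HomUnitElim_sig]
abbreviation "HomUnitElim G Q d h \<equiv> pcon HomUnitElim_d [h, d, Q, G]"

definition "Ev1_d = transp 74 ((ANY G:Rgraph. ANY h:Hom UnitG G.
  Vert G :==
  OnV UnitG G h st) 0)"
schematic_goal Ev1_sig: "tsig Ev1_d ?n ?\<Gamma> ?R ?l ?b"
  by (rule sigI(1)[OF Ev1_d_def], unfold px) (simp only: ev)
lemmas [ev] = tsigD[OF Ev1_sig]
abbreviation "Ev1 G h \<equiv> pcon Ev1_d [h, G]"

definition "PreK_d = opaq 75 ((ANY G:Rgraph. ANY h:Hom UnitG G.
  Eqt (Hom UnitG G) (VertexHom G (Ev1 G h)) h :==
  HomUnitElim G (LAM h:Hom UnitG G. Eqt (Hom UnitG G) (VertexHom G (Ev1 G h)) h) (LAM v:Vert G. idp (VertexHom G v)) h) 0)"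
schematic_goal PreK_sig: "osig PreK_d ?n ?\<Gamma> ?R ?l"
  by (rule sigI(3)[OF PreK_d_def], unfold px) (simp only: ev)
lemmas [ev] = osigD[OF PreK_sig]
abbreviation "PreK G h \<equiv> pcon PreK_d [h, G]"

text \<open>\<open>PreK\<close> need not be reflexivity at \<open>VertexHom G v\<close>; \<open>Kap\<close> is corrected so as to be, which makes \<open>ApEvKap\<close> true.\<close>

definition "Kap_d = transp 76 ((ANY G:Rgraph. ANY h:Hom UnitG G.
  Eqt (Hom UnitG G) (VertexHom G (Ev1 G h)) h :==
  Trans (Hom UnitG G) (VertexHom G (Ev1 G h)) (VertexHom G (Ev1 G h)) h
   (Sym (Hom UnitG G) (VertexHom G (Ev1 G h)) (VertexHom G (Ev1 G h)) (PreK G (VertexHom G (Ev1 G h)))) (PreK G h)) 0)"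
schematic_goal Kap_sig: "tsig Kap_d ?n ?\<Gamma> ?R ?l ?b"
  by (rule sigI(1)[OF Kap_d_def], unfold px) (simp only: ev)
lemmas [ev] = tsigD[OF Kap_sig]
abbreviation "Kap G h \<equiv> pcon Kap_d [h, G]"

text \<open>Evaluating \<open>VertexHom G v\<close> returns \<open>v\<close> judgementally, so both
  paths composed in \<open>Kap\<close> are the same \<open>PreK\<close>, one of them
  inverted.\<close>

definition "KapV_d = opaq 77 ((ANY G:Rgraph. ANY v:Vert G.
  Eqt (Eqt (Hom UnitG G) (VertexHom G v) (VertexHom G v)) (Kap G (VertexHom G v)) (idp (VertexHom G v)) :==
  SymTrans (Hom UnitG G) (VertexHom G v) (VertexHom G v) (PreK G (VertexHom G v))) 0)"
schematic_goal KapV_sig: "osig KapV_d ?n ?\<Gamma> ?R ?l"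
  by (rule sigI(3)[OF KapV_d_def], unfold px) (simp only: ev)
lemmas [ev] = osigD[OF KapV_sig]
abbreviation "KapV G v \<equiv> pcon KapV_d [v, G]"

definition "ApEv_d = transp 78 ((ANY G:Rgraph. ANY h:Hom UnitG G. ANY k:Hom UnitG G. ANY p:Eqt (Hom UnitG G) h k.
  Eqt (Vert G) (Ev1 G h) (Ev1 G k) :==
  Ap (Hom UnitG G) (Vert G) (LAM h:Hom UnitG G. Ev1 G h) h k p) 0)"
schematic_goal ApEv_sig: "tsig ApEv_d ?n ?\<Gamma> ?R ?l ?b"
  by (rule sigI(1)[OF ApEv_d_def], unfold px) (simp only: ev)
lemmas [ev] = tsigD[OF ApEv_sig]
abbreviation "ApEv G h k p \<equiv> pcon ApEv_d [p, k, h, G]"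

text \<open>On \<open>VertexHom G v\<close> this is the image of \<open>KapV\<close> under
  \<open>ApEv\<close>; the general case is reduced to it by \<open>HomUnitElim\<close>.\<close>

definition "ApEvKap_d = opaq 79 ((ANY G:Rgraph. ANY h:Hom UnitG G.
  Eqt (Eqt (Vert G) (Ev1 G h) (Ev1 G h)) (ApEv G (VertexHom G (Ev1 G h)) h (Kap G h)) (idp (Ev1 G h)) :==
  HomUnitElim G (LAM h:Hom UnitG G. Eqt (Eqt (Vert G) (Ev1 G h) (Ev1 G h)) (ApEv G (VertexHom G (Ev1 G h)) h (Kap G h)) (idp (Ev1 G h)))
   (LAM v:Vert G. Ap (Eqt (Hom UnitG G) (VertexHom G v) (VertexHom G v)) (Eqt (Vert G) v v)
      (LAM p:Eqt (Hom UnitG G) (VertexHom G v) (VertexHom G v). ApEv G (VertexHom G v) (VertexHom G v) p)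
      (Kap G (VertexHom G v)) (idp (VertexHom G v)) (KapV G v)) h) 0)"
schematic_goal ApEvKap_sig: "osig ApEvKap_d ?n ?\<Gamma> ?R ?l"
  by (rule sigI(3)[OF ApEvKap_d_def], unfold px) (simp only: ev)
lemmas [ev] = osigD[OF ApEvKap_sig]
abbreviation "ApEvKap G h \<equiv> pcon ApEvKap_d [h, G]"

definition "Fibre_d = transp 80 ((ANY G:Rgraph. ANY h:Hom UnitG G.
  Ty 0 :==
  SIG x:Vert G. Eqt (Hom UnitG G) (VertexHom G x) h) 0)"
schematic_goal Fibre_sig: "tsig Fibre_d ?n ?\<Gamma> ?R ?l ?b"
  by (rule sigI(1)[OF Fibre_d_def], unfold px) (simp only: ev)
lemmas [ev] = tsigD[OF Fibre_sig]
abbreviation "Fibre G h \<equiv> pcon Fibre_d [h, G]"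

text \<open>With \<open>x\<close> fixed and the other end of \<open>p\<close> free, path induction
  leaves the case of reflexivity, where the centre is \<open>Kap\<close> at
  \<open>VertexHom G x\<close> and \<open>KapV\<close> applies.\<close>

definition "FibreContr_d = opaq 81 ((ANY G:Rgraph. ANY h:Hom UnitG G. ANY x:Vert G. ANY p:Eqt (Hom UnitG G) (VertexHom G x) h.
  Eqt (Fibre G h) <<Ev1 G h, Kap G h>> <<x, p>> :==
  Jl (Hom UnitG G) (VertexHom G x) (LAM h:Hom UnitG G. LAM p:Eqt (Hom UnitG G) (VertexHom G x) h. Eqt (Fibre G h) <<Ev1 G h, Kap G h>> <<x, p>>)
   (Ap (Eqt (Hom UnitG G) (VertexHom G x) (VertexHom G x)) (Fibre G (VertexHom G x))
     (LAM q:Eqt (Hom UnitG G) (VertexHom G x) (VertexHom G x). <<x, q>>) (Kap G (VertexHom G x)) (idp (VertexHom G x)) (KapV G x))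
   h p) 0)"
schematic_goal FibreContr_sig: "osig FibreContr_d ?n ?\<Gamma> ?R ?l"
  by (rule sigI(3)[OF FibreContr_d_def], unfold px) (simp only: ev)
lemmas [ev] = osigD[OF FibreContr_sig]
abbreviation "FibreContr G h x p \<equiv> pcon FibreContr_d [p, x, h, G]"

definition "FibreElim_d = opaq 82 ((ANY G:Rgraph. ANY h:Hom UnitG G. ANY Q:PI x:Vert G. Eqt (Hom UnitG G) (VertexHom G x) h -> Ty 0. ANY d:Q $ Ev1 G h $ Kap G h. ANY x:Vert G. ANY p:Eqt (Hom UnitG G) (VertexHom G x) h.
  Q $ x $ p :==
  Tr (Fibre G h) (LAM s:Fibre G h. Q $ p1 s $ p2 s) <<Ev1 G h, Kap G h>> <<x, p>> (FibreContr G h x p) d) 0)"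
schematic_goal FibreElim_sig: "osig FibreElim_d ?n ?\<Gamma> ?R ?l"
  by (rule sigI(3)[OF FibreElim_d_def], unfold px) (simp only: ev)
lemmas [ev] = osigD[OF FibreElim_sig]
abbreviation "FibreElim G h Q d x p \<equiv> pcon FibreElim_d [p, x, d, Q, h, G]"

section \<open>Morphisms from the walking edge as edges\<close>

text \<open>\<open>LAM t:Em. st\<close> is the chosen edge from 0 to 1;
  \<open>FromEmptyContr\<close> identifies it with every other one.\<close>

definition "EvI_d = transp 83 ((ANY G:Rgraph. ANY g:Hom WalkE G.
  TotE G :==
  <<OnV WalkE G g ff, <<OnV WalkE G g tt, OnE WalkE G g ff tt $ (LAM t:Em. st)>>>>) 0)"
schematic_goal EvI_sig: "tsig EvI_d ?n ?\<Gamma> ?R ?l ?b"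
  by (rule sigI(1)[OF EvI_d_def], unfold px) (simp only: ev)
lemmas [ev] = tsigD[OF EvI_sig]
abbreviation "EvI G g \<equiv> pcon EvI_d [g, G]"

definition "Pt_d = transp 84 ((ANY V:Ty 0. ANY x:V. ANY y:V.
  (Tw -> V) :==
  LAM b:Tw. TwI (\<lambda>b. V) x y b) 0)"
schematic_goal Pt_sig: "tsig Pt_d ?n ?\<Gamma> ?R ?l ?b"
  by (rule sigI(1)[OF Pt_d_def], unfold px) (simp only: ev)
lemmas [ev] = tsigD[OF Pt_sig]
abbreviation "Pt V x y \<equiv> pcon Pt_d [y, x, V]"

text \<open>The general edge map up to paths: one edge for each of the three inhabited hom types,
  and an elimination from \<open>Em\<close> for the edges from 1 to 0. The loops \<open>u\<close>
  and \<open>v\<close> stay arbitrary until the reflexivity component is known.\<close>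

definition "EdF_d = transp 85 ((ANY G:Rgraph. ANY x:Vert G. ANY y:Vert G. ANY u:Edge G x x. ANY e:Edge G x y. ANY v:Edge G y y.
  EdgeMapT WalkE G (Pt (Vert G) x y) :==
  LAM a:Tw. TwI (\<lambda>a. PI b:Tw. (Tau a -> Tau b) -> Edge G (Pt (Vert G) x y $ a) (Pt (Vert G) x y $ b))
    (LAM b:Tw. TwI (\<lambda>b. (Em -> Tau b) -> Edge G x (Pt (Vert G) x y $ b)) (LAM k:Em -> Em. u) (LAM k:Em -> On. e) b)
    (LAM b:Tw. TwI (\<lambda>b. (On -> Tau b) -> Edge G y (Pt (Vert G) x y $ b)) (LAM k:On -> Em. EmI (\<lambda>u. Edge G y x) (k $ st)) (LAM k:On -> On. v) b)
    a) 0)"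
schematic_goal EdF_sig: "tsig EdF_d ?n ?\<Gamma> ?R ?l ?b"
  by (rule sigI(1)[OF EdF_d_def], unfold px) (simp only: ev)
lemmas [ev] = tsigD[OF EdF_sig]
abbreviation "EdF G x y u e v \<equiv> pcon EdF_d [v, e, u, y, x, G]"

definition "RfF_d = transp 86 ((ANY G:Rgraph. ANY x:Vert G. ANY y:Vert G. ANY u:Edge G x x. ANY e:Edge G x y. ANY v:Edge G y y. ANY r:Eqt (Edge G x x) u (Rfx G x). ANY s:Eqt (Edge G y y) v (Rfx G y).
  RfxMapT WalkE G (Pt (Vert G) x y) (EdF G x y u e v) :==
  LAM a:Tw. TwI (\<lambda>a. Eqt (Edge G (Pt (Vert G) x y $ a) (Pt (Vert G) x y $ a)) (EdF G x y u e v $ a $ a $ (LAM t:Tau a. t)) (Rfx G (Pt (Vert G) x y $ a))) r s a) 0)"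
schematic_goal RfF_sig: "tsig RfF_d ?n ?\<Gamma> ?R ?l ?b"
  by (rule sigI(1)[OF RfF_d_def], unfold px) (simp only: ev)
lemmas [ev] = tsigD[OF RfF_sig]
abbreviation "RfF G x y u e v r s \<equiv> pcon RfF_d [s, r, v, e, u, y, x, G]"

definition "IvI_d = transp 87 ((ANY G:Rgraph. ANY z:TotE G.
  Hom WalkE G :==
  <<Pt (Vert G) (Src G z) (Tgt G z),
   <<EdF G (Src G z) (Tgt G z) (Rfx G (Src G z)) (p2 (p2 z)) (Rfx G (Tgt G z)),
    RfF G (Src G z) (Tgt G z) (Rfx G (Src G z)) (p2 (p2 z)) (Rfx G (Tgt G z)) (idp (Rfx G (Src G z))) (idp (Rfx G (Tgt G z)))>>>>) 0)"
schematic_goal IvI_sig: "tsig IvI_d ?n ?\<Gamma> ?R ?l ?b"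
  by (rule sigI(1)[OF IvI_d_def], unfold px) (simp only: ev)
lemmas [ev] = tsigD[OF IvI_sig]
abbreviation "IvI G z \<equiv> pcon IvI_d [z, G]"

abbreviation "QI G Q x y f1 \<equiv> PI r:RfxMapT WalkE G (Pt (Vert G) x y) f1. Q $ <<Pt (Vert G) x y, <<f1, r>>>>"

text \<open>The reflexivity component amounts to its two values, which are paths from
  \<open>u\<close> and \<open>v\<close> to reflexivity; path induction contracts both pairs, and
  only the edge \<open>e\<close> survives.\<close>

definition "HomWalkElim3_d = opaq 88 ((ANY G:Rgraph. ANY Q:Hom WalkE G -> Ty 0. ANY d:PI z:TotE G. Q $ IvI G z. ANY x:Vert G. ANY y:Vert G. ANY u:Edge G x x. ANY e:Edge G x y. ANY v:Edge G y y. ANY r:RfxMapT WalkE G (Pt (Vert G) x y) (EdF G x y u e v).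
  Q $ <<Pt (Vert G) x y, <<EdF G x y u e v, r>>>> :==
  TwoElim (LAM a:Tw. Eqt (Edge G (Pt (Vert G) x y $ a) (Pt (Vert G) x y $ a)) (EdF G x y u e v $ a $ a $ (LAM t:Tau a. t)) (Rfx G (Pt (Vert G) x y $ a)))
    (LAM r:RfxMapT WalkE G (Pt (Vert G) x y) (EdF G x y u e v). Q $ <<Pt (Vert G) x y, <<EdF G x y u e v, r>>>>)
    (LAM r:Eqt (Edge G x x) u (Rfx G x). LAM s:Eqt (Edge G y y) v (Rfx G y).
       Jr (Edge G x x) (Rfx G x) (LAM u:Edge G x x. LAM r:Eqt (Edge G x x) u (Rfx G x). Q $ <<Pt (Vert G) x y, <<EdF G x y u e v, RfF G x y u e v r s>>>>)
         (Jr (Edge G y y) (Rfx G y) (LAM v:Edge G y y. LAM s:Eqt (Edge G y y) v (Rfx G y).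
             Q $ <<Pt (Vert G) x y, <<EdF G x y (Rfx G x) e v, RfF G x y (Rfx G x) e v (idp (Rfx G x)) s>>>>) (d $ <<x, <<y, e>>>>) v s)
         u r)
    r) 0)"
schematic_goal HomWalkElim3_sig: "osig HomWalkElim3_d ?n ?\<Gamma> ?R ?l"
  by (rule sigI(3)[OF HomWalkElim3_d_def], unfold px) (simp only: ev)
lemmas [ev] = osigD[OF HomWalkElim3_sig]
abbreviation "HomWalkElim3 G Q d x y u e v r \<equiv> pcon HomWalkElim3_d [r, v, e, u, y, x, d, Q, G]"

abbreviation "QK G Q x y k00 k01 k10 k11 \<equiv> QI G Q x y (LAM a:Tw. TwI (\<lambda>a. PI b:Tw. (Tau a -> Tau b) -> Edge G (Pt (Vert G) x y $ a) (Pt (Vert G) x y $ b))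
    (LAM b:Tw. TwI (\<lambda>b. (Em -> Tau b) -> Edge G x (Pt (Vert G) x y $ b)) k00 k01 b)
    (LAM b:Tw. TwI (\<lambda>b. (On -> Tau b) -> Edge G y (Pt (Vert G) x y $ b)) k10 k11 b) a)"

text \<open>Two applications of case distinction split the edge map into four functions, on
  \<open>Em -> Em\<close>, \<open>Em -> On\<close>, \<open>On -> Em\<close> and
  \<open>On -> On\<close>. Three of these domains are contractible and the third listed is empty,
  which brings the edge map into the form \<open>EdF\<close>.\<close>

definition "HomWalkElim2_d = opaq 89 ((ANY G:Rgraph. ANY Q:Hom WalkE G -> Ty 0. ANY d:PI z:TotE G. Q $ IvI G z. ANY x:Vert G. ANY y:Vert G. ANY f1:EdgeMapT WalkE G (Pt (Vert G) x y).
  QI G Q x y f1 :==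
  TwoElim (LAM a:Tw. PI b:Tw. (Tau a -> Tau b) -> Edge G (Pt (Vert G) x y $ a) (Pt (Vert G) x y $ b))
   (LAM f1:EdgeMapT WalkE G (Pt (Vert G) x y). QI G Q x y f1)
   (LAM k0:(PI b:Tw. (Em -> Tau b) -> Edge G x (Pt (Vert G) x y $ b)).
    LAM k1:(PI b:Tw. (On -> Tau b) -> Edge G y (Pt (Vert G) x y $ b)).
    TwoElim (LAM b:Tw. (Em -> Tau b) -> Edge G x (Pt (Vert G) x y $ b))
     (LAM k0:(PI b:Tw. (Em -> Tau b) -> Edge G x (Pt (Vert G) x y $ b)).
       QI G Q x y (LAM a:Tw. TwI (\<lambda>a. PI b:Tw. (Tau a -> Tau b) -> Edge G (Pt (Vert G) x y $ a) (Pt (Vert G) x y $ b)) k0 k1 a))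
     (LAM k00:((Em -> Em) -> Edge G x x). LAM k01:((Em -> On) -> Edge G x y).
      TwoElim (LAM b:Tw. (On -> Tau b) -> Edge G y (Pt (Vert G) x y $ b))
       (LAM k1:(PI b:Tw. (On -> Tau b) -> Edge G y (Pt (Vert G) x y $ b)).
         QI G Q x y (LAM a:Tw. TwI (\<lambda>a. PI b:Tw. (Tau a -> Tau b) -> Edge G (Pt (Vert G) x y $ a) (Pt (Vert G) x y $ b))
            (LAM b:Tw. TwI (\<lambda>b. (Em -> Tau b) -> Edge G x (Pt (Vert G) x y $ b)) k00 k01 b) k1 a))
       (LAM k10:((On -> Em) -> Edge G y x). LAM k11:((On -> On) -> Edge G y y).
         ContrElim (Em -> Em) (LAM t:Em. t) (LAM h:Em -> Em. FromEmptyContr Em (LAM t:Em. t) h) (Edge G x x)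
          (LAM k00:((Em -> Em) -> Edge G x x). QK G Q x y k00 k01 k10 k11)
          (LAM u:Edge G x x. ContrElim (Em -> On) (LAM t:Em. st) (LAM h:Em -> On. FromEmptyContr On (LAM t:Em. st) h) (Edge G x y)
            (LAM k01:((Em -> On) -> Edge G x y). QK G Q x y (LAM k:Em -> Em. u) k01 k10 k11)
            (LAM e:Edge G x y. EmptyElim (On -> Em) (LAM k:On -> Em. k $ st) (Edge G y x)
              (LAM k10:((On -> Em) -> Edge G y x). QK G Q x y (LAM k:Em -> Em. u) (LAM k:Em -> On. e) k10 k11)
              (ContrElim (On -> On) (LAM t:On. t) (LAM h:On -> On. OneEndoContr h) (Edge G y y)
                (LAM k11:((On -> On) -> Edge G y y). QK G Q x y (LAM k:Em -> Em. u) (LAM k:Em -> On. e) (LAM k:On -> Em. EmI (\<lambda>u. Edge G y x) (k $ st)) k11)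
                (LAM v:Edge G y y. LAM r:RfxMapT WalkE G (Pt (Vert G) x y) (EdF G x y u e v). HomWalkElim3 G Q d x y u e v r)
                k11)
              k10)
            k01)
          k00)
       k1)
     k0)
   f1) 0)"
schematic_goal HomWalkElim2_sig: "osig HomWalkElim2_d ?n ?\<Gamma> ?R ?l"
  by (rule sigI(3)[OF HomWalkElim2_d_def], unfold px) (simp only: ev)
lemmas [ev] = osigD[OF HomWalkElim2_sig]
abbreviation "HomWalkElim2 G Q d x y f1 \<equiv> pcon HomWalkElim2_d [f1, y, x, d, Q, G]"

definition "HomWalkElim_d = opaq 90 ((ANY G:Rgraph. ANY Q:Hom WalkE G -> Ty 0. ANY d:PI z:TotE G. Q $ IvI G z. ANY g:Hom WalkE G.
  Q $ g :==
  TwoElim (LAM b:Tw. Vert G) (LAM f0:Tw -> Vert G. PI f1:EdgeMapT WalkE G f0. PI r:RfxMapT WalkE G f0 f1. Q $ <<f0, <<f1, r>>>>)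
   (LAM x:Vert G. LAM y:Vert G. LAM f1:EdgeMapT WalkE G (Pt (Vert G) x y). HomWalkElim2 G Q d x y f1)
   (H0 WalkE G g) $ H1 WalkE G g $ H2 WalkE G g) 0)"
schematic_goal HomWalkElim_sig: "osig HomWalkElim_d ?n ?\<Gamma> ?R ?l"
  by (rule sigI(3)[OF HomWalkElim_d_def], unfold px) (simp only: ev)
lemmas [ev] = osigD[OF HomWalkElim_sig]
abbreviation "HomWalkElim G Q d g \<equiv> pcon HomWalkElim_d [g, d, Q, G]"

text \<open>Reflexivity suffices on the canonical morphisms because the opposite composite,
  \<open>EvI\<close> after \<open>IvI\<close>, is the identity judgementally.\<close>

definition "IvEv_d = opaq 91 ((ANY G:Rgraph. ANY g:Hom WalkE G.
  Eqt (Hom WalkE G) (IvI G (EvI G g)) g :==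
  HomWalkElim G (LAM g:Hom WalkE G. Eqt (Hom WalkE G) (IvI G (EvI G g)) g) (LAM z:TotE G. idp (IvI G z)) g) 0)"
schematic_goal IvEv_sig: "osig IvEv_d ?n ?\<Gamma> ?R ?l"
  by (rule sigI(3)[OF IvEv_d_def], unfold px) (simp only: ev)
lemmas [ev] = osigD[OF IvEv_sig]
abbreviation "IvEv G g \<equiv> pcon IvEv_d [g, G]"


section \<open>Comparison of the gap maps\<close>

text \<open>If the gap map \<open>F\<close> is an equivalence, then so is \<open>G\<close>.  The map \<open>i\<close> need not be a left inverse of \<open>e\<close>.\<close>

definition "Transfer_d = opaq 92 ((ANY C:Ty 0. ANY D:Ty 0. ANY P:Ty 0. ANY Q:Ty 0. ANY F:C -> P. ANY G:D -> Q. ANY e:C -> D. ANY i:D -> C. ANY m:P -> Q. ANY n:Q -> P. ANY ei:PI z:D. Eqt D (e $ (i $ z)) z. ANY nm:PI w:P. Eqt P (n $ (m $ w)) w. ANY mn:PI w:Q. Eqt Q (m $ (n $ w)) w. ANY sq:PI c:C. Eqt Q (m $ (F $ c)) (G $ (e $ c)). ANY q:Isequiv C P F.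
  Isequiv D Q G :==
  <<<<LAM w:Q. e $ (p1 (p1 q) $ (n $ w)),
    LAM w:Q. Trans Q (G $ (e $ (p1 (p1 q) $ (n $ w)))) (m $ (F $ (p1 (p1 q) $ (n $ w)))) w
      (Sym Q (m $ (F $ (p1 (p1 q) $ (n $ w)))) (G $ (e $ (p1 (p1 q) $ (n $ w)))) (sq $ (p1 (p1 q) $ (n $ w))))
      (Trans Q (m $ (F $ (p1 (p1 q) $ (n $ w)))) (m $ (n $ w)) w
        (Ap P Q m (F $ (p1 (p1 q) $ (n $ w))) (n $ w) (p2 (p1 q) $ (n $ w))) (mn $ w))>>,
   <<LAM w:Q. e $ (p1 (p2 q) $ (n $ w)),
    LAM z:D. Tr D (LAM z:D. Eqt D (e $ (p1 (p2 q) $ (n $ (G $ z)))) z) (e $ (i $ z)) z (ei $ z)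
      (Tr Q (LAM w:Q. Eqt D (e $ (p1 (p2 q) $ (n $ w))) (e $ (i $ z))) (m $ (F $ (i $ z))) (G $ (e $ (i $ z))) (sq $ (i $ z))
        (Ap C D e (p1 (p2 q) $ (n $ (m $ (F $ (i $ z))))) (i $ z)
          (Trans C (p1 (p2 q) $ (n $ (m $ (F $ (i $ z))))) (p1 (p2 q) $ (F $ (i $ z))) (i $ z)
            (Ap P C (p1 (p2 q)) (n $ (m $ (F $ (i $ z)))) (F $ (i $ z)) (nm $ (F $ (i $ z)))) (p2 (p2 q) $ (i $ z)))))>>>>) 0)"
schematic_goal Transfer_sig: "osig Transfer_d ?n ?\<Gamma> ?R ?l"
  by (rule sigI(3)[OF Transfer_d_def], unfold px) (simp only: ev)
lemmas [ev] = osigD[OF Transfer_sig]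
abbreviation "Transfer C D P Q F G e i m n ei nm mn sq q \<equiv> pcon Transfer_d [q, sq, mn, nm, ei, n, m, i, e, G, F, Q, P, D, C]"

text \<open>Evaluation at the vertex sees only the first component. After path induction on
  \<open>p\<close> both applications of \<open>Ap\<close> compute to reflexivity.\<close>

definition "ApEvThird_d = opaq 93 ((ANY G:Rgraph. ANY f0:On -> Vert G. ANY f1:EdgeMapT UnitG G f0. ANY r:RfxMapT UnitG G f0 f1. ANY s:RfxMapT UnitG G f0 f1. ANY p:Eqt (RfxMapT UnitG G f0 f1) r s.
  Eqt (Eqt (Vert G) (f0 $ st) (f0 $ st))
   (ApEv G <<f0, <<f1, r>>>> <<f0, <<f1, s>>>> (Ap (RfxMapT UnitG G f0 f1) (Hom UnitG G) (LAM t:RfxMapT UnitG G f0 f1. <<f0, <<f1, t>>>>) r s p))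
   (idp (f0 $ st)) :==
  Jd (RfxMapT UnitG G f0 f1) (\<lambda>r s p. Eqt (Eqt (Vert G) (f0 $ st) (f0 $ st))
     (ApEv G <<f0, <<f1, r>>>> <<f0, <<f1, s>>>> (Ap (RfxMapT UnitG G f0 f1) (Hom UnitG G) (LAM t:RfxMapT UnitG G f0 f1. <<f0, <<f1, t>>>>) r s p))
     (idp (f0 $ st))) (\<lambda>r. idp (idp (f0 $ st))) r s p) 0)"
schematic_goal ApEvThird_sig: "osig ApEvThird_d ?n ?\<Gamma> ?R ?l"
  by (rule sigI(3)[OF ApEvThird_d_def], unfold px) (simp only: ev)
lemmas [ev] = osigD[OF ApEvThird_sig]
abbreviation "ApEvThird G f0 f1 r s p \<equiv> pcon ApEvThird_d [p, s, r, f1, f0, G]"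

abbreviation "PA Y B A f g j \<equiv> OnV B A f (OnV Y B g (Ev1 Y j))"

text \<open>\<open>CompAssoc\<close> unfolds to the application of \<open>Ap\<close> treated in
  \<open>ApEvThird\<close>, whatever path function extensionality provides between the reflexivity
  components.\<close>

definition "ApEvAssoc_d = opaq 94 ((ANY Y:Rgraph. ANY B:Rgraph. ANY A:Rgraph. ANY f:Hom B A. ANY g:Hom Y B. ANY j:Hom UnitG Y.
  Eqt (Eqt (Vert A) (PA Y B A f g j) (PA Y B A f g j))
   (ApEv A (AsL UnitG Y B A f g j) (AsR UnitG Y B A f g j) (CompAssoc UnitG Y B A f g j)) (idp (PA Y B A f g j)) :==
  ApEvThird A (H0 UnitG A (AsR UnitG Y B A f g j)) (H1 UnitG A (AsR UnitG Y B A f g j))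
      (H2 UnitG A (AsL UnitG Y B A f g j)) (H2 UnitG A (AsR UnitG Y B A f g j)) (AssocPath UnitG Y B A f g j)) 0)"
schematic_goal ApEvAssoc_sig: "osig ApEvAssoc_d ?n ?\<Gamma> ?R ?l"
  by (rule sigI(3)[OF ApEvAssoc_d_def], unfold px) (simp only: ev)
lemmas [ev] = osigD[OF ApEvAssoc_sig]
abbreviation "ApEvAssoc Y B A f g j \<equiv> pcon ApEvAssoc_d [j, g, f, A, B, Y]"

text \<open>The left (\<open>s = False\<close>) and right (\<open>s = True\<close>) cases are treated uniformly: \<open>Nr\<close> is the end of an edge that is
  kept by the restriction along \<open>Vx\<close>, and \<open>Fr\<close> is the other one.\<close>

abbreviation "Vx s  \<equiv> VertexHom WalkE (side s ff tt)"

abbreviation "Ed s A x y \<equiv> side s (Edge A x y) (Edge A y x)"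

abbreviation "Tri s x y e \<equiv> side s <<x, <<y, e>>>> <<y, <<x, e>>>>"

abbreviation "Nr s A z \<equiv> side s (Src A z) (Tgt A z)"

abbreviation "Fr s A z \<equiv> side s (Tgt A z) (Src A z)"

abbreviation "SFib s B A f \<equiv> side s (LFib B A f) (RFib B A f)"

abbreviation "SCart s B A f \<equiv> side s (LCart B A f) (RCart B A f)"

section \<open>The two pullbacks and their gap maps\<close>

text \<open>The codomain of the orthogonality gap map. Both sides share one text but carry different
  numbers, since declarations are told apart by \<open>dno\<close>.\<close>

definition "Gap1T_d s = transp (side s 95 96) ((ANY B:Rgraph. ANY A:Rgraph. ANY f:Hom B A.
  Ty 0 :==
  SIG a:Hom WalkE A. SIG b:Hom UnitG B. Eqt (Hom UnitG A) (Comp UnitG WalkE A a (Vx s)) (Comp UnitG B A f b)) 0)"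
schematic_goal Gap1T_sig: "tsig (Gap1T_d False) ?n ?\<Gamma> ?R ?l ?b" "tsig (Gap1T_d True) ?n' ?\<Gamma>' ?R' ?l' ?b'"
  by (rule sigI(1)[OF Gap1T_d_def], unfold px, simp only: ev)+
lemmas [ev] = tsigD[OF Gap1T_sig(1)] tsigD[OF Gap1T_sig(2)]
abbreviation "Gap1T s B A f \<equiv> pcon (Gap1T_d s) [f, A, B]"

definition "Gap2T_d s = transp (side s 97 98) ((ANY B:Rgraph. ANY A:Rgraph. ANY f:Hom B A.
  Ty 0 :==
  SIG z:TotE A. SIG b:Vert B. Eqt (Vert A) (Nr s A z) (OnV B A f b)) 0)"
schematic_goal Gap2T_sig: "tsig (Gap2T_d False) ?n ?\<Gamma> ?R ?l ?b" "tsig (Gap2T_d True) ?n' ?\<Gamma>' ?R' ?l' ?b'"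
  by (rule sigI(1)[OF Gap2T_d_def], unfold px, simp only: ev)+
lemmas [ev] = tsigD[OF Gap2T_sig(1)] tsigD[OF Gap2T_sig(2)]
abbreviation "Gap2T s B A f \<equiv> pcon (Gap2T_d s) [f, A, B]"

definition "Gap1_d s = transp (side s 99 100) ((ANY B:Rgraph. ANY A:Rgraph. ANY f:Hom B A. ANY g:Hom WalkE B.
  Gap1T s B A f :==
  <<Comp WalkE B A f g, <<Comp UnitG WalkE B g (Vx s), CompAssoc UnitG WalkE B A f g (Vx s)>>>>) 0)"
schematic_goal Gap1_sig: "tsig (Gap1_d False) ?n ?\<Gamma> ?R ?l ?b" "tsig (Gap1_d True) ?n' ?\<Gamma>' ?R' ?l' ?b'"
  by (rule sigI(1)[OF Gap1_d_def], unfold px, simp only: ev)+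
lemmas [ev] = tsigD[OF Gap1_sig(1)] tsigD[OF Gap1_sig(2)]
abbreviation "Gap1 s B A f g \<equiv> pcon (Gap1_d s) [g, f, A, B]"

definition "Gap2_d s = transp (side s 101 102) ((ANY B:Rgraph. ANY A:Rgraph. ANY f:Hom B A. ANY z:TotE B.
  Gap2T s B A f :==
  <<OnT B A f z, <<Nr s B z, idp (OnV B A f (Nr s B z))>>>>) 0)"
schematic_goal Gap2_sig: "tsig (Gap2_d False) ?n ?\<Gamma> ?R ?l ?b" "tsig (Gap2_d True) ?n' ?\<Gamma>' ?R' ?l' ?b'"
  by (rule sigI(1)[OF Gap2_d_def], unfold px, simp only: ev)+
lemmas [ev] = tsigD[OF Gap2_sig(1)] tsigD[OF Gap2_sig(2)]
abbreviation "Gap2 s B A f z \<equiv> pcon (Gap2_d s) [z, f, A, B]"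

text \<open>The path from \<open>ApEv\<close> fits the target because evaluating a restriction along
  a vertex, or a composite with \<open>f\<close>, gives the near vertex and the image under
  \<open>f\<close> by computation.\<close>

definition "EvP_d s = transp (side s 103 104) ((ANY B:Rgraph. ANY A:Rgraph. ANY f:Hom B A. ANY w:Gap1T s B A f.
  Gap2T s B A f :==
  <<EvI A (p1 w), <<Ev1 B (p1 (p2 w)), ApEv A (Comp UnitG WalkE A (p1 w) (Vx s)) (Comp UnitG B A f (p1 (p2 w))) (p2 (p2 w))>>>>) 0)"
schematic_goal EvP_sig: "tsig (EvP_d False) ?n ?\<Gamma> ?R ?l ?b" "tsig (EvP_d True) ?n' ?\<Gamma>' ?R' ?l' ?b'"
  by (rule sigI(1)[OF EvP_d_def], unfold px, simp only: ev)+
lemmas [ev] = tsigD[OF EvP_sig(1)] tsigD[OF EvP_sig(2)]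
abbreviation "EvP s B A f w \<equiv> pcon (EvP_d s) [w, f, A, B]"

text \<open>The two types of \<open>p\<close> are convertible.  Naming the conversion keeps the later conversion problems small.\<close>

definition "Cast_d s = transp (side s 105 106) ((ANY B:Rgraph. ANY A:Rgraph. ANY f:Hom B A. ANY b:Vert B. ANY x:Vert A. ANY y:Vert A. ANY e:Ed s A x y. ANY p:Eqt (Hom UnitG A) (VertexHom A x) (Comp UnitG B A f (VertexHom B b)).
  Eqt (Hom UnitG A) (Comp UnitG WalkE A (IvI A (Tri s x y e)) (Vx s)) (Comp UnitG B A f (VertexHom B b)) :==
  p) 0)"
schematic_goal Cast_sig: "tsig (Cast_d False) ?n ?\<Gamma> ?R ?l ?b" "tsig (Cast_d True) ?n' ?\<Gamma>' ?R' ?l' ?b'"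
  by (rule sigI(1)[OF Cast_d_def], unfold px, simp only: ev)+
lemmas [ev] = tsigD[OF Cast_sig(1)] tsigD[OF Cast_sig(2)]
abbreviation "Cast s B A f b x y e p \<equiv> pcon (Cast_d s) [p, e, y, x, b, f, A, B]"

text \<open>The inverse at a triple whose path is reflexivity. \<open>Kap\<close> is indispensable
  here: composing \<open>f\<close> with \<open>VertexHom B b\<close> does not give
  \<open>VertexHom\<close> at the image of \<open>b\<close> judgementally.\<close>

definition "IvPt_d s = transp (side s 107 108) ((ANY B:Rgraph. ANY A:Rgraph. ANY f:Hom B A. ANY b:Vert B. ANY y:Vert A. ANY e:Ed s A (OnV B A f b) y.
  Gap1T s B A f :==
  <<IvI A (Tri s (OnV B A f b) y e), <<VertexHom B b, Cast s B A f b (OnV B A f b) y e (Kap A (Comp UnitG B A f (VertexHom B b)))>>>>) 0)"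
schematic_goal IvPt_sig: "tsig (IvPt_d False) ?n ?\<Gamma> ?R ?l ?b" "tsig (IvPt_d True) ?n' ?\<Gamma>' ?R' ?l' ?b'"
  by (rule sigI(1)[OF IvPt_d_def], unfold px, simp only: ev)+
lemmas [ev] = tsigD[OF IvPt_sig(1)] tsigD[OF IvPt_sig(2)]
abbreviation "IvPt s B A f b y e \<equiv> pcon (IvPt_d s) [e, y, b, f, A, B]"

text \<open>The near vertex is contracted onto the image of \<open>b\<close> with the far vertex and
  the edge generalized over it, which avoids an explicit transport of edges.\<close>

definition "IvP_d s = transp (side s 109 110) ((ANY B:Rgraph. ANY A:Rgraph. ANY f:Hom B A. ANY w:Gap2T s B A f.
  Gap1T s B A f :==
  Jr (Vert A) (OnV B A f (p1 (p2 w))) (LAM x:Vert A. LAM p:Eqt (Vert A) x (OnV B A f (p1 (p2 w))). PI y:Vert A. Ed s A x y -> Gap1T s B A f)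
   (LAM y:Vert A. LAM e:Ed s A (OnV B A f (p1 (p2 w))) y. IvPt s B A f (p1 (p2 w)) y e)
   (Nr s A (p1 w)) (p2 (p2 w)) $ Fr s A (p1 w) $ p2 (p2 (p1 w))) 0)"
schematic_goal IvP_sig: "tsig (IvP_d False) ?n ?\<Gamma> ?R ?l ?b" "tsig (IvP_d True) ?n' ?\<Gamma>' ?R' ?l' ?b'"
  by (rule sigI(1)[OF IvP_d_def], unfold px, simp only: ev)+
lemmas [ev] = tsigD[OF IvP_sig(1)] tsigD[OF IvP_sig(2)]
abbreviation "IvP s B A f w \<equiv> pcon (IvP_d s) [w, f, A, B]"

text \<open>The edge and the vertex return judgementally; the path returns as the evaluation of
  \<open>Kap\<close>, which \<open>ApEvKap\<close> makes reflexivity.\<close>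

definition "EvIvPt_d s = opaq (side s 111 112) ((ANY B:Rgraph. ANY A:Rgraph. ANY f:Hom B A. ANY b:Vert B. ANY y:Vert A. ANY e:Ed s A (OnV B A f b) y.
  Eqt (Gap2T s B A f) (EvP s B A f (IvPt s B A f b y e)) <<(Tri s (OnV B A f b) y e), <<b, idp (OnV B A f b)>>>> :==
  Ap (Eqt (Vert A) (OnV B A f b) (OnV B A f b)) (Gap2T s B A f)
       (LAM q:Eqt (Vert A) (OnV B A f b) (OnV B A f b). <<(Tri s (OnV B A f b) y e), <<b, q>>>>)
       (ApEv A (VertexHom A (OnV B A f b)) (Comp UnitG B A f (VertexHom B b)) (Kap A (Comp UnitG B A f (VertexHom B b))))
       (idp (OnV B A f b))
       (ApEvKap A (Comp UnitG B A f (VertexHom B b)))) 0)"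
schematic_goal EvIvPt_sig: "osig (EvIvPt_d False) ?n ?\<Gamma> ?R ?l" "osig (EvIvPt_d True) ?n' ?\<Gamma>' ?R' ?l'"
  by (rule sigI(3)[OF EvIvPt_d_def], unfold px, simp only: ev)+
lemmas [ev] = osigD[OF EvIvPt_sig(1)] osigD[OF EvIvPt_sig(2)]
abbreviation "EvIvPt s B A f b y e \<equiv> pcon (EvIvPt_d s) [e, y, b, f, A, B]"

text \<open>The motive is stated for a triple with free near vertex, path, far vertex and edge; at
  reflexivity \<open>IvP\<close> computes to \<open>IvPt\<close>.\<close>

definition "EvIvP_d s = opaq (side s 113 114) ((ANY B:Rgraph. ANY A:Rgraph. ANY f:Hom B A. ANY w:Gap2T s B A f.
  Eqt (Gap2T s B A f) (EvP s B A f (IvP s B A f w)) w :==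
  Jr (Vert A) (OnV B A f (p1 (p2 w))) (LAM x:Vert A. LAM p:Eqt (Vert A) x (OnV B A f (p1 (p2 w))). PI y:Vert A. PI e:Ed s A x y.
     Eqt (Gap2T s B A f) (EvP s B A f (IvP s B A f <<(Tri s x y e), <<p1 (p2 w), p>>>>)) <<(Tri s x y e), <<p1 (p2 w), p>>>>)
   (LAM y:Vert A. LAM e:Ed s A (OnV B A f (p1 (p2 w))) y.
     EvIvPt s B A f (p1 (p2 w)) y e)
   (Nr s A (p1 w)) (p2 (p2 w)) $ Fr s A (p1 w) $ p2 (p2 (p1 w))) 0)"
schematic_goal EvIvP_sig: "osig (EvIvP_d False) ?n ?\<Gamma> ?R ?l" "osig (EvIvP_d True) ?n' ?\<Gamma>' ?R' ?l'"
  by (rule sigI(3)[OF EvIvP_d_def], unfold px, simp only: ev)+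
lemmas [ev] = osigD[OF EvIvP_sig(1)] osigD[OF EvIvP_sig(2)]
abbreviation "EvIvP s B A f w \<equiv> pcon (EvIvP_d s) [w, f, A, B]"

text \<open>The vertex \<open>x\<close> and the path \<open>p\<close> form a point of a fibre of
  \<open>VertexHom\<close>, which is contracted to its centre. There the path fed to
  \<open>IvP\<close> is the evaluation of \<open>Kap\<close>; transporting from reflexivity, by
  \<open>ApEvKap\<close>, leaves an instance at which \<open>IvP\<close> computes to
  \<open>IvPt\<close>.\<close>

definition "IvEvPt_d s = opaq (side s 115 116) ((ANY B:Rgraph. ANY A:Rgraph. ANY f:Hom B A. ANY b:Vert B. ANY x:Vert A. ANY p:Eqt (Hom UnitG A) (VertexHom A x) (Comp UnitG B A f (VertexHom B b)). ANY y:Vert A. ANY e:Ed s A x y.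
  Eqt (Gap1T s B A f) (IvP s B A f (EvP s B A f <<IvI A (Tri s x y e), <<VertexHom B b, Cast s B A f b x y e p>>>>)) <<IvI A (Tri s x y e), <<VertexHom B b, Cast s B A f b x y e p>>>> :==
  FibreElim A (Comp UnitG B A f (VertexHom B b))
   (LAM x:Vert A. LAM p:Eqt (Hom UnitG A) (VertexHom A x) (Comp UnitG B A f (VertexHom B b)). PI y:Vert A. PI e:Ed s A x y.
      Eqt (Gap1T s B A f) (IvP s B A f (EvP s B A f <<IvI A (Tri s x y e), <<VertexHom B b, Cast s B A f b x y e p>>>>)) <<IvI A (Tri s x y e), <<VertexHom B b, Cast s B A f b x y e p>>>>)
   (LAM y:Vert A. LAM e:Ed s A (OnV B A f b) y.
     Tr (Eqt (Vert A) (OnV B A f b) (OnV B A f b))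
       (LAM q:Eqt (Vert A) (OnV B A f b) (OnV B A f b). Eqt (Gap1T s B A f) (IvP s B A f <<(Tri s (OnV B A f b) y e), <<b, q>>>>) (IvPt s B A f b y e))
       (idp (OnV B A f b)) (ApEv A (VertexHom A (OnV B A f b)) (Comp UnitG B A f (VertexHom B b)) (Kap A (Comp UnitG B A f (VertexHom B b))))
       (Sym (Eqt (Vert A) (OnV B A f b) (OnV B A f b)) (ApEv A (VertexHom A (OnV B A f b)) (Comp UnitG B A f (VertexHom B b)) (Kap A (Comp UnitG B A f (VertexHom B b))))
         (idp (OnV B A f b)) (ApEvKap A (Comp UnitG B A f (VertexHom B b))))
       (idp (IvPt s B A f b y e)))
   x p $ y $ e) 0)"
schematic_goal IvEvPt_sig: "osig (IvEvPt_d False) ?n ?\<Gamma> ?R ?l" "osig (IvEvPt_d True) ?n' ?\<Gamma>' ?R' ?l'"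
  by (rule sigI(3)[OF IvEvPt_d_def], unfold px, simp only: ev)+
lemmas [ev] = osigD[OF IvEvPt_sig(1)] osigD[OF IvEvPt_sig(2)]
abbreviation "IvEvPt s B A f b x p y e \<equiv> pcon (IvEvPt_d s) [e, y, p, x, b, f, A, B]"

text \<open>Both morphisms in the triple are replaced by canonical ones. The restriction of
  \<open>IvI A z\<close> along the vertex then computes to the morphism at the near vertex, which is
  the form \<open>IvEvPt\<close> expects.\<close>

definition "IvEvP_d s = opaq (side s 117 118) ((ANY B:Rgraph. ANY A:Rgraph. ANY f:Hom B A. ANY w:Gap1T s B A f.
  Eqt (Gap1T s B A f) (IvP s B A f (EvP s B A f w)) w :==
  HomWalkElim A (LAM a:Hom WalkE A. PI b:Hom UnitG B. PI p:Eqt (Hom UnitG A) (Comp UnitG WalkE A a (Vx s)) (Comp UnitG B A f b).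
      Eqt (Gap1T s B A f) (IvP s B A f (EvP s B A f <<a, <<b, p>>>>)) <<a, <<b, p>>>>)
   (LAM z:TotE A. LAM b:Hom UnitG B. HomUnitElim B
      (LAM b:Hom UnitG B. PI p:Eqt (Hom UnitG A) (VertexHom A (Nr s A z)) (Comp UnitG B A f b). Eqt (Gap1T s B A f) (IvP s B A f (EvP s B A f <<IvI A z, <<b, p>>>>)) <<IvI A z, <<b, p>>>>)
      (LAM b:Vert B. LAM p:Eqt (Hom UnitG A) (VertexHom A (Nr s A z)) (Comp UnitG B A f (VertexHom B b)).
         IvEvPt s B A f b (Nr s A z) p (Fr s A z) (p2 (p2 z)))
      b)
   (p1 w) $ p1 (p2 w) $ p2 (p2 w)) 0)"
schematic_goal IvEvP_sig: "osig (IvEvP_d False) ?n ?\<Gamma> ?R ?l" "osig (IvEvP_d True) ?n' ?\<Gamma>' ?R' ?l'"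
  by (rule sigI(3)[OF IvEvP_d_def], unfold px, simp only: ev)+
lemmas [ev] = osigD[OF IvEvP_sig(1)] osigD[OF IvEvP_sig(2)]
abbreviation "IvEvP s B A f w \<equiv> pcon (IvEvP_d s) [w, f, A, B]"

text \<open>The edge and vertex components of both sides agree judgementally; only the path differs,
  and \<open>ApEvAssoc\<close> identifies it with reflexivity.\<close>

definition "Square_d s = opaq (side s 119 120) ((ANY B:Rgraph. ANY A:Rgraph. ANY f:Hom B A. ANY g:Hom WalkE B.
  Eqt (Gap2T s B A f) (EvP s B A f (Gap1 s B A f g)) (Gap2 s B A f (EvI B g)) :==
  Ap (Eqt (Vert A) (OnV B A f (Nr s B (EvI B g))) (OnV B A f (Nr s B (EvI B g)))) (Gap2T s B A f)
    (LAM q:Eqt (Vert A) (OnV B A f (Nr s B (EvI B g))) (OnV B A f (Nr s B (EvI B g))). <<OnT B A f (EvI B g), <<Nr s B (EvI B g), q>>>>)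
    (ApEv A (AsL UnitG WalkE B A f g (Vx s)) (AsR UnitG WalkE B A f g (Vx s)) (CompAssoc UnitG WalkE B A f g (Vx s)))
    (idp (OnV B A f (Nr s B (EvI B g))))
    (ApEvAssoc WalkE B A f g (Vx s))) 0)"
schematic_goal Square_sig: "osig (Square_d False) ?n ?\<Gamma> ?R ?l" "osig (Square_d True) ?n' ?\<Gamma>' ?R' ?l'"
  by (rule sigI(3)[OF Square_d_def], unfold px, simp only: ev)+
lemmas [ev] = osigD[OF Square_sig(1)] osigD[OF Square_sig(2)]
abbreviation "Square s B A f g \<equiv> pcon (Square_d s) [g, f, A, B]"

section \<open>The equivalence of the two notions\<close>

definition "Fwd_d s = opaq (side s 121 122) ((ANY B:Rgraph. ANY A:Rgraph. ANY f:Hom B A. ANY q:SFib s B A f.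
  SCart s B A f :==
  Transfer (Hom WalkE B) (TotE B) (Gap1T s B A f) (Gap2T s B A f) (LAM g:Hom WalkE B. Gap1 s B A f g) (LAM z:TotE B. Gap2 s B A f z)
    (LAM g:Hom WalkE B. EvI B g) (LAM z:TotE B. IvI B z) (LAM w:Gap1T s B A f. EvP s B A f w) (LAM w:Gap2T s B A f. IvP s B A f w)
    (LAM z:TotE B. idp z) (LAM w:Gap1T s B A f. IvEvP s B A f w) (LAM w:Gap2T s B A f. EvIvP s B A f w) (LAM g:Hom WalkE B. Square s B A f g) q) 0)"
schematic_goal Fwd_sig: "osig (Fwd_d False) ?n ?\<Gamma> ?R ?l" "osig (Fwd_d True) ?n' ?\<Gamma>' ?R' ?l'"
  by (rule sigI(3)[OF Fwd_d_def], unfold px, simp only: ev)+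
lemmas [ev] = osigD[OF Fwd_sig(1)] osigD[OF Fwd_sig(2)]
abbreviation "Fwd s B A f q \<equiv> pcon (Fwd_d s) [q, f, A, B]"

text \<open>The square for the inverse maps follows from \<open>Square\<close> at
  \<open>IvI B z\<close> by applying \<open>IvP\<close> and cancelling with \<open>IvEvP\<close>.
  Here the section condition is \<open>IvEv\<close>, a genuine path, where the other direction has
  reflexivity.\<close>

definition "Bwd_d s = opaq (side s 123 124) ((ANY B:Rgraph. ANY A:Rgraph. ANY f:Hom B A. ANY q:SCart s B A f.
  SFib s B A f :==
  Transfer (TotE B) (Hom WalkE B) (Gap2T s B A f) (Gap1T s B A f) (LAM z:TotE B. Gap2 s B A f z) (LAM g:Hom WalkE B. Gap1 s B A f g)
    (LAM z:TotE B. IvI B z) (LAM g:Hom WalkE B. EvI B g) (LAM w:Gap2T s B A f. IvP s B A f w) (LAM w:Gap1T s B A f. EvP s B A f w)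
    (LAM g:Hom WalkE B. IvEv B g) (LAM w:Gap2T s B A f. EvIvP s B A f w) (LAM w:Gap1T s B A f. IvEvP s B A f w)
    (LAM z:TotE B. Trans (Gap1T s B A f) (IvP s B A f (Gap2 s B A f z)) (IvP s B A f (EvP s B A f (Gap1 s B A f (IvI B z)))) (Gap1 s B A f (IvI B z))
      (Ap (Gap2T s B A f) (Gap1T s B A f) (LAM w:Gap2T s B A f. IvP s B A f w) (Gap2 s B A f z) (EvP s B A f (Gap1 s B A f (IvI B z)))
        (Sym (Gap2T s B A f) (EvP s B A f (Gap1 s B A f (IvI B z))) (Gap2 s B A f z) (Square s B A f (IvI B z))))
      (IvEvP s B A f (Gap1 s B A f (IvI B z)))) q) 0)"
schematic_goal Bwd_sig: "osig (Bwd_d False) ?n ?\<Gamma> ?R ?l" "osig (Bwd_d True) ?n' ?\<Gamma>' ?R' ?l'"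
  by (rule sigI(3)[OF Bwd_d_def], unfold px, simp only: ev)+
lemmas [ev] = osigD[OF Bwd_sig(1)] osigD[OF Bwd_sig(2)]
abbreviation "Bwd s B A f q \<equiv> pcon (Bwd_d s) [q, f, A, B]"

definition "Main_d = opaq 125 (((PI B:Rgraph. PI A:Rgraph. PI f:Hom B A.
   ((LFib B A f -> LCart B A f) ** (LCart B A f -> LFib B A f)) **
   ((RFib B A f -> RCart B A f) ** (RCart B A f -> RFib B A f)) **
   ((Fib B A f -> Cart B A f) ** (Cart B A f -> Fib B A f))) :==
  LAM B:Rgraph. LAM A:Rgraph. LAM f:Hom B A.
   <<<<LAM q:LFib B A f. Fwd False B A f q, LAM q:LCart B A f. Bwd False B A f q>>,
    <<<<LAM q:RFib B A f. Fwd True B A f q, LAM q:RCart B A f. Bwd True B A f q>>,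
     <<LAM q:Fib B A f. <<Fwd False B A f (p1 q), Fwd True B A f (p2 q)>>, LAM q:Cart B A f. <<Bwd False B A f (p1 q), Bwd True B A f (p2 q)>>>>>>>>) 0)"
schematic_goal Main_sig: "osig Main_d ?n ?\<Gamma> ?R ?l"
  by (rule sigI(3)[OF Main_d_def], unfold px) (simp only: ev)
lemmas [ev] = osigD[OF Main_sig]

theorem mainTheorem3:
  fixes i :: nat
  shows "provable
    (\<^bold>\<Pi>\<B>\<^bold>:rgraph i. \<^bold>\<Pi>\<A>\<^bold>:rgraph i. \<^bold>\<Pi>f\<^bold>:hom i \<cdot> \<B> \<cdot> \<A>.
       (left_fibration i \<cdot> \<B> \<cdot> \<A> \<cdot> f \<^bold>\<leftrightarrow> left_cartesian i \<cdot> \<B> \<cdot> \<A> \<cdot> f) \<^bold>\<times>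
       (right_fibration i \<cdot> \<B> \<cdot> \<A> \<cdot> f \<^bold>\<leftrightarrow> right_cartesian i \<cdot> \<B> \<cdot> \<A> \<cdot> f) \<^bold>\<times>
       (fibration i \<cdot> \<B> \<cdot> \<A> \<cdot> f \<^bold>\<leftrightarrow> cartesian i \<cdot> \<B> \<cdot> \<A> \<cdot> f))"
proof -
  have "valid Main_d" "dtele Main_d = []"
    by (simp_all only: ev)
  then have "[] \<turnstile> draw Main_d i \<^bold>: er i (drty Main_d)"
    by (simp add: valid_def)
  \<comment> \<open>The witness is the raw term of \<open>Main_d\<close>; its type erases to the
    stated one, as the notions in it have been matched with the declared constants by the
    \<open>_clo\<close> equations and by unfolding the notation.\<close>
  then show ?thesis
    unfolding provable_def by (intro exI[of _ "draw Main_d i"]) (simp only: raw er_eqs ev)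
qed

end
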